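(* There is a deterministic white-box polynomial identity testing algorithm for $n$-variate read-$k$ oblivious ABPs of width $w$ and degree $d$ that runs in time $\mathrm{poly}(n,w,d)^{\,n^{1-1/2^{k-1}}\exp(k^2)\,\mathrm{polylog}(n)}$. Furthermore, given only the order in which the variables are read, one can construct a hitting set, of size $\mathrm{poly}(n,w,d)^{\,n^{1-1/2^{k-1}}\exp(k^2)\,\mathrm{polylog}(n)}$, for the class of polynomials computed by such ABPs that read their variables in this order.
   Context: An algebraic branching program (ABP) over a field $\mathbb{F}$ is a directed acyclic graph whose vertices are partitioned into layers $0,\dots,L$, with a single source in layer $0$ and a single sink in layer $L$, edges only from layer $\ell-1$ to layer $\ell$, each edge labeled by a polynomial; it computes the sum over all source–sink paths of the product of the edge labels. Its width is the maximum number of vertices in a layer and its degree is the maximum degree of an edge label. It is oblivious if in each layer $\ell$ all edge labels are univariate polynomials in one common variable $x_{i_\ell}$; the sequence $x_{i_1},\dots,x_{i_L}$ is the order in which it reads variables. An oblivious ABP is read-$k$ if each variable is read in at most $k$ layers. Polynomial identity testing asks to decide whether the polynomial computed by a given ABP is identically zero; white-box means the algorithm receives the ABP itself as input. A hitting set for a class of $n$-variate polynomials is a set $\mathcal{H}\subseteq\mathbb{F}^n$ such that every nonzero polynomial in the class is nonzero at some point of $\mathcal{H}$.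
   Formalization: For the hitting set, the field is assumed to have at least (n+w+d+2)^(c·exp(c·k^2)) elements and the construction is given that many distinct ones; over a small finite field with q elements no hitting set in F^n need exist, since x^q − x is nonzero but vanishes everywhere. *)

theory Defs
  imports Complex_Main
    "HOL-Library.Poly_Mapping"
    "HOL-Computational_Algebra.Polynomial"
begin

section \<open>Multivariate polynomials and hitting sets\<close>

text \<open>
  A polynomial in the variables x_0, x_1, ... is a finitely supported map from monomials to
  coefficients; a monomial is a finitely supported map from variable indices to exponents. The ring
  structure on this type is the convolution product of \<^theory>\<open>HOL-Library.Poly_Mapping\<close>.
\<close>

type_synonym 'a mpoly = "(nat \<Rightarrow>\<^sub>0 nat) \<Rightarrow>\<^sub>0 'a"

text \<open>The univariate polynomial q, read as a polynomial in the variable x_v.\<close>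

definition poly_in_var :: "nat \<Rightarrow> 'a::comm_semiring_1 poly \<Rightarrow> 'a mpoly" where
  "poly_in_var v q =
     (\<Sum>j\<le>degree q. Poly_Mapping.single (Poly_Mapping.single v j) (coeff q j))"

definition eval_mpoly :: "'a::comm_semiring_1 mpoly \<Rightarrow> 'a list \<Rightarrow> 'a" where
  "eval_mpoly f a =
     (\<Sum>m\<in>Poly_Mapping.keys f. Poly_Mapping.lookup f m *
        (\<Prod>i\<in>Poly_Mapping.keys m. (a ! i) ^ Poly_Mapping.lookup m i))"

text \<open>Points of the n-dimensional space over the field are lists of length n.\<close>

definition hitting_set :: "nat \<Rightarrow> 'a::comm_semiring_1 mpoly set \<Rightarrow> 'a list set \<Rightarrow> bool" where
  "hitting_set n C H \<longleftrightarrow>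
     H \<subseteq> {a. length a = n} \<and> (\<forall>f\<in>C. f \<noteq> 0 \<longrightarrow> (\<exists>a\<in>H. eval_mpoly f a \<noteq> 0))"


section \<open>Oblivious algebraic branching programs\<close>

text \<open>
  The vertices of layer l are the pairs (l, 0), ..., (l, layer_size l - 1). A triple (l, u, v) in
  \<open>edges\<close> is the edge from (l, u) to (l + 1, v); its label is the univariate polynomial
  \<open>label l u v\<close> in the variable with index \<open>var_order ! l\<close>. So entry l of \<open>var_order\<close> is the
  variable read between the layers l and l + 1, and the length of this list is the number L of
  the last layer. The order of reading is part of the program since a layer all of whose labels are
  constant does not determine its variable.
\<close>

record (overloaded) 'a oabp =
  var_order :: "nat list"
  layer_size :: "nat \<Rightarrow> nat"
  edges :: "(nat \<times> nat \<times> nat) set"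
  label :: "nat \<Rightarrow> nat \<Rightarrow> nat \<Rightarrow> 'a poly"

abbreviation depth :: "'a::zero oabp \<Rightarrow> nat" where
  "depth A \<equiv> length (var_order A)"

definition is_oabp :: "nat \<Rightarrow> 'a::zero oabp \<Rightarrow> bool" where
  "is_oabp n A \<longleftrightarrow>
     set (var_order A) \<subseteq> {..<n} \<and>
     layer_size A 0 = 1 \<and> layer_size A (depth A) = 1 \<and>
     edges A \<subseteq> {(l, u, v). l < depth A \<and> u < layer_size A l \<and> v < layer_size A (Suc l)}"

definition abp_width :: "'a::zero oabp \<Rightarrow> nat" where
  "abp_width A = Max (layer_size A ` {..depth A})"

text \<open>The additional 0 only matters for programs without edges.\<close>

definition abp_degree :: "'a::zero oabp \<Rightarrow> nat" where
  "abp_degree A = Max (insert 0 ((\<lambda>(l, u, v). degree (label A l u v)) ` edges A))"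

definition read_at_most :: "nat \<Rightarrow> nat list \<Rightarrow> bool" where
  "read_at_most k xs \<longleftrightarrow> (\<forall>i. count_list xs i \<le> k)"

text \<open>A path is the list of its vertices' positions in the layers 0, ..., L.\<close>

definition abp_paths :: "'a::zero oabp \<Rightarrow> nat list set" where
  "abp_paths A =
     {p. length p = Suc (depth A) \<and> (\<forall>l\<le>depth A. p ! l < layer_size A l) \<and>
         (\<forall>l<depth A. (l, p ! l, p ! Suc l) \<in> edges A)}"

definition abp_poly :: "'a::comm_semiring_1 oabp \<Rightarrow> 'a mpoly" where
  "abp_poly A =
     (\<Sum>p\<in>abp_paths A. \<Prod>l<depth A.
        poly_in_var (var_order A ! l) (label A l (p ! l) (p ! Suc l)))"

definition read_k_oabps :: "nat \<Rightarrow> nat \<Rightarrow> nat \<Rightarrow> nat \<Rightarrow> 'a::zero oabp set" where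
  "read_k_oabps n k w d =
     {A. is_oabp n A \<and> read_at_most k (var_order A) \<and> abp_width A \<le> w \<and> abp_degree A \<le> d}"


section \<open>The model of computation\<close>

text \<open>
  A random access machine over a field, as a small structured language. The memory consists of
  arrays of natural numbers and arrays of field elements, each indexed by a natural number and
  unbounded; arrays are named by numbers that are fixed in the program text, while indices are
  computed. Field operations and zero tests of field elements have unit cost, as is usual for
  algebraic branching programs. Natural numbers can be added, subtracted (truncating) and compared,
  also at unit cost; multiplication is left out, as unit-cost multiplication would give machines
  that no longer are polynomially equivalent to Turing machines. A program text does not mention the
  field: the only field constants are 0 and 1.
\<close>

datatype nexp =
    NConst nat
  | NGet nat nexp
  | NAdd nexp nexp
  | NSub nexp nexp

datatype fexp =
    FZero
  | FOne
  | FGet nat nexp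
  | FAdd fexp fexp
  | FSub fexp fexp
  | FMul fexp fexp
  | FDiv fexp fexp

datatype test =
    NEq nexp nexp
  | NLess nexp nexp
  | FIsZero fexp
  | TNot test
  | TAnd test test

datatype prog =
    Skip
  | NSet nat nexp nexp    \<comment> \<open>array, index, value\<close>
  | FSet nat nexp fexp
  | Seq prog prog
  | If test prog prog
  | While test prog

record 'a mem =
  nmem :: "nat \<Rightarrow> nat \<Rightarrow> nat"
  fmem :: "nat \<Rightarrow> nat \<Rightarrow> 'a"

fun nval :: "'a mem \<Rightarrow> nexp \<Rightarrow> nat" where
  "nval s (NConst c) = c"
| "nval s (NGet x e) = nmem s x (nval s e)"
| "nval s (NAdd e1 e2) = nval s e1 + nval s e2"
| "nval s (NSub e1 e2) = nval s e1 - nval s e2"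

fun fval :: "'a::field mem \<Rightarrow> fexp \<Rightarrow> 'a" where
  "fval s FZero = 0"
| "fval s FOne = 1"
| "fval s (FGet x e) = fmem s x (nval s e)"
| "fval s (FAdd e1 e2) = fval s e1 + fval s e2"
| "fval s (FSub e1 e2) = fval s e1 - fval s e2"
| "fval s (FMul e1 e2) = fval s e1 * fval s e2"
| "fval s (FDiv e1 e2) = fval s e1 / fval s e2"

fun tval :: "'a::field mem \<Rightarrow> test \<Rightarrow> bool" where
  "tval s (NEq e1 e2) \<longleftrightarrow> nval s e1 = nval s e2"
| "tval s (NLess e1 e2) \<longleftrightarrow> nval s e1 < nval s e2"
| "tval s (FIsZero e) \<longleftrightarrow> fval s e = 0"
| "tval s (TNot b) \<longleftrightarrow> \<not> tval s b"
| "tval s (TAnd b1 b2) \<longleftrightarrow> tval s b1 \<and> tval s b2"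

text \<open>
  \<open>runs c s t s'\<close>: started in memory s, the program c halts after t steps in memory s'. A step is
  an assignment, a skip or the evaluation of a test; as expressions have constant size in a fixed
  program, this is the number of elementary operations up to a constant factor that depends only
  on the program.
\<close>

inductive runs :: "prog \<Rightarrow> 'a::field mem \<Rightarrow> nat \<Rightarrow> 'a mem \<Rightarrow> bool" where
  Skip: "runs Skip s 1 s"
| NSet: "runs (NSet x e1 e2) s 1
           (s\<lparr>nmem := (nmem s)(x := (nmem s x)(nval s e1 := nval s e2))\<rparr>)"
| FSet: "runs (FSet x e1 e2) s 1
           (s\<lparr>fmem := (fmem s)(x := (fmem s x)(nval s e1 := fval s e2))\<rparr>)"
| Seq: "runs c1 s t1 s1 \<Longrightarrow> runs c2 s1 t2 s2 \<Longrightarrow> runs (Seq c1 c2) s (t1 + t2) s2"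
| IfTrue: "tval s b \<Longrightarrow> runs c1 s t s1 \<Longrightarrow> runs (If b c1 c2) s (Suc t) s1"
| IfFalse: "\<not> tval s b \<Longrightarrow> runs c2 s t s1 \<Longrightarrow> runs (If b c1 c2) s (Suc t) s1"
| WhileTrue: "tval s b \<Longrightarrow> runs c s t1 s1 \<Longrightarrow> runs (While b c) s1 t2 s2 \<Longrightarrow>
    runs (While b c) s (Suc (t1 + t2)) s2"
| WhileFalse: "\<not> tval s b \<Longrightarrow> runs (While b c) s 1 s"

inductive_cases runs_SkipE: "runs Skip s t s'"
inductive_cases runs_NSetE: "runs (NSet x e1 e2) s t s'"
inductive_cases runs_FSetE: "runs (FSet x e1 e2) s t s'"
inductive_cases runs_SeqE: "runs (Seq c1 c2) s t s'"
inductive_cases runs_IfE: "runs (If b c1 c2) s t s'"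
inductive_cases runs_WhileE: "runs (While b c) s t s'"

lemma runs_deterministic:
  "runs c s t s' \<Longrightarrow> runs c s u s'' \<Longrightarrow> u = t \<and> s'' = s'"
proof (induction arbitrary: u s'' rule: runs.induct)
  case (Skip s)
  then show ?case by (rule runs_SkipE) simp
next
  case (NSet x e1 e2 s)
  then show ?case by (rule runs_NSetE) simp
next
  case (FSet x e1 e2 s)
  then show ?case by (rule runs_FSetE) simp
next
  case (Seq c1 s t1 s1 c2 t2 s2)
  from Seq.prems obtain v1 r v2 where
    "runs c1 s v1 r" "runs c2 r v2 s''" "u = v1 + v2"
    by (rule runs_SeqE) blast
  then show ?case using Seq.IH by blast
next
  case (IfTrue s b c1 t s1 c2)
  from IfTrue.prems IfTrue.hyps(1) obtain v where "runs c1 s v s''" "u = Suc v"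
    by (blast elim: runs_IfE)
  then show ?case using IfTrue.IH by blast
next
  case (IfFalse s b c2 t s1 c1)
  from IfFalse.prems IfFalse.hyps(1) obtain v where "runs c2 s v s''" "u = Suc v"
    by (blast elim: runs_IfE)
  then show ?case using IfFalse.IH by blast
next
  case (WhileTrue s b c t1 s1 t2 s2)
  from WhileTrue.prems obtain v1 r v2 where
    "runs c s v1 r" "runs (While b c) r v2 s''" "u = Suc (v1 + v2)"
    by (rule runs_WhileE) (use WhileTrue.hyps(1) in blast)+
  then show ?case using WhileTrue.IH by blast
next
  case (WhileFalse s b c)
  from WhileFalse.prems show ?case
    by (rule runs_WhileE) (use WhileFalse.hyps in auto)+
qed

text \<open>The input occupies the two arrays with name 0; everything else is 0 initially.\<close>

definition input_mem :: "nat list \<Rightarrow> 'a::zero list \<Rightarrow> 'a mem" where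
  "input_mem xs ys =
     \<lparr>nmem = (\<lambda>x i. if x = 0 \<and> i < length xs then xs ! i else 0),
      fmem = (\<lambda>x i. if x = 0 \<and> i < length ys then ys ! i else 0)\<rparr>"

text \<open>
  A program as input: the numbers n and L, the order of reading, the sizes of the layers 0, ..., L
  and then, for every pair of vertices in consecutive layers, 0 if there is no edge and otherwise
  1 + the number of coefficients of its label; the coefficients themselves are listed in the
  array of field elements, in the same sequence.
\<close>

definition vertex_pairs :: "'a::zero oabp \<Rightarrow> (nat \<times> nat \<times> nat) list" where
  "vertex_pairs A =
     [(l, u, v). l \<leftarrow> [0..<depth A], u \<leftarrow> [0..<layer_size A l], v \<leftarrow> [0..<layer_size A (Suc l)]]"

definition encode_nats :: "nat \<Rightarrow> 'a::zero oabp \<Rightarrow> nat list" where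
  "encode_nats n A =
     [n, depth A] @ var_order A @ map (layer_size A) [0..<Suc (depth A)] @
     map (\<lambda>(l, u, v). if (l, u, v) \<in> edges A then Suc (length (coeffs (label A l u v))) else 0)
       (vertex_pairs A)"

definition encode_coeffs :: "'a::zero oabp \<Rightarrow> 'a list" where
  "encode_coeffs A =
     concat (map (\<lambda>(l, u, v). if (l, u, v) \<in> edges A then coeffs (label A l u v) else [])
       (vertex_pairs A))"

definition abp_input :: "nat \<Rightarrow> 'a::zero oabp \<Rightarrow> 'a mem" where
  "abp_input n A = input_mem (encode_nats n A) (encode_coeffs A)"

text \<open>
  For the construction of hitting sets, the machine gets the parameters n, w, d and the order of
  reading, and in addition a list of field elements, as a stand-in for the ability to enumerate
  elements of the field (from 0 and 1 it can only reach the prime field).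
\<close>

definition order_input :: "nat \<Rightarrow> nat \<Rightarrow> nat \<Rightarrow> nat list \<Rightarrow> 'a::zero list \<Rightarrow> 'a mem" where
  "order_input n w d xs es = input_mem ([n, w, d, length xs, length es] @ xs) es"

definition accepts :: "'a mem \<Rightarrow> bool" where
  "accepts s \<longleftrightarrow> nmem s 1 0 = 1"

text \<open>A list of points is output as its length, together with all coordinates in sequence.\<close>

definition output_points :: "nat \<Rightarrow> 'a mem \<Rightarrow> 'a list set" where
  "output_points n s = (\<lambda>j. map (\<lambda>i. fmem s 1 (j * n + i)) [0..<n]) ` {..<nmem s 1 0}"


section \<open>The bounds\<close>

text \<open>
  The implicit constants of poly, exp and polylog are merged into one number c. The offset 2 and
  the summand 1 take care of the degenerate parameters: a polynomial in n, w, d is at most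
  (n + w + d + 2) ^ c for some c, and log n vanishes for n = 1.
\<close>

definition pit_bound :: "nat \<Rightarrow> nat \<Rightarrow> nat \<Rightarrow> nat \<Rightarrow> nat \<Rightarrow> real" where
  "pit_bound c n k w d =
     real (n + w + d + 2) powr
       (real c * real n powr (1 - 1 / 2 ^ (k - 1)) * exp (real c * real k ^ 2) *
        (1 + log 2 (real n)) ^ c)"

text \<open>
  The number of distinct field elements that are needed for a hitting set with points over the field
  itself: polynomial in n, w, d for every fixed k.
\<close>

definition field_bound :: "nat \<Rightarrow> nat \<Rightarrow> nat \<Rightarrow> nat \<Rightarrow> nat \<Rightarrow> real" where
  "field_bound c n k w d = real (n + w + d + 2) powr (real c * exp (real c * real k ^ 2))"

end

theory Submission
  imports Defs "HOL-Library.FuncSet" "HOL-Library.Function_Algebras" "HOL-Computational_Algebra.Fraction_Field"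
begin

text \<open>
  Rank the variables by their first reads. The j-th reads define k orders on the ranks. Removing
  longest chains of all \<open>2 ^ (k - 1)\<close> order types in turn, one needs
  \<open>O(n powr (1 - 1 / 2 ^ (k - 1)) * log n)\<close> rounds until all ranks are in classes on which every order is
  monotone, because u ranks without a chain of length \<open>\<rho> + 1\<close> satisfy \<open>u \<le> \<rho> ^ 2 ^ (k - 1)\<close>. Cutting the
  classes according to the parity of greedily chosen windows, at the cost of a factor \<open>2 ^ k\<^sup>2\<close>,
  makes them regular: an interval of a class and its complement in the class alternate at most
  \<open>2 * k\<^sup>2\<close> times in the order of reading. Hence the matrix of coefficients that belongs to
  this interval has rank at most \<open>w ^ (2 * k\<^sup>2)\<close>, and basis isolation along dyadic intervals
  (Agrawal, Gurjar, Korwar, Saxena) shows that the variables of one class, of ranks i, may be replaced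
  by \<open>\<Prod>j\<le>log n. a\<^sub>j ^ (G ^ i mod q\<^sub>j)\<close> for some small \<open>q\<^sub>j\<close> and some \<open>a\<^sub>j\<close> from a small set without
  making the polynomial zero. The hitting set consists of these points for all choices of the
  \<open>q\<^sub>j\<close> and \<open>a\<^sub>j\<close> of all classes. The identity test takes powers of a new variable for the \<open>a\<^sub>j\<close>
  and computes the resulting univariate polynomials.
\<close>

section \<open>Weights that separate monomials\<close>

text \<open>Monotone orders alone do not bound the alternation: if the a-th and b-th reads of a
  class advance in step, the b-th reads of earlier ranks can separate the a-th reads of an interval
  one by one. Regularity allows such an interruption only once for each pair of read numbers. The
  rank bound concerns one class while all other variables are fixed. So the classes are substituted
  one at a time and have independent seeds, of \<open>2 * levels n\<close> digits each. The number
  of seeds is therefore a power whose exponent is, up to logarithms, the number of classes; this is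
  the origin of the exponent in \<open>pit_bound\<close>. Each dyadic level keeps a field element of
  its own. A single weight combining all levels would be of size about \<open>N ^ levels n\<close>
  and would need as many field elements. Time is not counted along a run. One number
  \<open>M\<close> bounds the iterations of every loop, and a fixed program text then takes at most
  a fixed power of \<open>M + 3\<close> steps, which the constant \<open>c\<close> absorbs. Hence
  multiplication by repeated addition is affordable.\<close>

lemma alternating_binomial_sum:
  "(\<Sum>j\<le>b. (-1) ^ j * real (b choose j) / real (a + j + 1)) =
    fact a * fact b / fact (a + b + 1)"
proof (induction b arbitrary: a)
  case 0
  have "fact (a + 1) = real (a + 1) * fact a" by simp
  then show ?case by (simp add: divide_simps del: fact_Suc of_nat_Suc)
next
  case (Suc b)
  let ?f = "\<lambda>b a j. (-1) ^ j * real (b choose j) / real (a + j + 1)"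
  have "(\<Sum>j\<le>Suc b. ?f (Suc b) a j) =
      ?f (Suc b) a 0 + (\<Sum>j\<le>b. ?f (Suc b) a (Suc j))"
    by (rule sum.atMost_Suc_shift)
  \<comment> \<open>Pascal's rule splits every binomial coefficient; in the second part the index is
    shifted, which turns \<open>a\<close> into \<open>Suc a\<close>.\<close>
  also have "(\<Sum>j\<le>b. ?f (Suc b) a (Suc j)) =
      (\<Sum>j\<le>b. ?f b a (Suc j)) - (\<Sum>j\<le>b. ?f b (Suc a) j)"
  proof -
    have "?f (Suc b) a (Suc j) = ?f b a (Suc j) - ?f b (Suc a) j" for j
      by (simp add: add_divide_distrib diff_divide_distrib distrib_left)
    then show ?thesis by (simp only: sum_subtractf)
  qed
  also have "?f (Suc b) a 0 = ?f b a 0" by simp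
  also have "?f b a 0 + ((\<Sum>j\<le>b. ?f b a (Suc j)) - (\<Sum>j\<le>b. ?f b (Suc a) j))
      = (\<Sum>j\<le>Suc b. ?f b a j) - (\<Sum>j\<le>b. ?f b (Suc a) j)"
    by (simp only: sum.atMost_Suc_shift)
  also have "(\<Sum>j\<le>Suc b. ?f b a j) = (\<Sum>j\<le>b. ?f b a j)"
    by (simp add: binomial_eq_0)
  finally have "(\<Sum>j\<le>Suc b. ?f (Suc b) a j) =
      fact a * fact b / fact (a + b + 1) - fact (Suc a) * fact b / fact (Suc a + b + 1)"
    using Suc.IH[of a] Suc.IH[of "Suc a"] by simp
  also have "\<dots> = fact a * fact (Suc b) / fact (a + Suc b + 1)"
  proof -
    have "fact (Suc a + b + 1) = real (a + b + 2) * fact (a + b + 1)" by simp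
    then show ?thesis
      by (simp add: divide_simps del: of_nat_Suc) (simp add: algebra_simps)
  qed
  finally show ?case .
qed

text \<open>The quotient of the two factorial expressions is 2m + 1 times the central binomial
  coefficient, the largest of the 2m + 1 binomial coefficients that add up to 4^m.\<close>

lemma four_power_le_fact: "4 ^ m * (fact m)\<^sup>2 \<le> (fact (2 * m + 1) :: nat)"
proof (induction m)
  case 0
  then show ?case by simp
next
  case (Suc m)
  have "4 ^ Suc m * (fact (Suc m))\<^sup>2 = (4 * (m + 1) ^ 2) * (4 ^ m * (fact m)\<^sup>2 :: nat)"
    by (simp add: power_mult_distrib algebra_simps power2_eq_square)
  also have "\<dots> \<le> ((2 * m + 3) * (2 * m + 2)) * fact (2 * m + 1)"
    by (rule mult_le_mono[OF _ Suc]) (simp add: power2_eq_square algebra_simps)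
  also have "\<dots> = fact (2 * Suc m + 1)" by (simp add: algebra_simps)
  finally show ?case .
qed

text \<open>Nair's argument: for \<open>a = b = m\<close> the alternating sum is the integral of x^m
  (1 - x)^m over the unit interval. It is positive, and its product with the least common multiple
  of the denominators is an integer, hence at least 1. This replaces estimates on primes in the
  choice of a modulus.\<close>

lemma four_power_le_Lcm: "4 ^ m \<le> (Lcm {1..2 * m + 1} :: nat)"
proof -
  define l where "l = (Lcm {1..2 * m + 1} :: nat)"
  have pos: "l > 0" unfolding l_def by (auto intro!: Nat.gr0I simp: Lcm_0_iff)
  have int: "real l * (\<Sum>j\<le>m. (-1) ^ j * real (m choose j) / real (m + j + 1)) \<in> \<int>"
    unfolding sum_distrib_left
  proof (rule Ints_sum)
    fix j assume "j \<in> {..m}"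
    then have "(m + j + 1) dvd l" unfolding l_def by (intro dvd_Lcm) auto
    then obtain t where t: "l = (m + j + 1) * t" by (elim dvdE)
    have gen: "(x * y) * (c * e / x) = c * e * y" if "x \<noteq> 0" for x y c e :: real
      using that by simp
    have "real l = real (m + j + 1) * real t" by (subst t) (rule of_nat_mult)
    then have "real l * ((-1) ^ j * real (m choose j) / real (m + j + 1)) =
        (-1) ^ j * real (m choose j) * real t"
      by (simp only: gen of_nat_eq_0_iff)
    then have "real l * ((-1) ^ j * real (m choose j) / real (m + j + 1)) =
        of_int ((-1) ^ j * int (m choose j) * int t)"
      by simp
    then show "real l * ((-1) ^ j * real (m choose j) / real (m + j + 1)) \<in> \<int>"
      by (metis Ints_of_int)
  qed
  let ?x = "real l * (fact m * fact m / fact (2 * m + 1))"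
  have "?x \<in> \<int>" using int unfolding alternating_binomial_sum mult_2 .
  moreover have "?x > 0"
    using pos by (intro mult_pos_pos divide_pos_pos fact_gt_zero) (rule of_nat_0_less_iff[THEN iffD2])
  ultimately have "?x \<ge> 1"
    by (metis Ints_nonzero_abs_ge1 abs_of_pos less_irrefl)
  moreover have "a \<le> x * b" if "x * (b / a) \<ge> 1" "a > 0" for a b x :: real
    using that by (simp add: field_simps)
  ultimately have "fact (2 * m + 1) \<le> real l * (fact m * fact m)"
    using fact_gt_zero by blast
  then have "real (fact (2 * m + 1)) \<le> real (l * (fact m)\<^sup>2)"
    by (simp only: of_nat_fact of_nat_mult power2_eq_square)
  then have "fact (2 * m + 1) \<le> l * (fact m)\<^sup>2" by (simp only: of_nat_le_iff)
  with four_power_le_fact[of m] have "4 ^ m * (fact m)\<^sup>2 \<le> l * (fact m)\<^sup>2" by linarith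
  then show ?thesis by (simp add: l_def)
qed

text \<open>The powers of \<open>G\<close> modulo \<open>q\<close> by the recursion that the machine
  follows, without large intermediate powers. The value at 0 is 1 even for \<open>q = 1\<close>, so
  the value is only congruent to the residue, and \<open>wt_le\<close> is not strict.\<close>

fun wt :: "nat \<Rightarrow> nat \<Rightarrow> nat \<Rightarrow> nat" where
  "wt G q 0 = 1"
| "wt G q (Suc i) = (wt G q i * G) mod q"

lemma wt_mod: "wt G q i mod q = G ^ i mod q"
  by (induction i) (auto simp: mod_mult_left_eq mult.commute, metis mod_mult_right_eq)

lemma wt_le: "q \<ge> 1 \<Longrightarrow> wt G q i \<le> q"
  by (cases i) (auto intro: less_imp_le)

definition lwt :: "nat \<Rightarrow> nat \<Rightarrow> nat \<Rightarrow> (nat \<Rightarrow> nat) \<Rightarrow> nat" where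
  "lwt G n q m = (\<Sum>i<n. m i * wt G q i)"

text \<open>The weight is a small representative of the Kronecker number of the exponents. Thus two
  monomials get different weights as soon as \<open>q\<close> does not divide the difference of
  their Kronecker numbers.\<close>

lemma lwt_mod: "lwt G n q m mod q = (\<Sum>i<n. m i * G ^ i) mod q"
proof -
  have "lwt G n q m mod q = (\<Sum>i<n. (m i * wt G q i) mod q) mod q"
    unfolding lwt_def by (rule mod_sum_eq[symmetric])
  also have "\<dots> = (\<Sum>i<n. (m i * G ^ i) mod q) mod q"
    by (metis (no_types, lifting) mod_mult_right_eq wt_mod)
  also have "\<dots> = (\<Sum>i<n. m i * G ^ i) mod q" by (rule mod_sum_eq)
  finally show ?thesis .
qed

lemma kronecker_less:
  assumes "\<And>i. i < n \<Longrightarrow> m i < G"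
  shows "(\<Sum>i<n. m i * G ^ i) < (G ^ n :: nat)"
  using assms
proof (induction n)
  case (Suc n)
  have "(\<Sum>i<Suc n. m i * G ^ i) < G ^ n + m n * G ^ n" using Suc by simp
  also have "\<dots> = (m n + 1) * G ^ n" by simp
  also have "\<dots> \<le> G * G ^ n" using Suc.prems[of n] by (intro mult_right_mono) auto
  finally show ?case by simp
qed simp

lemma kronecker_inj:
  assumes "\<And>i. i < n \<Longrightarrow> m i < G" "\<And>i. i < n \<Longrightarrow> m' i < G"
    and "(\<Sum>i<n. m i * G ^ i) = (\<Sum>i<n. m' i * G ^ i :: nat)" "i < n"
  shows "m i = m' i"
  using assms
proof (induction n)
  case (Suc n)
  let ?a = "\<Sum>i<n. m i * G ^ i" and ?b = "\<Sum>i<n. m' i * G ^ i"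
  have eq: "?a + G ^ n * m n = ?b + G ^ n * m' n" using Suc.prems(3) by (simp add: mult.commute)
  have ab: "?a < G ^ n" "?b < G ^ n" using Suc.prems(1,2) by (auto intro!: kronecker_less)
  have "(?a + G ^ n * m n) div G ^ n = m n" "(?b + G ^ n * m' n) div G ^ n = m' n"
    using ab by (simp_all only: div_mult_self2) auto
  then have n: "m n = m' n" using eq by metis
  then have "?a = ?b" using eq by simp
  then show ?case using Suc n by (cases "i = n") auto
qed simp

text \<open>All differences of Kronecker numbers are multiplied together. The product is positive
  and less than 4^t, so the least common multiple of 1, ..., 2t + 1 cannot divide it; some
  \<open>q\<close> in this range does not divide the product and hence none of its factors.\<close>

lemma lwt_separates:
  assumes fin: "finite Pr" and card: "card Pr \<le> N0"
    and G: "\<And>m m' i. (m, m') \<in> Pr \<Longrightarrow> i < n \<Longrightarrow> m i < G \<and> m' i < G"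
    and ne: "\<And>m m'. (m, m') \<in> Pr \<Longrightarrow> \<exists>i<n. m i \<noteq> m' i"
    and t: "G ^ (n * N0) < 4 ^ t" and Q: "2 * t + 1 \<le> Q" and G1: "G \<ge> 1"
  shows "\<exists>q. 1 \<le> q \<and> q \<le> Q \<and> (\<forall>(m, m') \<in> Pr. lwt G n q m \<noteq> lwt G n q m')"
proof -
  define K where "K m = (\<Sum>i<n. m i * G ^ i)" for m :: "nat \<Rightarrow> nat"
  define D where "D = (\<lambda>(m, m'). nat \<bar>int (K m) - int (K m')\<bar>)"
  define Z where "Z = (\<Prod>p\<in>Pr. D p)"
  have Kne: "K m \<noteq> K m'" if "(m, m') \<in> Pr" for m m'
    using kronecker_inj[of n m G m'] G[OF that] ne[OF that] unfolding K_def by metis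
  have Dpos: "D p > 0" if "p \<in> Pr" for p using that Kne by (cases p) (auto simp: D_def)
  have Dle: "D p \<le> G ^ n" if "p \<in> Pr" for p
  proof -
    obtain m m' where p: "p = (m, m')" by (cases p)
    have "K m < G ^ n" "K m' < G ^ n"
      unfolding K_def using G[of m m'] that p by (auto intro!: kronecker_less)
    then have "\<bar>int (K m) - int (K m')\<bar> \<le> int (G ^ n)" by linarith
    then show ?thesis unfolding p D_def prod.case by linarith
  qed
  have "Z \<le> (\<Prod>p\<in>Pr. G ^ n)" unfolding Z_def by (intro prod_mono) (auto simp: Dle)
  also have "\<dots> = G ^ (n * card Pr)" by (simp add: power_mult)
  also have "\<dots> \<le> G ^ (n * N0)" using card G1 by (intro power_increasing mult_left_mono) auto
  finally have Zlt: "Z < 4 ^ t" using t by linarith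
  have Zpos: "Z > 0" unfolding Z_def using Dpos by (intro prod_pos) auto
  have "\<exists>q\<in>{1..2 * t + 1}. \<not> q dvd Z"
  proof (rule ccontr)
    assume "\<not> ?thesis"
    then have "Lcm {1..2 * t + 1} dvd Z" by (intro Lcm_least) auto
    with Zpos have "Lcm {1..2 * t + 1} \<le> Z" by (intro dvd_imp_le)
    with four_power_le_Lcm[of t] Zlt show False by linarith
  qed
  then obtain q where q: "1 \<le> q" "q \<le> 2 * t + 1" "\<not> q dvd Z" by auto
  have "lwt G n q m \<noteq> lwt G n q m'" if "(m, m') \<in> Pr" for m m'
  proof
    assume "lwt G n q m = lwt G n q m'"
    then have "K m mod q = K m' mod q" unfolding K_def by (metis lwt_mod)
    then have "int q dvd int (K m) - int (K m')"
      by (metis mod_eq_dvd_iff of_nat_mod)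
    then have "q dvd D (m, m')"
    proof -
      assume "int q dvd int (K m) - int (K m')"
      then have "int q dvd int (nat \<bar>int (K m) - int (K m')\<bar>)" by simp
      then show ?thesis unfolding D_def prod.case int_dvd_int_iff .
    qed
    then have "q dvd Z" unfolding Z_def using that fin by (meson dvd_prodI dvd_trans)
    with q show False by simp
  qed
  with q Q show ?thesis by (intro exI[of _ q]) auto
qed

section \<open>Basis isolation\<close>

definition Mon :: "nat \<Rightarrow> nat set \<Rightarrow> (nat \<Rightarrow> nat) set" where
  "Mon G S = {m. (\<forall>i\<in>S. m i < G) \<and> (\<forall>i. i \<notin> S \<longrightarrow> m i = 0)}"

definition madd :: "(nat \<Rightarrow> nat) \<Rightarrow> (nat \<Rightarrow> nat) \<Rightarrow> nat \<Rightarrow> nat" where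
  "madd m1 m2 = (\<lambda>i. m1 i + m2 i)"

definition restr :: "nat set \<Rightarrow> (nat \<Rightarrow> nat) \<Rightarrow> nat \<Rightarrow> nat" where
  "restr B m = (\<lambda>i. if i \<in> B then m i else 0)"

lemma Mon_empty [simp]: "Mon G {} = {\<lambda>_. 0}"
  by (auto simp: Mon_def)

lemma finite_Mon [intro]: 
  assumes "finite S" shows "finite (Mon G S)"
proof (rule finite_subset)
  show "Mon G S \<subseteq> (\<lambda>f i. if i \<in> S then f i else 0) ` (S \<rightarrow>\<^sub>E {..<G})"
  proof
    fix m assume "m \<in> Mon G S"
    then show "m \<in> (\<lambda>f i. if i \<in> S then f i else 0) ` (S \<rightarrow>\<^sub>E {..<G})"
      by (intro image_eqI[of _ _ "restrict m S"]) (auto simp: Mon_def fun_eq_iff)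
  qed
qed (use assms in \<open>auto intro: finite_PiE\<close>)

lemma restr_Mon: "m \<in> Mon G S \<Longrightarrow> B \<subseteq> S \<Longrightarrow> restr B m \<in> Mon G B"
  by (auto simp: Mon_def restr_def)

lemma madd_Mon: "m1 \<in> Mon G A \<Longrightarrow> m2 \<in> Mon G B \<Longrightarrow> A \<inter> B = {} \<Longrightarrow> madd m1 m2 \<in> Mon G (A \<union> B)"
  by (fastforce simp: Mon_def madd_def)

lemma madd_restr: "m \<in> Mon G (A \<union> B) \<Longrightarrow> A \<inter> B = {} \<Longrightarrow> madd (restr A m) (restr B m) = m"
  by (fastforce simp: Mon_def madd_def restr_def fun_eq_iff)

lemma restr_madd:
  "m1 \<in> Mon G A \<Longrightarrow> m2 \<in> Mon G B \<Longrightarrow> A \<inter> B = {} \<Longrightarrow> restr A (madd m1 m2) = m1"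
  "m1 \<in> Mon G A \<Longrightarrow> m2 \<in> Mon G B \<Longrightarrow> A \<inter> B = {} \<Longrightarrow> restr B (madd m1 m2) = m2"
  by (fastforce simp: Mon_def madd_def restr_def fun_eq_iff)+

lemma madd_assoc: "madd (madd a b) c = madd a (madd b c)"
  by (simp add: madd_def add.assoc)

lemma card_Mon_le: "card B \<le> 1 \<Longrightarrow> finite B \<Longrightarrow> G \<ge> 1 \<Longrightarrow> card (Mon G B) \<le> G"
proof (cases "B = {}")
  case False
  assume "card B \<le> 1" "finite B"
  then obtain b where b: "B = {b}" using False
    by (metis One_nat_def card_1_singletonE card_gt_0_iff le_antisym less_eq_Suc_le)
  have "Mon G B \<subseteq> (\<lambda>x i. if i = b then x else 0) ` {..<G}"
    unfolding b by (auto simp: Mon_def image_def fun_eq_iff)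
  then have "card (Mon G B) \<le> card {..<G}" by (rule surj_card_le[rotated]) auto
  then show ?thesis by simp
qed simp

interpretation fv: vector_space "\<lambda>(a::'b::field) f x. a * (f x :: 'b)"
  by unfold_locales (auto simp: fun_eq_iff algebra_simps)

text \<open>
  The row of the monomial m in the matrix of coefficients whose columns are indexed by the monomials
  in the variables outside B.
\<close>

definition row :: "nat \<Rightarrow> nat set \<Rightarrow> ((nat \<Rightarrow> nat) \<Rightarrow> 'b::field) \<Rightarrow> nat set \<Rightarrow> (nat \<Rightarrow> nat) \<Rightarrow> (nat \<Rightarrow> nat) \<Rightarrow> 'b"
  where "row G S c B m = (\<lambda>m'. if m' \<in> Mon G (S - B) then c (madd m m') else 0)"

text \<open>In basis isolation \<open>K\<close> indexes a basis and has distinct weights. Both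
  requirements are split off, so that the property holds for all monomials at the start and survives
  products of two blocks; \<open>isolating_basis\<close> thins \<open>K\<close> out
  afterwards.\<close>

definition isolating :: "nat \<Rightarrow> nat set \<Rightarrow> ((nat \<Rightarrow> nat) \<Rightarrow> 'b::field) \<Rightarrow> nat set \<Rightarrow>
    ((nat \<Rightarrow> nat) \<Rightarrow> nat) \<Rightarrow> (nat \<Rightarrow> nat) set \<Rightarrow> bool" where
  "isolating G S c B \<omega> K \<longleftrightarrow> K \<subseteq> Mon G B \<and>
     (\<forall>m\<in>Mon G B - K. row G S c B m \<in> fv.span (row G S c B ` {s\<in>K. \<omega> s < \<omega> m}))"

lemma isolating_Mon: "isolating G S c B \<omega> (Mon G B)"
  by (auto simp: isolating_def)

text \<open>Fixing the exponents in \<open>B2\<close> to those of \<open>m2\<close> is a linear map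
  (\<open>\<Phi>\<close> in the proof) that sends the row of a monomial in \<open>B1\<close> to the
  row of its product with \<open>m2\<close>. So a linear dependency may be multiplied by
  \<open>m2\<close>.\<close>

lemma row_madd_span:
  assumes B: "B1 \<inter> B2 = {}" "B1 \<union> B2 \<subseteq> S" and m2: "m2 \<in> Mon G B2"
    and span: "row G S c B1 m1 \<in> fv.span (row G S c B1 ` T)"
    and T: "\<And>t. t \<in> T \<Longrightarrow> row G S c (B1 \<union> B2) (madd t m2) \<in> fv.span X"
  shows "row G S c (B1 \<union> B2) (madd m1 m2) \<in> fv.span X"
proof -
  define \<Phi> where "\<Phi> f = (\<lambda>m'. if m' \<in> Mon G (S - (B1 \<union> B2)) then f (madd m2 m') else 0)"
    for f :: "(nat \<Rightarrow> nat) \<Rightarrow> 'a"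
  have row: "\<Phi> (row G S c B1 m) = row G S c (B1 \<union> B2) (madd m m2)" for m
  proof
    fix m'
    have "madd m2 m' \<in> Mon G (S - B1)" if "m' \<in> Mon G (S - (B1 \<union> B2))"
    proof -
      have "B2 \<union> (S - (B1 \<union> B2)) = S - B1" using B by auto
      with madd_Mon[OF m2 that] show ?thesis by auto
    qed
    then show "\<Phi> (row G S c B1 m) m' = row G S c (B1 \<union> B2) (madd m m2) m'"
      by (auto simp: \<Phi>_def row_def madd_assoc)
  qed
  have "fv.subspace {f. \<Phi> f \<in> fv.span X}"
  proof (rule fv.subspaceI)
    show "0 \<in> {f. \<Phi> f \<in> fv.span X}"
    proof -
      have "\<Phi> 0 = 0" by (auto simp: \<Phi>_def fun_eq_iff)
      then show ?thesis by (simp add: fv.span_zero)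
    qed
  next
    fix f g assume "f \<in> {f. \<Phi> f \<in> fv.span X}" "g \<in> {f. \<Phi> f \<in> fv.span X}"
    moreover have "\<Phi> (f + g) = \<Phi> f + \<Phi> g" by (auto simp: \<Phi>_def fun_eq_iff)
    ultimately show "f + g \<in> {f. \<Phi> f \<in> fv.span X}" by (simp add: fv.span_add)
  next
    fix a f assume "f \<in> {f. \<Phi> f \<in> fv.span X}"
    moreover have "\<Phi> (\<lambda>x. a * f x) = (\<lambda>x. a * \<Phi> f x)" by (auto simp: \<Phi>_def fun_eq_iff)
    ultimately show "(\<lambda>x. a * f x) \<in> {f. \<Phi> f \<in> fv.span X}" by (simp add: fv.span_scale)
  qed
  moreover have "row G S c B1 ` T \<subseteq> {f. \<Phi> f \<in> fv.span X}" using T by (auto simp: row)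
  ultimately have "row G S c B1 m1 \<in> {f. \<Phi> f \<in> fv.span X}"
    using fv.span_minimal span by blast
  then show ?thesis by (simp add: row)
qed

lemma madd_commute: "madd a b = madd b a"
  by (simp add: madd_def add.commute)

text \<open>A part of \<open>m\<close> that is not in its \<open>K\<close> is replaced by lighter
  elements of this \<open>K\<close>, first in \<open>B1\<close> and then, if necessary, in
  \<open>B2\<close>. Every replacement lowers the weight of one part and never raises that of the
  other; by additivity only products lighter than \<open>m\<close> remain.\<close>

lemma isolating_merge:
  assumes B: "B1 \<inter> B2 = {}" "B1 \<union> B2 \<subseteq> S"
    and \<omega>: "\<And>m1 m2. \<omega> (madd m1 m2) = \<omega> m1 + \<omega> m2"
    and K1: "isolating G S c B1 \<omega> K1" and K2: "isolating G S c B2 \<omega> K2"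
  shows "isolating G S c (B1 \<union> B2) \<omega> ((\<lambda>(s, t). madd s t) ` (K1 \<times> K2))"
    (is "isolating _ _ _ ?B _ ?K")
  unfolding isolating_def
proof (intro conjI ballI)
  have sub: "K1 \<subseteq> Mon G B1" "K2 \<subseteq> Mon G B2" using K1 K2 by (auto simp: isolating_def)
  show "?K \<subseteq> Mon G ?B" using sub B by (auto intro!: madd_Mon)
  fix m assume m: "m \<in> Mon G ?B - ?K"
  let ?m1 = "restr B1 m" and ?m2 = "restr B2 m"
  have m12: "madd ?m1 ?m2 = m" using m B by (auto intro: madd_restr)
  have M1: "?m1 \<in> Mon G B1" and M2: "?m2 \<in> Mon G B2" using m by (auto intro: restr_Mon)
  have wm: "\<omega> m = \<omega> ?m1 + \<omega> ?m2" using \<omega>[of ?m1 ?m2] m12 by simp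
  let ?X = "row G S c ?B ` {s \<in> ?K. \<omega> s < \<omega> m}"
  have base: "row G S c ?B (madd s t) \<in> fv.span ?X"
    if "s \<in> K1" "t \<in> K2" "\<omega> s + \<omega> t < \<omega> m" for s t
    using that by (intro fv.span_base imageI) (auto simp: \<omega>)
  \<comment> \<open>The first part need not be strictly lighter here: strictness comes from
    replacing the second part.\<close>
  have right: "row G S c ?B (madd s ?m2) \<in> fv.span ?X"
    if s: "s \<in> K1" "?m2 \<notin> K2" "\<omega> s \<le> \<omega> ?m1" for s
  proof -
    have "row G S c (B2 \<union> B1) (madd ?m2 s) \<in> fv.span ?X"
    proof (rule row_madd_span)
      show "row G S c B2 ?m2 \<in> fv.span (row G S c B2 ` {t \<in> K2. \<omega> t < \<omega> ?m2})"
        using K2 M2 s(2) by (auto simp: isolating_def)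
    next
      fix t assume "t \<in> {t \<in> K2. \<omega> t < \<omega> ?m2}"
      then have "row G S c ?B (madd s t) \<in> fv.span ?X" using s wm by (intro base) auto
      then show "row G S c (B2 \<union> B1) (madd t s) \<in> fv.span ?X"
        by (simp add: Un_commute madd_commute)
    qed (use B s sub in auto)
    then show ?thesis by (simp add: Un_commute madd_commute)
  qed
  show "row G S c ?B m \<in> fv.span ?X"
  proof (cases "?m1 \<in> K1")
    case True
    have "?m2 \<notin> K2"
    proof
      assume "?m2 \<in> K2"
      with True have "(\<lambda>(s, t). madd s t) (?m1, ?m2) \<in> ?K" by (intro imageI) auto
      with m show False by (simp add: m12)
    qed
    then have "row G S c ?B (madd ?m1 ?m2) \<in> fv.span ?X" using True by (intro right) auto
    then show ?thesis by (simp add: m12)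
  next
    case False
    have "row G S c ?B (madd ?m1 ?m2) \<in> fv.span ?X"
    proof (rule row_madd_span)
      show "row G S c B1 ?m1 \<in> fv.span (row G S c B1 ` {t \<in> K1. \<omega> t < \<omega> ?m1})"
        using K1 M1 False by (auto simp: isolating_def)
    next
      fix t assume t: "t \<in> {t \<in> K1. \<omega> t < \<omega> ?m1}"
      then show "row G S c ?B (madd t ?m2) \<in> fv.span ?X"
        using base[of t ?m2] right[of t] wm by (cases "?m2 \<in> K2") auto
    qed (use B M2 in auto)
    then show ?thesis by (simp add: m12)
  qed
qed

text \<open>A refined weight may break ties but must not reverse a strict comparison.\<close>

lemma isolating_mono:
  assumes "isolating G S c B \<omega> K" "\<And>s m. s \<in> Mon G B \<Longrightarrow> \<omega> s < \<omega> m \<Longrightarrow> \<omega>' s < \<omega>' m"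
  shows "isolating G S c B \<omega>' K"
  unfolding isolating_def
proof (intro conjI ballI)
  fix m assume "m \<in> Mon G B - K"
  then have "row G S c B m \<in> fv.span (row G S c B ` {s\<in>K. \<omega> s < \<omega> m})"
    using assms(1) by (auto simp: isolating_def)
  also have "\<dots> \<subseteq> fv.span (row G S c B ` {s\<in>K. \<omega>' s < \<omega>' m})"
    using assms(1,2) by (intro fv.span_mono image_mono) (auto simp: isolating_def)
  finally show "row G S c B m \<in> fv.span (row G S c B ` {s\<in>K. \<omega>' s < \<omega>' m})" .
qed (use assms in \<open>auto simp: isolating_def\<close>)

text \<open>Greedy choice: an element is kept if its row is not spanned by the rows of lighter
  elements. Distinct weights make the elements arrive one by one, so the kept rows are independent
  and their number is at most the rank.\<close>

lemma isolating_basis: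
  assumes K: "isolating G S c B \<omega> K" "finite K" "inj_on \<omega> K"
    and rank: "finite T" "card T \<le> r" "\<And>m. m \<in> Mon G B \<Longrightarrow> row G S c B m \<in> fv.span T"
  shows "\<exists>K'\<subseteq>K. isolating G S c B \<omega> K' \<and> card K' \<le> r"
proof -
  let ?row = "row G S c B"
  define K' where "K' = {s \<in> K. ?row s \<notin> fv.span (?row ` {s'\<in>K. \<omega> s' < \<omega> s})}"
  have sub: "K' \<subseteq> K" by (auto simp: K'_def)
  have span1: "?row s \<in> fv.span (?row ` {u\<in>K'. \<omega> u \<le> \<omega> s})" if "s \<in> K" for s
    using that
  proof (induction "\<omega> s" arbitrary: s rule: less_induct)
    case less
    show ?case
    proof (cases "s \<in> K'")
      case True
      then show ?thesis by (intro fv.span_base imageI) auto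
    next
      case False
      then have "?row s \<in> fv.span (?row ` {s'\<in>K. \<omega> s' < \<omega> s})"
        using less.prems by (auto simp: K'_def)
      also have "\<dots> \<subseteq> fv.span (?row ` {u\<in>K'. \<omega> u \<le> \<omega> s})"
      proof (rule fv.span_minimal)
        show "?row ` {s'\<in>K. \<omega> s' < \<omega> s} \<subseteq> fv.span (?row ` {u\<in>K'. \<omega> u \<le> \<omega> s})"
        proof (rule image_subsetI)
          fix x assume x: "x \<in> {s'\<in>K. \<omega> s' < \<omega> s}"
          then have "?row x \<in> fv.span (?row ` {u\<in>K'. \<omega> u \<le> \<omega> x})" using less.hyps by auto
          also have "\<dots> \<subseteq> fv.span (?row ` {u\<in>K'. \<omega> u \<le> \<omega> s})"
            using x by (intro fv.span_mono image_mono) auto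
          finally show "?row x \<in> fv.span (?row ` {u\<in>K'. \<omega> u \<le> \<omega> s})" .
        qed
      qed auto
      finally show ?thesis .
    qed
  qed
  have lower: "fv.span (?row ` {s'\<in>K. \<omega> s' < x}) \<subseteq> fv.span (?row ` {u\<in>K'. \<omega> u < x})" for x
  proof (rule fv.span_minimal)
    show "?row ` {s'\<in>K. \<omega> s' < x} \<subseteq> fv.span (?row ` {u\<in>K'. \<omega> u < x})"
    proof (rule image_subsetI)
      fix y assume y: "y \<in> {s'\<in>K. \<omega> s' < x}"
      then have "?row y \<in> fv.span (?row ` {u\<in>K'. \<omega> u \<le> \<omega> y})" using span1 by auto
      also have "\<dots> \<subseteq> fv.span (?row ` {u\<in>K'. \<omega> u < x})"
        using y by (intro fv.span_mono image_mono) auto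
      finally show "?row y \<in> fv.span (?row ` {u\<in>K'. \<omega> u < x})" .
    qed
  qed auto
  have iso: "isolating G S c B \<omega> K'"
    unfolding isolating_def
  proof (intro conjI ballI)
    show "K' \<subseteq> Mon G B" using sub K by (auto simp: isolating_def)
    fix m assume m: "m \<in> Mon G B - K'"
    have "?row m \<in> fv.span (?row ` {s'\<in>K. \<omega> s' < \<omega> m})"
    proof (cases "m \<in> K")
      case True
      with m show ?thesis by (auto simp: K'_def)
    next
      case False
      with m K show ?thesis by (auto simp: isolating_def)
    qed
    with lower show "?row m \<in> fv.span (?row ` {u\<in>K'. \<omega> u < \<omega> m})" by blast
  qed
  \<comment> \<open>Induction over a threshold for the weight; by injectivity at most one element is
    added in each step.\<close>
  have "fv.independent (?row ` {s\<in>K'. \<omega> s < x}) \<and> inj_on ?row {s\<in>K'. \<omega> s < x}" for x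
  proof (induction x)
    case 0
    then show ?case by (simp add: fv.independent_empty)
  next
    case (Suc x)
    show ?case
    proof (cases "\<exists>t\<in>K'. \<omega> t = x")
      case False
      then have "{s\<in>K'. \<omega> s < Suc x} = {s\<in>K'. \<omega> s < x}" by (auto simp: less_Suc_eq)
      with Suc show ?thesis by simp
    next
      case True
      then obtain t where t: "t \<in> K'" "\<omega> t = x" by auto
      then have eq: "{s\<in>K'. \<omega> s < Suc x} = insert t {s\<in>K'. \<omega> s < x}"
        using K(3) sub by (auto simp: less_Suc_eq inj_on_def)
      have notin: "?row t \<notin> fv.span (?row ` {s\<in>K'. \<omega> s < x})"
      proof
        assume "?row t \<in> fv.span (?row ` {s\<in>K'. \<omega> s < x})"
        also have "\<dots> \<subseteq> fv.span (?row ` {s\<in>K. \<omega> s < x})"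
          using sub by (intro fv.span_mono image_mono) auto
        finally show False using t by (auto simp: K'_def)
      qed
      then have "fv.independent (insert (?row t) (?row ` {s\<in>K'. \<omega> s < x}))"
        using Suc fv.independent_insertI by blast
      moreover have "?row t \<notin> ?row ` {s\<in>K'. \<omega> s < x}"
        using notin fv.span_base[of "?row t"] by (meson notin)
      ultimately show ?thesis unfolding eq using Suc t by auto
    qed
  qed
  \<comment> \<open>Below this threshold lies all of \<open>K'\<close>; for empty \<open>K'\<close>
    the value of \<open>Max\<close> does not matter.\<close>
  from this[of "Suc (Max (\<omega> ` K'))"]
  have "fv.independent (?row ` {s\<in>K'. \<omega> s < Suc (Max (\<omega> ` K'))}) \<and>
      inj_on ?row {s\<in>K'. \<omega> s < Suc (Max (\<omega> ` K'))}" .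
  moreover have "{s\<in>K'. \<omega> s < Suc (Max (\<omega> ` K'))} = K'"
    using finite_subset[OF sub K(2)] by (auto simp: less_Suc_eq_le intro: Max_ge)
  ultimately have ind: "fv.independent (?row ` K')" "inj_on ?row K'" by auto
  have "?row ` K' \<subseteq> fv.span T"
    using rank(3) iso by (auto simp: isolating_def)
  then have "card (?row ` K') \<le> card T"
    using fv.independent_span_bound[OF rank(1) ind(1)] by auto
  with ind(2) rank(2) have "card K' \<le> r" by (simp add: card_image)
  with iso sub show ?thesis by blast
qed

text \<open>For the full block the zero monomial is the only column, and a row is a single
  coefficient. The lightest element of \<open>K\<close> with nonzero coefficient is isolated:
  another monomial of its weight is not in \<open>K\<close>, by injectivity, and so its coefficient
  is a combination of coefficients of lighter elements of \<open>K\<close>, which all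
  vanish.\<close>

lemma isolating_full:
  assumes K: "isolating G S c S \<omega> K" "inj_on \<omega> K"
    and nz: "m0 \<in> Mon G S" "c m0 \<noteq> 0"
  shows "\<exists>ms\<in>Mon G S. c ms \<noteq> 0 \<and> (\<forall>m\<in>Mon G S. \<omega> m = \<omega> ms \<longrightarrow> m \<noteq> ms \<longrightarrow> c m = 0)"
proof -
  have row0: "row G S c S m (\<lambda>_. 0) = c m" for m by (simp add: row_def madd_def)
  have vanish: "c m = 0" if m: "m \<in> Mon G S" "m \<notin> K" and low: "\<And>s. s \<in> K \<Longrightarrow> \<omega> s < \<omega> m \<Longrightarrow> c s = 0" for m
  proof -
    have "fv.subspace {f. f (\<lambda>_. 0) = (0::'a)}"
      by (rule fv.subspaceI) auto
    then have "fv.span (row G S c S ` {s\<in>K. \<omega> s < \<omega> m}) \<subseteq> {f. f (\<lambda>_. 0) = 0}"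
      using low by (intro fv.span_minimal) (auto simp: row0)
    moreover have "row G S c S m \<in> fv.span (row G S c S ` {s\<in>K. \<omega> s < \<omega> m})"
      using K m by (auto simp: isolating_def)
    ultimately show ?thesis using row0[of m] by auto
  qed
  have "\<exists>s\<in>K. c s \<noteq> 0" using vanish[of m0] nz by blast
  then obtain ms where ms: "ms \<in> K" "c ms \<noteq> 0" "\<And>s. s \<in> K \<Longrightarrow> c s \<noteq> 0 \<Longrightarrow> \<omega> ms \<le> \<omega> s"
    using ex_has_least_nat[of "\<lambda>s. s \<in> K \<and> c s \<noteq> 0" _ \<omega>] by metis
  have "c m = 0" if "m \<in> Mon G S" "\<omega> m = \<omega> ms" "m \<noteq> ms" for m
  proof (cases "m \<in> K")
    case True
    with K(2) ms(1) that show ?thesis by (auto simp: inj_on_def)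
  next
    case False
    with that(1) show ?thesis
    proof (rule vanish)
      fix s assume "s \<in> K" "\<omega> s < \<omega> m"
      with ms(3)[of s] that(2) show "c s = 0" by linarith
    qed
  qed
  moreover have "ms \<in> Mon G S" using K(1) ms(1) by (auto simp: isolating_def)
  ultimately show ?thesis using ms by blast
qed

section \<open>Weights along dyadic intervals\<close>

lemma lwt_madd: "lwt G n q (madd a b) = lwt G n q a + lwt G n q b"
  by (simp add: lwt_def madd_def distrib_right sum.distrib)

text \<open>
  The number in base Z with these digits, so that weights are compared level by level.
\<close>

fun cwt :: "nat \<Rightarrow> nat \<Rightarrow> nat \<Rightarrow> (nat \<Rightarrow> nat) \<Rightarrow> nat \<Rightarrow> (nat \<Rightarrow> nat) \<Rightarrow> nat" where
  "cwt Z G n q 0 m = lwt G n (q 0) m"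
| "cwt Z G n q (Suc l) m = cwt Z G n q l m * Z + lwt G n (q (Suc l)) m"

lemma cwt_cong: "(\<And>j. j \<le> l \<Longrightarrow> q j = q' j) \<Longrightarrow> cwt Z G n q l m = cwt Z G n q' l m"
  by (induction l) auto

lemma cwt_madd: "cwt Z G n q l (madd a b) = cwt Z G n q l a + cwt Z G n q l b"
  by (induction l) (auto simp: lwt_madd algebra_simps)

lemma cwt_eqI: "(\<And>j. j \<le> l \<Longrightarrow> lwt G n (q j) m = lwt G n (q j) m') \<Longrightarrow> cwt Z G n q l m = cwt Z G n q l m'"
  by (induction l) auto

text \<open>Intervals of ranks rather than of positions inside \<open>S\<close>: the dyadic tree is
  the same for all classes, at the price of empty blocks.\<close>

definition dblock :: "nat set \<Rightarrow> nat \<Rightarrow> nat \<Rightarrow> nat set" where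
  "dblock S l b = {i \<in> S. i div 2 ^ l = b}"

lemma dblock_Suc: "dblock S (Suc l) b = dblock S l (2 * b) \<union> dblock S l (2 * b + 1)"
proof -
  have "i div 2 ^ Suc l = b \<longleftrightarrow> i div 2 ^ l = 2 * b \<or> i div 2 ^ l = 2 * b + 1" for i
  proof -
    have "i div 2 ^ Suc l = (i div 2 ^ l) div 2" by (simp only: power_Suc2 div_mult2_eq)
    moreover have "x div 2 = b \<longleftrightarrow> x = 2 * b \<or> x = 2 * b + 1" for x :: nat by presburger
    ultimately show ?thesis by simp
  qed
  then show ?thesis by (auto simp: dblock_def)
qed

lemma dblock_disjoint: "b \<noteq> b' \<Longrightarrow> dblock S l b \<inter> dblock S l b' = {}"
  by (auto simp: dblock_def)

lemma dblock_subset: "dblock S l b \<subseteq> S"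
  by (auto simp: dblock_def)

lemma dblock_beyond: "S \<subseteq> {..<n} \<Longrightarrow> n \<le> b \<Longrightarrow> dblock S l b = {}"
  unfolding dblock_def by auto (metis div_le_dividend leD le_trans lessThan_iff subsetD)

lemma dblock_full: "S \<subseteq> {..<n} \<Longrightarrow> n \<le> 2 ^ l \<Longrightarrow> dblock S l 0 = S"
  unfolding dblock_def by auto

lemma card_dblock_0: "card (dblock S 0 b) \<le> 1"
proof -
  have "dblock S 0 b \<subseteq> {b}" by (auto simp: dblock_def)
  then show ?thesis using card_mono[of "{b}"] by fastforce
qed

text \<open>\<open>Cd\<close> bounds the candidates of a block before thinning: at most
  \<open>G\<close> monomials at level 0 and \<open>r * r\<close> products above. At most
  \<open>n\<close> blocks of a level are nonempty, so there are \<open>n * (Cd * Cd)\<close> pairs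
  to separate, and \<open>t\<close> and \<open>Q\<close> are the resulting parameters of
  \<open>lwt_separates\<close>. \<open>Z\<close> exceeds every single weight.\<close>

locale isolation =
  fixes G n r Q t Cd Z :: nat and S :: "nat set" and c :: "(nat \<Rightarrow> nat) \<Rightarrow> 'b::field"
  assumes S: "S \<subseteq> {..<n}" and G1: "G \<ge> 1"
    and rank: "\<And>l b. \<exists>T. finite T \<and> card T \<le> r \<and>
      (\<forall>m\<in>Mon G (dblock S l b). row G S c (dblock S l b) m \<in> fv.span T)"
    and Cd: "G \<le> Cd" "r * r \<le> Cd"
    and t: "G ^ (n * (n * (Cd * Cd))) < 4 ^ t" and Q: "2 * t + 1 \<le> Q" and Z: "n * G * Q < Z"
begin

lemma finS: "finite S" using S finite_subset by blast

lemma fin_dblock: "finite (dblock S l b)"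
  by (rule finite_subset[OF dblock_subset finS])

lemma fin_Mon_block: "finite (Mon G (dblock S l b))"
  by (rule finite_Mon[OF fin_dblock])

lemma lwt_less: "m \<in> Mon G S \<Longrightarrow> 1 \<le> q \<Longrightarrow> q \<le> Q \<Longrightarrow> lwt G n q m < Z"
proof -
  assume m: "m \<in> Mon G S" and q: "1 \<le> q" "q \<le> Q"
  have mi: "m i \<le> G" for i 
  proof (cases "i \<in> S")
    case True
    then have "m i < G" using m unfolding Mon_def by blast
    then show ?thesis by simp
  next
    case False
    then have "m i = 0" using m unfolding Mon_def by blast
    then show ?thesis by simp
  qed
  have "lwt G n q m \<le> (\<Sum>i<n. G * Q)"
    unfolding lwt_def by (intro sum_mono mult_mono mi le_trans[OF wt_le[OF q(1)] q(2)]) auto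
  also have "\<dots> < Z" using Z by simp
  finally show ?thesis .
qed

lemma Mon_block_S: "m \<in> Mon G (dblock S l b) \<Longrightarrow> m \<in> Mon G S"
  using G1 dblock_subset[of S l b] by (force simp: Mon_def)

text \<open>One modulus has to serve all blocks of a level at once, as a seed has only one modulus
  per level. Blocks with number at least \<open>n\<close> are empty and need no separation.\<close>

lemma select_weight:
  assumes K: "\<And>b. K b \<subseteq> Mon G (dblock S l b)" "\<And>b. card (K b) \<le> Cd"
  shows "\<exists>q. 1 \<le> q \<and> q \<le> Q \<and> (\<forall>b. inj_on (lwt G n q) (K b))"
proof -
  define Pr where "Pr = (\<Union>b<n. {(s, s'). s \<in> K b \<and> s' \<in> K b \<and> s \<noteq> s'})"
  have fin: "finite (K b)" for b by (rule finite_subset[OF K(1) fin_Mon_block])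
  have sub: "{(s, s'). s \<in> K b \<and> s' \<in> K b \<and> s \<noteq> s'} \<subseteq> K b \<times> K b" for b by auto
  have c1: "card {(s, s'). s \<in> K b \<and> s' \<in> K b \<and> s \<noteq> s'} \<le> Cd * Cd" for b
  proof -
    have "card {(s, s'). s \<in> K b \<and> s' \<in> K b \<and> s \<noteq> s'} \<le> card (K b \<times> K b)"
      using sub fin by (intro card_mono) auto
    also have "\<dots> \<le> Cd * Cd" using K(2) by (simp add: card_cartesian_product mult_mono)
    finally show ?thesis .
  qed
  have "\<exists>q. 1 \<le> q \<and> q \<le> Q \<and> (\<forall>(m, m') \<in> Pr. lwt G n q m \<noteq> lwt G n q m')"
  proof (rule lwt_separates[where G = G and ?N0.0 = "n * (Cd * Cd)"])
    show "finite Pr" unfolding Pr_def using finite_subset[OF sub] fin by auto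
    have "card Pr \<le> (\<Sum>b<n. card {(s, s'). s \<in> K b \<and> s' \<in> K b \<and> s \<noteq> s'})"
      unfolding Pr_def by (rule card_UN_le) auto
    also have "\<dots> \<le> (\<Sum>b<n. Cd * Cd)" by (intro sum_mono c1)
    finally show "card Pr \<le> n * (Cd * Cd)" by simp
  next
    fix m m' i assume "(m, m') \<in> Pr" "i < n"
    then have "m \<in> Mon G S" "m' \<in> Mon G S" unfolding Pr_def using K(1) Mon_block_S by blast+
    then show "m i < G \<and> m' i < G" using G1 by (cases "i \<in> S") (auto simp: Mon_def)
  next
    fix m m' assume mm: "(m, m') \<in> Pr"
    then have "m \<in> Mon G S" "m' \<in> Mon G S" unfolding Pr_def using K(1) Mon_block_S by blast+
    moreover have "m \<noteq> m'" using mm by (auto simp: Pr_def)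
    then obtain i where i: "m i \<noteq> m' i" by auto
    ultimately have "i \<in> S" by (auto simp: Mon_def) (metis)
    with i S show "\<exists>i<n. m i \<noteq> m' i" by auto
  qed (use t Q G1 in auto)
  then obtain q where q: "1 \<le> q" "q \<le> Q" "\<And>m m'. (m, m') \<in> Pr \<Longrightarrow> lwt G n q m \<noteq> lwt G n q m'"
    by blast
  have "inj_on (lwt G n q) (K b)" for b
  proof (cases "b < n")
    case True
    show ?thesis
    proof (rule inj_onI, rule ccontr)
      fix x y assume "x \<in> K b" "y \<in> K b" "lwt G n q x = lwt G n q y" "x \<noteq> y"
      then have "(x, y) \<in> Pr" using True by (auto simp: Pr_def)
      with q(3) \<open>lwt G n q x = lwt G n q y\<close> show False by blast
    qed
  next
    case False
    then have "dblock S l b = {}" using dblock_beyond[OF S] by auto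
    then show ?thesis using K(1)[of b] by (auto intro: inj_on_subset[of _ "{\<lambda>_. 0}"])
  qed
  with q show ?thesis by blast
qed

text \<open>Merging squares the size of the isolating sets. A new least significant digit of the
  weight makes the products of two children distinct, and then the rank bound brings the size back
  to \<open>r\<close>, so that it does not grow with the level.\<close>

lemma levels:
  "\<exists>q. (\<forall>j\<le>l. 1 \<le> q j \<and> q j \<le> Q) \<and>
     (\<forall>b. \<exists>K. isolating G S c (dblock S l b) (cwt Z G n q l) K \<and>
        inj_on (cwt Z G n q l) K \<and> card K \<le> r)"
proof (induction l)
  case 0
  have "card (Mon G (dblock S 0 b)) \<le> Cd" for b
    using card_Mon_le[OF card_dblock_0 fin_dblock G1] Cd(1) by (rule le_trans)
  then obtain q where q: "1 \<le> q" "q \<le> Q" "\<And>b. inj_on (lwt G n q) (Mon G (dblock S 0 b))"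
    using select_weight[of "\<lambda>b. Mon G (dblock S 0 b)" 0] by blast
  have "\<exists>K. isolating G S c (dblock S 0 b) (cwt Z G n (\<lambda>_. q) 0) K \<and>
      inj_on (cwt Z G n (\<lambda>_. q) 0) K \<and> card K \<le> r" for b
  proof -
    let ?w = "cwt Z G n (\<lambda>_. q) 0"
    have inj: "inj_on ?w (Mon G (dblock S 0 b))" using q(3) by (simp cong: inj_on_cong)
    from rank[of 0 b] obtain T where "finite T" "card T \<le> r"
      "\<And>m. m\<in>Mon G (dblock S 0 b) \<Longrightarrow> row G S c (dblock S 0 b) m \<in> fv.span T" by blast
    from isolating_basis[OF isolating_Mon fin_Mon_block inj this]
    show ?thesis using inj inj_on_subset by blast
  qed
  then show ?case using q(1,2) by (intro exI[of _ "\<lambda>_. q"] conjI allI impI)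
next
  case (Suc l)
  then obtain q where q: "\<And>j. j \<le> l \<Longrightarrow> 1 \<le> q j \<and> q j \<le> Q"
    and ex: "\<And>b. \<exists>K. isolating G S c (dblock S l b) (cwt Z G n q l) K \<and>
        inj_on (cwt Z G n q l) K \<and> card K \<le> r" by blast
  from ex obtain K where K: "\<And>b. isolating G S c (dblock S l b) (cwt Z G n q l) (K b)"
    "\<And>b. inj_on (cwt Z G n q l) (K b)" "\<And>b. card (K b) \<le> r" by metis
  have Ksub: "K b \<subseteq> Mon G (dblock S l b)" for b using K(1) by (auto simp: isolating_def)
  have Kfin: "finite (K b)" for b by (rule finite_subset[OF Ksub fin_Mon_block])
  define K' where "K' b = (\<lambda>(s, u). madd s u) ` (K (2 * b) \<times> K (2 * b + 1))" for b
  have iso: "isolating G S c (dblock S (Suc l) b) (cwt Z G n q l) (K' b)" for b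
    unfolding dblock_Suc K'_def using dblock_disjoint[of "2*b" "2*b+1"] dblock_subset
    by (intro isolating_merge K cwt_madd) auto
  have K'sub: "K' b \<subseteq> Mon G (dblock S (Suc l) b)" for b
    using iso by (auto simp: isolating_def)
  have "card (K' b) \<le> Cd" for b
  proof -
    have "card (K' b) \<le> card (K (2 * b) \<times> K (2 * b + 1))"
      unfolding K'_def by (intro card_image_le finite_cartesian_product Kfin)
    also have "\<dots> \<le> r * r" by (simp add: card_cartesian_product mult_mono K(3))
    finally show ?thesis using Cd(2) by linarith
  qed
  then obtain p where p: "1 \<le> p" "p \<le> Q" "\<And>b. inj_on (lwt G n p) (K' b)"
    using select_weight[of K' "Suc l"] K'sub by blast
  define q' where "q' = q(Suc l := p)"
  have cw: "cwt Z G n q' (Suc l) m = cwt Z G n q l m * Z + lwt G n p m" for m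
    using cwt_cong[of l q' q] by (simp add: q'_def)
  have lwtK: "lwt G n p s < Z" if "s \<in> Mon G (dblock S (Suc l) b)" for s b
    using Mon_block_S[OF that] p lwt_less by blast
  have "\<exists>K. isolating G S c (dblock S (Suc l) b) (cwt Z G n q' (Suc l)) K \<and>
      inj_on (cwt Z G n q' (Suc l)) K \<and> card K \<le> r" for b
  proof -
    let ?B = "dblock S (Suc l) b"
    \<comment> \<open>The new digit is less than \<open>Z\<close>, so it cannot reverse a strict
      comparison of the old weights.\<close>
    have iso': "isolating G S c ?B (cwt Z G n q' (Suc l)) (K' b)"
    proof (rule isolating_mono[OF iso])
      fix s m assume s: "s \<in> Mon G ?B" and less: "cwt Z G n q l s < cwt Z G n q l m"
      have "cwt Z G n q l s * Z + lwt G n p s < (cwt Z G n q l s + 1) * Z" using lwtK[OF s] by simp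
      also have "\<dots> \<le> cwt Z G n q l m * Z" using less by (intro mult_right_mono) auto
      finally show "cwt Z G n q' (Suc l) s < cwt Z G n q' (Suc l) m" unfolding cw by linarith
    qed
    \<comment> \<open>The new digit, recovered modulo \<open>Z\<close>, separates the elements by
      itself.\<close>
    have inj: "inj_on (cwt Z G n q' (Suc l)) (K' b)"
    proof (rule inj_onI)
      fix x y assume xy: "x \<in> K' b" "y \<in> K' b" "cwt Z G n q' (Suc l) x = cwt Z G n q' (Suc l) y"
      then have "lwt G n p x < Z" "lwt G n p y < Z" using K'sub lwtK by blast+
      moreover have "(cwt Z G n q l x * Z + lwt G n p x) mod Z = (cwt Z G n q l y * Z + lwt G n p y) mod Z"
        using xy(3) unfolding cw by simp
      ultimately have "lwt G n p x = lwt G n p y" by simp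
      with p(3) xy show "x = y" by (auto simp: inj_on_def)
    qed
    from rank[of "Suc l" b] obtain T where "finite T" "card T \<le> r"
      "\<And>m. m\<in>Mon G ?B \<Longrightarrow> row G S c ?B m \<in> fv.span T" by blast
    from isolating_basis[OF iso' finite_subset[OF K'sub fin_Mon_block] inj this]
    show ?thesis using inj inj_on_subset by blast
  qed
  moreover have "\<forall>j\<le>Suc l. 1 \<le> q' j \<and> q' j \<le> Q" using q p by (auto simp: q'_def le_Suc_eq)
  ultimately show ?case by blast
qed

text \<open>Monomials with the same weights at all levels have the same \<open>cwt\<close>, so only
  \<open>ms\<close> contributes. In this form the sum is a coefficient of a polynomial in
  \<open>Suc l\<close> new variables, each of degree less than \<open>Z\<close>; the combined weight
  \<open>cwt\<close> only serves for comparisons and never becomes an exponent.\<close>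

lemma isolated_coefficient:
  assumes "n \<le> 2 ^ l" and nz: "m0 \<in> Mon G S" "c m0 \<noteq> 0"
  shows "\<exists>q. \<exists>ms\<in>Mon G S. (\<forall>j\<le>l. 1 \<le> q j \<and> q j \<le> Q) \<and>
    (\<Sum>m\<in>{m\<in>Mon G S. \<forall>j\<in>{..<Suc l}. lwt G n (q j) m = lwt G n (q j) ms}. c m) \<noteq> 0"
proof -
  from levels[of l] obtain q where q: "\<forall>j\<le>l. 1 \<le> q j \<and> q j \<le> Q"
    and ex: "\<And>b. \<exists>K. isolating G S c (dblock S l b) (cwt Z G n q l) K \<and>
        inj_on (cwt Z G n q l) K \<and> card K \<le> r" by blast
  from ex[of 0] obtain K where K: "isolating G S c S (cwt Z G n q l) K" "inj_on (cwt Z G n q l) K"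
    unfolding dblock_full[OF S assms(1)] by blast
  from isolating_full[OF this nz] obtain ms where ms: "ms \<in> Mon G S" "c ms \<noteq> 0"
    "\<And>m. m\<in>Mon G S \<Longrightarrow> cwt Z G n q l m = cwt Z G n q l ms \<Longrightarrow> m \<noteq> ms \<Longrightarrow> c m = 0" by blast
  let ?M = "{m\<in>Mon G S. \<forall>j\<in>{..<Suc l}. lwt G n (q j) m = lwt G n (q j) ms}"
  have "(\<Sum>m\<in>?M. c m) = (\<Sum>m\<in>{ms}. c m)"
  proof (rule sum.mono_neutral_right)
    show "finite ?M" using finite_Mon[OF finS, of G] by simp
    show "\<forall>m\<in>?M - {ms}. c m = 0"
    proof
      fix m assume m: "m \<in> ?M - {ms}"
      then have "cwt Z G n q l m = cwt Z G n q l ms" by (intro cwt_eqI) auto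
      with m ms(3) show "c m = 0" by blast
    qed
  qed (use ms in auto)
  with ms q show ?thesis by (intro exI[of _ q] bexI[of _ ms]) auto
qed

end

text \<open>A polynomial whose degree in each variable is less than the side of a grid is determined
  by its values there. It is given as a family of terms whose exponent vectors may collide, because
  distinct monomials may collide after the substitution; \<open>\<nu>\<close> is the exponent vector
  whose coefficient is read off.\<close>

lemma grid_vanishing:
  fixes c :: "'i \<Rightarrow> 'b::idom" and m :: nat
  assumes fin: "finite I" and E: "finite E" and w: "\<And>i j. i \<in> I \<Longrightarrow> j < m \<Longrightarrow> w j i < card E"
    and zero: "\<And>e. (\<And>j. j < m \<Longrightarrow> e j \<in> E) \<Longrightarrow> (\<Sum>i\<in>I. c i * (\<Prod>j<m. e j ^ w j i)) = 0"
  shows "(\<Sum>i\<in>{i\<in>I. \<forall>j\<in>{..<m}. w j i = \<nu> j}. c i) = 0"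
  using fin w zero
proof (induction m arbitrary: I)
  case 0
  from 0(3)[of "\<lambda>_. undefined"] show ?case by simp
next
  case (Suc m)
  let ?I = "{i\<in>I. w m i = \<nu> m}"
  have eq: "{i\<in>I. \<forall>j\<in>{..<Suc m}. w j i = \<nu> j} = {i\<in>?I. \<forall>j\<in>{..<m}. w j i = \<nu> j}"
    by (auto simp: less_Suc_eq)
  have "(\<Sum>i\<in>?I. c i * (\<Prod>j<m. e j ^ w j i)) = 0" if e: "\<And>j. j < m \<Longrightarrow> e j \<in> E" for e
  \<comment> \<open>No term attains an exponent beyond the bound, so the sum is empty then.\<close>
  proof (cases "card E = 0 \<or> \<nu> m \<ge> card E")
    case True
    then have "?I = {}" using Suc.prems(2)[of _ m] by fastforce
    then show ?thesis by (simp only: sum.empty)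
  next
    case False
    define p where "p = (\<Sum>i\<in>I. monom (c i * (\<Prod>j<m. e j ^ w j i)) (w m i))"
    have "poly p x = 0" if "x \<in> E" for x
    proof -
      have "poly p x = (\<Sum>i\<in>I. c i * (\<Prod>j<Suc m. (e(m := x)) j ^ w j i))"
        unfolding p_def poly_sum
      proof (intro sum.cong refl)
        fix i
        have "(\<Prod>j<m. (e(m := x)) j ^ w j i) = (\<Prod>j<m. e j ^ w j i)" by (intro prod.cong) auto
        then show "poly (monom (c i * (\<Prod>j<m. e j ^ w j i)) (w m i)) x =
            c i * (\<Prod>j<Suc m. (e(m := x)) j ^ w j i)"
          by (simp add: poly_monom mult.assoc)
      qed
      also have "\<dots> = 0" using e that by (intro Suc.prems(3)) (auto simp: less_Suc_eq)
      finally show ?thesis .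
    qed
    moreover have "degree p < card E"
      unfolding p_def using Suc.prems(2)[of _ m] False
      by (intro degree_sum_less) (auto intro: le_less_trans[OF degree_monom_le])
    ultimately have "p = 0"
    proof -
      assume roots: "\<And>x. x \<in> E \<Longrightarrow> poly p x = 0" and deg: "degree p < card E"
      show "p = 0"
      proof (rule ccontr)
        assume p: "p \<noteq> 0"
        have "card E \<le> card {x. poly p x = 0}"
          using roots by (intro card_mono poly_roots_finite p) auto
        also have "\<dots> \<le> degree p" by (rule card_poly_roots_bound[OF p])
        finally show False using deg by simp
      qed
    qed
    then have "0 = coeff p (\<nu> m)" by simp
    also have "\<dots> = (\<Sum>i\<in>I. if w m i = \<nu> m then c i * (\<Prod>j<m. e j ^ w j i) else 0)"
      by (simp add: p_def coeff_sum)
    also have "\<dots> = (\<Sum>i\<in>?I. c i * (\<Prod>j<m. e j ^ w j i))"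
      using Suc.prems(1) by (subst sum.inter_filter) auto
    finally show ?thesis by simp
  qed
  then have "(\<Sum>i\<in>{i\<in>?I. \<forall>j\<in>{..<m}. w j i = \<nu> j}. c i) = 0"
    using Suc.prems(1,2) by (intro Suc.IH) auto
  then show ?case unfolding eq .
qed

section \<open>Substitution of a generator into a class of variables\<close>

text \<open>The program after renaming variables to ranks, over the field in which the generator
  takes its values; \<open>lam\<close> holds the coefficients of the labels, with 0 for missing
  edges. The assumption \<open>reads\<close> keeps the individual degrees below \<open>G\<close>, so
  \<open>Mon G S\<close> contains all monomials that occur.\<close>

locale layered =
  fixes L d w n G :: nat and vs sz :: "nat \<Rightarrow> nat"
    and lam :: "nat \<Rightarrow> nat \<Rightarrow> nat \<Rightarrow> nat \<Rightarrow> 'b::field"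
  assumes vs: "\<And>l. l < L \<Longrightarrow> vs l < n" and sz: "\<And>l. l < L \<Longrightarrow> sz l \<le> w"
    and reads: "\<And>i. d * card {l. l < L \<and> vs l = i} < G" and w1: "w \<ge> 1"
begin

fun val :: "(nat \<Rightarrow> 'b) \<Rightarrow> nat \<Rightarrow> nat \<Rightarrow> 'b" where
  "val x 0 u = (if u = 0 then 1 else 0)"
| "val x (Suc l) u' = (\<Sum>u<sz l. (\<Sum>e\<le>d. lam l u u' e * x (vs l) ^ e) * val x l u)"

text \<open>The coefficients of \<^const>\<open>val\<close> as a polynomial in the variables in S, the others being set to a.\<close>

fun cf :: "nat set \<Rightarrow> (nat \<Rightarrow> 'b) \<Rightarrow> nat \<Rightarrow> nat \<Rightarrow> (nat \<Rightarrow> nat) \<Rightarrow> 'b" where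
  "cf S a 0 u m = (if u = 0 \<and> m = (\<lambda>_. 0) then 1 else 0)"
| "cf S a (Suc l) u' m = (\<Sum>u<sz l. \<Sum>e\<le>d. lam l u u' e *
     (if vs l \<in> S then if e \<le> m (vs l) then cf S a l u (m(vs l := m (vs l) - e)) else 0
      else a (vs l) ^ e * cf S a l u m))"

section \<open>Coefficients of a program in the variables of a class, and their rank\<close>

lemma G1: "G \<ge> 1" using reads[of 0] by simp

definition cnt :: "nat \<Rightarrow> nat \<Rightarrow> nat" where "cnt l i = card {l'. l' < l \<and> vs l' = i}"

lemma cnt_Suc: "cnt (Suc l) i = cnt l i + (if vs l = i then 1 else 0)"
proof -
  have "{l'. l' < Suc l \<and> vs l' = i} = {l'. l' < l \<and> vs l' = i} \<union> (if vs l = i then {l} else {})"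
    by (auto simp: less_Suc_eq)
  then show ?thesis by (simp add: cnt_def)
qed

lemma cnt_mono: "l \<le> l' \<Longrightarrow> cnt l i \<le> cnt l' i"
  unfolding cnt_def by (intro card_mono) auto

lemma cf_support: "cf S a l u m \<noteq> 0 \<Longrightarrow> i \<in> S \<Longrightarrow> m i \<le> d * cnt l i"
proof (induction l arbitrary: u m)
  case 0
  then show ?case by (auto split: if_splits)
next
  case (Suc l)
  from Suc.prems(1) obtain u0 e where e: "e \<le> d" and nz:
    "(if vs l \<in> S then if e \<le> m (vs l) then cf S a l u0 (m(vs l := m (vs l) - e)) else 0
      else a (vs l) ^ e * cf S a l u0 m) \<noteq> 0"
    by (auto elim!: sum.not_neutral_contains_not_neutral simp del: mult_eq_0_iff) fastforce
  show ?case
  proof (cases "vs l \<in> S")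
    case True
    with nz have nz': "cf S a l u0 (m(vs l := m (vs l) - e)) \<noteq> 0" "e \<le> m (vs l)"
      by (auto split: if_splits)
    have "(m(vs l := m (vs l) - e)) i \<le> d * cnt l i" by (rule Suc.IH[OF nz'(1) Suc.prems(2)])
    then show ?thesis using e nz'(2) by (auto simp: cnt_Suc distrib_left split: if_splits)
  next
    case False
    with nz have "m i \<le> d * cnt l i" using Suc.IH[OF _ Suc.prems(2)] by auto
    then show ?thesis by (auto simp: cnt_Suc distrib_left)
  qed
qed

lemma val_expand:
  assumes S: "finite S" and l: "l \<le> L"
  shows "val (\<lambda>i. if i \<in> S then x i else a i) l u =
    (\<Sum>m\<in>Mon G S. cf S a l u m * (\<Prod>i\<in>S. x i ^ m i))"
  using l
proof (induction l arbitrary: u)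
  case 0
  have zero: "(\<lambda>_. 0) \<in> Mon G S" using G1 by (auto simp: Mon_def)
  have "(\<Sum>m\<in>Mon G S. cf S a 0 u m * (\<Prod>i\<in>S. x i ^ m i)) =
      (\<Sum>m\<in>Mon G S. if m = (\<lambda>_. 0) then if u = 0 then 1 else 0 else 0)"
    by (intro sum.cong) auto
  then show ?case using zero finite_Mon[OF S] by (simp add: sum.delta)
next
  case (Suc l)
  let ?x = "\<lambda>i. if i \<in> S then x i else a i" and ?v = "vs l"
  let ?h = "\<lambda>u e m. if ?v \<in> S then if e \<le> m ?v then cf S a l u (m(?v := m ?v - e)) else 0
      else a ?v ^ e * cf S a l u m"
  have key: "(\<Sum>m\<in>Mon G S. ?h u e m * (\<Prod>i\<in>S. x i ^ m i)) = ?x ?v ^ e * val ?x l u"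
    if e: "e \<le> d" for u e
  proof (cases "?v \<in> S")
    case False
    then show ?thesis using Suc by (simp add: sum_distrib_left mult.assoc)
  next
    case True
    have "(\<Sum>m\<in>Mon G S. ?h u e m * (\<Prod>i\<in>S. x i ^ m i)) =
        (\<Sum>m\<in>{m\<in>Mon G S. e \<le> m ?v}. cf S a l u (m(?v := m ?v - e)) * (\<Prod>i\<in>S. x i ^ m i))"
      using True by (intro sum.mono_neutral_cong_right finite_Mon[OF S]) auto
    also have "\<dots> = (\<Sum>m\<in>{m\<in>Mon G S. m ?v + e < G}. cf S a l u m * (x ?v ^ e * (\<Prod>i\<in>S. x i ^ m i)))"
    proof (rule sum.reindex_bij_witness[where i = "\<lambda>m. m(?v := m ?v + e)" and j = "\<lambda>m. m(?v := m ?v - e)"])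
      fix m assume m: "m \<in> {m\<in>Mon G S. e \<le> m ?v}"
      have "(\<Prod>i\<in>S. x i ^ m i) = x ?v ^ m ?v * (\<Prod>i\<in>S - {?v}. x i ^ m i)"
        using S True by (rule prod.remove)
      also have "x ?v ^ m ?v = x ?v ^ e * x ?v ^ (m ?v - e)"
        using m by (simp add: power_add[symmetric])
      also have "(\<Prod>i\<in>S - {?v}. x i ^ m i) = (\<Prod>i\<in>S - {?v}. x i ^ (m(?v := m ?v - e)) i)"
        by (intro prod.cong) auto
      also have "x ?v ^ e * x ?v ^ (m ?v - e) * (\<Prod>i\<in>S - {?v}. x i ^ (m(?v := m ?v - e)) i) =
          x ?v ^ e * (\<Prod>i\<in>S. x i ^ (m(?v := m ?v - e)) i)"
        using S True by (simp add: prod.remove[of S ?v])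
      finally show "cf S a l u (m(?v := m ?v - e)) * (x ?v ^ e * (\<Prod>i\<in>S. x i ^ (m(?v := m ?v - e)) i)) =
          cf S a l u (m(?v := m ?v - e)) * (\<Prod>i\<in>S. x i ^ m i)" by simp
    qed (use True in \<open>auto simp: Mon_def\<close>)
    \<comment> \<open>Only monomials for which the factor x^e would raise the exponent to
      \<open>G\<close> or beyond were dropped by the shift; their coefficients are 0 by
      \<open>cf_support\<close>.\<close>
    also have "\<dots> = (\<Sum>m\<in>Mon G S. cf S a l u m * (x ?v ^ e * (\<Prod>i\<in>S. x i ^ m i)))"
    proof (rule sum.mono_neutral_left)
      show "\<forall>m\<in>Mon G S - {m \<in> Mon G S. m ?v + e < G}.
          cf S a l u m * (x ?v ^ e * (\<Prod>i\<in>S. x i ^ m i)) = 0"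
      proof
        fix m assume m: "m \<in> Mon G S - {m \<in> Mon G S. m ?v + e < G}"
        have "d * cnt l ?v + d = d * cnt (Suc l) ?v" by (simp add: cnt_Suc)
        also have "\<dots> \<le> d * cnt L ?v" using Suc.prems by (intro mult_left_mono cnt_mono) auto
        also have "\<dots> < G" using reads[of ?v] by (simp add: cnt_def)
        finally have "\<not> m ?v \<le> d * cnt l ?v" using m e by auto
        then have "cf S a l u m = 0" using cf_support[OF _ True] by blast
        then show "cf S a l u m * (x ?v ^ e * (\<Prod>i\<in>S. x i ^ m i)) = 0" by simp
      qed
    qed (use finite_Mon[OF S] in auto)
    also have "\<dots> = ?x ?v ^ e * val ?x l u"
      using True Suc by (simp add: sum_distrib_left algebra_simps)
    finally show ?thesis .
  qed
  have "(\<Sum>m\<in>Mon G S. cf S a (Suc l) u m * (\<Prod>i\<in>S. x i ^ m i)) =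
      (\<Sum>m\<in>Mon G S. \<Sum>u'<sz l. \<Sum>e\<le>d. lam l u' u e * (?h u' e m * (\<Prod>i\<in>S. x i ^ m i)))"
    by (simp only: cf.simps sum_distrib_right mult.assoc)
  also have "\<dots> = (\<Sum>u'<sz l. \<Sum>e\<le>d. lam l u' u e * (\<Sum>m\<in>Mon G S. ?h u' e m * (\<Prod>i\<in>S. x i ^ m i)))"
    unfolding sum_distrib_left
    by (subst sum.swap, intro sum.cong refl, subst sum.swap, rule refl)
  also have "\<dots> = (\<Sum>u'<sz l. \<Sum>e\<le>d. lam l u' u e * (?x ?v ^ e * val ?x l u'))"
    by (intro sum.cong refl arg_cong2[of _ _ _ _ "(*)"] key) auto
  also have "\<dots> = val ?x (Suc l) u"
    by (simp add: sum_distrib_right mult.assoc)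
  finally show ?case by simp
qed

text \<open>A factorisation suited to a phase in which no variable of \<open>Y\<close> is read: only
  the factor for \<open>X\<close> depends on the current vertex. The indices are lists because every
  change of phase prepends the vertex at which it takes place.\<close>

definition separated :: "nat set \<Rightarrow> (nat \<Rightarrow> 'b) \<Rightarrow> nat set \<Rightarrow> nat set \<Rightarrow> nat \<Rightarrow> nat \<Rightarrow> bool" where
  "separated S a X Y R l \<longleftrightarrow> (\<exists>(H :: nat list set) \<alpha> \<beta>. finite H \<and> card H \<le> R \<and>
     (\<forall>u<w. \<forall>m\<in>Mon G S. cf S a l u m = (\<Sum>h\<in>H. \<alpha> h u (restr X m) * \<beta> h (restr Y m))))"

lemma separated_0:
  assumes "X \<union> Y = S"
  shows "separated S a X Y 1 0"
proof -
  have "m = (\<lambda>_. 0) \<longleftrightarrow> restr X m = (\<lambda>_. 0) \<and> restr Y m = (\<lambda>_. 0)" if "m \<in> Mon G S" for m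
    using that assms by (auto simp: Mon_def restr_def fun_eq_iff)
  then show ?thesis
    unfolding separated_def
    by (intro exI[of _ "{[]}"] exI[of _ "\<lambda>h u m. if u = 0 \<and> m = (\<lambda>_. 0) then 1 else 0"]
        exI[of _ "\<lambda>h m. if m = (\<lambda>_. 0) then 1 else 0"]) auto
qed

text \<open>The current vertex becomes part of the index, which costs the factor \<open>w\<close>.
  The factor for \<open>X\<close> is frozen at this vertex, and the factor of the newly active side
  is 0 unless its vertex is the one in the index.\<close>

lemma separated_switch:
  assumes "separated S a X Y R l"
  shows "separated S a Y X (R * w) l"
proof -
  from assms obtain H :: "nat list set" and \<alpha> \<beta> where H: "finite H" "card H \<le> R"
    and eq: "\<And>u m. u < w \<Longrightarrow> m \<in> Mon G S \<Longrightarrow>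
      cf S a l u m = (\<Sum>h\<in>H. \<alpha> h u (restr X m) * \<beta> h (restr Y m))"
    unfolding separated_def by blast
  let ?H = "(\<lambda>(h, u). u # h) ` (H \<times> {..<w})"
  have inj: "inj_on (\<lambda>(h, u). u # h) (H \<times> {..<w})" by (auto simp: inj_on_def)
  have "cf S a l u m = (\<Sum>h\<in>?H. (if u = hd h then \<beta> (tl h) (restr Y m) else 0) * \<alpha> (tl h) (hd h) (restr X m))"
    if "u < w" "m \<in> Mon G S" for u m
  proof -
    have "(\<Sum>h\<in>?H. (if u = hd h then \<beta> (tl h) (restr Y m) else 0) * \<alpha> (tl h) (hd h) (restr X m)) =
        (\<Sum>h\<in>H. \<Sum>u'<w. (if u = u' then \<beta> h (restr Y m) else 0) * \<alpha> h u' (restr X m))"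
      by (subst sum.reindex[OF inj]) (auto simp: sum.cartesian_product intro!: sum.cong)
    also have "\<dots> = (\<Sum>h\<in>H. \<Sum>u'<w. if u = u' then \<beta> h (restr Y m) * \<alpha> h u' (restr X m) else 0)"
      by (intro sum.cong refl) auto
    also have "\<dots> = cf S a l u m" using that eq by (simp add: mult.commute)
    finally show ?thesis by simp
  qed
  moreover have "card ?H \<le> R * w" using H by (subst card_image[OF inj]) (simp add: card_cartesian_product)
  moreover have "finite ?H" using H by auto
  ultimately show ?thesis unfolding separated_def
    by (intro exI[of _ ?H] exI[of _ "\<lambda>h u m. if u = hd h then \<beta> (tl h) m else 0"]
        exI[of _ "\<lambda>h m. \<alpha> (tl h) (hd h) m"]) auto
qed

text \<open>Reading a variable outside \<open>Y\<close> acts on the first factor alone: it shifts an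
  exponent in \<open>X\<close> or, outside \<open>S\<close>, multiplies by a constant. Thus a phase
  costs nothing however long it is.\<close>

lemma separated_Suc:
  assumes sep: "separated S a X Y R l" and XY: "X \<union> Y = S" "X \<inter> Y = {}" and l: "l < L"
    and v: "vs l \<notin> Y"
  shows "separated S a X Y R (Suc l)"
proof -
  from sep obtain H :: "nat list set" and \<alpha> \<beta> where H: "finite H" "card H \<le> R"
    and eq: "\<And>u m. u < w \<Longrightarrow> m \<in> Mon G S \<Longrightarrow>
      cf S a l u m = (\<Sum>h\<in>H. \<alpha> h u (restr X m) * \<beta> h (restr Y m))"
    unfolding separated_def by blast
  let ?v = "vs l"
  define A where "A h u e \<mu> = (if ?v \<in> S then if e \<le> \<mu> ?v then \<alpha> h u (\<mu>(?v := \<mu> ?v - e)) else 0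
      else a ?v ^ e * \<alpha> h u \<mu>)" for h u e and \<mu> :: "nat \<Rightarrow> nat"
  have "cf S a (Suc l) u' m = (\<Sum>h\<in>H. (\<Sum>u<sz l. \<Sum>e\<le>d. lam l u u' e * A h u e (restr X m)) *
      \<beta> h (restr Y m))" if m: "m \<in> Mon G S" for u' m
  proof -
    have A: "(if ?v \<in> S then if e \<le> m ?v then cf S a l u (m(?v := m ?v - e)) else 0
      else a ?v ^ e * cf S a l u m) = (\<Sum>h\<in>H. A h u e (restr X m) * \<beta> h (restr Y m))"
      if u: "u < sz l" for u e
    proof -
      have uw: "u < w" using u sz[OF l] by simp
      show ?thesis
      proof (cases "?v \<in> S")
        case False
        then show ?thesis by (simp add: A_def eq[OF uw m] sum_distrib_left mult.assoc)
      next
        case True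
        then have vX: "?v \<in> X" using v XY by auto
        have m': "m(?v := m ?v - e) \<in> Mon G S" using m True by (auto simp: Mon_def)
        have "restr X (m(?v := m ?v - e)) = (restr X m)(?v := restr X m ?v - e)"
          "restr Y (m(?v := m ?v - e)) = restr Y m" "restr X m ?v = m ?v"
          using vX v by (auto simp: restr_def fun_eq_iff)
        then show ?thesis using True by (simp add: A_def eq[OF uw m'])
      qed
    qed
    have "cf S a (Suc l) u' m = (\<Sum>u<sz l. \<Sum>e\<le>d. lam l u u' e *
        (\<Sum>h\<in>H. A h u e (restr X m) * \<beta> h (restr Y m)))"
      unfolding cf.simps by (intro sum.cong refl arg_cong2[of _ _ _ _ "(*)"] A) auto
    also have "\<dots> = (\<Sum>u<sz l. \<Sum>h\<in>H. \<Sum>e\<le>d. lam l u u' e * (A h u e (restr X m) * \<beta> h (restr Y m)))"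
      unfolding sum_distrib_left by (intro sum.cong refl sum.swap)
    also have "\<dots> = (\<Sum>h\<in>H. \<Sum>u<sz l. \<Sum>e\<le>d. lam l u u' e * (A h u e (restr X m) * \<beta> h (restr Y m)))"
      by (rule sum.swap)
    finally show ?thesis by (simp add: sum_distrib_right mult.assoc)
  qed
  with H show ?thesis unfolding separated_def
    by (intro exI[of _ H] exI[of _ "\<lambda>h u' \<mu>. \<Sum>u<sz l. \<Sum>e\<le>d. lam l u u' e * A h u e \<mu>"] exI[of _ \<beta>]) auto
qed

text \<open>Before layer 0 the predicate counts as false, in accordance with the complement of the
  block being the active side at the start.\<close>

definition changes :: "(nat \<Rightarrow> bool) \<Rightarrow> nat \<Rightarrow> nat" where
  "changes \<chi> l = card {l'. l' < l \<and> \<chi> l' \<noteq> (l' > 0 \<and> \<chi> (l' - 1))}"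

lemma changes_Suc: "changes \<chi> (Suc l) = changes \<chi> l + (if \<chi> l \<noteq> (l > 0 \<and> \<chi> (l - 1)) then 1 else 0)"
proof -
  have "{l'. l' < Suc l \<and> \<chi> l' \<noteq> (l' > 0 \<and> \<chi> (l' - 1))} =
      {l'. l' < l \<and> \<chi> l' \<noteq> (l' > 0 \<and> \<chi> (l' - 1))} \<union>
      (if \<chi> l \<noteq> (l > 0 \<and> \<chi> (l - 1)) then {l} else {})"
    by (auto simp: less_Suc_eq)
  then show ?thesis unfolding changes_def by (cases "\<chi> l \<noteq> (l > 0 \<and> \<chi> (l - 1))") simp_all
qed

lemma separated_changes:
  assumes B: "B \<subseteq> S" and \<chi>: "\<And>l. l < L \<Longrightarrow> vs l \<in> B \<Longrightarrow> \<chi> l" "\<And>l. l < L \<Longrightarrow> vs l \<in> S - B \<Longrightarrow> \<not> \<chi> l"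
    and l: "l \<le> L"
  shows "separated S a (if l > 0 \<and> \<chi> (l - 1) then B else S - B) (if l > 0 \<and> \<chi> (l - 1) then S - B else B)
    (w ^ changes \<chi> l) l"
  using l
proof (induction l)
  case 0
  have "separated S a (S - B) B 1 0" using B by (intro separated_0) auto
  then show ?case by (simp add: changes_def)
next
  case (Suc l)
  let ?p = "l > 0 \<and> \<chi> (l - 1)"
  have IH: "separated S a (if ?p then B else S - B) (if ?p then S - B else B) (w ^ changes \<chi> l) l"
    using Suc by simp
  have "separated S a (if \<chi> l then B else S - B) (if \<chi> l then S - B else B) (w ^ changes \<chi> (Suc l)) l"
  proof (cases "\<chi> l = ?p")
    case True
    with IH show ?thesis by (simp add: changes_Suc)
  next
    case False
    with separated_switch[OF IH] show ?thesis by (auto simp: changes_Suc mult.commute)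
  qed
  then have "separated S a (if \<chi> l then B else S - B) (if \<chi> l then S - B else B) (w ^ changes \<chi> (Suc l)) (Suc l)"
    using \<chi>[of l] B Suc.prems by (intro separated_Suc) auto
  then show ?case by simp
qed

text \<open>Cutting the program at the changes of \<open>\<chi>\<close> yields a factorisation with
  one factor \<open>w\<close> per change. Reads outside \<open>S\<close> may get either value of
  \<open>\<chi>\<close>, since they fit into any phase.\<close>

lemma row_rank:
  assumes B: "B \<subseteq> S" and \<chi>: "\<And>l. l < L \<Longrightarrow> vs l \<in> B \<Longrightarrow> \<chi> l" "\<And>l. l < L \<Longrightarrow> vs l \<in> S - B \<Longrightarrow> \<not> \<chi> l"
    and r: "w ^ changes \<chi> L \<le> r"
  shows "\<exists>T. finite T \<and> card T \<le> r \<and>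
    (\<forall>m\<in>Mon G B. row G S (cf S a L 0) B m \<in> fv.span T)"
proof -
  have sep: "separated S a (if L > 0 \<and> \<chi> (L - 1) then B else S - B)
      (if L > 0 \<and> \<chi> (L - 1) then S - B else B) (w ^ changes \<chi> L) L"
    by (rule separated_changes) (use assms in auto)
  have "\<exists>(H :: nat list set) \<alpha> \<beta>. finite H \<and> card H \<le> w ^ changes \<chi> L \<and>
     (\<forall>m\<in>Mon G S. cf S a L 0 m = (\<Sum>h\<in>H. \<alpha> h (restr B m) * \<beta> h (restr (S - B) m)))"
  \<comment> \<open>The side read last decides which factor carries the vertex. At the sink, vertex
    0, the two factors have symmetric roles.\<close>
  proof (cases "L > 0 \<and> \<chi> (L - 1)")
    case True
    with sep
    have "separated S a B (S - B) (w ^ changes \<chi> L) L" by auto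
    then obtain H :: "nat list set" and \<alpha> \<beta> where H: "finite H" "card H \<le> w ^ changes \<chi> L" and
      *: "\<And>u m. u < w \<Longrightarrow> m\<in>Mon G S \<Longrightarrow>
        cf S a L u m = (\<Sum>h\<in>H. \<alpha> h u (restr B m) * \<beta> h (restr (S - B) m))"
      unfolding separated_def by blast
    have "0 < w" using w1 by simp
    from *[OF this] H show ?thesis
      by (intro exI[of _ H] exI[of _ \<beta>] exI[of _ "\<lambda>h. \<alpha> h 0"]) auto
  next
    case False
    with sep
    have "separated S a (S - B) B (w ^ changes \<chi> L) L" by auto
    then obtain H :: "nat list set" and \<alpha> \<beta> where H: "finite H" "card H \<le> w ^ changes \<chi> L" and
      *: "\<And>u m. u < w \<Longrightarrow> m\<in>Mon G S \<Longrightarrow>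
        cf S a L u m = (\<Sum>h\<in>H. \<alpha> h u (restr (S - B) m) * \<beta> h (restr B m))"
      unfolding separated_def by blast
    have "0 < w" using w1 by simp
    from *[OF this] H show ?thesis
      by (intro exI[of _ H] exI[of _ \<beta>] exI[of _ "\<lambda>h. \<alpha> h 0"]) (auto simp: mult.commute)
  qed
  then obtain H :: "nat list set" and \<alpha> \<beta> where H: "finite H" "card H \<le> w ^ changes \<chi> L" and
    eq: "\<And>m. m\<in>Mon G S \<Longrightarrow> cf S a L 0 m = (\<Sum>h\<in>H. \<alpha> h (restr B m) * \<beta> h (restr (S - B) m))"
    by blast
  define T where "T h = (\<lambda>m'. if m' \<in> Mon G (S - B) then \<beta> h m' else 0)" for h
  have "row G S (cf S a L 0) B m \<in> fv.span (T ` H)" if m: "m \<in> Mon G B" for m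
  proof -
    have "row G S (cf S a L 0) B m = (\<Sum>h\<in>H. (\<lambda>m'. \<alpha> h m * T h m'))"
    proof
      fix m'
      have "(\<Sum>h\<in>H. (\<lambda>m'. \<alpha> h m * T h m')) m' = (\<Sum>h\<in>H. \<alpha> h m * T h m')"
        using H(1) by (induction H rule: finite_induct) auto
      also have "\<dots> = row G S (cf S a L 0) B m m'"
      proof (cases "m' \<in> Mon G (S - B)")
        case True
        have "B \<inter> (S - B) = {}" "B \<union> (S - B) = S" using B by auto
        with madd_Mon[OF m True] restr_madd[OF m True] True show ?thesis
          by (auto simp: row_def T_def eq)
      qed (auto simp: row_def T_def)
      finally show "row G S (cf S a L 0) B m m' = (\<Sum>h\<in>H. (\<lambda>m'. \<alpha> h m * T h m')) m'" by simp
    qed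
    also have "\<dots> \<in> fv.span (T ` H)"
      by (intro fv.span_sum fv.span_scale fv.span_base imageI)
    finally show ?thesis .
  qed
  moreover have "card (T ` H) \<le> r" using card_image_le[OF H(1), of T] H(2) r by linarith
  ultimately show ?thesis using H(1) by blast
qed

text \<open>The values of the variables outside \<open>S\<close> are arbitrary constants, which lets
  the classes be treated one after the other. Isolation yields a nonzero coefficient in the new
  variables, one per level, and a large enough grid then contains values at which the polynomial
  does not vanish.\<close>

lemma substitute_class:
  assumes S: "S \<subseteq> {..<n}"
    and \<chi>: "\<And>l b. \<exists>\<chi>. (\<forall>j<L. vs j \<in> dblock S l b \<longrightarrow> \<chi> j) \<and> (\<forall>j<L. vs j \<in> S - dblock S l b \<longrightarrow> \<not> \<chi> j) \<and>
      w ^ changes \<chi> L \<le> r"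
    and Cd: "G \<le> Cd" "r * r \<le> Cd"
    and t: "G ^ (n * (n * (Cd * Cd))) < 4 ^ t" and Q: "2 * t + 1 \<le> Q" and N: "n * G * Q < N"
    and e: "inj_on e {..<N}" and lv: "n \<le> 2 ^ lv"
    and nz: "val x L 0 \<noteq> 0"
  shows "\<exists>q a. (\<forall>j\<le>lv. 1 \<le> q j \<and> q j \<le> Q \<and> a j < N) \<and>
    val (\<lambda>i. if i \<in> S then \<Prod>j\<le>lv. e (a j) ^ wt G (q j) i else x i) L 0 \<noteq> 0"
proof -
  have finS: "finite S" using S finite_subset by blast
  let ?c = "cf S x L 0"
  have expand: "val (\<lambda>i. if i \<in> S then y i else x i) L 0 =
    (\<Sum>m\<in>Mon G S. ?c m * (\<Prod>i\<in>S. y i ^ m i))" for y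
    by (rule val_expand[OF finS]) simp
  have "val (\<lambda>i. if i \<in> S then x i else x i) L 0 \<noteq> 0" using nz by simp
  then obtain m0 where m0: "m0 \<in> Mon G S" "?c m0 \<noteq> 0"
    unfolding expand by (metis (no_types, lifting) mult_zero_left sum.neutral)
  \<comment> \<open>\<open>N\<close> is both the base \<open>Z\<close> of the isolation and the
    number of elements of the grid: the weights below it become the exponents.\<close>
  interpret isolation G n r Q t Cd N S ?c
  proof
    fix l b
    from \<chi>[of l b] obtain \<chi>0 where "\<forall>j<L. vs j \<in> dblock S l b \<longrightarrow> \<chi>0 j"
      "\<forall>j<L. vs j \<in> S - dblock S l b \<longrightarrow> \<not> \<chi>0 j" "w ^ changes \<chi>0 L \<le> r" by blast
    then show "\<exists>T. finite T \<and> card T \<le> r \<and>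
      (\<forall>m\<in>Mon G (dblock S l b). row G S ?c (dblock S l b) m \<in> fv.span T)"
      by (intro row_rank[OF dblock_subset]) auto
  qed (use assms G1 in auto)
  from isolated_coefficient[OF lv m0] obtain q ms where q: "\<forall>j\<le>lv. 1 \<le> q j \<and> q j \<le> Q"
    and ms: "ms \<in> Mon G S"
      "(\<Sum>m\<in>{m\<in>Mon G S. \<forall>j\<in>{..<Suc lv}. lwt G n (q j) m = lwt G n (q j) ms}. ?c m) \<noteq> 0" by blast
  have "\<exists>e'. (\<forall>j<Suc lv. e' j \<in> e ` {..<N}) \<and>
      (\<Sum>m\<in>Mon G S. ?c m * (\<Prod>j<Suc lv. e' j ^ lwt G n (q j) m)) \<noteq> 0"
  proof (rule ccontr)
    assume neg: "\<not> ?thesis"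
    have "(\<Sum>m\<in>{m\<in>Mon G S. \<forall>j\<in>{..<Suc lv}. lwt G n (q j) m = lwt G n (q j) ms}. ?c m) = 0"
    proof (rule grid_vanishing[where E = "e ` {..<N}"])
      show "lwt G n (q j) m < card (e ` {..<N})" if "m \<in> Mon G S" "j < Suc lv" for m j
        using lwt_less[OF that(1), of "q j"] q that(2) e by (simp add: card_image)
    next
      fix e' assume "\<And>j. j < Suc lv \<Longrightarrow> e' j \<in> e ` {..<N}"
      with neg show "(\<Sum>m\<in>Mon G S. ?c m * (\<Prod>j<Suc lv. e' j ^ lwt G n (q j) m)) = 0" by blast
    qed (use finite_Mon[OF finS] in auto)
    with ms(2) show False by contradiction
  qed
  \<comment> \<open>The grid consists of the first \<open>N\<close> values of \<open>e\<close>;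
    below, they are replaced by their indices, since a seed stores indices.\<close>
  then obtain e' where e': "\<And>j. j < Suc lv \<Longrightarrow> e' j \<in> e ` {..<N}"
    and nz': "(\<Sum>m\<in>Mon G S. ?c m * (\<Prod>j<Suc lv. e' j ^ lwt G n (q j) m)) \<noteq> 0" by blast
  from e' have "\<forall>j. \<exists>a. j < Suc lv \<longrightarrow> a < N \<and> e' j = e a" by auto
  then obtain a where a: "\<And>j. j < Suc lv \<Longrightarrow> a j < N \<and> e' j = e (a j)" by metis
  let ?y = "\<lambda>i. \<Prod>j\<le>lv. e (a j) ^ wt G (q j) i"
  have "(\<Prod>j<Suc lv. e' j ^ lwt G n (q j) m) = (\<Prod>i\<in>S. ?y i ^ m i)" if m: "m \<in> Mon G S" for m
  proof -
    have lw: "lwt G n (q j) m = (\<Sum>i\<in>S. m i * wt G (q j) i)" for j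
      unfolding lwt_def using m S by (intro sum.mono_neutral_right) (auto simp: Mon_def)
    have "(\<Prod>j<Suc lv. e' j ^ lwt G n (q j) m) = (\<Prod>j<Suc lv. \<Prod>i\<in>S. e (a j) ^ (wt G (q j) i * m i))"
      using a by (intro prod.cong refl) (simp add: lw power_sum mult.commute)
    also have "\<dots> = (\<Prod>i\<in>S. \<Prod>j<Suc lv. e (a j) ^ (wt G (q j) i * m i))" by (rule prod.swap)
    also have "\<dots> = (\<Prod>i\<in>S. ?y i ^ m i)"
      by (intro prod.cong refl) (simp only: prod_power_distrib power_mult lessThan_Suc_atMost)
    finally show ?thesis .
  qed
  then have "(\<Sum>m\<in>Mon G S. ?c m * (\<Prod>i\<in>S. ?y i ^ m i)) \<noteq> 0" using nz' by simp
  then have "val (\<lambda>i. if i \<in> S then ?y i else x i) L 0 \<noteq> 0" unfolding expand .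
  moreover have "\<forall>j\<le>lv. 1 \<le> q j \<and> q j \<le> Q \<and> a j < N" using q a by auto
  ultimately show ?thesis by blast
qed

end

section \<open>Regular classes\<close>

text \<open>
  The a-th reads fall into consecutive windows: the b-th reads of a window come after its a-th reads
  and before the a-th reads of the next window.
\<close>

definition regular :: "nat \<Rightarrow> (nat \<Rightarrow> nat \<Rightarrow> nat) \<Rightarrow> nat set \<Rightarrow> bool" where
  "regular k p S \<longleftrightarrow>
    (\<forall>j<k. (\<forall>i\<in>S. \<forall>i'\<in>S. i < i' \<longrightarrow> p j i < p j i') \<or> (\<forall>i\<in>S. \<forall>i'\<in>S. i < i' \<longrightarrow> p j i' < p j i)) \<and>
    (\<forall>a b. a < b \<longrightarrow> b < k \<longrightarrow> (\<exists>win :: nat \<Rightarrow> nat. \<forall>i\<in>S. \<forall>i'\<in>S.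
       (win i = win i' \<longrightarrow> p a i < p b i') \<and> (win i < win i' \<longrightarrow> p b i < p a i')))"

section \<open>Alternation between an interval and the rest of its class\<close>

locale block =
  fixes k n :: nat and p :: "nat \<Rightarrow> nat \<Rightarrow> nat" and S B :: "nat set"
  assumes reg: "regular k p S" and BS: "B \<subseteq> S" and Sn: "S \<subseteq> {..<n}"
    and inj: "\<And>j j' i i'. j < k \<Longrightarrow> j' < k \<Longrightarrow> i < n \<Longrightarrow> i' < n \<Longrightarrow> p j i = p j' i' \<Longrightarrow> j = j' \<and> i = i'"
    and interval: "\<And>i'. i' \<in> S - B \<Longrightarrow> (\<forall>x\<in>B. i' < x) \<or> (\<forall>x\<in>B. x < i')"
begin

text \<open>Monotonicity of the j-th reads turns an interval of ranks into an interval among the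
  j-th reads of the class.\<close>

lemma side: "j < k \<Longrightarrow> i' \<in> S - B \<Longrightarrow> (\<forall>x\<in>B. p j i' < p j x) \<or> (\<forall>x\<in>B. p j x < p j i')"
proof -
  assume j: "j < k" and i': "i' \<in> S - B"
  have "(\<forall>i\<in>S. \<forall>i'\<in>S. i < i' \<longrightarrow> p j i < p j i') \<or> (\<forall>i\<in>S. \<forall>i'\<in>S. i < i' \<longrightarrow> p j i' < p j i)"
    using reg j by (auto simp: regular_def)
  then show ?thesis
  proof
    assume "\<forall>i\<in>S. \<forall>i'\<in>S. i < i' \<longrightarrow> p j i < p j i'"
    then show ?thesis using interval[OF i'] i' BS by blast
  next
    assume "\<forall>i\<in>S. \<forall>i'\<in>S. i < i' \<longrightarrow> p j i' < p j i"
    then show ?thesis using interval[OF i'] i' BS by blast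
  qed
qed

lemma windows:
  assumes "a < b" "b < k"
  shows "\<exists>win :: nat \<Rightarrow> nat. \<forall>i\<in>S. \<forall>i'\<in>S.
       (win i = win i' \<longrightarrow> p a i < p b i') \<and> (win i < win i' \<longrightarrow> p b i < p a i')"
  using reg assms unfolding regular_def by simp

text \<open>
  After the read of i' outside the block, the j-th reads of the block resume with that of i.
\<close>

definition resumes :: "nat \<Rightarrow> nat \<Rightarrow> nat \<Rightarrow> nat \<Rightarrow> bool" where
  "resumes j j' i i' \<longleftrightarrow> i \<in> B \<and> i' \<in> S - B \<and> (\<exists>x\<in>B. p j x < p j i) \<and> p j' i' < p j i \<and>
     (\<forall>x\<in>B. p j x < p j i \<longrightarrow> p j x < p j' i')"

text \<open>At a resumption the a-th reads of the block pass from the window of \<open>i'\<close> to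
  a later one, and all previous a-th reads of the block lie in the window of \<open>i'\<close>. A
  second resumption would put the reads on both sides of the first one into a single window.\<close>

lemma resumes_unique_less:
  assumes ab: "a < b" "b < k" and r1: "resumes a b i1 i1'" and r2: "resumes a b i2 i2'"
  shows "\<not> p a i1 < p a i2"
proof
  assume less: "p a i1 < p a i2"
  from windows[OF ab] obtain win :: "nat \<Rightarrow> nat" where
    win: "\<forall>i\<in>S. \<forall>i'\<in>S. (win i = win i' \<longrightarrow> p a i < p b i') \<and> (win i < win i' \<longrightarrow> p b i < p a i')"
    by (elim exE)
  have w1: "win i = win i' \<Longrightarrow> p a i < p b i'" and w2: "win i < win i' \<Longrightarrow> p b i < p a i'"
    if "i \<in> S" "i' \<in> S" for i i'
    using bspec[OF bspec[OF win that(1)] that(2)] by simp_all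
  have pab: "p a i < p b i" if "i \<in> S" for i using w1[OF that that] by simp
  have *: "win i' < win i \<and> (\<forall>y\<in>B. p a y < p a i \<longrightarrow> win y = win i')" if r: "resumes a b i i'" for i i'
  proof -
    from r have i: "i \<in> S" "i' \<in> S" "i \<in> B" "i' \<in> S - B" and lt: "p b i' < p a i"
      and ex: "\<And>y. y \<in> B \<Longrightarrow> p a y < p a i \<Longrightarrow> p a y < p b i'"
      using BS by (auto simp: resumes_def)
    have "\<not> win i < win i'"
    proof
      assume "win i < win i'"
      from w2[OF i(1,2) this] show False using pab[OF i(1)] pab[OF i(2)] lt by linarith
    qed
    moreover have "win i \<noteq> win i'" using w1[OF i(1,2)] lt by linarith
    moreover have "\<not> (\<forall>x\<in>B. p a x < p a i')" using i(3) pab[OF i(2)] lt by (meson not_less_iff_gr_or_eq less_trans)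
    then have before: "\<forall>x\<in>B. p a i' < p a x" using side[OF _ i(4), of a] ab by auto
    have "win y = win i'" if y: "y \<in> B" "p a y < p a i" for y
    proof (rule ccontr)
      assume "win y \<noteq> win i'"
      then consider "win y < win i'" | "win i' < win y" by linarith
      then show False
      proof cases
        case 1
        have yS: "y \<in> S" using y BS by auto
        from w2[OF yS i(2) 1] before y(1) pab[OF yS] show False by (meson less_trans not_less_iff_gr_or_eq)
      next
        case 2
        have yS: "y \<in> S" using y BS by auto
        from w2[OF i(2) yS 2] ex[OF y] show False by linarith
      qed
    qed
    ultimately show ?thesis by auto
  qed
  have i1B: "i1 \<in> B" using r1 by (simp add: resumes_def)
  obtain x where x: "x \<in> B" "p a x < p a i1" using r1 by (auto simp: resumes_def)
  have "win x = win i1'" using *[OF r1] x by blast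
  moreover have "win x = win i2'" using *[OF r2] x less by (meson less_trans)
  moreover have "win i1 = win i2'" using *[OF r2] i1B less by blast
  ultimately show False using *[OF r1] by simp
qed

text \<open>Here \<open>i\<close> lies in the window of \<open>i'\<close>, which is the last window
  that the block meets, while the previous b-th reads of the block are in earlier windows. A second
  resumption would need a still later window.\<close>

lemma resumes_unique_greater:
  assumes ab: "a < b" "b < k" and r1: "resumes b a i1 i1'" and r2: "resumes b a i2 i2'"
  shows "\<not> p b i1 < p b i2"
proof
  assume less: "p b i1 < p b i2"
  from windows[OF ab] obtain win :: "nat \<Rightarrow> nat" where
    win: "\<forall>i\<in>S. \<forall>i'\<in>S. (win i = win i' \<longrightarrow> p a i < p b i') \<and> (win i < win i' \<longrightarrow> p b i < p a i')"
    by (elim exE)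
  have w1: "win i = win i' \<Longrightarrow> p a i < p b i'" and w2: "win i < win i' \<Longrightarrow> p b i < p a i'"
    if "i \<in> S" "i' \<in> S" for i i'
    using bspec[OF bspec[OF win that(1)] that(2)] by simp_all
  have pab: "p a i < p b i" if "i \<in> S" for i using w1[OF that that] by simp
  have *: "win i = win i' \<and> (\<forall>z\<in>B. win z \<le> win i') \<and> (\<forall>y\<in>B. p b y < p b i \<longrightarrow> win y < win i')"
    if r: "resumes b a i i'" for i i'
  proof -
    from r have i: "i \<in> S" "i' \<in> S" "i \<in> B" "i' \<in> S - B" and lt: "p a i' < p b i"
      and ex: "\<And>y. y \<in> B \<Longrightarrow> p b y < p b i \<Longrightarrow> p b y < p a i'" and exx: "\<exists>x\<in>B. p b x < p b i"
      using BS by (auto simp: resumes_def)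
    have early: "win y < win i'" if y: "y \<in> B" "p b y < p b i" for y
    proof (rule ccontr)
      have yS: "y \<in> S" using y BS by auto
      assume "\<not> win y < win i'"
      then consider "win i' = win y" | "win i' < win y" by linarith
      then show False
      proof cases
        case 1
        from w1[OF i(2) yS 1] ex[OF y] show False by linarith
      next
        case 2
        from w2[OF i(2) yS 2] ex[OF y] pab[OF i(2)] pab[OF yS] show False by linarith
      qed
    qed
    have le: "win i' \<le> win i" using w2[OF i(1,2)] lt by linarith
    obtain x where x: "x \<in> B" "p b x < p b i" using exx by blast
    have "\<not> (\<forall>x\<in>B. p b i' < p b x)"
    proof
      assume "\<forall>x\<in>B. p b i' < p b x"
      then have "p b i' < p b x" using x by blast
      with ex[OF x] pab[OF i(2)] show False by linarith
    qed
    then have after: "\<forall>x\<in>B. p b x < p b i'" using side[OF ab(2) i(4)] by auto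
    have all: "win z \<le> win i'" if z: "z \<in> B" for z
    proof (rule ccontr)
      have zS: "z \<in> S" using z BS by auto
      assume "\<not> win z \<le> win i'"
      then have "p b i' < p a z" using w2[OF i(2) zS] by linarith
      moreover have "p b z < p b i'" using after z by blast
      ultimately show False using pab[OF zS] by linarith
    qed
    show ?thesis using early all le i(3) by (auto intro: antisym)
  qed
  have i12: "i1 \<in> B" "i2 \<in> B" using r1 r2 by (auto simp: resumes_def)
  have "win i1 = win i1'" "win i2 \<le> win i1'" using *[OF r1] i12 by auto
  moreover have "win i1 < win i2'" "win i2 = win i2'" using *[OF r2] i12 less by auto
  ultimately show False by linarith
qed

lemma resumes_unique:
  assumes "j < k" "j' < k" "j \<noteq> j'" "resumes j j' i1 i1'" "resumes j j' i2 i2'"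
  shows "p j i1 = p j i2"
proof -
  have "\<not> p j i1 < p j i2 \<and> \<not> p j i2 < p j i1"
  proof (cases "j < j'")
    case True
    with assms show ?thesis using resumes_unique_less by blast
  next
    case False
    then have "j' < j" using assms by simp
    with assms show ?thesis using resumes_unique_greater by blast
  qed
  then show ?thesis by simp
qed

text \<open>
  The last read of a variable in S up to time l is the read of a variable in B.
\<close>

definition inside :: "nat \<Rightarrow> bool" where
  "inside l \<longleftrightarrow> (\<exists>j<k. \<exists>i\<in>B. p j i \<le> l \<and> (\<forall>j'<k. \<forall>i'\<in>S. p j' i' \<le> l \<longrightarrow> p j' i' \<le> p j i))"

lemma inside_read: "j < k \<Longrightarrow> i \<in> B \<Longrightarrow> inside (p j i)"
  unfolding inside_def by blast

lemma not_inside_read: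
  assumes "j < k" "i \<in> S - B" shows "\<not> inside (p j i)"
proof
  assume "inside (p j i)"
  then obtain j' i' where *: "j' < k" "i' \<in> B" "p j' i' \<le> p j i"
    "\<forall>j''<k. \<forall>i''\<in>S. p j'' i'' \<le> p j i \<longrightarrow> p j'' i'' \<le> p j' i'" unfolding inside_def by blast
  have "p j i \<le> p j' i'" using *(4) assms by auto
  then have "p j i = p j' i'" using *(3) by simp
  then have "i = i'" using inj[of j j' i i'] assms * Sn BS by blast
  with assms * show False by auto
qed

definition entry :: "nat \<Rightarrow> bool" where
  "entry l \<longleftrightarrow> inside l \<and> \<not> (l > 0 \<and> inside (l - 1))"

text \<open>An entry is charged to a pair of read numbers: \<open>j\<close> belongs to the read that
  enters the block, \<open>j'\<close> to the last read of the class before it. If no j-th read of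
  the block came earlier, the charge goes to the pair (j, j) instead.\<close>

lemma entry_cases:
  assumes "entry l"
  shows "\<exists>j<k. \<exists>j'<k. \<exists>i\<in>B. p j i = l \<and>
    (j' = j \<and> (\<forall>x\<in>B. p j i \<le> p j x) \<or> j' \<noteq> j \<and> (\<exists>i'. resumes j j' i i'))"
proof -
  from assms obtain j i where ji: "j < k" "i \<in> B" "p j i \<le> l"
    and max: "\<And>j' i'. j'<k \<Longrightarrow> i'\<in>S \<Longrightarrow> p j' i' \<le> l \<Longrightarrow> p j' i' \<le> p j i"
    unfolding entry_def inside_def by blast
  have l: "p j i = l"
  proof (rule ccontr)
    assume "p j i \<noteq> l"
    then have "l > 0" "p j i \<le> l - 1" using ji(3) by auto
    moreover have "p j' i' \<le> p j i" if "j' < k" "i' \<in> S" "p j' i' \<le> l - 1" for j' i'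
      using max that by auto
    ultimately have "inside (l - 1)" unfolding inside_def using ji by blast
    with \<open>l > 0\<close> assms show False by (simp add: entry_def)
  qed
  show ?thesis
  proof (cases "\<forall>x\<in>B. p j i \<le> p j x")
    case True
    with ji l show ?thesis by blast
  next
    case False
    then obtain x where x: "x \<in> B" "p j x < p j i" by (auto simp: not_le)
    \<comment> \<open>The times of all reads of the class before \<open>l\<close>. The last of them
      lies outside \<open>B\<close>, since otherwise \<open>inside (l - 1)\<close> would
      hold.\<close>
    define R where "R = {t. t < l \<and> (\<exists>j'<k. \<exists>i'\<in>S. t = p j' i')}"
    have R: "finite R" "R \<noteq> {}" using x ji l BS by (auto simp: R_def)
    have "Max R \<in> R" using R by (rule Max_in)
    then obtain j' i' where j'i': "j' < k" "i' \<in> S" "Max R = p j' i'" "p j' i' < l"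
      by (auto simp: R_def)
    have le: "p j'' i'' \<le> p j' i'" if "j'' < k" "i'' \<in> S" "p j'' i'' < l" for j'' i''
      unfolding j'i'(3)[symmetric] using that R by (intro Max_ge) (auto simp: R_def)
    have notB: "i' \<notin> B"
    proof
      assume "i' \<in> B"
      moreover have "l > 0" "p j' i' \<le> l - 1" using j'i'(4) by auto
      moreover have "p j'' i'' \<le> p j' i'" if "j'' < k" "i'' \<in> S" "p j'' i'' \<le> l - 1" for j'' i''
        using le that \<open>l > 0\<close> by auto
      ultimately have "inside (l - 1)" unfolding inside_def using j'i'(1) by blast
      with \<open>l > 0\<close> assms show False by (simp add: entry_def)
    qed
    have lower: "p j y < p j' i'" if y: "y \<in> B" "p j y < p j i" for y
    proof -
      have yS: "y \<in> S" using y BS by auto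
      have "p j y \<le> p j' i'" using le[OF ji(1) yS] y l by auto
      moreover have "p j y \<noteq> p j' i'" using inj[OF ji(1) j'i'(1), of y i'] yS j'i'(2) Sn y notB by auto
      ultimately show ?thesis by simp
    qed
    have res: "resumes j j' i i'"
      unfolding resumes_def using ji j'i' notB x lower l by auto
    have "j' \<noteq> j"
    proof
      assume "j' = j"
      have "i' \<in> S - B" using j'i' notB by auto
      from side[OF ji(1) this] show False
      proof
        assume "\<forall>x\<in>B. p j i' < p j x"
        then have "p j i' < p j x" using x by blast
        with lower[OF x] \<open>j' = j\<close> show False by simp
      next
        assume "\<forall>x\<in>B. p j x < p j i'"
        then have "p j i < p j i'" using ji by blast
        with j'i'(4) l \<open>j' = j\<close> show False by simp
      qed
    qed
    with res ji j'i' l show ?thesis by blast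
  qed
qed

text \<open>No pair of read numbers is charged twice: a first j-th read is unique, and so is a
  resumption, by \<open>resumes_unique\<close>.\<close>

lemma card_entries: "card {l. l < L \<and> entry l} \<le> k * k"
proof -
  have "\<forall>l. \<exists>c. entry l \<longrightarrow> fst c < k \<and> snd c < k \<and> (\<exists>i\<in>B. p (fst c) i = l \<and>
    (snd c = fst c \<and> (\<forall>x\<in>B. p (fst c) i \<le> p (fst c) x) \<or>
     snd c \<noteq> fst c \<and> (\<exists>i'. resumes (fst c) (snd c) i i')))"
    using entry_cases by (metis fst_conv snd_conv)
  then obtain f where f: "\<And>l. entry l \<Longrightarrow> fst (f l) < k \<and> snd (f l) < k \<and> (\<exists>i\<in>B. p (fst (f l)) i = l \<and>
    (snd (f l) = fst (f l) \<and> (\<forall>x\<in>B. p (fst (f l)) i \<le> p (fst (f l)) x) \<or>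
     snd (f l) \<noteq> fst (f l) \<and> (\<exists>i'. resumes (fst (f l)) (snd (f l)) i i')))" by metis
  have "inj_on f {l. l < L \<and> entry l}"
  proof (rule inj_onI)
    fix l1 l2 assume l: "l1 \<in> {l. l < L \<and> entry l}" "l2 \<in> {l. l < L \<and> entry l}" and eq: "f l1 = f l2"
    define j j' where jj: "j = fst (f l1)" "j' = snd (f l1)"
    from f[of l1] l obtain i1 where 1: "j < k" "j' < k" "i1 \<in> B" "p j i1 = l1"
      "j' = j \<and> (\<forall>x\<in>B. p j i1 \<le> p j x) \<or> j' \<noteq> j \<and> (\<exists>i'. resumes j j' i1 i')"
      unfolding jj by auto
    from f[of l2] l obtain i2 where 2: "i2 \<in> B" "p j i2 = l2"
      "j' = j \<and> (\<forall>x\<in>B. p j i2 \<le> p j x) \<or> j' \<noteq> j \<and> (\<exists>i'. resumes j j' i2 i')"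
      unfolding jj eq by auto
    show "l1 = l2"
    proof (cases "j' = j")
      case True
      with 1 2 show ?thesis by (metis antisym)
    next
      case False
      then obtain i1' i2' where "resumes j j' i1 i1'" "resumes j j' i2 i2'" using 1 2 by blast
      from resumes_unique[OF 1(1,2) _ this] False 1 2 show ?thesis by simp
    qed
  qed
  moreover have "f ` {l. l < L \<and> entry l} \<subseteq> {..<k} \<times> {..<k}"
  proof (rule image_subsetI)
    fix l assume "l \<in> {l. l < L \<and> entry l}"
    then show "f l \<in> {..<k} \<times> {..<k}" using f[of l] by (simp add: mem_Times_iff)
  qed
  ultimately have "card {l. l < L \<and> entry l} \<le> card ({..<k} \<times> {..<k})"
    by (intro card_inj_on_le) auto
  then show ?thesis by (simp add: card_cartesian_product)
qed

end

text \<open>Entries and exits alternate, beginning with an entry; the summand on the left is the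
  exit still to come. This yields at most \<open>2 * (k * k)\<close> changes and thereby the rank
  bound.\<close>

lemma (in layered) changes_eq:
  "changes \<chi> l + (if l > 0 \<and> \<chi> (l - 1) then 1 else 0) =
    2 * card {l'. l' < l \<and> \<chi> l' \<and> \<not> (l' > 0 \<and> \<chi> (l' - 1))}"
proof (induction l)
  case 0
  then show ?case by (simp add: changes_def)
next
  case (Suc l)
  let ?c = "\<lambda>l. card {l'. l' < l \<and> \<chi> l' \<and> \<not> (l' > 0 \<and> \<chi> (l' - 1))}"
  define P where "P \<longleftrightarrow> l > 0 \<and> \<chi> (l - 1)"
  have "{l'. l' < Suc l \<and> \<chi> l' \<and> \<not> (l' > 0 \<and> \<chi> (l' - 1))} =
      {l'. l' < l \<and> \<chi> l' \<and> \<not> (l' > 0 \<and> \<chi> (l' - 1))} \<union> (if \<chi> l \<and> \<not> P then {l} else {})"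
    by (auto simp: less_Suc_eq P_def)
  then have c: "?c (Suc l) = ?c l + (if \<chi> l \<and> \<not> P then 1 else 0)" by simp
  have "changes \<chi> (Suc l) = changes \<chi> l + (if \<chi> l \<noteq> P then 1 else 0)"
    unfolding changes_Suc P_def ..
  moreover have "changes \<chi> l + (if P then 1 else 0) = 2 * ?c l" using Suc.IH unfolding P_def .
  moreover have "(Suc l > 0 \<and> \<chi> (Suc l - 1)) = \<chi> l" by simp
  ultimately show ?case unfolding c by (cases "\<chi> l"; cases P) simp_all
qed

lemma dblock_interval: "i' \<in> S - dblock S l b \<Longrightarrow> (\<forall>x\<in>dblock S l b. i' < x) \<or> (\<forall>x\<in>dblock S l b. x < i')"
proof -
  assume i': "i' \<in> S - dblock S l b"
  then have "i' div 2 ^ l \<noteq> b" by (auto simp: dblock_def)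
  then consider "i' div 2 ^ l < b" | "b < i' div 2 ^ l" by linarith
  then show ?thesis
  proof cases
    case 1
    have "i' < x" if "x \<in> dblock S l b" for x
      using that 1 div_le_mono[of x i' "2 ^ l"] by (auto simp: dblock_def not_less[symmetric])
    then show ?thesis by blast
  next
    case 2
    have "x < i'" if "x \<in> dblock S l b" for x
      using that 2 div_le_mono[of i' x "2 ^ l"] by (auto simp: dblock_def not_less[symmetric])
    then show ?thesis by blast
  qed
qed

text \<open>A hybrid argument: the values of the classes already substituted count as constants when
  the next class is treated, and the value of the program stays nonzero throughout.\<close>

lemma (in layered) substitute_all:
  fixes ph :: "nat \<Rightarrow> nat" and p :: "nat \<Rightarrow> nat \<Rightarrow> nat"
  assumes inj: "\<And>j j' i i'. j < k \<Longrightarrow> j' < k \<Longrightarrow> i < n \<Longrightarrow> i' < n \<Longrightarrow> p j i = p j' i' \<Longrightarrow> j = j' \<and> i = i'"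
    and layers: "\<And>l. l < L \<Longrightarrow> \<exists>j<k. p j (vs l) = l"
    and regular: "\<And>c. c < P \<Longrightarrow> regular k p {i. i < n \<and> ph i = c}"
    and ph: "\<And>i. i < n \<Longrightarrow> ph i < P"
    and Cd: "G \<le> Cd" "w ^ (2 * (k * k)) * w ^ (2 * (k * k)) \<le> Cd"
    and t: "G ^ (n * (n * (Cd * Cd))) < 4 ^ t" and Q: "2 * t + 1 \<le> Q" and N: "n * G * Q < N"
    and e: "inj_on e {..<N}" and lv: "n \<le> 2 ^ lv"
    and nz: "val x L 0 \<noteq> 0"
  shows "\<exists>q a. (\<forall>c j. j \<le> lv \<longrightarrow> 1 \<le> q c j \<and> q c j \<le> Q \<and> a c j < N) \<and>
    val (\<lambda>i. \<Prod>j\<le>lv. e (a (ph i) j) ^ wt G (q (ph i) j) i) L 0 \<noteq> 0"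
proof -
  let ?r = "w ^ (2 * (k * k))"
  let ?bd = "\<lambda>q a. \<forall>c j. j \<le> lv \<longrightarrow> 1 \<le> q c j \<and> q c j \<le> Q \<and> a c j < N"
  have val_cong: "val y l u = val z l u" if "\<And>i. i < n \<Longrightarrow> y i = z i" "l \<le> L" for y z l u
    using that(2) by (induction l arbitrary: u) (auto simp: that(1)[OF vs] intro!: sum.cong)
  have "C \<le> P \<Longrightarrow> \<exists>q a. ?bd q a \<and> val (\<lambda>i. if i < n \<and> ph i < C then
    \<Prod>j\<le>lv. e (a (ph i) j) ^ wt G (q (ph i) j) i else x i) L 0 \<noteq> 0" for C
  proof (induction C)
    case 0
    \<comment> \<open>The modulus 1 and the index 0 are placeholders for classes not yet
      substituted, as the bounds are required for all class numbers.\<close>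
    have "?bd (\<lambda>_ _. 1) (\<lambda>_ _. 0)" using Q N by auto
    then show ?case using nz by (intro exI[of _ "\<lambda>_ _. 1"] exI[of _ "\<lambda>_ _. 0"]) simp
  next
    case (Suc C)
    then obtain q a where qa: "?bd q a" and nz': "val (\<lambda>i. if i < n \<and> ph i < C then
      \<Prod>j\<le>lv. e (a (ph i) j) ^ wt G (q (ph i) j) i else x i) L 0 \<noteq> 0" (is "val ?y L 0 \<noteq> 0") by auto
    let ?S = "{i. i < n \<and> ph i = C}"
    have "\<exists>q0 a0. (\<forall>j\<le>lv. 1 \<le> q0 j \<and> q0 j \<le> Q \<and> a0 j < N) \<and>
      val (\<lambda>i. if i \<in> ?S then \<Prod>j\<le>lv. e (a0 j) ^ wt G (q0 j) i else ?y i) L 0 \<noteq> 0"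
    proof (rule substitute_class[OF _ _ Cd t Q N e lv nz'])
      show "?S \<subseteq> {..<n}" by auto
      fix l b
      interpret block k n p ?S "dblock ?S l b"
        using Suc.prems regular[of C] inj dblock_interval[of _ ?S l b] dblock_subset
        by unfold_locales auto
      have "\<forall>j<L. vs j \<in> dblock ?S l b \<longrightarrow> inside j"
      proof (intro allI impI)
        fix j assume j: "j < L" "vs j \<in> dblock ?S l b"
        obtain j' where "j' < k" "p j' (vs j) = j" using layers[OF j(1)] by blast
        with inside_read[OF _ j(2), of j'] show "inside j" by simp
      qed
      moreover have "\<forall>j<L. vs j \<in> ?S - dblock ?S l b \<longrightarrow> \<not> inside j"
      proof (intro allI impI)
        fix j assume j: "j < L" "vs j \<in> ?S - dblock ?S l b"
        obtain j' where "j' < k" "p j' (vs j) = j" using layers[OF j(1)] by blast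
        with not_inside_read[OF _ j(2), of j'] show "\<not> inside j" by simp
      qed
      moreover have "changes inside L \<le> 2 * (k * k)"
        using changes_eq[of inside L] card_entries[of L] unfolding entry_def by linarith
      then have "w ^ changes inside L \<le> ?r" using w1 by (intro power_increasing) auto
      ultimately show "\<exists>\<chi>. (\<forall>j<L. vs j \<in> dblock ?S l b \<longrightarrow> \<chi> j) \<and>
        (\<forall>j<L. vs j \<in> ?S - dblock ?S l b \<longrightarrow> \<not> \<chi> j) \<and> w ^ changes \<chi> L \<le> ?r" by blast
    qed
    then obtain q0 a0 where q0: "\<forall>j\<le>lv. 1 \<le> q0 j \<and> q0 j \<le> Q \<and> a0 j < N" and
      nz0: "val (\<lambda>i. if i \<in> ?S then \<Prod>j\<le>lv. e (a0 j) ^ wt G (q0 j) i else ?y i) L 0 \<noteq> 0" by blast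
    let ?q = "q(C := q0)" and ?a = "a(C := a0)"
    have "(\<lambda>i. if i < n \<and> ph i < Suc C then
      \<Prod>j\<le>lv. e (?a (ph i) j) ^ wt G (?q (ph i) j) i else x i) =
      (\<lambda>i. if i \<in> ?S then \<Prod>j\<le>lv. e (a0 j) ^ wt G (q0 j) i else ?y i)"
      by (auto simp: fun_eq_iff less_Suc_eq)
    with nz0 have "val (\<lambda>i. if i < n \<and> ph i < Suc C then
      \<Prod>j\<le>lv. e (?a (ph i) j) ^ wt G (?q (ph i) j) i else x i) L 0 \<noteq> 0" by simp
    moreover have "?bd ?q ?a" using qa q0 by auto
    ultimately show ?case by blast
  qed
  from this[of P] obtain q a where qa: "?bd q a" and nz': "val (\<lambda>i. if i < n \<and> ph i < P then
      \<Prod>j\<le>lv. e (a (ph i) j) ^ wt G (q (ph i) j) i else x i) L 0 \<noteq> 0" by auto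
  have "val (\<lambda>i. if i < n \<and> ph i < P then
      \<Prod>j\<le>lv. e (a (ph i) j) ^ wt G (q (ph i) j) i else x i) L 0 =
    val (\<lambda>i. \<Prod>j\<le>lv. e (a (ph i) j) ^ wt G (q (ph i) j) i) L 0"
    using ph by (intro val_cong) auto
  with nz' have "val (\<lambda>i. \<Prod>j\<le>lv. e (a (ph i) j) ^ wt G (q (ph i) j) i) L 0 \<noteq> 0" by simp
  with qa show ?thesis by (intro exI[of _ q] exI[of _ a] conjI)
qed

section \<open>Evaluation of branching programs\<close>

definition mon_val :: "(nat \<Rightarrow> 'b::comm_ring_1) \<Rightarrow> (nat \<Rightarrow>\<^sub>0 nat) \<Rightarrow> 'b" where
  "mon_val x m = (\<Prod>i\<in>Poly_Mapping.keys m. x i ^ Poly_Mapping.lookup m i)"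

lemma mon_val_superset:
  "finite T \<Longrightarrow> Poly_Mapping.keys m \<subseteq> T \<Longrightarrow> mon_val x m = (\<Prod>i\<in>T. x i ^ Poly_Mapping.lookup m i)"
  unfolding mon_val_def by (rule prod.mono_neutral_left) (auto simp: in_keys_iff)

lemma mon_val_add: "mon_val x (m + m') = mon_val x m * mon_val x m'"
proof -
  let ?T = "Poly_Mapping.keys m \<union> Poly_Mapping.keys m'"
  have "mon_val x (m + m') = (\<Prod>i\<in>?T. x i ^ Poly_Mapping.lookup (m + m') i)"
    using Poly_Mapping.keys_add[of m m'] by (intro mon_val_superset) auto
  also have "\<dots> = (\<Prod>i\<in>?T. x i ^ Poly_Mapping.lookup m i) * (\<Prod>i\<in>?T. x i ^ Poly_Mapping.lookup m' i)"
    by (simp add: lookup_add power_add prod.distrib)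
  also have "\<dots> = mon_val x m * mon_val x m'"
    by (simp add: mon_val_superset[where T = ?T])
  finally show ?thesis .
qed

lemma mon_val_single: "mon_val x (Poly_Mapping.single v j) = x v ^ j"
  by (cases "j = 0") (auto simp: mon_val_def)

text \<open>Evaluation at points over another ring. The instances are the field itself for the
  hitting set, and constant polynomials and fractions of polynomials for the identity test.\<close>

locale coefficient_hom =
  fixes \<phi> :: "'a::field \<Rightarrow> 'b::comm_ring_1"
  assumes \<phi>_add: "\<phi> (a + b) = \<phi> a + \<phi> b" and \<phi>_mult: "\<phi> (a * b) = \<phi> a * \<phi> b"
    and \<phi>_0: "\<phi> 0 = 0" and \<phi>_1: "\<phi> 1 = 1"
begin

definition evalh :: "'a mpoly \<Rightarrow> (nat \<Rightarrow> 'b) \<Rightarrow> 'b" where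
  "evalh f x = (\<Sum>m\<in>Poly_Mapping.keys f. \<phi> (Poly_Mapping.lookup f m) * mon_val x m)"

lemma evalh_superset:
  "finite T \<Longrightarrow> Poly_Mapping.keys f \<subseteq> T \<Longrightarrow> evalh f x = (\<Sum>m\<in>T. \<phi> (Poly_Mapping.lookup f m) * mon_val x m)"
  unfolding evalh_def by (rule sum.mono_neutral_left) (auto simp: in_keys_iff \<phi>_0)

lemma evalh_0 [simp]: "evalh 0 x = 0"
  by (simp add: evalh_def)

lemma evalh_single: "evalh (Poly_Mapping.single m c) x = \<phi> c * mon_val x m"
  by (cases "c = 0") (auto simp: evalh_def \<phi>_0)

lemma evalh_1 [simp]: "evalh 1 x = 1"
  using evalh_single[of 0 1 x] by (simp add: \<phi>_1 mon_val_def)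

lemma evalh_add: "evalh (f + g) x = evalh f x + evalh g x"
proof -
  let ?T = "Poly_Mapping.keys f \<union> Poly_Mapping.keys g"
  have "evalh (f + g) x = (\<Sum>m\<in>?T. \<phi> (Poly_Mapping.lookup (f + g) m) * mon_val x m)"
    using Poly_Mapping.keys_add[of f g] by (intro evalh_superset) auto
  also have "\<dots> = evalh f x + evalh g x"
    by (simp add: lookup_add \<phi>_add distrib_right sum.distrib evalh_superset[where T = ?T])
  finally show ?thesis .
qed

lemma evalh_sum: "evalh (sum f I) x = (\<Sum>i\<in>I. evalh (f i) x)"
  by (induction I rule: infinite_finite_induct) (auto simp: evalh_add)

lemma poly_mapping_sum_single:
  "f = (\<Sum>m\<in>Poly_Mapping.keys f. Poly_Mapping.single m (Poly_Mapping.lookup f m))"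
proof (rule poly_mapping_eqI)
  fix m
  show "Poly_Mapping.lookup f m = Poly_Mapping.lookup
      (\<Sum>m\<in>Poly_Mapping.keys f. Poly_Mapping.single m (Poly_Mapping.lookup f m)) m"
    by (auto simp: lookup_sum lookup_single when_def in_keys_iff)
qed

lemma evalh_mult: "evalh (f * g) x = evalh f x * evalh g x"
proof -
  let ?f = "\<lambda>m. Poly_Mapping.single m (Poly_Mapping.lookup f m)"
  let ?g = "\<lambda>m. Poly_Mapping.single m (Poly_Mapping.lookup g m)"
  have "f * g = (\<Sum>m\<in>Poly_Mapping.keys f. ?f m) * (\<Sum>m\<in>Poly_Mapping.keys g. ?g m)"
    using poly_mapping_sum_single[of f] poly_mapping_sum_single[of g] by simp
  also have "\<dots> = (\<Sum>m\<in>Poly_Mapping.keys f. \<Sum>m'\<in>Poly_Mapping.keys g. Poly_Mapping.single (m + m')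
      (Poly_Mapping.lookup f m * Poly_Mapping.lookup g m'))"
    by (simp add: sum_product mult_single)
  finally have "evalh (f * g) x = (\<Sum>m\<in>Poly_Mapping.keys f. \<Sum>m'\<in>Poly_Mapping.keys g.
      (\<phi> (Poly_Mapping.lookup f m) * mon_val x m) * (\<phi> (Poly_Mapping.lookup g m') * mon_val x m'))"
    by (simp add: evalh_sum evalh_single \<phi>_mult mon_val_add algebra_simps)
  then show ?thesis by (simp add: evalh_def sum_product)
qed

lemma evalh_prod: "evalh (prod f I) x = (\<Prod>i\<in>I. evalh (f i) x)"
  by (induction I rule: infinite_finite_induct) (auto simp: evalh_mult)

definition label_val :: "'a oabp \<Rightarrow> (nat \<Rightarrow> 'b) \<Rightarrow> nat \<Rightarrow> nat \<Rightarrow> nat \<Rightarrow> 'b" where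
  "label_val A x l u v = (\<Sum>j\<le>degree (label A l u v). \<phi> (coeff (label A l u v) j) * x (var_order A ! l) ^ j)"

fun abp_val :: "'a oabp \<Rightarrow> (nat \<Rightarrow> 'b) \<Rightarrow> nat \<Rightarrow> nat \<Rightarrow> 'b" where
  "abp_val A x 0 u = (if u = 0 then 1 else 0)"
| "abp_val A x (Suc l) v = (\<Sum>u<layer_size A l.
     (if (l, u, v) \<in> edges A then label_val A x l u v else 0) * abp_val A x l u)"

definition paths_to :: "'a oabp \<Rightarrow> nat \<Rightarrow> nat \<Rightarrow> nat list set" where
  "paths_to A l u = {p. length p = Suc l \<and> (\<forall>i\<le>l. p ! i < layer_size A i) \<and>
     (\<forall>i<l. (i, p ! i, p ! Suc i) \<in> edges A) \<and> p ! l = u}"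

lemma paths_to_Suc:
  assumes "v < layer_size A (Suc l)"
  shows "paths_to A (Suc l) v =
    (\<Union>u\<in>{u. u < layer_size A l \<and> (l, u, v) \<in> edges A}. (\<lambda>p. p @ [v]) ` paths_to A l u)"
    (is "?l = ?r")
proof (intro equalityI subsetI)
  fix p assume p: "p \<in> ?l"
  then have len: "length p = Suc (Suc l)" and last: "p ! Suc l = v" by (auto simp: paths_to_def)
  have eq: "p = take (Suc l) p @ [v]"
    using len last by (metis butlast_conv_take append_butlast_last_id diff_Suc_1 last_conv_nth
        length_greater_0_conv zero_less_Suc)
  have "take (Suc l) p \<in> paths_to A l (p ! l)" using p by (auto simp: paths_to_def)
  moreover have "p ! l < layer_size A l" "(l, p ! l, v) \<in> edges A" using p by (auto simp: paths_to_def)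
  ultimately show "p \<in> ?r" using eq by blast
next
  fix p assume "p \<in> ?r"
  then obtain u q where "u < layer_size A l" "(l, u, v) \<in> edges A" "q \<in> paths_to A l u" "p = q @ [v]" by auto
  with assms show "p \<in> ?l"
    by (auto simp: paths_to_def nth_append le_Suc_eq less_Suc_eq)
qed

lemma finite_paths_to: "finite (paths_to A l u)"
proof -
  have "paths_to A l u \<subseteq> {p. set p \<subseteq> (\<Union>i\<le>l. {..<layer_size A i}) \<and> length p = Suc l}"
    by (fastforce simp: paths_to_def in_set_conv_nth less_Suc_eq_le)
  then show ?thesis by (rule finite_subset) (auto intro: finite_lists_length_eq)
qed

lemma sum_paths_to:
  assumes "layer_size A 0 = 1" "u < layer_size A l"
  shows "(\<Sum>p\<in>paths_to A l u. \<Prod>i<l. label_val A x i (p ! i) (p ! Suc i)) = abp_val A x l u"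
  using assms(2)
proof (induction l arbitrary: u)
  case 0
  then have "paths_to A 0 u = {[u]}" "u = 0"
    using assms(1) by (auto simp: paths_to_def length_Suc_conv)
  then show ?case by simp
next
  case (Suc l v)
  let ?U = "{u. u < layer_size A l \<and> (l, u, v) \<in> edges A}"
  let ?f = "\<lambda>l p. \<Prod>i<l. label_val A x i (p ! i) (p ! Suc i)"
  have "(\<Sum>p\<in>paths_to A (Suc l) v. ?f (Suc l) p) =
      (\<Sum>u\<in>?U. \<Sum>p\<in>(\<lambda>p. p @ [v]) ` paths_to A l u. ?f (Suc l) p)"
    unfolding paths_to_Suc[OF Suc.prems]
    by (rule sum.UNION_disjoint) (auto simp: finite_paths_to, auto simp: paths_to_def)
  also have "\<dots> = (\<Sum>u\<in>?U. \<Sum>p\<in>paths_to A l u. label_val A x l u v * ?f l p)"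
  proof (rule sum.cong[OF refl])
    fix u
    have "(\<Sum>p\<in>(\<lambda>p. p @ [v]) ` paths_to A l u. ?f (Suc l) p) = (\<Sum>p\<in>paths_to A l u. ?f (Suc l) (p @ [v]))"
      by (subst sum.reindex) (auto simp: inj_on_def)
    also have "\<dots> = (\<Sum>p\<in>paths_to A l u. label_val A x l u v * ?f l p)"
    proof (intro sum.cong refl)
      fix p assume p: "p \<in> paths_to A l u"
      have "?f l (p @ [v]) = ?f l p" using p by (intro prod.cong) (auto simp: paths_to_def nth_append)
      then show "?f (Suc l) (p @ [v]) = label_val A x l u v * ?f l p"
        using p by (simp add: paths_to_def nth_append mult.commute)
    qed
    finally show "(\<Sum>p\<in>(\<lambda>p. p @ [v]) ` paths_to A l u. ?f (Suc l) p) =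
        (\<Sum>p\<in>paths_to A l u. label_val A x l u v * ?f l p)" .
  qed
  also have "\<dots> = (\<Sum>u\<in>?U. label_val A x l u v * abp_val A x l u)"
    using Suc.IH by (intro sum.cong refl) (simp add: sum_distrib_left[symmetric])
  also have "\<dots> = (\<Sum>u<layer_size A l. if (l, u, v) \<in> edges A then label_val A x l u v * abp_val A x l u else 0)"
    by (subst sum.inter_filter[symmetric]) (auto intro: sum.cong)
  also have "\<dots> = abp_val A x (Suc l) v" by (auto intro!: sum.cong)
  finally show ?case .
qed

lemma evalh_poly_in_var: "evalh (poly_in_var v q) x = (\<Sum>j\<le>degree q. \<phi> (coeff q j) * x v ^ j)"
  by (simp add: poly_in_var_def evalh_sum evalh_single mon_val_single)

lemma evalh_abp_poly:
  assumes "is_oabp n A"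
  shows "evalh (abp_poly A) x = abp_val A x (depth A) 0"
proof -
  have sz: "layer_size A 0 = 1" "layer_size A (depth A) = 1" using assms by (auto simp: is_oabp_def)
  have "abp_paths A = paths_to A (depth A) 0"
    using sz by (auto simp: abp_paths_def paths_to_def)
  then show ?thesis
    using sum_paths_to[OF sz(1), of 0 "depth A" x] sz(2)
    by (simp add: abp_poly_def evalh_sum evalh_prod evalh_poly_in_var label_val_def)
qed

end

section \<open>Degrees of the computed polynomial and choice of parameters\<close>

lemma keys_prod_poly_in_var:
  fixes L :: nat
  assumes "m \<in> Poly_Mapping.keys (\<Prod>l<L. poly_in_var (xs l) (q l) :: 'a::comm_semiring_1 mpoly)"
    and "\<And>l. l < L \<Longrightarrow> degree (q l) \<le> d"
  shows "Poly_Mapping.lookup m i \<le> d * card {l. l < L \<and> xs l = i}"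
  using assms
proof (induction L arbitrary: m)
  case 0
  then show ?case by simp
next
  case (Suc L)
  from Suc.prems(1) obtain a b where
    a: "a \<in> Poly_Mapping.keys (\<Prod>l<L. poly_in_var (xs l) (q l))" and
    b: "b \<in> Poly_Mapping.keys (poly_in_var (xs L) (q L))" and m: "m = a + b"
    using keys_mult by fastforce
  from b obtain j where j: "j \<le> degree (q L)"
    "b \<in> Poly_Mapping.keys (Poly_Mapping.single (Poly_Mapping.single (xs L) j) (coeff (q L) j))"
    unfolding poly_in_var_def in_keys_iff lookup_sum
    by (auto elim!: sum.not_neutral_contains_not_neutral simp: in_keys_iff)
  then have bj: "b = Poly_Mapping.single (xs L) j" by (auto split: if_splits)
  have IH: "Poly_Mapping.lookup a i \<le> d * card {l. l < L \<and> xs l = i}" using Suc a by simp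
  have "{l. l < Suc L \<and> xs l = i} = {l. l < L \<and> xs l = i} \<union> (if xs L = i then {L} else {})"
    by (auto simp: less_Suc_eq)
  then have "card {l. l < Suc L \<and> xs l = i} = card {l. l < L \<and> xs l = i} + (if xs L = i then 1 else 0)"
    by simp
  moreover have "j \<le> d" using j(1) Suc.prems(2)[of L] by simp
  ultimately show ?case using IH
    by (auto simp: m bj lookup_add lookup_single when_def distrib_left)
qed

lemma finite_edges: "is_oabp n A \<Longrightarrow> finite (edges A)"
proof -
  assume "is_oabp n A"
  then have "edges A \<subseteq> {(l, u, v). l < depth A \<and> u < layer_size A l \<and> v < layer_size A (Suc l)}"
    by (simp add: is_oabp_def)
  also have "\<dots> \<subseteq> (SIGMA l:{..<depth A}. {..<layer_size A l} \<times> {..<layer_size A (Suc l)})" by auto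
  finally show ?thesis by (rule finite_subset) auto
qed

lemma degree_label_le: "is_oabp n A \<Longrightarrow> (l, u, v) \<in> edges A \<Longrightarrow> degree (label A l u v) \<le> abp_degree A"
  unfolding abp_degree_def using finite_edges by (intro Max_ge) (auto intro!: image_eqI[of _ _ "(l, u, v)"])

lemma layer_size_le: "l \<le> depth A \<Longrightarrow> layer_size A l \<le> abp_width A"
  unfolding abp_width_def by (intro Max_ge) auto

lemma card_reads: "card {l. l < length xs \<and> xs ! l = i} = count_list xs i"
  by (simp add: count_list_eq_length_filter length_filter_conv_card eq_commute)

lemma lookup_abp_poly_le:
  assumes A: "is_oabp n A" and m: "m \<in> Poly_Mapping.keys (abp_poly A)"
  shows "Poly_Mapping.lookup m i \<le> abp_degree A * count_list (var_order A) i"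
proof -
  from m obtain p where p: "p \<in> abp_paths A" and
    "m \<in> Poly_Mapping.keys (\<Prod>l<depth A. poly_in_var (var_order A ! l) (label A l (p ! l) (p ! Suc l)))"
    unfolding abp_poly_def in_keys_iff lookup_sum
    by (auto elim!: sum.not_neutral_contains_not_neutral simp: in_keys_iff)
  from keys_prod_poly_in_var[OF this(2), of "abp_degree A" i] p degree_label_le[OF A] show ?thesis
    by (auto simp: abp_paths_def card_reads)
qed

text \<open>Bernoulli's inequality. It makes \<open>G = B ^ k\<close> exceed the individual degrees,
  which are at most \<open>d * k\<close>, although \<open>k\<close> is not bounded in terms of the
  base.\<close>

lemma base_mult_less_power: "d * k < (d + 2 + x) ^ k"
proof -
  have "d * k + 1 \<le> (1 + d) ^ k"
  proof (induction k)
    case (Suc k)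
    have "d * Suc k + 1 \<le> (1 + d) * (d * k + 1)" by (simp add: algebra_simps)
    also have "\<dots> \<le> (1 + d) * (1 + d) ^ k" using Suc by (rule mult_left_mono) simp
    finally show ?case by simp
  qed simp
  also have "\<dots> \<le> (d + 2 + x) ^ k" by (rule power_mono) auto
  finally show ?thesis by simp
qed

text \<open>The exponent of \<open>Cd\<close> is that of the squared rank bound
  \<open>w ^ (2 * (k * k))\<close>. In the second inequality the exponents add up to
  \<open>2 * k + 5 + 8 * (k * k)\<close>, at most 15 k^2; rounding up to 16 lets the machine reach
  this power from \<open>(B ^ k) ^ k\<close> by four squarings.\<close>

lemma parameter_bounds:
  fixes B n k :: nat
  assumes B: "4 \<le> B" "n < B" "1 \<le> n" and k: "1 \<le> k"
  defines "Cd \<equiv> B ^ (4 * (k * k))" and "G \<equiv> B ^ k"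
  defines "t \<equiv> B * (k * (n * (n * (Cd * Cd))))"
  shows "G ^ (n * (n * (Cd * Cd))) < 4 ^ t" "n * G * (2 * t + 1) < B ^ (16 * (k * k))"
proof -
  have tpos: "t > 0" using B k by (simp add: t_def Cd_def)
  have "G ^ (n * (n * (Cd * Cd))) = B ^ (k * (n * (n * (Cd * Cd))))" by (simp add: G_def power_mult)
  also have "\<dots> \<le> (2 ^ B) ^ (k * (n * (n * (Cd * Cd))))"
    by (rule power_mono) (auto intro: less_imp_le)
  also have "\<dots> = 2 ^ t" by (simp only: t_def power_mult)
  also have "\<dots> < 4 ^ t" using tpos by (intro power_strict_mono) auto
  finally show "G ^ (n * (n * (Cd * Cd))) < 4 ^ t" .
  have kB: "k \<le> B ^ k"
  proof -
    have "k < 2 ^ k" by (rule less_exp)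
    also have "\<dots> \<le> B ^ k" using B by (intro power_mono) auto
    finally show ?thesis by simp
  qed
  have "t \<le> B * (B ^ k * (B * (B * (Cd * Cd))))"
    unfolding t_def using B kB by (intro mult_left_mono mult_mono) auto
  also have "\<dots> = B ^ (1 + (k + (1 + (1 + (4 * (k * k) + 4 * (k * k))))))"
    by (simp only: Cd_def power_add power_one_right)
  also have "1 + (k + (1 + (1 + (4 * (k * k) + 4 * (k * k))))) = k + 3 + 8 * (k * k)" by simp
  finally have t: "t \<le> B ^ (k + 3 + 8 * (k * k))" .
  have "2 * t + 1 \<le> B * t" using B tpos mult_le_mono1[of 4 B t] by linarith
  also have "\<dots> \<le> B * B ^ (k + 3 + 8 * (k * k))" using t by (rule mult_left_mono) simp
  also have "\<dots> = B ^ Suc (k + 3 + 8 * (k * k))" by (simp only: power_Suc)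
  also have "Suc (k + 3 + 8 * (k * k)) = k + 4 + 8 * (k * k)" by simp
  finally have Q: "2 * t + 1 \<le> B ^ (k + 4 + 8 * (k * k))" .
  have "n * (G * (2 * t + 1)) < B * (G * (2 * t + 1))"
    using B by (intro mult_strict_right_mono) (auto simp: G_def)
  then have "n * G * (2 * t + 1) < B * G * (2 * t + 1)" by (simp only: mult.assoc)
  also have "\<dots> \<le> B * G * B ^ (k + 4 + 8 * (k * k))" using Q by (rule mult_left_mono) simp
  also have "\<dots> = B ^ (1 + k + (k + 4 + 8 * (k * k)))"
    by (simp only: G_def power_add power_one_right)
  also have "1 + k + (k + 4 + 8 * (k * k)) = 2 * k + 5 + 8 * (k * k)" by simp
  also have "B ^ (2 * k + 5 + 8 * (k * k)) \<le> B ^ (16 * (k * k))"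
  proof (rule power_increasing)
    have "k \<le> k * k" "1 \<le> k * k" using k by auto
    then show "2 * k + 5 + 8 * (k * k) \<le> 16 * (k * k)" using k by linarith
  qed (use B in auto)
  finally show "n * G * (2 * t + 1) < B ^ (16 * (k * k))" .
qed

section \<open>Nonzero values of the generator\<close>

context coefficient_hom
begin

lemma abp_val_cong:
  "(\<And>v. v \<in> set (var_order A) \<Longrightarrow> x v = y v) \<Longrightarrow> l \<le> depth A \<Longrightarrow> abp_val A x l u = abp_val A y l u"
  by (induction l arbitrary: u) (auto simp: label_val_def intro!: sum.cong)

end

locale coefficient_embedding = coefficient_hom \<phi> for \<phi> :: "'a::field \<Rightarrow> 'b::field" +
  assumes \<phi>_inj: "\<phi> c = 0 \<Longrightarrow> c = 0"
begin

text \<open>The hybrid argument needs some point to start from. A grid with more elements than every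
  individual degree contains one.\<close>

lemma nonzero_point:
  fixes E :: "'b set"
  assumes A: "is_oabp n A" and nz: "abp_poly A \<noteq> 0" and E: "finite E"
    and deg: "\<And>i. abp_degree A * count_list (var_order A) i < card E"
  shows "\<exists>x. evalh (abp_poly A) x \<noteq> 0"
proof (rule ccontr)
  assume neg: "\<not> ?thesis"
  let ?f = "abp_poly A" and ?I = "Poly_Mapping.keys (abp_poly A)"
  have keys: "Poly_Mapping.keys m \<subseteq> {..<n}" if "m \<in> ?I" for m
  proof
    fix i assume "i \<in> Poly_Mapping.keys m"
    then have "Poly_Mapping.lookup m i \<noteq> 0" by (simp add: in_keys_iff)
    then have "count_list (var_order A) i \<noteq> 0" using lookup_abp_poly_le[OF A that, of i]
      by (cases "count_list (var_order A) i = 0") auto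
    then have "i \<in> set (var_order A)" by (simp add: count_list_0_iff)
    with A show "i \<in> {..<n}" by (auto simp: is_oabp_def)
  qed
  from nz obtain m0 where m0: "m0 \<in> ?I" by (metis all_not_in_conv keys_eq_empty)
  have "(\<Sum>m\<in>{m\<in>?I. \<forall>j\<in>{..<n}. Poly_Mapping.lookup m j = Poly_Mapping.lookup m0 j}.
      \<phi> (Poly_Mapping.lookup ?f m)) = 0"
  proof (rule grid_vanishing[OF finite_keys E])
    fix m j assume "m \<in> ?I" "j < n"
    then show "Poly_Mapping.lookup m j < card E"
      using lookup_abp_poly_le[OF A] deg le_less_trans by blast
  next
    fix e :: "nat \<Rightarrow> 'b"
    have "mon_val e m = (\<Prod>j<n. e j ^ Poly_Mapping.lookup m j)" if "m \<in> ?I" for m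
      using keys[OF that] by (intro mon_val_superset) auto
    then have "(\<Sum>m\<in>?I. \<phi> (Poly_Mapping.lookup ?f m) * (\<Prod>j<n. e j ^ Poly_Mapping.lookup m j)) = evalh ?f e"
      by (simp add: evalh_def)
    with neg show "(\<Sum>m\<in>?I. \<phi> (Poly_Mapping.lookup ?f m) * (\<Prod>j<n. e j ^ Poly_Mapping.lookup m j)) = 0" by simp
  qed
  also have "{m\<in>?I. \<forall>j\<in>{..<n}. Poly_Mapping.lookup m j = Poly_Mapping.lookup m0 j} = {m0}"
  proof (intro equalityI subsetI)
    fix m assume m: "m \<in> {m\<in>?I. \<forall>j\<in>{..<n}. Poly_Mapping.lookup m j = Poly_Mapping.lookup m0 j}"
    have "Poly_Mapping.lookup m j = Poly_Mapping.lookup m0 j" for j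
    proof (cases "j < n")
      case False
      then have "j \<notin> Poly_Mapping.keys m" "j \<notin> Poly_Mapping.keys m0" using keys m m0 by auto
      then show ?thesis by (simp add: in_keys_iff)
    qed (use m in auto)
    then show "m \<in> {m0}" by (auto intro: poly_mapping_eqI)
  qed (use m0 in auto)
  finally have "\<phi> (Poly_Mapping.lookup ?f m0) = 0" by simp
  then show False using \<phi>_inj m0 by (auto simp: in_keys_iff)
qed

text \<open>A modulus is represented by its predecessor, so that moduli and indices alike are digits
  to the base \<open>N\<close>.\<close>

lemma nonzero_generator:
  fixes ph :: "nat \<Rightarrow> nat" and p :: "nat \<Rightarrow> nat \<Rightarrow> nat" and rk :: "nat \<Rightarrow> nat"
  assumes A: "is_oabp n A" and nz: "abp_poly A \<noteq> 0"
    and w: "abp_width A \<le> w" and d: "abp_degree A \<le> d" and k: "1 \<le> k" and n: "1 \<le> n"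
    and rdk: "\<And>i. count_list (var_order A) i \<le> k"
    and rk: "inj_on rk {..<n}" "\<And>v. v < n \<Longrightarrow> rk v < n"
    and inj: "\<And>j j' i i'. j < k \<Longrightarrow> j' < k \<Longrightarrow> i < n \<Longrightarrow> i' < n \<Longrightarrow> p j i = p j' i' \<Longrightarrow> j = j' \<and> i = i'"
    and layers: "\<And>l. l < depth A \<Longrightarrow> \<exists>j<k. p j (rk (var_order A ! l)) = l"
    and regular: "\<And>c. c < P \<Longrightarrow> regular k p {i. i < n \<and> ph i = c}"
    and ph: "\<And>i. i < n \<Longrightarrow> ph i < P"
    and e: "inj_on e {..<(n + w + d + 2) ^ (16 * (k * k))}" and lv: "n \<le> 2 ^ lv"
  defines "N \<equiv> (n + w + d + 2) ^ (16 * (k * k))" and "G \<equiv> (n + w + d + 2) ^ k"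
  shows "\<exists>q a. (\<forall>c j. j \<le> lv \<longrightarrow> q c j < N \<and> a c j < N) \<and>
    evalh (abp_poly A) (\<lambda>v. \<Prod>j\<le>lv. e (a (ph (rk v)) j) ^ wt G (Suc (q (ph (rk v)) j)) (rk v)) \<noteq> 0"
proof -
  let ?B = "n + w + d + 2" and ?L = "depth A"
  have xs: "set (var_order A) \<subseteq> {..<n}" using A by (simp add: is_oabp_def)
  have w1: "1 \<le> w" using layer_size_le[of 0 A] A w by (simp add: is_oabp_def)
  define Cd where "Cd = ?B ^ (4 * (k * k))"
  define t where "t = ?B * (k * (n * (n * (Cd * Cd))))"
  have bounds: "G ^ (n * (n * (Cd * Cd))) < 4 ^ t" "n * G * (2 * t + 1) < N"
    unfolding t_def Cd_def G_def N_def by (rule parameter_bounds; use n w1 k in simp)+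
  have dk: "d * k < G" unfolding G_def using base_mult_less_power[of d k "n + w"] by (simp add: ac_simps)
  have "1 \<le> G" by (simp add: G_def)
  have GN: "G \<le> N" unfolding G_def N_def using k by (intro power_increasing) (auto simp: Suc_le_eq)
  have card: "card {l. l < ?L \<and> rk (var_order A ! l) = i} \<le> k" for i
  proof (cases "\<exists>v<n. rk v = i")
    case True
    then obtain v where v: "v < n" "rk v = i" by blast
    have "{l. l < ?L \<and> rk (var_order A ! l) = i} \<subseteq> {l. l < ?L \<and> var_order A ! l = v}"
      using v rk(1) xs by (auto simp: inj_on_def dest: nth_mem)
    then have "card {l. l < ?L \<and> rk (var_order A ! l) = i} \<le> card {l. l < ?L \<and> var_order A ! l = v}"
      by (intro card_mono) auto
    with rdk[of v] show ?thesis by (simp add: card_reads)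
  next
    case False
    then have "{l. l < ?L \<and> rk (var_order A ! l) = i} = {}" using xs nth_mem by blast
    then show ?thesis by (simp only: card.empty)
  qed
  define lam where "lam = (\<lambda>l u u' e. if (l, u, u') \<in> edges A then \<phi> (coeff (label A l u u') e) else 0)"
  interpret layered ?L d w n G "\<lambda>l. rk (var_order A ! l)" "layer_size A" lam
  proof
    show "rk (var_order A ! l) < n" if "l < ?L" for l using rk(2) xs nth_mem[OF that] by auto
    show "layer_size A l \<le> w" if "l < ?L" for l using layer_size_le[of l A] that w by simp
    show "d * card {l. l < ?L \<and> rk (var_order A ! l) = i} < G" for i
      using dk mult_le_mono2[OF card[of i], of d] by linarith
  qed (rule w1)
  have val: "val y l u = abp_val A (\<lambda>v. y (rk v)) l u" for y l u
  proof (induction l arbitrary: u)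
    case (Suc l)
    have "(\<Sum>e\<le>d. lam l u' u e * y (rk (var_order A ! l)) ^ e) =
        (if (l, u', u) \<in> edges A then label_val A (\<lambda>v. y (rk v)) l u' u else 0)" for u'
    proof (cases "(l, u', u) \<in> edges A")
      case True
      have "(\<Sum>e\<le>d. lam l u' u e * y (rk (var_order A ! l)) ^ e) = label_val A (\<lambda>v. y (rk v)) l u' u"
        unfolding label_val_def using degree_label_le[OF A True] d True
        by (intro sum.mono_neutral_cong_right) (auto simp: lam_def coeff_eq_0 \<phi>_0)
      with True show ?thesis by simp
    qed (simp add: lam_def)
    with Suc show ?case by simp
  qed simp
  obtain x where x: "evalh (abp_poly A) x \<noteq> 0"
  proof -
    have "abp_degree A * count_list (var_order A) i < card (e ` {..<N})" for i
    proof -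
      have "abp_degree A * count_list (var_order A) i \<le> d * k" using d rdk by (intro mult_mono) auto
      then show ?thesis using dk GN e by (simp add: card_image N_def)
    qed
    then show ?thesis using nonzero_point[OF A nz, of "e ` {..<N}"] that by blast
  qed
  \<comment> \<open>The starting point is transported from variables to ranks along the inverse of
    \<open>rk\<close>.\<close>
  have "val (\<lambda>i. x (inv_into {..<n} rk i)) ?L 0 \<noteq> 0"
  proof -
    have "val (\<lambda>i. x (inv_into {..<n} rk i)) ?L 0 = abp_val A x ?L 0"
      unfolding val using xs rk(1) by (intro abp_val_cong) auto
    with x show ?thesis by (simp add: evalh_abp_poly[OF A])
  qed
  moreover have "w ^ (2 * (k * k)) * w ^ (2 * (k * k)) \<le> Cd"
  proof -
    have "w ^ (2 * (k * k)) * w ^ (2 * (k * k)) = w ^ (4 * (k * k))" by (simp add: power_add[symmetric])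
    also have "\<dots> \<le> Cd" unfolding Cd_def by (intro power_mono) auto
    finally show ?thesis .
  qed
  moreover have "G \<le> Cd" unfolding G_def Cd_def by (intro power_increasing) auto
  moreover have "2 * t + 1 \<le> 2 * t + 1" by simp
  moreover have "inj_on e {..<N}" using e by (simp only: N_def)
  ultimately have "\<exists>q a. (\<forall>c j. j \<le> lv \<longrightarrow> 1 \<le> q c j \<and> q c j \<le> 2 * t + 1 \<and> a c j < N) \<and>
    val (\<lambda>i. \<Prod>j\<le>lv. e (a (ph i) j) ^ wt G (q (ph i) j) i) ?L 0 \<noteq> 0"
    using inj layers regular ph bounds lv
    by (intro substitute_all[where k = k and p = p and ph = ph and P = P and Cd = Cd and t = t])
  then obtain q a where qa: "\<And>c j. j \<le> lv \<Longrightarrow> 1 \<le> q c j \<and> q c j \<le> 2 * t + 1 \<and> a c j < N"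
    and nz': "val (\<lambda>i. \<Prod>j\<le>lv. e (a (ph i) j) ^ wt G (q (ph i) j) i) ?L 0 \<noteq> 0" by blast
  have "2 * t + 1 < N"
  proof -
    have "2 * t + 1 = 1 * (2 * t + 1)" by (simp only: mult_1)
    also have "\<dots> \<le> n * G * (2 * t + 1)" using n \<open>1 \<le> G\<close> by (intro mult_right_mono) auto
    also have "\<dots> < N" by (rule bounds(2))
    finally show ?thesis .
  qed
  \<comment> \<open>The moduli are at least 1, so taking predecessors loses nothing.\<close>
  then have bd: "\<forall>c j. j \<le> lv \<longrightarrow> q c j - 1 < N \<and> a c j < N"
    using qa by (meson diff_le_self le_less_trans)
  have "(\<Prod>j\<le>lv. e (a c j) ^ wt G (Suc (q c j - 1)) i) = (\<Prod>j\<le>lv. e (a c j) ^ wt G (q c j) i)" for c i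
  proof (rule prod.cong[OF refl])
    fix j assume "j \<in> {..lv}"
    then have "Suc (q c j - 1) = q c j" using qa[of j c] by simp
    then show "e (a c j) ^ wt G (Suc (q c j - 1)) i = e (a c j) ^ wt G (q c j) i" by (simp only:)
  qed
  with nz' have "evalh (abp_poly A) (\<lambda>v. \<Prod>j\<le>lv. e (a (ph (rk v)) j) ^ wt G (Suc (q (ph (rk v)) j - 1)) (rk v)) \<noteq> 0"
    by (simp add: evalh_abp_poly[OF A] val)
  with bd show ?thesis by (intro exI[of _ "\<lambda>c j. q c j - 1"] exI[of _ a] conjI)
qed

end

section \<open>Weakest preconditions\<close>

definition upn :: "'a mem \<Rightarrow> nat \<Rightarrow> nat \<Rightarrow> nat \<Rightarrow> 'a mem" where
  "upn s x i v = s\<lparr>nmem := (nmem s)(x := (nmem s x)(i := v))\<rparr>"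

definition upf :: "'a mem \<Rightarrow> nat \<Rightarrow> nat \<Rightarrow> 'a \<Rightarrow> 'a mem" where
  "upf s x i v = s\<lparr>fmem := (fmem s)(x := (fmem s x)(i := v))\<rparr>"

lemma upn_simps [simp]:
  "nmem (upn s x i v) x = (nmem s x)(i := v)"
  "y \<noteq> x \<Longrightarrow> nmem (upn s x i v) y = nmem s y"
  "fmem (upn s x i v) = fmem s"
  "nmem (upf s x i c) = nmem s"
  "fmem (upf s x i c) x = (fmem s x)(i := c)"
  "y \<noteq> x \<Longrightarrow> fmem (upf s x i c) y = fmem s y"
  by (simp_all add: upn_def upf_def)

text \<open>
  \<open>wp M c Q s\<close>: started in s, the program c halts in a memory with Q, and no loop makes more than M
  iterations.
\<close>

primrec wp :: "nat \<Rightarrow> prog \<Rightarrow> ('a::field mem \<Rightarrow> bool) \<Rightarrow> 'a mem \<Rightarrow> bool" where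
  "wp M Skip Q s = Q s"
| "wp M (NSet x e1 e2) Q s = Q (upn s x (nval s e1) (nval s e2))"
| "wp M (FSet x e1 e2) Q s = Q (upf s x (nval s e1) (fval s e2))"
| "wp M (Seq c1 c2) Q s = wp M c1 (wp M c2 Q) s"
| "wp M (If b c1 c2) Q s = (if tval s b then wp M c1 Q s else wp M c2 Q s)"
| "wp M (While b c) Q s = rec_nat (\<lambda>s. \<not> tval s b \<and> Q s)
     (\<lambda>_ W s. if tval s b then wp M c W s else Q s) M s"

fun time_bound :: "nat \<Rightarrow> prog \<Rightarrow> nat" where
  "time_bound M (Seq c1 c2) = time_bound M c1 + time_bound M c2"
| "time_bound M (If b c1 c2) = Suc (time_bound M c1 + time_bound M c2)"
| "time_bound M (While b c) = M * Suc (time_bound M c) + 1"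
| "time_bound M _ = 1"

lemma wp_sound:
  "wp M c Q s \<Longrightarrow> \<exists>t s'. runs c s t s' \<and> t \<le> time_bound M c \<and> Q s'"
proof (induction c arbitrary: Q s)
  case Skip
  then show ?case using runs.Skip by fastforce
next
  case (NSet x e1 e2)
  then show ?case using runs.NSet by (fastforce simp: upn_def)
next
  case (FSet x e1 e2)
  then show ?case using runs.FSet by (fastforce simp: upf_def)
next
  case (Seq c1 c2)
  then have "wp M c1 (wp M c2 Q) s" by simp
  from Seq.IH(1)[OF this] obtain t1 s1 where 1: "runs c1 s t1 s1" "t1 \<le> time_bound M c1" "wp M c2 Q s1" by blast
  from Seq.IH(2)[OF this(3)] obtain t2 s2 where "runs c2 s1 t2 s2" "t2 \<le> time_bound M c2" "Q s2" by blast
  with 1 show ?case using runs.Seq[of c1 s t1 s1 c2 t2 s2] by (intro exI[of _ "t1 + t2"] exI[of _ s2]) auto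
next
  case (If b c1 c2)
  show ?case
  proof (cases "tval s b")
    case True
    with If.prems have "wp M c1 Q s" by simp
    from If.IH(1)[OF this] obtain t s' where "runs c1 s t s'" "t \<le> time_bound M c1" "Q s'" by blast
    with True show ?thesis using runs.IfTrue[of s b c1 t s' c2] by (intro exI[of _ "Suc t"] exI[of _ s']) auto
  next
    case False
    with If.prems have "wp M c2 Q s" by simp
    from If.IH(2)[OF this] obtain t s' where "runs c2 s t s'" "t \<le> time_bound M c2" "Q s'" by blast
    with False show ?thesis using runs.IfFalse[of s b c2 t s' c1] by (intro exI[of _ "Suc t"] exI[of _ s']) auto
  qed
next
  case (While b c)
  have "rec_nat (\<lambda>s. \<not> tval s b \<and> Q s) (\<lambda>_ W s. if tval s b then wp M c W s else Q s) m s \<Longrightarrow>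
    \<exists>t s'. runs (While b c) s t s' \<and> t \<le> m * Suc (time_bound M c) + 1 \<and> Q s'" for m s
  proof (induction m arbitrary: s)
    case 0
    then show ?case using runs.WhileFalse by fastforce
  next
    case (Suc m)
    show ?case
    proof (cases "tval s b")
      case True
      with Suc.prems have "wp M c (rec_nat (\<lambda>s. \<not> tval s b \<and> Q s)
          (\<lambda>_ W s. if tval s b then wp M c W s else Q s) m) s" by simp
      from While.IH[OF this] obtain t1 s1 where 1: "runs c s t1 s1" "t1 \<le> time_bound M c"
        "rec_nat (\<lambda>s. \<not> tval s b \<and> Q s) (\<lambda>_ W s. if tval s b then wp M c W s else Q s) m s1" by blast
      from Suc.IH[OF this(3)] obtain t2 s2 where "runs (While b c) s1 t2 s2"
        "t2 \<le> m * Suc (time_bound M c) + 1" "Q s2" by blast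
      with 1 True show ?thesis using runs.WhileTrue[of s b c t1 s1 t2 s2]
        by (intro exI[of _ "Suc (t1 + t2)"] exI[of _ s2]) auto
    next
      case False
      with Suc.prems have "Q s" by simp
      with False show ?thesis using runs.WhileFalse[of s b c] by (intro exI[of _ 1] exI[of _ s]) auto
    qed
  qed
  with While.prems show ?case by simp
qed

lemma wp_mono: "wp M c Q s \<Longrightarrow> (\<And>s. Q s \<Longrightarrow> R s) \<Longrightarrow> wp M c R s"
proof (induction c arbitrary: Q R s)
  case (Seq c1 c2)
  have "wp M c1 (wp M c2 Q) s" using Seq.prems(1) by simp
  then have "wp M c1 (wp M c2 R) s"
    by (rule Seq.IH(1)) (rule Seq.IH(2)[OF _ Seq.prems(2)])
  then show ?case by simp
next
  case (If b c1 c2)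
  show ?case using If.prems(1) If.IH(1)[OF _ If.prems(2)] If.IH(2)[OF _ If.prems(2)]
    by (auto split: if_splits)
next
  case (While b c)
  have "rec_nat (\<lambda>s. \<not> tval s b \<and> Q s) (\<lambda>_ W s. if tval s b then wp M c W s else Q s) m s \<Longrightarrow>
    rec_nat (\<lambda>s. \<not> tval s b \<and> R s) (\<lambda>_ W s. if tval s b then wp M c W s else R s) m s" for m s
  proof (induction m arbitrary: s)
    case (Suc m)
    show ?case
    proof (cases "tval s b")
      case True
      with Suc.prems have "wp M c (rec_nat (\<lambda>s. \<not> tval s b \<and> Q s)
          (\<lambda>_ W s. if tval s b then wp M c W s else Q s) m) s" by simp
      then have "wp M c (rec_nat (\<lambda>s. \<not> tval s b \<and> R s)
          (\<lambda>_ W s. if tval s b then wp M c W s else R s) m) s" by (rule While.IH) (rule Suc.IH)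
      with True show ?thesis by simp
    qed (use Suc.prems While.prems(2) in auto)
  qed (use While.prems(2) in auto)
  then show ?case using While.prems(1) by simp
qed auto

lemma wp_conj: "wp M c Q s \<Longrightarrow> wp M c R s \<Longrightarrow> wp M c (\<lambda>s'. Q s' \<and> R s') s"
proof (induction c arbitrary: Q R s)
  case (Seq c1 c2)
  from Seq.prems have "wp M c1 (\<lambda>s'. wp M c2 Q s' \<and> wp M c2 R s') s" by (auto intro: Seq.IH(1))
  then have "wp M c1 (wp M c2 (\<lambda>s'. Q s' \<and> R s')) s"
    by (rule wp_mono) (auto intro: Seq.IH(2))
  then show ?case by simp
next
  case (While b c)
  let ?W = "\<lambda>Q. rec_nat (\<lambda>s. \<not> tval s b \<and> Q s) (\<lambda>_ W s. if tval s b then wp M c W s else Q s)"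
  have "?W Q m s \<Longrightarrow> ?W R m s \<Longrightarrow> ?W (\<lambda>s'. Q s' \<and> R s') m s" for m s
  proof (induction m arbitrary: s)
    case (Suc m)
    show ?case
    proof (cases "tval s b")
      case True
      with Suc.prems have "wp M c (?W Q m) s" "wp M c (?W R m) s" by simp_all
      then have "wp M c (\<lambda>s. ?W Q m s \<and> ?W R m s) s" by (rule While.IH)
      then have "wp M c (?W (\<lambda>s'. Q s' \<and> R s') m) s" by (rule wp_mono) (use Suc.IH in blast)
      with True show ?thesis by simp
    qed (use Suc.prems in auto)
  qed auto
  from this[of M s] While.prems show ?case by simp
qed (auto split: if_splits)

text \<open>A single exact postcondition determines \<open>wp\<close> for every \<open>Q\<close>.
  The analysis of an arithmetic macro thus becomes an equation that serves as a rewrite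
  rule.\<close>

lemma wp_exact: "wp M c (\<lambda>s'. s' = s1) s \<Longrightarrow> wp M c Q s = Q s1"
proof
  assume "wp M c (\<lambda>s'. s' = s1) s" "wp M c Q s"
  from wp_sound[OF wp_conj[OF this]] show "Q s1" by blast
next
  assume "wp M c (\<lambda>s'. s' = s1) s" "Q s1"
  then show "wp M c Q s" by (auto elim: wp_mono)
qed

section \<open>Frame conditions\<close>

fun nwrites :: "prog \<Rightarrow> nat set" where
  "nwrites (NSet x _ _) = {x}"
| "nwrites (Seq c1 c2) = nwrites c1 \<union> nwrites c2"
| "nwrites (If b c1 c2) = nwrites c1 \<union> nwrites c2"
| "nwrites (While b c) = nwrites c"
| "nwrites _ = {}"

fun fwrites :: "prog \<Rightarrow> nat set" where
  "fwrites (FSet x _ _) = {x}"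
| "fwrites (Seq c1 c2) = fwrites c1 \<union> fwrites c2"
| "fwrites (If b c1 c2) = fwrites c1 \<union> fwrites c2"
| "fwrites (While b c) = fwrites c"
| "fwrites _ = {}"

fun nreads :: "nexp \<Rightarrow> nat set" where
  "nreads (NConst _) = {}"
| "nreads (NGet x e) = insert x (nreads e)"
| "nreads (NAdd e1 e2) = nreads e1 \<union> nreads e2"
| "nreads (NSub e1 e2) = nreads e1 \<union> nreads e2"

definition agree :: "nat set \<Rightarrow> nat set \<Rightarrow> 'a mem \<Rightarrow> 'a mem \<Rightarrow> bool" where
  "agree X Y s s' \<longleftrightarrow> (\<forall>x. x \<notin> X \<longrightarrow> nmem s' x = nmem s x) \<and> (\<forall>y. y \<notin> Y \<longrightarrow> fmem s' y = fmem s y)"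

lemma agree_refl [simp]: "agree X Y s s"
  by (simp add: agree_def)

lemma agree_trans: "agree X Y s s' \<Longrightarrow> agree X Y s' s'' \<Longrightarrow> agree X Y s s''"
  by (simp add: agree_def)

lemma nval_agree: "agree X Y s s' \<Longrightarrow> nreads e \<inter> X = {} \<Longrightarrow> nval s' e = nval s e"
  by (induction e) (auto simp: agree_def Int_Un_distrib2)

lemma wp_agree: "wp M c Q s \<Longrightarrow> wp M c (\<lambda>s'. Q s' \<and> agree (nwrites c) (fwrites c) s s') s"
proof (induction c arbitrary: Q s)
  case (Seq c1 c2)
  have "wp M c1 (wp M c2 Q) s" using Seq.prems by simp
  from Seq.IH(1)[OF this]
  have "wp M c1 (wp M c2 (\<lambda>s'. Q s' \<and> agree (nwrites (Seq c1 c2)) (fwrites (Seq c1 c2)) s s')) s"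
  proof (rule wp_mono, elim conjE)
    fix s1 assume 1: "wp M c2 Q s1" "agree (nwrites c1) (fwrites c1) s s1"
    from Seq.IH(2)[OF 1(1)]
    show "wp M c2 (\<lambda>s'. Q s' \<and> agree (nwrites (Seq c1 c2)) (fwrites (Seq c1 c2)) s s') s1"
      by (rule wp_mono) (use 1(2) in \<open>auto simp: agree_def\<close>)
  qed
  then show ?case by simp
next
  case (If b c1 c2)
  show ?case
  proof (cases "tval s b")
    case True
    with If.prems have "wp M c1 Q s" by simp
    from If.IH(1)[OF this] have "wp M c1 (\<lambda>s'. Q s' \<and> agree (nwrites (If b c1 c2)) (fwrites (If b c1 c2)) s s') s"
      by (rule wp_mono) (auto simp: agree_def)
    with True show ?thesis by simp
  next
    case False
    with If.prems have "wp M c2 Q s" by simp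
    from If.IH(2)[OF this] have "wp M c2 (\<lambda>s'. Q s' \<and> agree (nwrites (If b c1 c2)) (fwrites (If b c1 c2)) s s') s"
      by (rule wp_mono) (auto simp: agree_def)
    with False show ?thesis by simp
  qed
next
  case (While b c)
  let ?W = "\<lambda>Q. rec_nat (\<lambda>s. \<not> tval s b \<and> Q s) (\<lambda>_ W s. if tval s b then wp M c W s else Q s)"
  let ?X = "nwrites c" and ?Y = "fwrites c"
  have "agree ?X ?Y s0 s \<Longrightarrow> ?W Q m s \<Longrightarrow> ?W (\<lambda>s'. Q s' \<and> agree ?X ?Y s0 s') m s" for m s0 s
  proof (induction m arbitrary: s)
    case (Suc m)
    show ?case
    proof (cases "tval s b")
      case True
      with Suc.prems have "wp M c (?W Q m) s" by simp
      from While.IH[OF this] have "wp M c (?W (\<lambda>s'. Q s' \<and> agree ?X ?Y s0 s') m) s"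
        by (rule wp_mono) (use Suc.IH Suc.prems(1) agree_trans in blast)
      with True show ?thesis by simp
    qed (use Suc.prems in auto)
  qed auto
  from this[of s s M] While.prems show ?case by simp
qed (auto simp: agree_def)

lemma wp_use:
  "wp M c Q s \<Longrightarrow> (\<And>s'. Q s' \<Longrightarrow> agree (nwrites c) (fwrites c) s s' \<Longrightarrow> R s') \<Longrightarrow> wp M c R s"
  by (rule wp_mono[OF wp_agree]) auto

text \<open>
  Evaluating the operands before the new memory is formed keeps symbolic execution from growing
  exponentially.
\<close>

lemma wp_NSet: "nval s e1 = i \<Longrightarrow> nval s e2 = v \<Longrightarrow> wp M (NSet x e1 e2) Q s = Q (upn s x i v)"
  by simp

lemma wp_FSet: "nval s e1 = i \<Longrightarrow> fval s e2 = v \<Longrightarrow> wp M (FSet x e1 e2) Q s = Q (upf s x i v)"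
  by simp

declare wp.simps(2,3) [simp del]
declare wp_NSet [simp] wp_FSet [simp]

section \<open>Loops and arithmetic of the machine\<close>

abbreviation V :: "nat \<Rightarrow> nexp" where "V x \<equiv> NGet x (NConst 0)"
abbreviation Asg :: "nat \<Rightarrow> nexp \<Rightarrow> prog"  (infix "::=" 75) where "x ::= e \<equiv> NSet x (NConst 0) e"
abbreviation Sq :: "prog \<Rightarrow> prog \<Rightarrow> prog"  (infixr ";;" 60) where "c1 ;; c2 \<equiv> Seq c1 c2"

definition For :: "nat \<Rightarrow> nexp \<Rightarrow> prog \<Rightarrow> prog" where
  "For i e c = i ::= NConst 0 ;; While (NLess (V i) e) (c ;; i ::= NAdd (V i) (NConst 1))"

lemma writes_For [simp]:
  "nwrites (For i e c) = insert i (nwrites c)" "fwrites (For i e c) = fwrites c"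
  by (auto simp: For_def)

text \<open>The test evaluates \<open>e\<close> anew in every iteration, hence the condition that
  the loop does not write what \<open>e\<close> reads. Every step is given the agreement with the
  initial memory, so an invariant has to mention only what changes.\<close>

lemma wp_For:
  assumes n: "nval s e = n" "n \<le> M" and e: "nreads e \<inter> insert i (nwrites c) = {}"
    and i: "i \<notin> nwrites c"
    and start: "I 0 (upn s i 0 0)"
    and step: "\<And>j s'. j < n \<Longrightarrow> agree (insert i (nwrites c)) (fwrites c) s s' \<Longrightarrow> nmem s' i 0 = j \<Longrightarrow> I j s' \<Longrightarrow>
      wp M c (\<lambda>s''. I (Suc j) (upn s'' i 0 (Suc j))) s'"
    and fin: "\<And>s'. agree (insert i (nwrites c)) (fwrites c) s s' \<Longrightarrow> nmem s' i 0 = n \<Longrightarrow> I n s' \<Longrightarrow> Q s'"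
  shows "wp M (For i e c) Q s"
proof -
  let ?b = "NLess (V i) e" and ?c = "c ;; i ::= NAdd (V i) (NConst 1)"
  let ?W = "rec_nat (\<lambda>s. \<not> tval s ?b \<and> Q s) (\<lambda>_ W s. if tval s ?b then wp M ?c W s else Q s)"
  let ?ag = "agree (insert i (nwrites c)) (fwrites c) s"
  have e': "nval s' e = n" if "?ag s'" for s' using nval_agree[OF that e] n by simp
  have "?ag s' \<Longrightarrow> nmem s' i 0 = j \<Longrightarrow> j \<le> n \<Longrightarrow> I j s' \<Longrightarrow> n \<le> j + m \<Longrightarrow> ?W m s'" for m j s'
  proof (induction m arbitrary: j s')
    case 0
    then have "j = n" by simp
    with 0 fin e' show ?case by simp
  next
    case (Suc m)
    show ?case
    proof (cases "j < n")
      case True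
      have "wp M c (\<lambda>s''. I (Suc j) (upn s'' i 0 (Suc j))) s'" using step True Suc.prems by blast
      then have "wp M c (\<lambda>s''. ?W m (upn s'' i 0 (Suc (nmem s'' i 0)))) s'"
      proof (rule wp_use)
        fix s'' assume I: "I (Suc j) (upn s'' i 0 (Suc j))" and ag: "agree (nwrites c) (fwrites c) s' s''"
        have "nmem s'' i 0 = j" using ag i Suc.prems(2) by (simp add: agree_def)
        moreover have "?ag (upn s'' i 0 (Suc j))" using ag Suc.prems(1) by (auto simp: agree_def)
        ultimately show "?W m (upn s'' i 0 (Suc (nmem s'' i 0)))"
          using Suc.IH[of "upn s'' i 0 (Suc j)" "Suc j"] I True Suc.prems(5) by simp
      qed
      then have "wp M ?c (?W m) s'"
        unfolding wp.simps(4) by (rule wp_mono) simp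
      then show ?thesis using True e'[OF Suc.prems(1)] Suc.prems(2) by simp
    next
      case False
      then have "j = n" using Suc.prems by simp
      then show ?thesis using fin Suc.prems e'[OF Suc.prems(1)] by simp
    qed
  qed
  from this[of "upn s i 0 0" 0 M] start n have "?W M (upn s i 0 0)" by (simp add: agree_def)
  moreover have "wp M (For i e c) Q s = ?W M (upn s i 0 0)" by (simp add: For_def)
  ultimately show ?thesis by simp
qed

lemma upn_upn [simp]: "upn (upn s x i v) x i v' = upn s x i v'"
  by (simp add: upn_def)

lemma upn_commute: "x \<noteq> y \<Longrightarrow> upn (upn s x i v) y j v' = upn (upn s y j v') x i v"
  by (simp add: upn_def fun_upd_twist)

text \<open>The scalars 2, 3 and 4 serve as temporaries of the arithmetic macros.\<close>

definition Mul :: "nat \<Rightarrow> nexp \<Rightarrow> nexp \<Rightarrow> prog" where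
  "Mul z e1 e2 = 3 ::= NConst 0 ;; For 2 e1 (3 ::= NAdd (V 3) e2) ;; z ::= V 3"

lemma writes_Mul [simp]: "nwrites (Mul z e1 e2) = {2, 3, z}" "fwrites (Mul z e1 e2) = {}"
  by (auto simp: Mul_def)

lemma wp_Mul:
  assumes "nval s e1 \<le> M" "nreads e1 \<inter> {2, 3} = {}" "nreads e2 \<inter> {2, 3} = {}"
  shows "wp M (Mul z e1 e2) Q s =
    Q (upn (upn (upn s 3 0 (nval s e1 * nval s e2)) 2 0 (nval s e1)) z 0 (nval s e1 * nval s e2))"
proof (rule wp_exact)
  let ?s0 = "upn s 3 0 0"
  have ag: "agree {2, 3} {} s ?s0" by (simp add: agree_def)
  have n1: "nval ?s0 e1 = nval s e1" using nval_agree[OF ag assms(2)] .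
  show "wp M (Mul z e1 e2) (\<lambda>s'. s' = upn (upn (upn s 3 0 (nval s e1 * nval s e2)) 2 0 (nval s e1)) z 0
      (nval s e1 * nval s e2)) s"
    unfolding Mul_def wp.simps nval.simps
  proof (rule wp_For[where I = "\<lambda>j s'. s' = upn (upn s 3 0 (j * nval s e2)) 2 0 j"])
    show "nval ?s0 e1 = nval s e1" by (rule n1)
    fix j s' assume s': "s' = upn (upn s 3 0 (j * nval s e2)) 2 0 j"
    have "agree {2, 3} {} s s'" by (simp add: agree_def s')
    then have "nval s' e2 = nval s e2" using nval_agree assms(3) by blast
    then show "wp M (3 ::= NAdd (V 3) e2) (\<lambda>s''. upn s'' 2 0 (Suc j) =
        upn (upn s 3 0 (Suc j * nval s e2)) 2 0 (Suc j)) s'"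
      by (simp add: s' upn_commute[of 2 3] add.commute)
  qed (use assms in auto)
qed

lemma wp_Mul_eval:
  assumes "nval s e1 = a" "nval s e2 = b" "a \<le> M" "nreads e1 \<inter> {2, 3} = {}" "nreads e2 \<inter> {2, 3} = {}"
  shows "wp M (Mul z e1 e2) Q s = Q (upn (upn (upn s 3 0 (a * b)) 2 0 a) z 0 (a * b))"
  using wp_Mul[of s e1 M e2 z Q] assms by simp

definition DivMod :: "nat \<Rightarrow> nat \<Rightarrow> nexp \<Rightarrow> nexp \<Rightarrow> prog" where
  "DivMod zq zr e1 e2 = 3 ::= NConst 0 ;; 4 ::= e1 ;;
     For 2 e1 (If (NLess (V 4) e2) Skip (4 ::= NSub (V 4) e2 ;; 3 ::= NAdd (V 3) (NConst 1))) ;;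
     zq ::= V 3 ;; zr ::= V 4"

lemma writes_DivMod [simp]: "nwrites (DivMod zq zr e1 e2) = {2, 3, 4, zq, zr}" "fwrites (DivMod zq zr e1 e2) = {}"
  by (auto simp: DivMod_def)

lemma wp_DivMod:
  assumes "nval s e1 \<le> M" "nreads e1 \<inter> {2, 3, 4} = {}" "nreads e2 \<inter> {2, 3, 4} = {}" "nval s e2 > 0" "zq \<noteq> 4"
  shows "wp M (DivMod zq zr e1 e2) Q s =
    Q (upn (upn (upn (upn (upn s 3 0 (nval s e1 div nval s e2)) 4 0 (nval s e1 mod nval s e2)) 2 0 (nval s e1))
      zq 0 (nval s e1 div nval s e2)) zr 0 (nval s e1 mod nval s e2))"
proof (rule wp_exact)
  let ?x = "nval s e1" and ?y = "nval s e2"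
  let ?s0 = "upn (upn s 3 0 0) 4 0 ?x"
  have ag0: "agree {2, 3, 4} {} s (upn s 3 0 0)" by (simp add: agree_def)
  have e1: "nval (upn s 3 0 0) e1 = ?x" using nval_agree[OF ag0 assms(2)] .
  have ag: "agree {2, 3, 4} {} s ?s0" by (simp add: agree_def)
  have n1: "nval ?s0 e1 = ?x" using nval_agree[OF ag assms(2)] .
  \<comment> \<open>The number of subtractions made in the first \<open>j\<close> rounds; once the
    remainder is reached, the other rounds are idle. The fixed number of rounds makes the loop bound
    immediate.\<close>
  let ?a = "\<lambda>j. min j (?x div ?y)"
  show "wp M (DivMod zq zr e1 e2) (\<lambda>s'. s' = upn (upn (upn (upn (upn s 3 0 (?x div ?y)) 4 0 (?x mod ?y)) 2 0 ?x)
      zq 0 (?x div ?y)) zr 0 (?x mod ?y)) s"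
    unfolding DivMod_def wp.simps nval.simps e1
  proof (rule wp_For[where I = "\<lambda>j s'. s' = upn (upn (upn s 3 0 (?a j)) 4 0 (?x - ?a j * ?y)) 2 0 j"])
    show "nval ?s0 e1 = ?x" by (rule n1)
    fix j s' assume s': "s' = upn (upn (upn s 3 0 (?a j)) 4 0 (?x - ?a j * ?y)) 2 0 j"
    have "agree {2, 3, 4} {} s s'" by (simp add: agree_def s')
    then have e2: "nval s' e2 = ?y" using nval_agree assms(3) by blast
    have e2': "nval (upn s' 4 0 v) e2 = ?y" for v
    proof -
      have "agree {2, 3, 4} {} s (upn s' 4 0 v)" by (simp add: agree_def s')
      then show ?thesis using nval_agree assms(3) by blast
    qed
    show "wp M (If (NLess (V 4) e2) Skip (4 ::= NSub (V 4) e2 ;; 3 ::= NAdd (V 3) (NConst 1)))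
        (\<lambda>s''. upn s'' 2 0 (Suc j) = upn (upn (upn s 3 0 (?a (Suc j))) 4 0 (?x - ?a (Suc j) * ?y)) 2 0 (Suc j)) s'"
    proof (cases "j < ?x div ?y")
      case True
      then have "Suc j * ?y \<le> ?x"
        using assms(4) by (metis Suc_leI less_eq_div_iff_mult_less_eq)
      then have ge: "\<not> ?x - j * ?y < ?y" by simp
      have a: "?a j = j" "?a (Suc j) = Suc j" using True by auto
      show ?thesis using ge unfolding s' a
        by (simp add: e2[unfolded s' a] upn_commute[of 2 3] upn_commute[of 2 4] upn_commute[of 4 3])
          (simp add: algebra_simps)
    next
      case False
      then have a: "?a j = ?x div ?y" "?a (Suc j) = ?x div ?y" by auto
      have m: "?x - ?x div ?y * ?y = ?x mod ?y" by (simp add: minus_div_mult_eq_mod)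
      show ?thesis using assms(4) unfolding s' a m by (simp add: e2[unfolded s' a m])
    qed
  next
    fix s' assume "s' = upn (upn (upn s 3 0 (?a ?x)) 4 0 (?x - ?a ?x * ?y)) 2 0 ?x"
    moreover have "?a ?x = ?x div ?y" by (simp add: min_absorb2)
    moreover have "?x - ?x div ?y * ?y = ?x mod ?y" by (simp add: minus_div_mult_eq_mod)
    ultimately have "s' = upn (upn (upn s 3 0 (?x div ?y)) 4 0 (?x mod ?y)) 2 0 ?x" by simp
    then show "upn (upn s' zq 0 (nmem s' 3 0)) zr 0 (nmem (upn s' zq 0 (nmem s' 3 0)) 4 0) =
        upn (upn (upn (upn (upn s 3 0 (?x div ?y)) 4 0 (?x mod ?y)) 2 0 ?x) zq 0 (?x div ?y)) zr 0 (?x mod ?y)"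
      using assms(5) by simp
  qed (use assms in auto)
qed

lemma wp_DivMod_eval:
  assumes "nval s e1 = a" "nval s e2 = b" "a \<le> M" "nreads e1 \<inter> {2, 3, 4} = {}" "nreads e2 \<inter> {2, 3, 4} = {}"
    "b > 0" "zq \<noteq> 4"
  shows "wp M (DivMod zq zr e1 e2) Q s =
    Q (upn (upn (upn (upn (upn s 3 0 (a div b)) 4 0 (a mod b)) 2 0 a) zq 0 (a div b)) zr 0 (a mod b))"
  using wp_DivMod[of s e1 M e2 zq zr Q] assms by simp

fun prog_height :: "prog \<Rightarrow> nat" where
  "prog_height (Seq c1 c2) = prog_height c1 + prog_height c2 + 1"
| "prog_height (If b c1 c2) = prog_height c1 + prog_height c2 + 1"
| "prog_height (While b c) = prog_height c + 2"
| "prog_height _ = 0"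

text \<open>Only the lengths of loops depend on the input. Sequencing and nesting are fixed by the
  text, so the time is a power of \<open>M + 3\<close> whose exponent depends on the program
  alone.\<close>

lemma time_bound_le: "time_bound M c \<le> (M + 3) ^ prog_height c"
proof (induction c)
  case (Seq c1 c2)
  let ?a = "(M + 3) ^ prog_height c1" and ?b = "(M + 3) ^ prog_height c2"
  have pos: "1 \<le> ?a" "1 \<le> ?b" by auto
  have "?a + ?b \<le> 2 * (?a * ?b)" using pos mult_le_mono[OF pos(1) order_refl[of ?b]] mult_le_mono[OF order_refl[of ?a] pos(2)] by linarith
  also have "\<dots> \<le> (M + 3) * (?a * ?b)" by (rule mult_right_mono) auto
  finally show ?case using Seq by (simp add: power_add)
next
  case (If b c1 c2)
  let ?a = "(M + 3) ^ prog_height c1" and ?b = "(M + 3) ^ prog_height c2"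
  have pos: "1 \<le> ?a" "1 \<le> ?b" by auto
  have "1 + ?a + ?b \<le> 3 * (?a * ?b)" using pos mult_le_mono[OF pos] mult_le_mono[OF pos(1) order_refl[of ?b]] mult_le_mono[OF order_refl[of ?a] pos(2)] by linarith
  also have "\<dots> \<le> (M + 3) * (?a * ?b)" by (rule mult_right_mono) auto
  finally show ?case using If by (simp add: power_add)
next
  case (While b c)
  let ?a = "(M + 3) ^ prog_height c"
  have pos: "1 \<le> ?a" by simp
  have "Suc (time_bound M c) \<le> 2 * ?a" using While pos by linarith
  then have "M * Suc (time_bound M c) + 1 \<le> M * (2 * ?a) + ?a"
    using pos by (intro add_mono mult_left_mono) auto
  also have "\<dots> = (2 * M + 1) * ?a" by (simp add: algebra_simps)
  also have "\<dots> \<le> ((M + 3) * (M + 3)) * ?a" by (intro mult_right_mono) (auto simp: algebra_simps)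
  finally show ?case by (simp add: mult.assoc)
qed auto

section \<open>Read positions\<close>

lemma count_list_take_Suc:
  "l < length zs \<Longrightarrow> count_list (take (Suc l) zs) v = count_list (take l zs) v + (if zs ! l = v then 1 else 0)"
  by (simp add: take_Suc_conv_app_nth)

lemma count_list_take_mono: "l \<le> l' \<Longrightarrow> count_list (take l zs) v \<le> count_list (take l' zs) v"
proof -
  assume "l \<le> l'"
  then obtain d where d: "l' = l + d" using le_Suc_ex by blast
  show ?thesis unfolding d by (simp add: take_add)
qed

lemma count_list_take_le: "count_list (take l zs) v \<le> count_list zs v"
  using count_list_take_mono[of l "max l (length zs)" zs v] by simp

definition first_rank :: "nat list \<Rightarrow> nat \<Rightarrow> nat" where
  "first_rank zs v = card (set (takeWhile (\<lambda>u. u \<noteq> v) zs))"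

definition occurrence :: "nat list \<Rightarrow> nat \<Rightarrow> nat" where
  "occurrence zs l = count_list (take l zs) (zs ! l)"

lemma takeWhile_total:
  "u \<in> set zs \<Longrightarrow> v \<in> set zs \<Longrightarrow> u \<noteq> v \<Longrightarrow>
    u \<in> set (takeWhile (\<lambda>x. x \<noteq> v) zs) \<or> v \<in> set (takeWhile (\<lambda>x. x \<noteq> u) zs)"
  by (induction zs) auto

lemma takeWhile_subset:
  "u \<in> set (takeWhile (\<lambda>x. x \<noteq> v) zs) \<Longrightarrow>
    set (takeWhile (\<lambda>x. x \<noteq> u) zs) \<subseteq> set (takeWhile (\<lambda>x. x \<noteq> v) zs)"
  by (induction zs) (auto split: if_splits)

lemma first_rank_less:
  assumes "u \<in> set (takeWhile (\<lambda>x. x \<noteq> v) zs)" shows "first_rank zs u < first_rank zs v"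
proof -
  have "u \<notin> set (takeWhile (\<lambda>x. x \<noteq> u) zs)" using set_takeWhileD by fastforce
  then have "set (takeWhile (\<lambda>x. x \<noteq> u) zs) \<subset> set (takeWhile (\<lambda>x. x \<noteq> v) zs)"
    using takeWhile_subset[OF assms] assms by blast
  then show ?thesis unfolding first_rank_def by (intro psubset_card_mono) auto
qed

lemma first_rank_inj: "inj_on (first_rank zs) (set zs)"
proof (rule inj_onI, rule ccontr)
  fix u v assume "u \<in> set zs" "v \<in> set zs" "first_rank zs u = first_rank zs v" "u \<noteq> v"
  then show False using takeWhile_total[of u zs v] first_rank_less[of u v zs] first_rank_less[of v u zs] by auto
qed

lemma first_rank_bound: "v \<in> set zs \<Longrightarrow> first_rank zs v < card (set zs)"
proof -
  assume v: "v \<in> set zs"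
  have "v \<notin> set (takeWhile (\<lambda>x. x \<noteq> v) zs)" using set_takeWhileD by fastforce
  moreover have "set (takeWhile (\<lambda>x. x \<noteq> v) zs) \<subseteq> set zs" by (auto dest: set_takeWhileD)
  ultimately have "set (takeWhile (\<lambda>x. x \<noteq> v) zs) \<subset> set zs" using v by blast
  then show ?thesis unfolding first_rank_def by (intro psubset_card_mono) auto
qed

lemma first_rank_first:
  assumes "l < length zs" "occurrence zs l = 0"
  shows "first_rank zs (zs ! l) = card (set (take l zs))"
proof -
  have notin: "zs ! l \<notin> set (take l zs)" using assms(2) by (simp add: occurrence_def count_list_0_iff)
  have "takeWhile (\<lambda>u. u \<noteq> zs ! l) zs = take l zs"
  proof (rule takeWhile_eq_take_P_nth)
    fix i assume "i < l" "i < length zs"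
    then have "zs ! i \<in> set (take l zs)" by (auto simp: in_set_conv_nth intro!: exI[of _ i])
    with notin show "zs ! i \<noteq> zs ! l" by auto
  qed simp
  then show ?thesis by (simp add: first_rank_def)
qed

lemma occurrence_less: "l < l' \<Longrightarrow> l' < length zs \<Longrightarrow> zs ! l = zs ! l' \<Longrightarrow> occurrence zs l < occurrence zs l'"
  using count_list_take_Suc[of l zs "zs ! l"] count_list_take_mono[of "Suc l" l' zs "zs ! l"]
  by (simp add: occurrence_def)

text \<open>The order of reading after padding. With exactly \<open>k\<close> reads of every
  variable, the pairs of read number and rank correspond one to one to positions, so every
  \<open>p j i\<close> is meaningful. Positions behind the true order have no layer and do not
  affect the program.\<close>

locale uniform_sequence =
  fixes zs :: "nat list" and n k :: nat
  assumes zs: "set zs \<subseteq> {..<n}" and cnt: "\<And>v. v < n \<Longrightarrow> count_list zs v = k" and k: "k \<ge> 1"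
begin

lemma set_zs: "set zs = {..<n}"
proof -
  have "v \<in> set zs" if "v < n" for v using cnt[OF that] k count_list_0_iff[of zs v] by force
  then show ?thesis using zs by auto
qed

lemma length_zs: "length zs = n * k"
  using sum_count_set[OF zs] cnt by simp

lemma rank_less: "v < n \<Longrightarrow> first_rank zs v < n"
  using first_rank_bound[of v zs] set_zs by simp

lemma rank_inj: "inj_on (first_rank zs) {..<n}"
  using first_rank_inj[of zs] set_zs by simp

lemma nth_less: "l < length zs \<Longrightarrow> zs ! l < n"
  using zs nth_mem by blast

lemma occurrence_less_k:
  assumes "l < length zs" shows "occurrence zs l < k"
proof -
  have "occurrence zs l < count_list (take (Suc l) zs) (zs ! l)"
    using count_list_take_Suc[OF assms, of "zs ! l"] by (simp add: occurrence_def)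
  also have "\<dots> \<le> k" using count_list_take_le[of "Suc l" zs "zs ! l"] cnt[OF nth_less[OF assms]] by simp
  finally show ?thesis .
qed

lemma position_inj:
  assumes "l < length zs" "l' < length zs" "occurrence zs l = occurrence zs l'"
    "first_rank zs (zs ! l) = first_rank zs (zs ! l')"
  shows "l = l'"
proof -
  have "zs ! l = zs ! l'" using rank_inj assms nth_less by (auto simp: inj_on_def)
  then show ?thesis using occurrence_less[of l l' zs] occurrence_less[of l' l zs] assms
    by (metis less_irrefl linorder_neqE_nat)
qed

text \<open>An injection between sets with \<open>n * k\<close> elements each.\<close>

lemma position_surj:
  assumes "j < k" "i < n"
  shows "\<exists>l<length zs. occurrence zs l = j \<and> first_rank zs (zs ! l) = i"
proof -
  let ?f = "\<lambda>l. (occurrence zs l, first_rank zs (zs ! l))"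
  have inj: "inj_on ?f {..<length zs}" using position_inj by (auto simp: inj_on_def)
  have "?f ` {..<length zs} \<subseteq> {..<k} \<times> {..<n}"
    using occurrence_less_k rank_less nth_less by auto
  moreover have "card (?f ` {..<length zs}) = card ({..<k} \<times> {..<n})"
    unfolding card_image[OF inj] by (simp add: length_zs card_cartesian_product mult.commute)
  ultimately have "?f ` {..<length zs} = {..<k} \<times> {..<n}" by (intro card_subset_eq) auto
  then have "(j, i) \<in> ?f ` {..<length zs}" using assms by blast
  then show ?thesis by auto
qed

end

text \<open>\<open>p j i\<close> is the time of the j-th read of the variable of rank i.\<close>

locale read_positions = uniform_sequence +
  fixes p :: "nat \<Rightarrow> nat \<Rightarrow> nat"
  assumes p: "\<And>l. l < length zs \<Longrightarrow> p (occurrence zs l) (first_rank zs (zs ! l)) = l"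
begin

lemma p_spec:
  assumes "j < k" "i < n"
  shows "p j i < length zs" "occurrence zs (p j i) = j" "first_rank zs (zs ! p j i) = i"
  using position_surj[OF assms] p by auto

lemma p_inj: "j < k \<Longrightarrow> j' < k \<Longrightarrow> i < n \<Longrightarrow> i' < n \<Longrightarrow> p j i = p j' i' \<Longrightarrow> j = j' \<and> i = i'"
  using p_spec by metis

lemma p_less:
  assumes "a < b" "b < k" "i < n"
  shows "p a i < p b i"
proof -
  have a: "p a i < length zs" "occurrence zs (p a i) = a" "first_rank zs (zs ! p a i) = i"
    using p_spec assms by auto
  have b: "p b i < length zs" "occurrence zs (p b i) = b" "first_rank zs (zs ! p b i) = i"
    using p_spec assms by auto
  have "zs ! p a i = zs ! p b i" using rank_inj a b nth_less by (auto simp: inj_on_def)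
  then have "p b i < p a i \<Longrightarrow> b < a" using occurrence_less[of "p b i" "p a i" zs] a b by simp
  moreover have "p a i \<noteq> p b i" using a b assms by auto
  ultimately show ?thesis using assms(1) by linarith
qed

lemma p_0_less:
  assumes "i < i'" "i' < n"
  shows "p 0 i < p 0 i'"
proof (rule ccontr)
  assume neg: "\<not> p 0 i < p 0 i'"
  have i: "p 0 i < length zs" "occurrence zs (p 0 i) = 0" "first_rank zs (zs ! p 0 i) = i"
    using p_spec[of 0 i] assms k by auto
  have i': "p 0 i' < length zs" "occurrence zs (p 0 i') = 0" "first_rank zs (zs ! p 0 i') = i'"
    using p_spec[of 0 i'] assms k by auto
  have "card (set (take (p 0 i') zs)) \<le> card (set (take (p 0 i) zs))"
    using neg by (intro card_mono set_take_subset_set_take) auto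
  then show False using first_rank_first[OF i(1,2)] first_rank_first[OF i'(1,2)] i(3) i'(3) assms by simp
qed

end

lemma agreeD2:
  assumes "agree X Y s s'"
  shows "\<And>x. x \<notin> X \<Longrightarrow> nmem s' x = nmem s x" "\<And>y. y \<notin> Y \<Longrightarrow> fmem s' y = fmem s y"
  using assms by (auto simp: agree_def)

text \<open>
  The scalar x is the entry 0 of the array x. The scalars are 5: n, 6: L, 7: the base B, 8: the number k
  of reads, 30: \<open>2 ^ (k - 1)\<close>, 32: the last class, 43: the number of levels, 45: G, 46: N, 47: the number
  of digits q of a seed, 48: the number of all its digits, 49: the number of seeds, 59: the seed.
  The arrays are 20: the reads, 23: the rank of a variable, 26: the time of the j-th read of the rank i
  at \<open>j * n + i\<close>, 27: the class of a rank, 28: heights, 50: the digits of the seed, 64: exponents,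
  70 to 74: layer, source, target, code and first coefficient of an edge.
\<close>

definition Count :: prog where
  "Count = 8 ::= NConst 1 ;; For 11 (V 6) (38 ::= NGet 20 (V 11) ;;
     NSet 21 (V 38) (NAdd (NGet 21 (V 38)) (NConst 1)) ;;
     If (NLess (V 8) (NGet 21 (V 38))) (8 ::= NGet 21 (V 38)) Skip)"

lemma writes_Count [simp]: "nwrites Count = {8, 11, 38, 21}" "fwrites Count = {}"
  by (auto simp: Count_def)

lemma wp_Count:
  assumes L: "nmem s 6 0 = length xs" "length xs \<le> M" and ys: "\<And>l. l < length xs \<Longrightarrow> nmem s 20 l = xs ! l"
    and c0: "nmem s 21 = (\<lambda>_. 0)" and kk: "1 \<le> kk" "\<And>v. count_list xs v \<le> kk"
  shows "wp M Count (\<lambda>s'. nmem s' 21 = count_list xs \<and> 1 \<le> nmem s' 8 0 \<and> nmem s' 8 0 \<le> kk \<and>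
    (\<forall>v. count_list xs v \<le> nmem s' 8 0)) s"
  unfolding Count_def wp.simps nval.simps
proof (rule wp_For[where n = "length xs" and I = "\<lambda>j s'. nmem s' 21 = count_list (take j xs) \<and> 1 \<le> nmem s' 8 0 \<and>
    nmem s' 8 0 \<le> kk \<and> (\<forall>v. count_list (take j xs) v \<le> nmem s' 8 0)"], goal_cases)
  case (6 j s')
  have y: "nmem s' 20 j = xs ! j" using agreeD2(1)[OF 6(2)] ys 6(1) by simp
  have c: "count_list (take (Suc j) xs) = (count_list (take j xs))(xs ! j := Suc (count_list (take j xs) (xs ! j)))"
    using 6(1) by (auto simp: fun_eq_iff count_list_take_Suc)
  have "Suc (count_list (take j xs) (xs ! j)) \<le> kk"
    using count_list_take_le[of "Suc j" xs "xs ! j"] kk(2)[of "xs ! j"] by (simp add: c)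
  moreover have "count_list (take j xs) v \<le> Suc (count_list (take j xs) (xs ! j))"
    if "nmem s' 8 0 < Suc (count_list (take j xs) (xs ! j))" for v
  proof -
    have "count_list (take j xs) v \<le> nmem s' 8 0" using 6 by blast
    with that show ?thesis by linarith
  qed
  ultimately show ?case using 6 by (auto simp: y c)
qed (use assms in auto)

text \<open>The missing reads are appended at the end, so that the layers of the program keep their
  positions.\<close>

definition Pad :: prog where
  "Pad = 9 ::= V 6 ;; For 11 (V 5) (For 12 (V 8) (If (NLess (NGet 21 (V 11)) (V 8))
     (NSet 20 (V 9) (V 11) ;; 9 ::= NAdd (V 9) (NConst 1) ;; NSet 21 (V 11) (NAdd (NGet 21 (V 11)) (NConst 1)))
     Skip))"

lemma writes_Pad [simp]: "nwrites Pad = {9, 11, 12, 20, 21}" "fwrites Pad = {}"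
  by (auto simp: Pad_def)

lemma wp_Pad:
  fixes s :: "'a::field mem"
  assumes L: "nmem s 6 0 = length xs" and ys: "\<And>l. l < length xs \<Longrightarrow> nmem s 20 l = xs ! l"
    and c0: "nmem s 21 = count_list xs" and n: "nmem s 5 0 = n" "n \<le> M" and k: "nmem s 8 0 = k" "k \<le> M"
    and cnt: "\<And>v. count_list xs v \<le> k" and xs: "set xs \<subseteq> {..<n}"
  shows "wp M Pad (\<lambda>s'. \<exists>zs. nmem s' 9 0 = length zs \<and> (\<forall>l<length zs. nmem s' 20 l = zs ! l) \<and>
    take (length xs) zs = xs \<and> set zs \<subseteq> {..<n} \<and> (\<forall>v<n. count_list zs v = k)) s"
proof -
  define J where "J = (\<lambda>(s' :: 'a mem) zs. nmem s' 9 0 = length zs \<and> (\<forall>l<length zs. nmem s' 20 l = zs ! l) \<and>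
    take (length xs) zs = xs \<and> set zs \<subseteq> {..<n} \<and> nmem s' 21 = count_list zs \<and> (\<forall>v. count_list zs v \<le> k))"
  have J_upn [simp]: "J (upn s' x i v) zs = J s' zs" if "x \<notin> {9, 20, 21}" for s' :: "'a mem" and x i v zs
    using that by (simp add: J_def)
  show ?thesis
    unfolding Pad_def wp.simps nval.simps
  proof (rule wp_For[where n = n and I = "\<lambda>v s'. \<exists>zs. J s' zs \<and> (\<forall>u<v. count_list zs u = k)"], goal_cases)
    case 5
    show ?case using assms by (intro exI[of _ xs]) (simp add: J_def)
  next
    case (6 v s')
    have ks: "nmem s' 8 0 = k" using agreeD2(1)[OF 6(2)] k by simp
    from 6 obtain zs0 where zs0: "J s' zs0" "\<forall>u<v. count_list zs0 u = k" by blast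
    show ?case
    proof (rule wp_For[where n = k and I = "\<lambda>j s'. \<exists>zs. J s' zs \<and> (\<forall>u<v. count_list zs u = k) \<and>
        (count_list zs v = k \<or> j \<le> count_list zs v)"], goal_cases)
      case 5
      show ?case using zs0 by (intro exI[of _ zs0]) simp
    next
      case (6 j s'')
      from 6 obtain zs where zs: "J s'' zs" "\<forall>u<v. count_list zs u = k" "count_list zs v = k \<or> j \<le> count_list zs v"
        by blast
      have vs: "nmem s'' 11 0 = v" "nmem s'' 8 0 = k" using agreeD2(1)[OF 6(2)] ks \<open>nmem s' 11 0 = v\<close> by simp_all
      show ?case
      proof (cases "count_list zs v < k")
        case False
        moreover have "count_list zs v \<le> k" using zs(1) by (simp add: J_def)
        ultimately have "count_list zs v = k" by simp
        with zs vs show ?thesis by (auto simp: J_def)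
      next
        case True
        let ?s = "upn (upn (upn s'' 20 (length zs) v) 9 0 (Suc (length zs))) 21 v (Suc (count_list zs v))"
        have "take (length xs) zs = xs" using zs(1) by (simp add: J_def)
        then have "length xs \<le> length zs" by (metis length_take min.cobounded1)
        then have "J ?s (zs @ [v])"
          using zs(1) \<open>v < n\<close> True by (auto simp: J_def nth_append fun_eq_iff)
        moreover have "\<forall>u<v. count_list (zs @ [v]) u = k" using zs(2) by auto
        moreover have "Suc j \<le> count_list (zs @ [v]) v" using zs(3) True by auto
        ultimately have "\<exists>zs'. J ?s zs' \<and> (\<forall>u<v. count_list zs' u = k) \<and>
          (count_list zs' v = k \<or> Suc j \<le> count_list zs' v)" by blast
        moreover have "nmem s'' 9 0 = length zs" "nmem s'' 21 = count_list zs" using zs(1) by (simp_all add: J_def)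
        ultimately show ?thesis using True vs by simp
      qed
    next
      case (7 s'')
      then obtain zs where zs: "J s'' zs" "\<forall>u<v. count_list zs u = k" "count_list zs v = k \<or> k \<le> count_list zs v" by blast
      then have "count_list zs v = k" by (auto simp: J_def intro: antisym)
      then have "\<forall>u<Suc v. count_list zs u = k" using zs(2) by (simp add: less_Suc_eq)
      then show ?case using zs(1) by (intro exI[of _ zs]) simp
    qed (use ks k in auto)
  next
    case (7 s')
    then show ?case by (auto simp: J_def)
  qed (use assms in auto)
qed

definition Scan :: prog where
  "Scan = 10 ::= NConst 0 ;; For 11 (V 9) (38 ::= NGet 20 (V 11) ;; 39 ::= NGet 22 (V 38) ;;
     If (NEq (V 39) (NConst 0)) (NSet 23 (V 38) (V 10) ;; 10 ::= NAdd (V 10) (NConst 1)) Skip ;;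
     NSet 24 (V 11) (NGet 23 (V 38)) ;; NSet 25 (V 11) (V 39) ;; Mul 40 (V 39) (V 5) ;;
     NSet 26 (NAdd (V 40) (NGet 23 (V 38))) (V 11) ;; NSet 22 (V 38) (NAdd (V 39) (NConst 1)))"

lemma writes_Scan [simp]: "nwrites Scan = {2, 3, 10, 11, 38, 39, 40, 22, 23, 24, 25, 26}" "fwrites Scan = {}"
  by (auto simp: Scan_def)

lemma pair_index_inj:
  fixes n :: nat
  assumes "a * n + b = c * n + d" "b < n" "d < n"
  shows "a = c \<and> b = d"
proof -
  have "(a * n + b) div n = a" "(c * n + d) div n = c" using assms(2,3) by simp_all
  then have "a = c" using assms(1) by metis
  then show ?thesis using assms(1) by simp
qed

lemma (in uniform_sequence) wp_Scan:
  assumes len: "nmem s 9 0 = length zs" "length zs \<le> M" and ys: "\<And>l. l < length zs \<Longrightarrow> nmem s 20 l = zs ! l"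
    and n: "nmem s 5 0 = n" and kM: "k \<le> M" and c0: "nmem s 22 = (\<lambda>_. 0)"
  shows "wp M Scan (\<lambda>s'. (\<forall>v<n. nmem s' 23 v = first_rank zs v) \<and>
    (\<forall>l<length zs. nmem s' 24 l = first_rank zs (zs ! l) \<and> nmem s' 25 l = occurrence zs l) \<and>
    read_positions zs n k (\<lambda>j i. nmem s' 26 (j * n + i))) s"
  unfolding Scan_def wp.simps nval.simps
proof (rule wp_For[where n = "length zs" and I = "\<lambda>l s'. nmem s' 22 = count_list (take l zs) \<and>
    nmem s' 10 0 = card (set (take l zs)) \<and> (\<forall>v\<in>set (take l zs). nmem s' 23 v = first_rank zs v) \<and>
    (\<forall>l'<l. nmem s' 24 l' = first_rank zs (zs ! l') \<and> nmem s' 25 l' = occurrence zs l' \<and>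
       nmem s' 26 (occurrence zs l' * n + first_rank zs (zs ! l')) = l')"], goal_cases)
  case (6 l s')
  let ?v = "zs ! l" and ?j = "occurrence zs l" and ?r = "first_rank zs (zs ! l)"
  have y: "nmem s' 20 l = ?v" "nmem s' 5 0 = n" using agreeD2(1)[OF 6(2)] ys 6(1) n by simp_all
  have c: "count_list (take (Suc l) zs) = (count_list (take l zs))(?v := Suc (count_list (take l zs) ?v))"
    using 6(1) by (auto simp: fun_eq_iff count_list_take_Suc)
  have j: "nmem s' 22 ?v = ?j" "count_list (take l zs) ?v = ?j" using 6 by (auto simp: occurrence_def)
  have set: "set (take (Suc l) zs) = insert ?v (set (take l zs))" using 6(1) by (simp add: take_Suc_conv_app_nth)
  have jM: "?j \<le> M" using occurrence_less_k[OF 6(1)] kM by simp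
  have in_iff: "?j = 0 \<longleftrightarrow> ?v \<notin> set (take l zs)" by (simp add: occurrence_def count_list_0_iff)
  \<comment> \<open>The cell written for \<open>l\<close> in array 26 belongs to no earlier
    position, since both the pair of read number and rank and its encoding are injective.\<close>
  have ne: "occurrence zs l' * n + first_rank zs (zs ! l') \<noteq> ?j * n + ?r" if "l' < l" for l'
  proof
    assume "occurrence zs l' * n + first_rank zs (zs ! l') = ?j * n + ?r"
    moreover have l': "l' < length zs" using that 6(1) by simp
    ultimately have "occurrence zs l' = ?j \<and> first_rank zs (zs ! l') = ?r"
      by (rule pair_index_inj[OF _ rank_less[OF nth_less] rank_less[OF nth_less[OF 6(1)]]])
    with position_inj[OF l' 6(1)] that show False by simp
  qed
  show ?case
  proof (cases "?j = 0")
    case True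
    then have r: "?r = nmem s' 10 0" using first_rank_first[OF 6(1)] 6 by simp
    have notin: "?v \<notin> set (take l zs)" using in_iff True by simp
    have "card (set (take (Suc l) zs)) = Suc (nmem s' 10 0)" using notin 6 by (simp add: set)
    then show ?thesis using 6(3,4) True jM ne notin
      by (auto simp: y j c wp_Mul_eval set r[symmetric] less_Suc_eq)
  next
    case False
    then have vin: "?v \<in> set (take l zs)" using in_iff by simp
    then have r: "nmem s' 23 ?v = ?r" using 6 by blast
    have "card (set (take (Suc l) zs)) = nmem s' 10 0" using vin 6 by (simp add: set insert_absorb)
    then show ?thesis using 6(3,4) False jM ne vin
      by (auto simp: y j c wp_Mul_eval set r less_Suc_eq insert_absorb)
  qed
next
  case (7 s')
  have "read_positions zs n k (\<lambda>j i. nmem s' 26 (j * n + i))"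
    by unfold_locales (use 7 in auto)
  then show ?case using 7 set_zs by auto
qed (use assms in auto)

section \<open>Partition into monotone chains\<close>

text \<open>
  The first reads are in the order of the ranks; a bit tells if the order of two later reads is reversed.
\<close>

fun colour :: "(nat \<Rightarrow> nat \<Rightarrow> nat) \<Rightarrow> nat \<Rightarrow> nat \<Rightarrow> nat \<Rightarrow> nat" where
  "colour p 0 a b = 0"
| "colour p (Suc j) a b = 2 * colour p j a b + (if p (Suc j) b < p (Suc j) a then 1 else 0)"

lemma colour_less: "colour p j a b < 2 ^ j"
  by (induction j) auto

lemma colour_eqD:
  "colour p J a b = colour p J c d \<Longrightarrow> 1 \<le> j \<Longrightarrow> j \<le> J \<Longrightarrow> (p j b < p j a) = (p j d < p j c)"
proof (induction J)
  case (Suc J)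
  have "colour p J a b = colour p J c d \<and> (p (Suc J) b < p (Suc J) a) = (p (Suc J) d < p (Suc J) c)"
    using Suc.prems(1) by (auto split: if_splits) presburger+
  with Suc show ?case by (cases "j = Suc J") auto
qed simp

text \<open>Each bit separately is transitive: 1 means strictly decreasing and 0 means not
  decreasing. Hence a chain can be built by comparing neighbours only.\<close>

lemma colour_trans: "colour p J a b = \<sigma> \<Longrightarrow> colour p J b c = \<sigma> \<Longrightarrow> colour p J a c = \<sigma>"
proof (induction J arbitrary: \<sigma>)
  case (Suc J)
  have eq: "colour p J a b = colour p J b c \<and> (p (Suc J) b < p (Suc J) a) = (p (Suc J) c < p (Suc J) b)"
    using Suc.prems by (auto split: if_splits) presburger+
  then have "colour p J a c = colour p J a b" using Suc.IH by metis
  with eq Suc.prems show ?case by (auto split: if_splits)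
qed simp

definition Colour :: "nexp \<Rightarrow> nexp \<Rightarrow> prog" where
  "Colour e1 e2 = 35 ::= NConst 0 ;; 36 ::= NConst 0 ;; For 16 (NSub (V 8) (NConst 1))
     (36 ::= NAdd (V 36) (V 5) ;; 35 ::= NAdd (V 35) (V 35) ;;
      If (NLess (NGet 26 (NAdd (V 36) e2)) (NGet 26 (NAdd (V 36) e1))) (35 ::= NAdd (V 35) (NConst 1)) Skip)"

lemma writes_Colour [simp]: "nwrites (Colour e1 e2) = {16, 35, 36}" "fwrites (Colour e1 e2) = {}"
  by (auto simp: Colour_def)

lemma wp_Colour:
  fixes s :: "'a::field mem"
  assumes e: "nval s e1 = a" "nval s e2 = b" "nreads e1 \<inter> {16, 35, 36} = {}" "nreads e2 \<inter> {16, 35, 36} = {}"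
    and n: "nmem s 5 0 = n" and k: "nmem s 8 0 = k" "k \<le> M"
  shows "wp M (Colour e1 e2) Q s = Q (upn (upn (upn s 35 0 (colour (\<lambda>j i. nmem s 26 (j * n + i)) (k - 1) a b))
    36 0 ((k - 1) * n)) 16 0 (k - 1))"
proof (rule wp_exact)
  let ?p = "\<lambda>j i. nmem s 26 (j * n + i)"
  let ?st = "\<lambda>j. upn (upn (upn s 35 0 (colour ?p j a b)) 36 0 (j * n)) 16 0 j"
  show "wp M (Colour e1 e2) (\<lambda>s'. s' = ?st (k - 1)) s"
    unfolding Colour_def wp.simps nval.simps
  proof (rule wp_For[where n = "k - 1" and I = "\<lambda>j s'. s' = ?st j"], goal_cases)
    case (6 j s')
    have e': "nval (upn (upn (upn s 35 0 y) 36 0 x) 16 0 z) e1 = a" "nval (upn (upn (upn s 35 0 y) 36 0 x) 16 0 z) e2 = b" for x y z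
    proof -
      have ag: "agree {16, 35, 36} {} s (upn (upn (upn s 35 0 y) 36 0 x) 16 0 z)" by (simp add: agree_def)
      show "nval (upn (upn (upn s 35 0 y) 36 0 x) 16 0 z) e1 = a" unfolding nval_agree[OF ag e(3)] by (rule e(1))
      show "nval (upn (upn (upn s 35 0 y) 36 0 x) 16 0 z) e2 = b" unfolding nval_agree[OF ag e(4)] by (rule e(2))
    qed
    show ?case using n unfolding 6(4)
      by (simp add: e' upn_commute[of 36 35] upn_commute[of 16 35] upn_commute[of 16 36] add.commute mult_2)
  qed (use assms in \<open>auto simp: upn_commute[of 16 35] upn_commute[of 16 36]\<close>)
qed

text \<open>
  \<open>h i\<close> is the length of the longest chain of colour \<open>\<sigma>\<close> in U that ends in i.
\<close>

definition heights :: "nat \<Rightarrow> nat set \<Rightarrow> (nat \<Rightarrow> nat \<Rightarrow> nat) \<Rightarrow> nat \<Rightarrow> (nat \<Rightarrow> nat) \<Rightarrow> nat \<Rightarrow> bool" where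
  "heights n U col \<sigma> h mx \<longleftrightarrow> (\<forall>i<n. i \<notin> U \<longrightarrow> h i = 0) \<and>
    (\<forall>i\<in>U. 1 \<le> h i \<and> h i \<le> mx \<and> (\<forall>i'\<in>U. i' < i \<and> col i' i = \<sigma> \<longrightarrow> h i' < h i) \<and>
      (h i \<ge> 2 \<longrightarrow> (\<exists>i'\<in>U. i' < i \<and> col i' i = \<sigma> \<and> Suc (h i') = h i))) \<and>
    (mx = 0 \<or> (\<exists>i\<in>U. h i = mx))"

definition Heights :: prog where
  "Heights = 31 ::= NConst 0 ;; For 13 (V 5) (NSet 28 (V 13) (NConst 0) ;;
     If (NEq (NGet 27 (V 13)) (NConst 0)) (NSet 28 (V 13) (NConst 1) ;;
       For 14 (V 13) (If (NEq (NGet 27 (V 14)) (NConst 0)) (Colour (V 14) (V 13) ;;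
         If (TAnd (NEq (V 35) (V 12)) (TNot (NLess (NGet 28 (V 14)) (NGet 28 (V 13)))))
           (NSet 28 (V 13) (NAdd (NGet 28 (V 14)) (NConst 1))) Skip) Skip)) Skip ;;
     If (NLess (V 31) (NGet 28 (V 13))) (31 ::= NGet 28 (V 13)) Skip)"

lemma writes_Heights [simp]: "nwrites Heights = {13, 14, 16, 28, 31, 35, 36}" "fwrites Heights = {}"
  by (auto simp: Heights_def)

lemma heights_Suc_out:
  assumes "heights j (U \<inter> {..<j}) col \<sigma> h mx" "j \<notin> U"
  shows "heights (Suc j) (U \<inter> {..<Suc j}) col \<sigma> (h(j := 0)) mx"
proof -
  have "U \<inter> {..<Suc j} = U \<inter> {..<j}" using assms(2) by (auto simp: less_Suc_eq)
  with assms show ?thesis unfolding heights_def by (auto simp: less_Suc_eq)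
qed

lemma heights_Suc_in:
  assumes h: "heights j (U \<inter> {..<j}) col \<sigma> h mx" and j: "j \<in> U" and x: "1 \<le> x"
    and lt: "\<And>i. i \<in> U \<Longrightarrow> i < j \<Longrightarrow> col i j = \<sigma> \<Longrightarrow> h i < x"
    and ex: "x \<ge> 2 \<Longrightarrow> \<exists>i\<in>U. i < j \<and> col i j = \<sigma> \<and> Suc (h i) = x"
  shows "heights (Suc j) (U \<inter> {..<Suc j}) col \<sigma> (h(j := x)) (max mx x)"
proof -
  have U: "U \<inter> {..<Suc j} = insert j (U \<inter> {..<j})" using j by (auto simp: less_Suc_eq)
  let ?h = "h(j := x)"
  have h1: "\<And>i. i < j \<Longrightarrow> i \<notin> U \<Longrightarrow> h i = 0" and
    h2: "\<And>i. i \<in> U \<Longrightarrow> i < j \<Longrightarrow> 1 \<le> h i \<and> h i \<le> mx \<and> (\<forall>i'\<in>U \<inter> {..<j}. i' < i \<and> col i' i = \<sigma> \<longrightarrow> h i' < h i) \<and>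
      (h i \<ge> 2 \<longrightarrow> (\<exists>i'\<in>U \<inter> {..<j}. i' < i \<and> col i' i = \<sigma> \<and> Suc (h i') = h i))"
    and h3: "mx = 0 \<or> (\<exists>i\<in>U \<inter> {..<j}. h i = mx)"
    using h unfolding heights_def by auto
  show ?thesis unfolding heights_def
  proof (intro conjI allI impI ballI)
    fix i assume "i < Suc j" "i \<notin> U \<inter> {..<Suc j}"
    then show "?h i = 0" using h1 j by (auto simp: less_Suc_eq)
  next
    fix i assume i: "i \<in> U \<inter> {..<Suc j}"
    show "1 \<le> ?h i" "?h i \<le> max mx x" using i h2[of i] x by (auto simp: less_Suc_eq intro: max.coboundedI1)
    fix i' assume i': "i' \<in> U \<inter> {..<Suc j}" "i' < i \<and> col i' i = \<sigma>"
    show "?h i' < ?h i"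
    proof (cases "i = j")
      case True
      then show ?thesis using lt[of i'] i' by auto
    next
      case False
      then have "i < j" using i by auto
      then have "h i' < h i" using h2[of i] i i' by auto
      then show ?thesis using False i' \<open>i < j\<close> by auto
    qed
  next
    fix i assume i: "i \<in> U \<inter> {..<Suc j}" "2 \<le> ?h i"
    show "\<exists>i'\<in>U \<inter> {..<Suc j}. i' < i \<and> col i' i = \<sigma> \<and> Suc (?h i') = ?h i"
    proof (cases "i = j")
      case True
      with ex i obtain i' where i': "i' \<in> U" "i' < j" "col i' j = \<sigma>" "Suc (h i') = x" by auto
      then show ?thesis using True by (intro bexI[of _ i']) auto
    next
      case False
      then have ij: "i < j" using i by auto
      then obtain i' where "i' \<in> U \<inter> {..<j}" "i' < i \<and> col i' i = \<sigma> \<and> Suc (h i') = h i"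
        using h2[of i] i False by auto
      then show ?thesis using ij by (intro bexI[of _ i']) auto
    qed
  next
    show "max mx x = 0 \<or> (\<exists>i\<in>U \<inter> {..<Suc j}. ?h i = max mx x)"
    proof (cases "mx \<le> x")
      case True
      then show ?thesis using j by (intro disjI2 bexI[of _ j]) (auto simp: max_def)
    next
      case False
      then obtain i where "i \<in> U \<inter> {..<j}" "h i = mx" using h3 by auto
      then show ?thesis using False by (intro disjI2 bexI[of _ i]) (auto simp: max_def)
    qed
  qed
qed

lemma wp_Heights:
  fixes s :: "'a::field mem"
  assumes n: "nmem s 5 0 = n" "n \<le> M" and k: "nmem s 8 0 = k" "k \<le> M" and \<sigma>: "nmem s 12 0 = \<sigma>"
    and col: "col = colour (\<lambda>j i. nmem s 26 (j * n + i)) (k - 1)" and U: "U = {i. i < n \<and> nmem s 27 i = 0}"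
  shows "wp M Heights (\<lambda>s'. heights n U col \<sigma> (nmem s' 28) (nmem s' 31 0)) s"
proof -
  have col': "colour (\<lambda>j i. nmem s 26 (j * n + i)) (k - Suc 0) = col" by (simp add: col)
  show ?thesis
  unfolding Heights_def wp.simps nval.simps
proof (rule wp_For[where n = n and I = "\<lambda>j s'. heights j (U \<inter> {..<j}) col \<sigma> (nmem s' 28) (nmem s' 31 0)"], goal_cases)
  case 5
  show ?case by (simp add: heights_def)
next
  case (6 i s1)
  note fr = agreeD2(1)[OF 6(2)]
  have s1: "nmem s1 5 0 = n" "nmem s1 8 0 = k" "nmem s1 12 0 = \<sigma>" "nmem s1 27 = nmem s 27" "nmem s1 26 = nmem s 26"
    using fr n k \<sigma> by simp_all
  note h = 6(4) and i = 6(3)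
  show ?case
  proof (cases "nmem s 27 i = 0")
    case False
    then have "i \<notin> U" by (simp add: U)
    from heights_Suc_out[OF h this] False show ?thesis by (simp add: s1 i)
  next
    case True
    then have iU: "i \<in> U" using 6(1) by (simp add: U)
    let ?Q = "\<lambda>s''. heights (Suc i) (U \<inter> {..<Suc i}) col \<sigma> (nmem s'' 28) (nmem s'' 31 0)"
    have "wp M (For 14 (V 13) (If (NEq (NGet 27 (V 14)) (NConst 0)) (Colour (V 14) (V 13) ;;
         If (TAnd (NEq (V 35) (V 12)) (TNot (NLess (NGet 28 (V 14)) (NGet 28 (V 13)))))
           (NSet 28 (V 13) (NAdd (NGet 28 (V 14)) (NConst 1))) Skip) Skip))
      (wp M (If (NLess (V 31) (NGet 28 (V 13))) (31 ::= NGet 28 (V 13)) Skip) ?Q)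
      (upn s1 28 i (Suc 0))"
    \<comment> \<open>\<open>x\<close> is one more than the largest height among the linked ranks
      seen so far, and 1 if there are none.\<close>
    proof (rule wp_For[where n = i and I = "\<lambda>j s'. \<exists>x. nmem s' 28 = (nmem s1 28)(i := x) \<and> 1 \<le> x \<and>
        (\<forall>i'\<in>U. i' < j \<and> col i' i = \<sigma> \<longrightarrow> nmem s1 28 i' < x) \<and>
        (x \<ge> 2 \<longrightarrow> (\<exists>i'\<in>U. i' < j \<and> col i' i = \<sigma> \<and> Suc (nmem s1 28 i') = x))"], goal_cases)
      case (6 j s2)
      note fr2 = agreeD2(1)[OF 6(2)]
      have s2: "nmem s2 5 0 = n" "nmem s2 8 0 = k" "nmem s2 12 0 = \<sigma>" "nmem s2 27 = nmem s 27"
        "nmem s2 26 = nmem s 26" "nmem s2 13 0 = i" "nmem s2 14 0 = j"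
        using fr2 s1 i 6(3) by simp_all
      from 6(4) obtain x where x: "nmem s2 28 = (nmem s1 28)(i := x)" "1 \<le> x"
        "\<And>i'. i' \<in> U \<Longrightarrow> i' < j \<Longrightarrow> col i' i = \<sigma> \<Longrightarrow> nmem s1 28 i' < x"
        "x \<ge> 2 \<Longrightarrow> \<exists>i'\<in>U. i' < j \<and> col i' i = \<sigma> \<and> Suc (nmem s1 28 i') = x" by blast
      have ji: "j < i" "j < n" using 6(1) \<open>i < n\<close> by auto
      have jU: "j \<in> U \<longleftrightarrow> nmem s 27 j = 0" using ji by (simp add: U)
      let ?y = "if j \<in> U \<and> col j i = \<sigma> \<and> x \<le> nmem s1 28 j then Suc (nmem s1 28 j) else x"
      have inv: "1 \<le> ?y \<and> (\<forall>i'\<in>U. i' < Suc j \<and> col i' i = \<sigma> \<longrightarrow> nmem s1 28 i' < ?y) \<and>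
        (?y \<ge> 2 \<longrightarrow> (\<exists>i'\<in>U. i' < Suc j \<and> col i' i = \<sigma> \<and> Suc (nmem s1 28 i') = ?y))"
      proof (intro conjI ballI impI)
        show "1 \<le> ?y" using x(2) by simp
      next
        fix i' assume "i' \<in> U" "i' < Suc j \<and> col i' i = \<sigma>"
        then show "nmem s1 28 i' < ?y" using x(3)[of i'] by (cases "i' = j") (auto intro: less_le_trans less_Suc_eq_le[THEN iffD2] less_imp_le)
      next
        assume y2: "2 \<le> ?y"
        show "\<exists>i'\<in>U. i' < Suc j \<and> col i' i = \<sigma> \<and> Suc (nmem s1 28 i') = ?y"
        proof (cases "j \<in> U \<and> col j i = \<sigma> \<and> x \<le> nmem s1 28 j")
          case True
          then show ?thesis by (intro bexI[of _ j]) auto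
        next
          case False
          with y2 x(4) obtain i' where "i' \<in> U" "i' < j" "col i' i = \<sigma>" "Suc (nmem s1 28 i') = x" by auto
          with False show ?thesis by (intro bexI[of _ i']) auto
        qed
      qed
      have h28: "nmem s2 28 j = nmem s1 28 j" "nmem s2 28 i = x" using x(1) ji by auto
      have "wp M (If (NEq (NGet 27 (V 14)) (NConst 0)) (Colour (V 14) (V 13) ;;
         If (TAnd (NEq (V 35) (V 12)) (TNot (NLess (NGet 28 (V 14)) (NGet 28 (V 13)))))
           (NSet 28 (V 13) (NAdd (NGet 28 (V 14)) (NConst 1))) Skip) Skip)
         (\<lambda>s3. nmem s3 28 = (nmem s1 28)(i := ?y)) s2"
      proof (cases "nmem s 27 j = 0")
        case True
        then have "j \<in> U" using jU by simp
        with True show ?thesis using k(2) ji(1)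
          by (simp add: s2 wp_Colour[where n = n and k = k] col' h28 x(1) not_less)
      next
        case False
        then have "j \<notin> U" using jU by simp
        with False x(1) show ?thesis by (simp add: s2)
      qed
      then show ?case
      proof (rule wp_mono)
        fix s3 :: "'a mem" assume "nmem s3 28 = (nmem s1 28)(i := ?y)"
        with inv show "\<exists>x. nmem (upn s3 14 0 (Suc j)) 28 = (nmem s1 28)(i := x) \<and> 1 \<le> x \<and>
          (\<forall>i'\<in>U. i' < Suc j \<and> col i' i = \<sigma> \<longrightarrow> nmem s1 28 i' < x) \<and>
          (x \<ge> 2 \<longrightarrow> (\<exists>i'\<in>U. i' < Suc j \<and> col i' i = \<sigma> \<and> Suc (nmem s1 28 i') = x))"
          by (intro exI[of _ ?y]) simp
      qed
    next
      case (7 s2)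
      then obtain x where x: "nmem s2 28 = (nmem s1 28)(i := x)" "1 \<le> x"
        "\<And>i'. i' \<in> U \<Longrightarrow> i' < i \<Longrightarrow> col i' i = \<sigma> \<Longrightarrow> nmem s1 28 i' < x"
        "x \<ge> 2 \<Longrightarrow> \<exists>i'\<in>U. i' < i \<and> col i' i = \<sigma> \<and> Suc (nmem s1 28 i') = x" by blast
      have "nmem s2 13 0 = i" "nmem s2 31 0 = nmem s1 31 0" using agreeD2(1)[OF 7(1)] i by simp_all
      then have s2: "nmem s2 13 0 = i" "nmem s2 31 0 = nmem s1 31 0" by simp_all
      have hh: "heights (Suc i) (U \<inter> {..<Suc i}) col \<sigma> ((nmem s1 28)(i := x)) (max (nmem s1 31 0) x)"
        by (rule heights_Suc_in[OF h iU x(2) x(3) x(4)])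
      show ?case
      proof (cases "nmem s1 31 0 < x")
        case True
        then have "max (nmem s1 31 0) x = x" by simp
        with hh True show ?thesis by (simp add: s2 x(1))
      next
        case False
        then have "max (nmem s1 31 0) x = nmem s1 31 0" by simp
        with hh False show ?thesis by (simp add: s2 x(1))
      qed
    qed (use i 6(1) n in auto)
    with True show ?thesis by (simp add: s1 i)
  qed
next
  case (7 s')
  have "U \<inter> {..<n} = U" by (auto simp: U)
  with 7 show ?case by simp
qed (use assms in auto)
qed

text \<open>A chain is collected from its top while the ranks decrease. Scalar 31 is the height
  wanted next, 34 the number of ranks without a class and 33 the member chosen last. The impossible
  rank \<open>n\<close> in 33 means that nothing is chosen yet; in this case the wanted colour is
  simply assumed.\<close>

definition Select :: prog where
  "Select = 37 ::= NSub (NSub (V 5) (NConst 1)) (V 15) ;;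
     If (TAnd (NEq (NGet 27 (V 37)) (NConst 0)) (NEq (NGet 28 (V 37)) (V 31)))
       (If (NEq (V 33) (V 5)) (35 ::= V 12) (Colour (V 37) (V 33)) ;;
        If (NEq (V 35) (V 12)) (NSet 27 (V 37) (V 32) ;; 33 ::= V 37 ;; 31 ::= NSub (V 31) (NConst 1) ;;
          34 ::= NSub (V 34) (NConst 1)) Skip) Skip"

definition Extract :: prog where
  "Extract = 32 ::= NAdd (V 32) (NConst 1) ;; 33 ::= V 5 ;; For 15 (V 5) Select"

lemma writes_Select [simp]: "nwrites Select = {16, 27, 31, 33, 34, 35, 36, 37}" "fwrites Select = {}"
  by (auto simp: Select_def)

lemma writes_Extract [simp]: "nwrites Extract = {15, 16, 27, 31, 32, 33, 34, 35, 36, 37}" "fwrites Extract = {}"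
  by (auto simp: Extract_def)

text \<open>Backtracking cannot get stuck: a member of height at least 2 has a linked predecessor of
  the next lower height, whose rank is smaller and hence still to be visited. Any rank that fits may
  be taken, so no predecessors have to be stored.\<close>

lemma wp_Extract:
  fixes s :: "'a::field mem"
  assumes n: "nmem s 5 0 = n" "n \<le> M" and k: "nmem s 8 0 = k" "k \<le> M" and \<sigma>: "nmem s 12 0 = \<sigma>"
    and col: "col = colour (\<lambda>j i. nmem s 26 (j * n + i)) (k - 1)" and U: "U = {i. i < n \<and> nmem s 27 i = 0}"
    and h: "heights n U col \<sigma> (nmem s 28) (nmem s 31 0)" and R: "nmem s 34 0 = card U"
  shows "wp M Extract (\<lambda>s'. \<exists>X\<subseteq>U. nmem s' 27 = (\<lambda>i. if i \<in> X then Suc (nmem s 32 0) else nmem s 27 i) \<and>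
    nmem s' 32 0 = Suc (nmem s 32 0) \<and> card X = nmem s 31 0 \<and> nmem s' 34 0 = card (U - X) \<and>
    (\<forall>i\<in>X. \<forall>i'\<in>X. i < i' \<longrightarrow> col i i' = \<sigma>)) s"
proof -
  let ?cl = "Suc (nmem s 32 0)" and ?mx = "nmem s 31 0" and ?h = "nmem s 28"
  have col': "colour (\<lambda>j i. nmem s 26 (j * n + i)) (k - Suc 0) = col" by (simp add: col)
  have finU: "finite U" by (simp add: U)
  have h2: "\<And>i. i \<in> U \<Longrightarrow> ?h i \<ge> 2 \<Longrightarrow> \<exists>i'\<in>U. i' < i \<and> col i' i = \<sigma> \<and> Suc (?h i') = ?h i"
    and h1: "\<And>i. i \<in> U \<Longrightarrow> 1 \<le> ?h i" and h3: "?mx = 0 \<or> (\<exists>i\<in>U. ?h i = ?mx)"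
    using h by (auto simp: heights_def)
  let ?I = "\<lambda>z s'. \<exists>X\<subseteq>U. X \<subseteq> {n - z..<n} \<and> nmem s' 27 = (\<lambda>i. if i \<in> X then ?cl else nmem s 27 i) \<and>
    card X + nmem s' 31 0 = ?mx \<and> card X + nmem s' 34 0 = card U \<and>
    (\<forall>i\<in>X. \<forall>i'\<in>X. i < i' \<longrightarrow> col i i' = \<sigma>) \<and>
    nmem s' 33 0 = (if X = {} then n else Min X) \<and>
    (nmem s' 31 0 > 0 \<longrightarrow> (\<exists>i\<in>U. i < n - z \<and> ?h i = nmem s' 31 0 \<and> (X = {} \<or> col i (Min X) = \<sigma>)))"
  show ?thesis
    unfolding Extract_def wp.simps nval.simps
  proof (rule wp_For[where n = n and I = ?I], goal_cases)
    case 5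
    have "?mx > 0 \<longrightarrow> (\<exists>i\<in>U. i < n \<and> ?h i = ?mx)" using h3 by (auto simp: U)
    then show ?case using n R by (intro exI[of _ "{}"]) auto
  next
    case (6 z s1)
    note fr = agreeD2(1)[OF 6(2)]
    have s1: "nmem s1 5 0 = n" "nmem s1 8 0 = k" "nmem s1 12 0 = \<sigma>" "nmem s1 28 = nmem s 28" "nmem s1 26 = nmem s 26"
      "nmem s1 32 0 = ?cl" "nmem s1 15 0 = z"
      using fr n k \<sigma> 6(3) by simp_all
    from 6(4) obtain X where X: "X \<subseteq> U" "X \<subseteq> {n - z..<n}" "nmem s1 27 = (\<lambda>i. if i \<in> X then ?cl else nmem s 27 i)"
      "card X + nmem s1 31 0 = ?mx" "card X + nmem s1 34 0 = card U" "\<forall>i\<in>X. \<forall>i'\<in>X. i < i' \<longrightarrow> col i i' = \<sigma>"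
      "nmem s1 33 0 = (if X = {} then n else Min X)"
      "nmem s1 31 0 > 0 \<longrightarrow> (\<exists>i\<in>U. i < n - z \<and> ?h i = nmem s1 31 0 \<and> (X = {} \<or> col i (Min X) = \<sigma>))"
      by (elim exE conjE) (rule that; assumption)
    define i where "i = n - 1 - z"
    have i: "i < n" "n - Suc z = i" "n - Suc 0 - z = i" "i < n - z" "\<And>x. x < n - z \<Longrightarrow> x \<noteq> i \<Longrightarrow> x < i"
      using 6(1) by (auto simp: i_def)
    have iX: "i \<notin> X" using X(2) 6(1) by (auto simp: i_def)
    have finX: "finite X" using X(1) finU finite_subset by blast
    have mini: "i < Min X" if "X \<noteq> {}"
    proof -
      have "Min X \<in> X" using finX that by simp
      with X(2) i(4) show ?thesis by auto
    qed
    define sel where "sel \<longleftrightarrow> nmem s 27 i = 0 \<and> ?h i = nmem s1 31 0 \<and> (X = {} \<or> col i (Min X) = \<sigma>)"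
    show ?case
    proof (cases sel)
      case False
      have stay: "?I (Suc z) s'" if "nmem s' 27 = nmem s1 27" "nmem s' 31 0 = nmem s1 31 0" "nmem s' 34 0 = nmem s1 34 0"
        "nmem s' 33 0 = nmem s1 33 0" for s' :: "'a mem"
      proof (intro exI[of _ X] conjI)
        show "X \<subseteq> {n - Suc z..<n}" by (rule subset_trans[OF X(2)]) auto
        show "nmem s' 31 0 > 0 \<longrightarrow> (\<exists>i\<in>U. i < n - Suc z \<and> ?h i = nmem s' 31 0 \<and> (X = {} \<or> col i (Min X) = \<sigma>))"
        proof
          assume "nmem s' 31 0 > 0"
          then have "nmem s1 31 0 > 0" using that by simp
          with X(8) obtain x where x: "x \<in> U" "x < n - z" "?h x = nmem s1 31 0" "X = {} \<or> col x (Min X) = \<sigma>"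
            by blast
          then have "x \<noteq> i" using False by (auto simp: sel_def U)
          then show "\<exists>i\<in>U. i < n - Suc z \<and> ?h i = nmem s' 31 0 \<and> (X = {} \<or> col i (Min X) = \<sigma>)"
            using x i(2) i(5)[OF x(2)] that by auto
        qed
      qed (use X that in auto)
      have "wp M Select (\<lambda>s'. nmem s' 27 = nmem s1 27 \<and> nmem s' 31 0 = nmem s1 31 0 \<and>
          nmem s' 34 0 = nmem s1 34 0 \<and> nmem s' 33 0 = nmem s1 33 0) s1"
      proof (cases "X = {}")
        case True
        then show ?thesis using False iX X(3,7) k(2) unfolding Select_def
          by (auto simp: s1 i(2,3) sel_def)
      next
        case F2: False
        have "Min X \<in> {n - z..<n}" by (rule subsetD[OF X(2) Min_in[OF finX F2]])
        then have "Min X < n" by simp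
        then show ?thesis using False iX F2 X(3,7) k(2) unfolding Select_def
          by (auto simp: s1 i(2,3) sel_def wp_Colour[where n = n and k = k] col')
      qed
      then show ?thesis by (rule wp_mono) (rule stay; simp)
    next
      case True
      then have iU: "i \<in> U" using i(1) by (simp add: U sel_def)
      let ?X = "insert i X"
      have hi: "?h i = nmem s1 31 0" "1 \<le> nmem s1 31 0" using True h1[OF iU] by (auto simp: sel_def)
      have Min: "Min ?X = i" using finX mini by (cases "X = {}") (auto simp: min_def)
      \<comment> \<open>The comparison with the member chosen last extends to the whole chain by
        transitivity of the colour.\<close>
      have coli: "col i x = \<sigma>" if "x \<in> X" for x
      proof (cases "x = Min X")
        case True
        with \<open>sel\<close> that show ?thesis by (auto simp: sel_def)
      next
        case False
        have "X \<noteq> {}" using that by auto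
        then have "Min X \<in> X" by (rule Min_in[OF finX])
        moreover have "Min X \<le> x" by (rule Min_le[OF finX that])
        ultimately have "col (Min X) x = \<sigma>" using False X(6) that by (metis le_neq_implies_less)
        moreover have "col i (Min X) = \<sigma>" using \<open>sel\<close> that by (auto simp: sel_def)
        ultimately show ?thesis unfolding col by (metis colour_trans)
      qed
      have card: "card ?X = Suc (card X)" using finX iX by simp
      have "X \<subset> U" using X(1) iU iX by blast
      then have ne: "card X < card U" by (rule psubset_card_mono[OF finU])
      have nxt: "?I (Suc z) s'" if "nmem s' 27 = (nmem s1 27)(i := ?cl)" "nmem s' 31 0 = nmem s1 31 0 - 1"
        "nmem s' 34 0 = nmem s1 34 0 - 1" "nmem s' 33 0 = i" for s' :: "'a mem"
      proof (intro exI[of _ ?X] conjI)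
        show "?X \<subseteq> U" using X(1) iU by simp
        have "{n - z..<n} \<subseteq> {n - Suc z..<n}" by auto
        then show "?X \<subseteq> {n - Suc z..<n}" using X(2) i(1,2) by auto
        show "nmem s' 27 = (\<lambda>i. if i \<in> ?X then ?cl else nmem s 27 i)" using that X(3) by (auto simp: fun_eq_iff)
        show "card ?X + nmem s' 31 0 = ?mx" using X(4) that hi card by simp
        show "card ?X + nmem s' 34 0 = card U" using X(5) that card ne by simp
        show "\<forall>a\<in>?X. \<forall>b\<in>?X. a < b \<longrightarrow> col a b = \<sigma>"
        proof (intro ballI impI)
          fix a b assume ab: "a \<in> ?X" "b \<in> ?X" "a < b"
          have "i \<le> a" using ab(1) Min finX by (metis Min_le finite_insert)
          then have "b \<noteq> i" using ab by auto
          then have b: "b \<in> X" using ab by simp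
          show "col a b = \<sigma>"
          proof (cases "a = i")
            case True
            with coli b show ?thesis by simp
          next
            case False
            with ab b X(6) show ?thesis by auto
          qed
        qed
        show "nmem s' 33 0 = (if ?X = {} then n else Min ?X)" using that Min by simp
        show "nmem s' 31 0 > 0 \<longrightarrow> (\<exists>x\<in>U. x < n - Suc z \<and> ?h x = nmem s' 31 0 \<and> (?X = {} \<or> col x (Min ?X) = \<sigma>))"
        proof
          assume "nmem s' 31 0 > 0"
          then have "?h i \<ge> 2" using hi that by simp
          from h2[OF iU this] obtain x where "x \<in> U" "x < i" "col x i = \<sigma>" "Suc (?h x) = ?h i" by blast
          then show "\<exists>x\<in>U. x < n - Suc z \<and> ?h x = nmem s' 31 0 \<and> (?X = {} \<or> col x (Min ?X) = \<sigma>)"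
            using hi that i(2) Min by (intro bexI[of _ x]) auto
        qed
      qed
      have "wp M Select (\<lambda>s'. nmem s' 27 = (nmem s1 27)(i := ?cl) \<and> nmem s' 31 0 = nmem s1 31 0 - 1 \<and>
          nmem s' 34 0 = nmem s1 34 0 - 1 \<and> nmem s' 33 0 = i) s1"
      proof (cases "X = {}")
        case T2: True
        then show ?thesis using True iX X(3,7) k(2) unfolding Select_def
          by (auto simp: s1 i(2,3) sel_def)
      next
        case False
        have "Min X \<in> {n - z..<n}" by (rule subsetD[OF X(2) Min_in[OF finX False]])
        then have "Min X < n" by simp
        then show ?thesis using True iX False X(3,7) k(2) unfolding Select_def
          by (auto simp: s1 i(2,3) sel_def wp_Colour[where n = n and k = k] col')
      qed
      then show ?thesis by (rule wp_mono) (rule nxt; simp)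
    qed
  next
    case (7 s')
    then obtain X where X: "X \<subseteq> U" "nmem s' 27 = (\<lambda>i. if i \<in> X then ?cl else nmem s 27 i)"
      "card X + nmem s' 31 0 = ?mx" "card X + nmem s' 34 0 = card U" "\<forall>i\<in>X. \<forall>i'\<in>X. i < i' \<longrightarrow> col i i' = \<sigma>"
      "nmem s' 31 0 = 0" by auto
    have "nmem s' 32 0 = ?cl" using agreeD2(1)[OF 7(1)] by simp
    moreover have "card (U - X) = card U - card X" using X(1) finU finite_subset by (intro card_Diff_subset) auto
    ultimately show ?case using X by (intro exI[of _ X]) auto
  qed (use assms in auto)
qed

section \<open>Rounds over all order types\<close>

definition Round :: prog where
  "Round = For 12 (V 30) (Heights ;; Extract)"

lemma writes_Round [simp]: "nwrites Round = {12, 13, 14, 15, 16, 27, 28, 31, 32, 33, 34, 35, 36, 37}" "fwrites Round = {}"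
  by (auto simp: Round_def)

text \<open>
  The class 0 consists of the ranks without a class.
\<close>

definition chains :: "nat \<Rightarrow> (nat \<Rightarrow> nat \<Rightarrow> nat) \<Rightarrow> (nat \<Rightarrow> nat) \<Rightarrow> nat \<Rightarrow> bool" where
  "chains n col ph cl \<longleftrightarrow> (\<forall>i<n. ph i \<le> cl) \<and>
    (\<exists>\<tau>. \<forall>i i'. i < i' \<and> i' < n \<and> ph i = ph i' \<and> ph i \<noteq> 0 \<longrightarrow> col i i' = \<tau> (ph i))"

lemma chains_extend:
  assumes c: "chains n col ph cl" and X: "\<forall>i\<in>X. \<forall>i'\<in>X. i < i' \<longrightarrow> col i i' = \<sigma>"
  shows "chains n col (\<lambda>i. if i \<in> X then Suc cl else ph i) (Suc cl)"
proof -
  from c obtain \<tau> where le: "\<And>i. i < n \<Longrightarrow> ph i \<le> cl" and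
    \<tau>: "\<And>i i'. i < i' \<Longrightarrow> i' < n \<Longrightarrow> ph i = ph i' \<Longrightarrow> ph i \<noteq> 0 \<Longrightarrow> col i i' = \<tau> (ph i)"
    unfolding chains_def by blast
  let ?ph = "\<lambda>i. if i \<in> X then Suc cl else ph i"
  have "col i i' = (\<tau>(Suc cl := \<sigma>)) (?ph i)"
    if i: "i < i'" "i' < n" "?ph i = ?ph i'" "?ph i \<noteq> 0" for i i'
  proof -
    have "i < n" using i by simp
    then have "ph i \<noteq> Suc cl" "ph i' \<noteq> Suc cl" using le[of i] le[of i'] i by auto
    then show ?thesis using i X \<tau>[of i i'] by (auto split: if_splits)
  qed
  moreover have "\<forall>i<n. ?ph i \<le> Suc cl" using le by (auto intro: le_SucI)
  ultimately show ?thesis unfolding chains_def by blast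
qed

text \<open>Seidenberg's proof of the theorem of Erdos and Szekeres: a remaining rank keeps, for
  each colour, its height at the time when the chain of this colour was removed. Two remaining ranks
  differ in the height for the colour of their pair, so the tuples are distinct; a height is at most
  the length of a removed chain and hence at most the number of removed ranks.\<close>

lemma wp_Round:
  fixes s :: "'a::field mem"
  assumes n: "nmem s 5 0 = n" "n \<le> M" and k: "nmem s 8 0 = k" "k \<le> M" and pw: "nmem s 30 0 = 2 ^ (k - 1)" "2 ^ (k - 1) \<le> M"
    and col: "col = colour (\<lambda>j i. nmem s 26 (j * n + i)) (k - 1)" and U0: "U0 = {i. i < n \<and> nmem s 27 i = 0}"
    and R: "nmem s 34 0 = card U0" and ch: "chains n col (nmem s 27) (nmem s 32 0)" and ne: "U0 \<noteq> {}"
  shows "wp M Round (\<lambda>s'. \<exists>U. U = {i. i < n \<and> nmem s' 27 i = 0} \<and> nmem s' 34 0 = card U \<and>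
    nmem s' 32 0 = nmem s 32 0 + 2 ^ (k - 1) \<and> chains n col (nmem s' 27) (nmem s' 32 0) \<and>
    card U < card U0 \<and> card U \<le> (card U0 - card U) ^ (2 ^ (k - 1))) s"
proof -
  let ?pw = "2 ^ (k - 1) :: nat"
  have finU0: "finite U0" by (simp add: U0)
  \<comment> \<open>\<open>H\<close> records the heights of the colours already treated. Later
    removals only shrink \<open>U\<close>, so the recorded inequalities persist.\<close>
  let ?I = "\<lambda>t s'. \<exists>U H. U = {i. i < n \<and> nmem s' 27 i = 0} \<and> U \<subseteq> U0 \<and> nmem s' 34 0 = card U \<and>
    nmem s' 32 0 = nmem s 32 0 + t \<and> chains n col (nmem s' 27) (nmem s' 32 0) \<and>
    (t > 0 \<longrightarrow> card U < card U0) \<and>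
    (\<forall>\<sigma><t. \<forall>i\<in>U. 1 \<le> H \<sigma> i \<and> H \<sigma> i \<le> card U0 - card U) \<and>
    (\<forall>i\<in>U. \<forall>i'\<in>U. i < i' \<and> col i i' < t \<longrightarrow> H (col i i') i < H (col i i') i')"
  show ?thesis
    unfolding Round_def
  proof (rule wp_For[where n = ?pw and I = ?I], goal_cases)
    case 5
    show ?case using R ch U0 by (intro exI[of _ U0]) auto
  next
    case (6 t s1)
    note fr = agreeD2(1)[OF 6(2)]
    have s1: "nmem s1 5 0 = n" "nmem s1 8 0 = k" "nmem s1 12 0 = t" "nmem s1 26 = nmem s 26"
      using fr n k 6(3) by simp_all
    from 6(4) obtain U H where U: "U = {i. i < n \<and> nmem s1 27 i = 0}" and sub: "U \<subseteq> U0" and R1: "nmem s1 34 0 = card U"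
      and cl: "nmem s1 32 0 = nmem s 32 0 + t" and ch1: "chains n col (nmem s1 27) (nmem s1 32 0)"
      and lt: "t > 0 \<longrightarrow> card U < card U0"
      and H1: "\<forall>\<sigma><t. \<forall>i\<in>U. 1 \<le> H \<sigma> i \<and> H \<sigma> i \<le> card U0 - card U"
      and H2: "\<forall>i\<in>U. \<forall>i'\<in>U. i < i' \<and> col i i' < t \<longrightarrow> H (col i i') i < H (col i i') i'"
      by (elim exE conjE) (rule that; assumption)
    have col1: "col = colour (\<lambda>j i. nmem s1 26 (j * n + i)) (k - 1)" by (simp add: s1 col)
    have finU: "finite U" using sub finU0 by (rule finite_subset)
    have leU: "card U \<le> card U0" using card_mono[OF finU0 sub] .
    show ?case unfolding wp.simps
    proof (rule wp_use[OF wp_Heights[OF s1(1) n(2) s1(2) k(2) s1(3) col1 U]])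
      fix s2 :: "'a mem" assume hts: "heights n U col t (nmem s2 28) (nmem s2 31 0)"
        and ag2: "agree (nwrites Heights) (fwrites Heights) s1 s2"
      note fr2 = agreeD2(1)[OF ag2]
      have s2: "nmem s2 5 0 = n" "nmem s2 8 0 = k" "nmem s2 12 0 = t" "nmem s2 26 = nmem s1 26" "nmem s2 27 = nmem s1 27"
        "nmem s2 34 0 = card U" "nmem s2 32 0 = nmem s1 32 0"
        using fr2 s1 R1 by simp_all
      have col2: "col = colour (\<lambda>j i. nmem s2 26 (j * n + i)) (k - 1)" by (simp add: s2 col1)
      have U2: "U = {i. i < n \<and> nmem s2 27 i = 0}" by (simp add: s2 U)
      show "wp M Extract (\<lambda>s''. ?I (Suc t) (upn s'' 12 0 (Suc t))) s2"
      proof (rule wp_use[OF wp_Extract[OF s2(1) n(2) s2(2) k(2) s2(3) col2 U2 hts s2(6)]])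
        fix s3 :: "'a mem"
        assume "\<exists>X\<subseteq>U. nmem s3 27 = (\<lambda>i. if i \<in> X then Suc (nmem s2 32 0) else nmem s2 27 i) \<and>
          nmem s3 32 0 = Suc (nmem s2 32 0) \<and> card X = nmem s2 31 0 \<and> nmem s3 34 0 = card (U - X) \<and>
          (\<forall>i\<in>X. \<forall>i'\<in>X. i < i' \<longrightarrow> col i i' = t)"
        then obtain X where X: "X \<subseteq> U" "nmem s3 27 = (\<lambda>i. if i \<in> X then Suc (nmem s2 32 0) else nmem s2 27 i)"
          "nmem s3 32 0 = Suc (nmem s2 32 0)" "card X = nmem s2 31 0" "nmem s3 34 0 = card (U - X)"
          "\<forall>i\<in>X. \<forall>i'\<in>X. i < i' \<longrightarrow> col i i' = t" by blast
        let ?h = "nmem s2 28"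
        have h: "\<And>i. i \<in> U \<Longrightarrow> 1 \<le> ?h i \<and> ?h i \<le> card X"
          "\<And>i i'. i \<in> U \<Longrightarrow> i' \<in> U \<Longrightarrow> i' < i \<Longrightarrow> col i' i = t \<Longrightarrow> ?h i' < ?h i"
          using hts unfolding heights_def X(4) by blast+
        have finX: "finite X" using X(1) finU by (rule finite_subset)
        have cUX: "card (U - X) = card U - card X" by (rule card_Diff_subset[OF finX X(1)])
        have cX: "card X \<le> card U" by (rule card_mono[OF finU X(1)])
        show "?I (Suc t) (upn s3 12 0 (Suc t))"
        proof (intro exI[of _ "U - X"] exI[of _ "H(t := ?h)"] conjI)
          show "U - X = {i. i < n \<and> nmem (upn s3 12 0 (Suc t)) 27 i = 0}" by (auto simp: X(2) s2 U)
          show "U - X \<subseteq> U0" using sub by auto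
          show "nmem (upn s3 12 0 (Suc t)) 34 0 = card (U - X)" using X(5) by simp
          show "nmem (upn s3 12 0 (Suc t)) 32 0 = nmem s 32 0 + Suc t" using X(3) cl s2 by simp
          show "chains n col (nmem (upn s3 12 0 (Suc t)) 27) (nmem (upn s3 12 0 (Suc t)) 32 0)"
          proof -
            have "nmem s3 27 = (\<lambda>i. if i \<in> X then Suc (nmem s1 32 0) else nmem s1 27 i)"
              unfolding X(2) s2(5,7) ..
            then show ?thesis using chains_extend[OF ch1 X(6)] by (simp add: X(3) s2(7))
          qed
          show "Suc t > 0 \<longrightarrow> card (U - X) < card U0"
          proof
            show "card (U - X) < card U0"
            proof (cases "t = 0")
              case False
              then show ?thesis using lt cUX by simp
            next
              case True
              \<comment> \<open>All heights are at least 1, so the first colour already removes a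
                nonempty chain; this is the progress of the round.\<close>
              have "card U > 0 \<Longrightarrow> card X > 0"
              proof -
                assume "card U > 0"
                then obtain i where "i \<in> U" by fastforce
                then show "card X > 0" using h(1)[of i] by linarith
              qed
              moreover have "card U0 > 0" using ne finU0 by (simp add: card_gt_0_iff)
              ultimately show ?thesis using leU cUX by (cases "card U = 0") auto
            qed
          qed
          show "\<forall>\<sigma><Suc t. \<forall>i\<in>U - X. 1 \<le> (H(t := ?h)) \<sigma> i \<and> (H(t := ?h)) \<sigma> i \<le> card U0 - card (U - X)"
          proof (intro allI impI ballI)
            fix \<sigma> i assume "\<sigma> < Suc t" "i \<in> U - X"
            then show "1 \<le> (H(t := ?h)) \<sigma> i \<and> (H(t := ?h)) \<sigma> i \<le> card U0 - card (U - X)"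
              using H1[rule_format, of \<sigma> i] h(1)[of i] cUX cX leU by (cases "\<sigma> = t") auto
          qed
          show "\<forall>i\<in>U - X. \<forall>i'\<in>U - X. i < i' \<and> col i i' < Suc t \<longrightarrow>
            (H(t := ?h)) (col i i') i < (H(t := ?h)) (col i i') i'"
          proof (intro ballI impI)
            fix i i' assume i: "i \<in> U - X" "i' \<in> U - X" "i < i' \<and> col i i' < Suc t"
            show "(H(t := ?h)) (col i i') i < (H(t := ?h)) (col i i') i'"
              using H2[rule_format, of i i'] h(2)[of i' i] i by (cases "col i i' = t") auto
          qed
        qed
      qed
    qed
  next
    case (7 s')
    from 7(3) obtain U H where U: "U = {i. i < n \<and> nmem s' 27 i = 0}" and R1: "nmem s' 34 0 = card U"
      and cl: "nmem s' 32 0 = nmem s 32 0 + ?pw" and ch1: "chains n col (nmem s' 27) (nmem s' 32 0)"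
      and lt: "?pw > 0 \<longrightarrow> card U < card U0"
      and H1: "\<forall>\<sigma><?pw. \<forall>i\<in>U. 1 \<le> H \<sigma> i \<and> H \<sigma> i \<le> card U0 - card U"
      and H2: "\<forall>i\<in>U. \<forall>i'\<in>U. i < i' \<and> col i i' < ?pw \<longrightarrow> H (col i i') i < H (col i i') i'"
      by (elim exE conjE) (rule that; assumption)
    let ?\<rho> = "card U0 - card U" and ?F = "\<lambda>i. restrict (\<lambda>\<sigma>. H \<sigma> i) {..<?pw}"
    have less: "col i i' < ?pw" for i i' unfolding col by (rule colour_less)
    have "inj_on ?F U"
    proof (rule inj_onI, rule ccontr)
      fix i i' assume i: "i \<in> U" "i' \<in> U" "?F i = ?F i'" "i \<noteq> i'"
      have eq: "H \<sigma> i = H \<sigma> i'" if "\<sigma> < ?pw" for \<sigma> using fun_cong[OF i(3), of \<sigma>] that by simp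
      show False
      proof (cases "i < i'")
        case True
        then show False using H2 i less eq[OF less[of i i']] by (metis less_irrefl)
      next
        case False
        then have "i' < i" using i(4) by simp
        then show False using H2 i less eq[OF less[of i' i]] by (metis less_irrefl)
      qed
    qed
    moreover have "?F ` U \<subseteq> {..<?pw} \<rightarrow>\<^sub>E {1..?\<rho>}"
    proof (rule image_subsetI)
      fix i assume "i \<in> U"
      then show "?F i \<in> {..<?pw} \<rightarrow>\<^sub>E {1..?\<rho>}" unfolding restrict_PiE_iff using H1 by simp
    qed
    ultimately have "card U \<le> card ({..<?pw} \<rightarrow>\<^sub>E {1..?\<rho>})"
      by (intro card_inj_on_le) (auto intro: finite_PiE)
    also have "\<dots> = ?\<rho> ^ ?pw" by (simp add: card_PiE)
    finally have "card U \<le> ?\<rho> ^ ?pw" .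
    then show ?case using U R1 cl ch1 lt by (intro exI[of _ U]) auto
  qed (use assms in auto)
qed

text \<open>
  The potential that bounds the number of rounds. In a round that leaves u1 of u0 ranks, the removed
  chains of all colours together have at most \<open>u0 - u1\<close> elements, and the tuples of heights show
  that \<open>u1 \<le> (u0 - u1) ^ 2 ^ (k - 1)\<close>.
\<close>

definition harmonic_sum :: "real \<Rightarrow> nat \<Rightarrow> real" where
  "harmonic_sum \<epsilon> u = (\<Sum>m=1..u. real m powr (- \<epsilon>))"

text \<open>With \<rho> removed elements, u0 is at most 2 \<rho>^P and so at most (2 \<rho>)^P. Each
  of the \<rho> lost terms is at least u0 powr (- 1/P), hence at least 1 / (2 \<rho>).\<close>

lemma harmonic_sum_step:
  assumes less: "u1 < u0" and le: "u1 \<le> (u0 - u1) ^ P" and P: "P \<ge> 1"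
  shows "harmonic_sum (1 / real P) u0 - harmonic_sum (1 / real P) u1 \<ge> 1 / 2"
proof -
  let ?\<epsilon> = "1 / real P" and ?\<rho> = "u0 - u1"
  have \<rho>: "?\<rho> \<ge> 1" "u0 = u1 + ?\<rho>" using less by auto
  have "u0 \<le> ?\<rho> ^ P + ?\<rho> ^ P"
  proof -
    have "?\<rho> \<le> ?\<rho> ^ P" using \<rho>(1) P by (metis power_increasing power_one_right)
    then show ?thesis using \<rho>(2) le by linarith
  qed
  also have "\<dots> \<le> 2 ^ P * ?\<rho> ^ P"
  proof -
    have "(2::nat) \<le> 2 ^ P" using P by (metis power_increasing power_one_right one_le_numeral)
    then show ?thesis by (metis mult_2 mult_le_mono1)
  qed
  also have "\<dots> = (2 * ?\<rho>) ^ P" by (simp add: power_mult_distrib)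
  finally have "real u0 \<le> real (2 * ?\<rho>) ^ P" by (metis of_nat_le_iff of_nat_power)
  then have "real u0 powr ?\<epsilon> \<le> (real (2 * ?\<rho>) ^ P) powr ?\<epsilon>" by (intro powr_mono2) auto
  also have "\<dots> = real (2 * ?\<rho>)"
    using \<rho>(1) P by (simp add: powr_realpow[symmetric] powr_powr)
  finally have u0: "real u0 powr ?\<epsilon> \<le> real (2 * ?\<rho>)" .
  have pos: "real u0 powr ?\<epsilon> > 0" using less by simp
  have "{1..u0} = {1..u1} \<union> {u1<..u0}" "{1..u1} \<inter> {u1<..u0} = {}" using less by auto
  then have "harmonic_sum ?\<epsilon> u0 = harmonic_sum ?\<epsilon> u1 + (\<Sum>m\<in>{u1<..u0}. real m powr (- ?\<epsilon>))"
    unfolding harmonic_sum_def by (simp add: sum.union_disjoint)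
  moreover have "(\<Sum>m\<in>{u1<..u0}. real m powr (- ?\<epsilon>)) \<ge> (\<Sum>m\<in>{u1<..u0}. real u0 powr (- ?\<epsilon>))"
  proof (rule sum_mono)
    fix m assume "m \<in> {u1<..u0}"
    then show "real u0 powr (- ?\<epsilon>) \<le> real m powr (- ?\<epsilon>)" by (intro powr_mono2') auto
  qed
  moreover have "(\<Sum>m\<in>{u1<..u0}. real u0 powr (- ?\<epsilon>)) = real ?\<rho> / real u0 powr ?\<epsilon>"
    by (simp add: powr_minus_divide)
  moreover have "real ?\<rho> / real u0 powr ?\<epsilon> \<ge> 1 / 2"
    using u0 pos by (simp add: field_simps)
  ultimately show ?thesis by linarith
qed

text \<open>A term equals m powr (1 - \<epsilon>) divided by m. The logarithm keeps the bound
  uniform up to \<epsilon> = 1, the case \<open>k = 1\<close>, where the sum is the harmonic sum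
  itself.\<close>

lemma harmonic_sum_le:
  assumes "0 \<le> \<epsilon>" "\<epsilon> \<le> 1" "n \<ge> 1"
  shows "harmonic_sum \<epsilon> n \<le> real n powr (1 - \<epsilon>) * (1 + ln (real n))"
proof -
  have "harmonic_sum \<epsilon> n \<le> (\<Sum>m=1..n. real n powr (1 - \<epsilon>) * (1 / real m))"
    unfolding harmonic_sum_def
  proof (rule sum_mono)
    fix m assume m: "m \<in> {1..n}"
    have "real m powr (- \<epsilon>) = real m powr (1 - \<epsilon>) * (1 / real m)"
      using m by (simp add: powr_diff powr_minus_divide)
    also have "\<dots> \<le> real n powr (1 - \<epsilon>) * (1 / real m)"
      using m assms by (intro mult_right_mono powr_mono2) auto
    finally show "real m powr (- \<epsilon>) \<le> real n powr (1 - \<epsilon>) * (1 / real m)" .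
  qed
  also have "\<dots> = real n powr (1 - \<epsilon>) * (\<Sum>m=1..n. 1 / real m)" by (simp add: sum_distrib_left)
  also have "\<dots> \<le> real n powr (1 - \<epsilon>) * (1 + ln (real n))"
  proof (rule mult_left_mono)
    show "(\<Sum>m=1..n. 1 / real m) \<le> 1 + ln (real n)"
      using assms(3)
    proof (induction n rule: dec_induct)
      case (step n)
      have "1 / real (Suc n) \<le> ln (real (Suc n)) - ln (real n)"
      proof -
        have "ln (real n / real (Suc n)) \<le> real n / real (Suc n) - 1" using step by (intro ln_le_minus_one) auto
        moreover have "ln (real n / real (Suc n)) = ln (real n) - ln (real (Suc n))" using step by (simp add: ln_div)
        moreover have "real n / real (Suc n) - 1 = - 1 / real (Suc n)" by (simp add: field_simps)
        ultimately show ?thesis by linarith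
      qed
      then show ?case using step by simp
    qed simp
  qed auto
  finally show ?thesis .
qed

definition Chains :: prog where
  "Chains = 30 ::= NConst 1 ;; For 11 (NSub (V 8) (NConst 1)) (30 ::= NAdd (V 30) (V 30)) ;;
     34 ::= V 5 ;; 32 ::= NConst 0 ;; For 11 (V 5) (If (NEq (V 34) (NConst 0)) Skip Round)"

lemma writes_Chains [simp]:
  "nwrites Chains = {11, 12, 13, 14, 15, 16, 27, 28, 30, 31, 32, 33, 34, 35, 36, 37}" "fwrites Chains = {}"
  by (auto simp: Chains_def)

text \<open>That the loop ends with no rank left only needs that a round removes at least one rank.
  The number of classes is controlled separately: a round opens \<open>2 ^ (k - 1)\<close> of them
  and lowers the potential by at least 1/2.\<close>

lemma wp_Chains:
  fixes s :: "'a::field mem"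
  assumes n: "nmem s 5 0 = n" "n \<le> M" and k: "nmem s 8 0 = k" "k \<le> M" and pw: "2 ^ (k - 1) \<le> M"
    and col: "col = colour (\<lambda>j i. nmem s 26 (j * n + i)) (k - 1)" and ph: "nmem s 27 = (\<lambda>_. 0)"
  shows "wp M Chains (\<lambda>s'. (\<forall>i<n. nmem s' 27 i \<noteq> 0) \<and> chains n col (nmem s' 27) (nmem s' 32 0) \<and>
    real (nmem s' 32 0) \<le> 2 ^ (k - 1) * (2 * harmonic_sum (1 / 2 ^ (k - 1)) n)) s"
proof -
  let ?pw = "2 ^ (k - 1) :: nat" and ?\<epsilon> = "1 / 2 ^ (k - 1) :: real"
  let ?body = "If (NEq (V 34) (NConst 0)) Skip Round"
  have main: "wp M (For 11 (V 5) ?body) (\<lambda>s'. (\<forall>i<n. nmem s' 27 i \<noteq> 0) \<and> chains n col (nmem s' 27) (nmem s' 32 0) \<and>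
    real (nmem s' 32 0) \<le> 2 ^ (k - 1) * (2 * harmonic_sum ?\<epsilon> n)) s0"
    if s0: "nmem s0 5 0 = n" "nmem s0 8 0 = k" "nmem s0 30 0 = ?pw" "nmem s0 26 = nmem s 26" "nmem s0 27 = (\<lambda>_. 0)"
      "nmem s0 34 0 = n" "nmem s0 32 0 = 0" for s0 :: "'a mem"
  proof (rule wp_For[where n = n and I = "\<lambda>t s'. \<exists>U. U = {i. i < n \<and> nmem s' 27 i = 0} \<and> nmem s' 34 0 = card U \<and>
      chains n col (nmem s' 27) (nmem s' 32 0) \<and> card U \<le> n - t \<and>
      real (nmem s' 32 0) \<le> 2 ^ (k - 1) * (2 * (harmonic_sum ?\<epsilon> n - harmonic_sum ?\<epsilon> (card U)))"], goal_cases)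
    case 5
    have "chains n col (\<lambda>_. 0) 0" by (simp add: chains_def)
    then show ?case using s0 by (intro exI[of _ "{..<n}"]) auto
  next
    case (6 t s1)
    from 6(4) obtain U where U: "U = {i. i < n \<and> nmem s1 27 i = 0}" and R: "nmem s1 34 0 = card U"
      and ch: "chains n col (nmem s1 27) (nmem s1 32 0)" and cU: "card U \<le> n - t"
      and bd: "real (nmem s1 32 0) \<le> 2 ^ (k - 1) * (2 * (harmonic_sum ?\<epsilon> n - harmonic_sum ?\<epsilon> (card U)))"
      by (elim exE conjE) (rule that; assumption)
    have finU: "finite U" by (simp add: U)
    show ?case
    proof (cases "card U = 0")
      case True
      then have Ue: "{i. i < n \<and> nmem s1 27 i = 0} = {}" using finU U by simp
      have "tval s1 (NEq (V 34) (NConst 0))" using R True by simp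
      then show ?thesis unfolding wp.simps using U R ch bd True Ue by (simp only: if_True) (intro exI[of _ "{}"], simp)
    next
      case False
      then have ne: "U \<noteq> {}" using finU by auto
      note fr = agreeD2(1)[OF 6(2)]
      have s1: "nmem s1 5 0 = n" "nmem s1 8 0 = k" "nmem s1 30 0 = ?pw" "nmem s1 26 = nmem s 26"
        using fr s0 by simp_all
      have col1: "col = colour (\<lambda>j i. nmem s1 26 (j * n + i)) (k - 1)" by (simp add: s1 col)
      have "wp M Round (\<lambda>s''. \<exists>U. U = {i. i < n \<and> nmem (upn s'' 11 0 (Suc t)) 27 i = 0} \<and>
        nmem (upn s'' 11 0 (Suc t)) 34 0 = card U \<and>
        chains n col (nmem (upn s'' 11 0 (Suc t)) 27) (nmem (upn s'' 11 0 (Suc t)) 32 0) \<and> card U \<le> n - Suc t \<and>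
        real (nmem (upn s'' 11 0 (Suc t)) 32 0) \<le> 2 ^ (k - 1) * (2 * (harmonic_sum ?\<epsilon> n - harmonic_sum ?\<epsilon> (card U)))) s1"
      proof (rule wp_mono[OF wp_Round[OF s1(1) n(2) s1(2) k(2) s1(3) pw col1 U R ch ne]], elim exE conjE, goal_cases)
        case (1 s2 U1)
        have "harmonic_sum (1 / real ?pw) (card U) - harmonic_sum (1 / real ?pw) (card U1) \<ge> 1 / 2"
          by (rule harmonic_sum_step) (use 1 in auto)
        then have "2 * (harmonic_sum ?\<epsilon> (card U) - harmonic_sum ?\<epsilon> (card U1)) \<ge> 1" by simp
        then have "(2 ^ (k - 1)) * (2 * (harmonic_sum ?\<epsilon> (card U) - harmonic_sum ?\<epsilon> (card U1))) \<ge> (2 ^ (k - 1)) * (1::real)"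
          by (intro mult_left_mono) auto
        then have "real (nmem s1 32 0) + 2 ^ (k - 1) \<le> 2 ^ (k - 1) * (2 * (harmonic_sum ?\<epsilon> n - harmonic_sum ?\<epsilon> (card U1)))"
          using bd by (simp add: algebra_simps)
        then show ?case using 1 cU by (intro exI[of _ U1]) auto
      qed
      then show ?thesis using False R by simp
    qed
  next
    case (7 s')
    then obtain U where U: "U = {i. i < n \<and> nmem s' 27 i = 0}"
      and ch: "chains n col (nmem s' 27) (nmem s' 32 0)" and cU: "card U \<le> n - n"
      and bd: "real (nmem s' 32 0) \<le> 2 ^ (k - 1) * (2 * (harmonic_sum ?\<epsilon> n - harmonic_sum ?\<epsilon> (card U)))"
      by blast
    have "finite U" by (simp add: U)
    with cU have "U = {}" by simp
    with U ch bd show ?case by (auto simp: harmonic_sum_def)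
  qed (use s0 n in auto)
  show ?thesis
    unfolding Chains_def wp.simps nval.simps
  proof (rule wp_For[where n = "k - 1" and I = "\<lambda>j s'. nmem s' 30 0 = 2 ^ j"], goal_cases)
    case (7 s1)
    note fr = agreeD2(1)[OF 7(1)]
    show ?case
      using fr 7(3) n k ph by (intro main) simp_all
  qed (use n k in \<open>auto simp: mult_2\<close>)
qed

section \<open>Refinement by the parity of windows\<close>

definition monotone_read :: "(nat \<Rightarrow> nat \<Rightarrow> nat) \<Rightarrow> nat \<Rightarrow> nat set \<Rightarrow> bool" where
  "monotone_read p j S \<longleftrightarrow> (\<forall>i\<in>S. \<forall>i'\<in>S. i < i' \<longrightarrow> p j i < p j i') \<or> (\<forall>i\<in>S. \<forall>i'\<in>S. i < i' \<longrightarrow> p j i' < p j i)"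

definition clustered :: "(nat \<Rightarrow> nat \<Rightarrow> nat) \<Rightarrow> nat \<Rightarrow> nat \<Rightarrow> nat set \<Rightarrow> bool" where
  "clustered p a b S \<longleftrightarrow> (\<exists>win :: nat \<Rightarrow> nat. \<forall>i\<in>S. \<forall>i'\<in>S.
     (win i = win i' \<longrightarrow> p a i < p b i') \<and> (win i < win i' \<longrightarrow> p b i < p a i'))"

lemma monotone_read_subset: "monotone_read p j S \<Longrightarrow> T \<subseteq> S \<Longrightarrow> monotone_read p j T"
  unfolding monotone_read_def by (meson subsetD)

lemma clustered_subset: "clustered p a b S \<Longrightarrow> T \<subseteq> S \<Longrightarrow> clustered p a b T"
  unfolding clustered_def by (meson subsetD)

lemma increasing_order:
  fixes f :: "nat \<Rightarrow> nat"
  assumes "\<forall>i\<in>S. \<forall>i'\<in>S. i < i' \<longrightarrow> f i < f i'" "u \<in> S" "v \<in> S" "f u < f v"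
  shows "u < v"
proof (rule ccontr)
  assume "\<not> u < v"
  then consider "u = v" | "v < u" by linarith
  then show False using assms by cases (auto dest: less_trans)
qed

lemma decreasing_order:
  fixes f :: "nat \<Rightarrow> nat"
  assumes "\<forall>i\<in>S. \<forall>i'\<in>S. i < i' \<longrightarrow> f i' < f i" "u \<in> S" "v \<in> S" "f u < f v"
  shows "v < u"
proof (rule ccontr)
  assume "\<not> v < u"
  then consider "u = v" | "u < v" by linarith
  then show False using assms by cases (auto dest: less_trans)
qed

text \<open>A common colour of all pairs of a class fixes the direction of every later read; the
  first reads increase by the choice of the ranks.\<close>

lemma (in read_positions) chains_monotone:
  assumes ch: "chains n (colour p (k - 1)) ph cl" and pos: "\<And>i. i < n \<Longrightarrow> ph i \<noteq> 0" and j: "j < k"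
  shows "monotone_read p j {i. i < n \<and> ph i = c}"
proof (cases "j = 0")
  case True
  then show ?thesis unfolding monotone_read_def using p_0_less by auto
next
  case False
  from ch obtain \<tau> where
    \<tau>: "\<And>i i'. i < i' \<Longrightarrow> i' < n \<Longrightarrow> ph i = ph i' \<Longrightarrow> ph i \<noteq> 0 \<Longrightarrow> colour p (k - 1) i i' = \<tau> (ph i)"
    unfolding chains_def by blast
  let ?S = "{i. i < n \<and> ph i = c}"
  have same: "(p j i' < p j i) = (p j x' < p j x)"
    if "i \<in> ?S" "i' \<in> ?S" "i < i'" "x \<in> ?S" "x' \<in> ?S" "x < x'" for i i' x x'
  proof (rule colour_eqD[where p = p and J = "k - 1"])
    show "colour p (k - 1) i i' = colour p (k - 1) x x'"
      using \<tau>[of i i'] \<tau>[of x x'] that pos by simp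
  qed (use False j in auto)
  show ?thesis
  proof (cases "\<exists>i\<in>?S. \<exists>i'\<in>?S. i < i' \<and> p j i' < p j i")
    case True
    then obtain i i' where "i \<in> ?S" "i' \<in> ?S" "i < i'" "p j i' < p j i" by blast
    with same[of i i'] show ?thesis unfolding monotone_read_def by blast
  next
    case False
    have "p j i < p j i'" if "i \<in> ?S" "i' \<in> ?S" "i < i'" for i i'
    proof -
      have "\<not> p j i' < p j i" using False that by blast
      moreover have "p j i \<noteq> p j i'" using p_inj[OF j j, of i i'] that by auto
      ultimately show ?thesis by simp
    qed
    then show ?thesis unfolding monotone_read_def by blast
  qed
qed

text \<open>
  Sweeping over the a-th reads in the order of time, every class is cut into windows: a window ends
  before the b-th read of its first member \<open>st c t\<close>. Windows of the same parity do not overlap.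
\<close>

definition sweep :: "nat \<Rightarrow> (nat \<Rightarrow> nat \<Rightarrow> nat) \<Rightarrow> nat \<Rightarrow> nat \<Rightarrow> (nat \<Rightarrow> nat) \<Rightarrow> nat \<Rightarrow> nat \<Rightarrow>
    (nat \<Rightarrow> nat) \<Rightarrow> (nat \<Rightarrow> nat) \<Rightarrow> (nat \<Rightarrow> nat) \<Rightarrow> bool" where
  "sweep n p a b ph0 cl l ph bd pr \<longleftrightarrow> (\<exists>W st cw.
     (\<forall>i<n. p a i < l \<longrightarrow> ph i = 2 * ph0 i + W i mod 2 \<and> 1 \<le> W i \<and> W i \<le> cw (ph0 i) \<and>
        p a (st (ph0 i) (W i)) \<le> p a i \<and> p a i < p b (st (ph0 i) (W i))) \<and>
     (\<forall>i<n. l \<le> p a i \<longrightarrow> ph i = ph0 i) \<and>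
     (\<forall>c\<le>cl. pr c = cw c mod 2 \<and> bd c = (if cw c = 0 then 0 else p b (st c (cw c)))) \<and>
     (\<forall>c\<le>cl. \<forall>t. 1 \<le> t \<and> t \<le> cw c \<longrightarrow> st c t < n \<and> p a (st c t) < l \<and> ph0 (st c t) = c) \<and>
     (\<forall>c\<le>cl. \<forall>t. 1 \<le> t \<and> t < cw c \<longrightarrow> p b (st c t) \<le> p a (st c (Suc t))))"

section \<open>The sweep over the a-th reads\<close>

context read_positions
begin

lemma sweep_idle:
  assumes sw: "sweep n p a b ph0 cl l ph bd pr" and no: "\<And>i. i < n \<Longrightarrow> p a i \<noteq> l"
  shows "sweep n p a b ph0 cl (Suc l) ph bd pr"
proof -
  have eq: "p a i < Suc l \<longleftrightarrow> p a i < l" "Suc l \<le> p a i \<longleftrightarrow> l \<le> p a i" if "i < n" for i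
    using no[OF that] by auto
  from sw show ?thesis unfolding sweep_def using eq by (elim exE) (intro exI, auto)
qed

text \<open>A read not before \<open>bd c\<close> opens the next window, with \<open>i\<close> as
  its first member; an earlier one joins the open window. The value 0 of \<open>bd c\<close> before
  any window makes the first read of a class open one.\<close>

lemma sweep_read:
  assumes sw: "sweep n p a b ph0 cl l ph bd pr" and i: "i < n" "p a i = l" and ab: "a < b" "b < k"
    and le: "\<And>i. i < n \<Longrightarrow> ph0 i \<le> cl"
  defines "c \<equiv> ph0 i"
  shows "ph i = c"
    "\<not> l < bd c \<Longrightarrow> sweep n p a b ph0 cl (Suc l) (ph(i := 2 * c + (1 - pr c))) (bd(c := p b i)) (pr(c := 1 - pr c))"
    "l < bd c \<Longrightarrow> sweep n p a b ph0 cl (Suc l) (ph(i := 2 * c + pr c)) bd pr"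
proof -
  have ccl: "c \<le> cl" using le i by (simp add: c_def)
  from sw obtain W st cw where
    f1: "\<And>i. i<n \<Longrightarrow> p a i < l \<Longrightarrow> ph i = 2 * ph0 i + W i mod 2 \<and> 1 \<le> W i \<and> W i \<le> cw (ph0 i) \<and>
        p a (st (ph0 i) (W i)) \<le> p a i \<and> p a i < p b (st (ph0 i) (W i))" and
    f2: "\<And>i. i<n \<Longrightarrow> l \<le> p a i \<Longrightarrow> ph i = ph0 i" and
    f3: "\<And>c. c\<le>cl \<Longrightarrow> pr c = cw c mod 2 \<and> bd c = (if cw c = 0 then 0 else p b (st c (cw c)))" and
    f4: "\<And>c t. c\<le>cl \<Longrightarrow> 1 \<le> t \<Longrightarrow> t \<le> cw c \<Longrightarrow> st c t < n \<and> p a (st c t) < l \<and> ph0 (st c t) = c" and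
    f5: "\<And>c t. c\<le>cl \<Longrightarrow> 1 \<le> t \<Longrightarrow> t < cw c \<Longrightarrow> p b (st c t) \<le> p a (st c (Suc t))"
    unfolding sweep_def by blast
  show "ph i = c" using f2[OF i(1)] i by (simp add: c_def)
  have ka: "a < k" using ab by simp
  have other: "p a x < l" if "x < n" "p a x < Suc l" "x \<noteq> i" for x
  proof -
    have "p a x \<noteq> l" using p_inj[OF ka ka that(1) i(1)] that(3) i(2) by auto
    with that(2) show ?thesis by (simp add: less_Suc_eq)
  qed
  have pab: "l < p b i" using p_less[OF ab i(1)] i(2) by simp
  {
    assume new: "\<not> l < bd c"
    let ?W = "W(i := Suc (cw c))" and ?st = "st(c := (st c)(Suc (cw c) := i))" and ?cw = "cw(c := Suc (cw c))"
    have *: "(ph(i := 2 * c + (1 - pr c))) x = 2 * ph0 x + ?W x mod 2 \<and> 1 \<le> ?W x \<and> ?W x \<le> ?cw (ph0 x) \<and>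
        p a (?st (ph0 x) (?W x)) \<le> p a x \<and> p a x < p b (?st (ph0 x) (?W x))"
      if x: "x < n" "p a x < Suc l" for x
    proof (cases "x = i")
      case True
      have "1 - pr c = Suc (cw c) mod 2" using f3[OF ccl] by presburger
      then show ?thesis using True pab i(2) by (simp add: c_def)
    next
      case False
      then show ?thesis using f1[OF x(1) other[OF x False]] by auto
    qed
    show "sweep n p a b ph0 cl (Suc l) (ph(i := 2 * c + (1 - pr c))) (bd(c := p b i)) (pr(c := 1 - pr c))"
      unfolding sweep_def
    proof (rule exI[of _ ?W], rule exI[of _ ?st], rule exI[of _ ?cw], intro conjI, goal_cases)
      case 1
      show ?case by (intro allI impI) (rule *; assumption)
    next
      case 2
      show ?case
      proof (intro allI impI)
        fix x assume x: "x < n" "Suc l \<le> p a x"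
        then have "x \<noteq> i" using i(2) by auto
        then show "(ph(i := 2 * c + (1 - pr c))) x = ph0 x" using f2[of x] x by simp
      qed
    next
      case 3
      have "1 - cw c mod 2 = Suc (cw c) mod 2" by presburger
      then show ?case using f3 ccl by auto
    next
      case 4
      show ?case
      proof (intro allI impI)
        fix c' t assume c': "c' \<le> cl" and t: "1 \<le> t \<and> t \<le> ?cw c'"
        then show "?st c' t < n \<and> p a (?st c' t) < Suc l \<and> ph0 (?st c' t) = c'"
          using f4[OF c', of t] i by (auto simp: c_def less_Suc_eq le_Suc_eq split: if_splits)
      qed
    next
      case 5
      show ?case
      proof (intro allI impI)
        fix c' t assume c': "c' \<le> cl" and t: "1 \<le> t \<and> t < ?cw c'"
        show "p b (?st c' t) \<le> p a (?st c' (Suc t))"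
        proof (cases "c' = c \<and> t = cw c")
          case True
          then show ?thesis using f3[OF ccl] new t i(2) by auto
        next
          case False
          then show ?thesis using f5[OF c', of t] t by (auto simp: less_Suc_eq split: if_splits)
        qed
      qed
    qed
  }
  {
    assume old: "l < bd c"
    then have cw: "cw c \<noteq> 0" "l < p b (st c (cw c))" using f3[OF ccl] by (auto split: if_splits)
    let ?W = "W(i := cw c)"
    have *: "(ph(i := 2 * c + pr c)) x = 2 * ph0 x + ?W x mod 2 \<and> 1 \<le> ?W x \<and> ?W x \<le> cw (ph0 x) \<and>
        p a (st (ph0 x) (?W x)) \<le> p a x \<and> p a x < p b (st (ph0 x) (?W x))"
      if x: "x < n" "p a x < Suc l" for x
    proof (cases "x = i")
      case True
      have "p a (st c (cw c)) < l" using f4[OF ccl, of "cw c"] cw by simp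
      then show ?thesis using True cw f3[OF ccl] i(2) by (simp add: c_def)
    next
      case False
      then show ?thesis using f1[OF x(1) other[OF x False]] by auto
    qed
    show "sweep n p a b ph0 cl (Suc l) (ph(i := 2 * c + pr c)) bd pr"
      unfolding sweep_def
    proof (rule exI[of _ ?W], rule exI[of _ st], rule exI[of _ cw], intro conjI, goal_cases)
      case 1
      show ?case by (intro allI impI) (rule *; assumption)
    next
      case 2
      show ?case
      proof (intro allI impI)
        fix x assume x: "x < n" "Suc l \<le> p a x"
        then have "x \<noteq> i" using i(2) by auto
        then show "(ph(i := 2 * c + pr c)) x = ph0 x" using f2[of x] x by simp
      qed
    next
      case 3
      show ?case by (intro allI impI) (rule f3; assumption)
    next
      case 4
      show ?case
      proof (intro allI impI)
        fix c' t assume c': "c' \<le> cl" and t: "1 \<le> t \<and> t \<le> cw c'"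
        then show "st c' t < n \<and> p a (st c' t) < Suc l \<and> ph0 (st c' t) = c'"
          using f4[OF c', of t] by auto
      qed
    next
      case 5
      show ?case by (intro allI impI, elim conjE) (rule f5; assumption)
    qed
  }
qed

lemma sweep_start:
  "(\<And>c. c \<le> cl \<Longrightarrow> bd c = 0 \<and> pr c = 0) \<Longrightarrow> sweep n p a b ph0 cl 0 ph0 bd pr"
  unfolding sweep_def by (intro exI[of _ "\<lambda>_. 0"] exI[of _ "\<lambda>_ _. 0"] exI[of _ "\<lambda>_. 0"]) auto

text \<open>The b-th reads of a window may reach into the next window but not beyond it: they come
  before the b-th read of the first member of the next window, which precedes the start of the
  window after that. Hence windows of equal parity are in order, and every class is cut into only
  two.\<close>

lemma sweep_result:
  assumes sw: "sweep n p a b ph0 cl (length zs) ph bd pr" and ab: "a < b" "b < k"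
    and le: "\<And>i. i < n \<Longrightarrow> ph0 i \<le> cl"
    and mono: "\<And>c j. j < k \<Longrightarrow> monotone_read p j {i. i < n \<and> ph0 i = c}"
  shows "\<And>i. i < n \<Longrightarrow> ph i div 2 = ph0 i" "\<And>c. clustered p a b {i. i < n \<and> ph i = c}"
proof -
  have ka: "a < k" using ab by simp
  have all: "p a i < length zs" if "i < n" for i using p_spec(1)[OF ka that] .
  from sw obtain W st cw where
    A: "\<forall>i<n. p a i < length zs \<longrightarrow> ph i = 2 * ph0 i + W i mod 2 \<and> 1 \<le> W i \<and> W i \<le> cw (ph0 i) \<and>
        p a (st (ph0 i) (W i)) \<le> p a i \<and> p a i < p b (st (ph0 i) (W i))" and
    B: "\<forall>c\<le>cl. \<forall>t. 1 \<le> t \<and> t \<le> cw c \<longrightarrow> st c t < n \<and> p a (st c t) < length zs \<and> ph0 (st c t) = c" and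
    C: "\<forall>c\<le>cl. \<forall>t. 1 \<le> t \<and> t < cw c \<longrightarrow> p b (st c t) \<le> p a (st c (Suc t))"
    unfolding sweep_def by (elim exE conjE) (rule that; assumption)
  have 1: "ph i = 2 * ph0 i + W i mod 2 \<and> 1 \<le> W i \<and> W i \<le> cw (ph0 i) \<and>
        p a (st (ph0 i) (W i)) \<le> p a i \<and> p a i < p b (st (ph0 i) (W i))" if "i < n" for i
    using A that all[OF that] by simp
  have 4: "st c t < n \<and> ph0 (st c t) = c" if "c \<le> cl" "1 \<le> t" "t \<le> cw c" for c t using B that by simp
  have 5: "p b (st c t) \<le> p a (st c (Suc t))" if "c \<le> cl" "1 \<le> t" "t < cw c" for c t using C that by simp
  show ph: "ph i div 2 = ph0 i" if "i < n" for i using 1[OF that] by simp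
  fix c
  show "clustered p a b {i. i < n \<and> ph i = c}"
    unfolding clustered_def
  proof (intro exI[of _ W] ballI)
    fix i i' assume "i \<in> {i. i < n \<and> ph i = c}" "i' \<in> {i. i < n \<and> ph i = c}"
    then have i: "i < n" "i' < n" "ph i = c" "ph i' = c" by auto
    let ?d = "c div 2"
    have d: "ph0 i = ?d" "ph0 i' = ?d" "?d \<le> cl" using ph[OF i(1)] ph[OF i(2)] i le[OF i(1)] by auto
    have par: "W i mod 2 = W i' mod 2" using 1[OF i(1)] 1[OF i(2)] i d by simp
    let ?S = "{i. i < n \<and> ph0 i = ?d}"
    \<comment> \<open>If some b-th read of the old class does not come after some a-th read of it,
      then both kinds of reads have the same direction.\<close>
    have same: "p b x < p b y" if crossing: "\<not> (\<forall>x\<in>?S. \<forall>y\<in>?S. p a x < p b y)" and xy: "x \<in> ?S" "y \<in> ?S" "p a x < p a y" for x y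
    proof (rule ccontr)
      assume neg: "\<not> p b x < p b y"
      have xn: "x \<noteq> y" using xy by auto
      have kb: "b < k" by (rule ab)
      have ma: "monotone_read p a ?S" and mb: "monotone_read p b ?S" using mono ab by auto
      have opp: "\<And>u v. u \<in> ?S \<Longrightarrow> v \<in> ?S \<Longrightarrow> p a u < p a v \<Longrightarrow> p b v < p b u"
        using ma
        unfolding monotone_read_def
      proof
        fix u v assume uv: "u \<in> ?S" "v \<in> ?S" "p a u < p a v"
          and inc: "\<forall>i\<in>?S. \<forall>i'\<in>?S. i < i' \<longrightarrow> p a i < p a i'"
        have "x < y" "u < v" using increasing_order[OF inc] xy uv by blast+
        with mb neg xy uv show "p b v < p b u" unfolding monotone_read_def by blast
      next
        fix u v assume uv: "u \<in> ?S" "v \<in> ?S" "p a u < p a v"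
          and dec: "\<forall>i\<in>?S. \<forall>i'\<in>?S. i < i' \<longrightarrow> p a i' < p a i"
        have "y < x" "v < u" using decreasing_order[OF dec] xy uv by blast+
        with mb neg xy uv show "p b v < p b u" unfolding monotone_read_def by blast
      qed
      \<comment> \<open>Suppose the directions are opposite. Of two members the one with the later
        a-th read has the earlier b-th read, so every a-th read precedes every b-th read, contrary
        to \<open>crossing\<close>.\<close>
      have "p a u < p b v" if uv: "u \<in> ?S" "v \<in> ?S" for u v
      proof (cases "p a v < p a u")
        case True
        have "p a u < p b u" using p_less[OF ab, of u] uv by simp
        also have "p b u < p b v" using opp[OF uv(2,1) True] .
        finally show ?thesis .
      next
        case False
        have "p a v < p b v" using p_less[OF ab, of v] uv by simp
        with False show ?thesis by simp
      qed
      with crossing show False by blast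
    qed
    have inS: "i \<in> ?S" "i' \<in> ?S" using i d by auto
    have stS: "st ?d t \<in> ?S" if "1 \<le> t" "t \<le> cw ?d" for t using 4[OF d(3) that] by auto
    show "(W i = W i' \<longrightarrow> p a i < p b i') \<and> (W i < W i' \<longrightarrow> p b i < p a i')"
    proof (intro conjI impI)
      assume eq: "W i = W i'"
      let ?s = "st ?d (W i)"
      show "p a i < p b i'"
      proof (cases "\<forall>x\<in>?S. \<forall>y\<in>?S. p a x < p b y")
        case True
        with inS show ?thesis by blast
      next
        case False
        have lt: "p a i < p b ?s" and le': "p a ?s \<le> p a i'" using 1[OF i(1)] 1[OF i(2)] d eq by auto
        have sS: "?s \<in> ?S" using stS 1[OF i(1)] d by auto
        have "p b ?s \<le> p b i'"
        proof (cases "p a ?s = p a i'")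
          case True
          then have "?s = i'" using p_inj[OF ka ka, of ?s i'] sS i by auto
          then show ?thesis by simp
        next
          case neq: False
          with le' have "p a ?s < p a i'" by simp
          from same[OF False sS inS(2) this] show ?thesis by simp
        qed
        with lt show ?thesis by simp
      qed
    next
      assume less: "W i < W i'"
      \<comment> \<open>Equal parity leaves at least one whole window between \<open>i\<close> and
        \<open>i'\<close>; its first member \<open>?s1\<close> is the barrier in the following
        estimates.\<close>
      with par have two: "W i + 2 \<le> W i'" by presburger
      have Wi: "1 \<le> W i" "W i' \<le> cw ?d" using 1[OF i(1)] 1[OF i(2)] d by auto
      let ?s1 = "st ?d (Suc (W i))" and ?s2 = "st ?d (Suc (Suc (W i)))"
      have s: "?s1 \<in> ?S" "?s2 \<in> ?S" using two Wi by (intro stS; simp)+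
      have b12: "p b ?s1 \<le> p a ?s2" using 5[OF d(3), of "Suc (W i)"] two Wi by simp
      have mono_st: "p a (st ?d t) \<le> p a (st ?d (t + e))" if "1 \<le> t" "t + e \<le> cw ?d" for t e
        using that
      proof (induction e)
        case (Suc e)
        have "p a (st ?d (t + e)) < p b (st ?d (t + e))" using p_less[OF ab, of "st ?d (t + e)"] 4[OF d(3), of "t + e"] Suc.prems by simp
        also have "\<dots> \<le> p a (st ?d (Suc (t + e)))" using 5[OF d(3), of "t + e"] Suc.prems by simp
        finally show ?case using Suc by simp
      qed simp
      have "p a ?s2 \<le> p a (st ?d (W i'))"
      proof -
        have "Suc (Suc (W i)) + (W i' - Suc (Suc (W i))) = W i'" using two by simp
        with mono_st[of "Suc (Suc (W i))" "W i' - Suc (Suc (W i))"] Wi show ?thesis by (simp only:)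
      qed
      also have "\<dots> \<le> p a i'" using 1[OF i(2)] d by simp
      finally have s2i': "p a ?s2 \<le> p a i'" .
      have crossing: "\<not> (\<forall>x\<in>?S. \<forall>y\<in>?S. p a x < p b y)"
      proof
        assume "\<forall>x\<in>?S. \<forall>y\<in>?S. p a x < p b y"
        then have "p a ?s2 < p b ?s1" using s by blast
        with b12 show False by simp
      qed
      have "p a i < p b (st ?d (W i))" using 1[OF i(1)] d by simp
      also have "\<dots> \<le> p a ?s1" using 5[OF d(3), of "W i"] two Wi by simp
      finally have "p b i < p b ?s1" using same[OF crossing inS(1) s(1)] by simp
      with b12 s2i' show "p b i < p a i'" by simp
    qed
  qed
qed

end

text \<open>Array 41 holds, for every old class, the time at which its open window ends, and array
  42 the parity of this window. A rank is still in its old class when it is met, since each rank has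
  only one a-th read.\<close>

definition Sweep_step :: prog where
  "Sweep_step = If (NEq (NGet 25 (V 14)) (V 11)) (37 ::= NGet 24 (V 14) ;; 39 ::= NGet 27 (V 37) ;;
     If (NLess (V 14) (NGet 41 (V 39))) Skip (NSet 41 (V 39) (NGet 26 (NAdd (V 40) (V 37))) ;;
       NSet 42 (V 39) (NSub (NConst 1) (NGet 42 (V 39)))) ;;
     NSet 27 (V 37) (NAdd (NAdd (V 39) (V 39)) (NGet 42 (V 39)))) Skip"

definition Sweep :: prog where
  "Sweep = Mul 40 (V 12) (V 5) ;;
     For 13 (NAdd (V 32) (NConst 1)) (NSet 41 (V 13) (NConst 0) ;; NSet 42 (V 13) (NConst 0)) ;;
     For 14 (V 9) Sweep_step ;; 32 ::= NAdd (NAdd (V 32) (V 32)) (NConst 1)"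

lemma writes_Sweep_step [simp]: "nwrites Sweep_step = {27, 37, 39, 41, 42}" "fwrites Sweep_step = {}"
  by (auto simp: Sweep_step_def)

lemma writes_Sweep [simp]: "nwrites Sweep = {2, 3, 13, 14, 27, 32, 37, 39, 40, 41, 42}" "fwrites Sweep = {}"
  by (auto simp: Sweep_def)

lemma (in read_positions) wp_Sweep:
  fixes s :: "'a::field mem"
  assumes n: "nmem s 5 0 = n" and b: "nmem s 12 0 = b" "b \<le> M" and a: "nmem s 11 0 = a"
    and len: "nmem s 9 0 = length zs" "length zs \<le> M" and cl: "nmem s 32 0 < M"
    and yr: "\<forall>l<length zs. nmem s 24 l = first_rank zs (zs ! l) \<and> nmem s 25 l = occurrence zs l"
    and p: "p = (\<lambda>j i. nmem s 26 (j * n + i))" and ab: "a < b" "b < k"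
    and le: "\<And>i. i < n \<Longrightarrow> nmem s 27 i \<le> nmem s 32 0"
  shows "wp M Sweep (\<lambda>s'. (\<exists>bd pr. sweep n p a b (nmem s 27) (nmem s 32 0) (length zs) (nmem s' 27) bd pr) \<and>
    nmem s' 32 0 = 2 * nmem s 32 0 + 1) s"
proof -
  let ?cl = "nmem s 32 0" and ?ph0 = "nmem s 27"
  have main: "wp M (For 14 (V 9) Sweep_step) (\<lambda>s'. (\<exists>bd pr. sweep n p a b ?ph0 ?cl (length zs) (nmem s' 27) bd pr) \<and>
      nmem s' 32 0 = ?cl) s0"
    if s0: "nmem s0 5 0 = n" "nmem s0 11 0 = a" "nmem s0 9 0 = length zs" "nmem s0 32 0 = ?cl" "nmem s0 24 = nmem s 24"
      "nmem s0 25 = nmem s 25" "nmem s0 26 = nmem s 26" "nmem s0 27 = ?ph0" "nmem s0 40 0 = b * n"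
      and z: "\<And>c. c \<le> ?cl \<Longrightarrow> nmem s0 41 c = 0 \<and> nmem s0 42 c = 0"
    for s0 :: "'a mem"
  proof (rule wp_For[where n = "length zs" and I = "\<lambda>l s'. sweep n p a b ?ph0 ?cl l (nmem s' 27) (nmem s' 41) (nmem s' 42)"], goal_cases)
    case 5
    show ?case using sweep_start[OF z] s0 by simp
  next
    case (6 l s1)
    note fr = agreeD2(1)[OF 6(2)]
    have s1: "nmem s1 11 0 = a" "nmem s1 24 l = first_rank zs (zs ! l)" "nmem s1 25 l = occurrence zs l"
      "nmem s1 26 = nmem s 26" "nmem s1 40 0 = b * n" "nmem s1 14 0 = l"
      using fr s0 yr 6(1,3) by simp_all
    let ?i = "first_rank zs (zs ! l)"
    have i: "?i < n" using rank_less nth_less 6(1) by blast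
    show ?case
    proof (cases "occurrence zs l = a")
      case False
      have "sweep n p a b ?ph0 ?cl (Suc l) (nmem s1 27) (nmem s1 41) (nmem s1 42)"
      proof (rule sweep_idle[OF 6(4)])
        fix x assume x: "x < n"
        have "a < k" using ab by simp
        from p_spec[OF this x] False show "p a x \<noteq> l" by auto
      qed
      then show ?thesis using False unfolding Sweep_step_def by (simp add: s1)
    next
      case True
      have pi: "p a ?i = l" using read_positions.p[OF read_positions_axioms 6(1)] True by simp
      note sr = sweep_read[OF 6(4) i pi ab le]
      have pb: "p b ?i = nmem s 26 (b * n + ?i)" by (simp add: p)
      show ?thesis
      proof (cases "l < nmem s1 41 (?ph0 ?i)")
        case less: True
        with sr(3)[OF _ less] sr(1) True show ?thesis unfolding Sweep_step_def by (simp add: s1 mult_2)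
      next
        case nless: False
        with sr(2)[OF _ nless] sr(1) True show ?thesis unfolding Sweep_step_def by (simp add: s1 mult_2 pb)
      qed
    qed
  next
    case (7 s1)
    have "nmem s1 32 0 = ?cl" using agreeD2(1)[OF 7(1)] s0 by simp
    with 7(3) show ?case by blast
  qed (use s0 len in auto)
  have start: "wp M (For 13 (NAdd (V 32) (NConst 1)) (NSet 41 (V 13) (NConst 0) ;; NSet 42 (V 13) (NConst 0)))
    (\<lambda>s'. \<forall>c\<le>?cl. nmem s' 41 c = 0 \<and> nmem s' 42 c = 0) s0" if s0: "nmem s0 32 0 = ?cl" for s0 :: "'a mem"
  proof (rule wp_For[where n = "Suc ?cl" and I = "\<lambda>j s'. \<forall>c<j. nmem s' 41 c = 0 \<and> nmem s' 42 c = 0"], goal_cases)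
    case (6 j s')
    then show ?case by (simp add: less_Suc_eq)
  next
    case (7 s')
    then show ?case by (simp add: less_Suc_eq_le)
  qed (use s0 cl in auto)
  let ?Q = "\<lambda>s'. (\<exists>bd pr. sweep n p a b ?ph0 ?cl (length zs) (nmem s' 27) bd pr) \<and> nmem s' 32 0 = 2 * ?cl + 1"
  let ?s1 = "upn (upn (upn s 3 0 (b * n)) 2 0 b) 40 0 (b * n)"
  have "wp M (For 13 (NAdd (V 32) (NConst 1)) (NSet 41 (V 13) (NConst 0) ;; NSet 42 (V 13) (NConst 0)) ;;
     For 14 (V 9) Sweep_step ;; 32 ::= NAdd (NAdd (V 32) (V 32)) (NConst 1)) ?Q ?s1"
    unfolding wp.simps(4)
  proof (rule wp_use[OF start])
    show "nmem ?s1 32 0 = ?cl" by simp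
    fix s2 :: "'a mem" assume z: "\<forall>c\<le>?cl. nmem s2 41 c = 0 \<and> nmem s2 42 c = 0"
      and ag: "agree (nwrites (For 13 (NAdd (V 32) (NConst 1)) (NSet 41 (V 13) (NConst 0) ;; NSet 42 (V 13) (NConst 0))))
        (fwrites (For 13 (NAdd (V 32) (NConst 1)) (NSet 41 (V 13) (NConst 0) ;; NSet 42 (V 13) (NConst 0)))) ?s1 s2"
    note fr = agreeD2(1)[OF ag]
    show "wp M (For 14 (V 9) Sweep_step) (wp M (32 ::= NAdd (NAdd (V 32) (V 32)) (NConst 1)) ?Q) s2"
    proof (rule wp_mono[OF main])
      fix s3 :: "'a mem" assume "(\<exists>bd pr. sweep n p a b ?ph0 ?cl (length zs) (nmem s3 27) bd pr) \<and> nmem s3 32 0 = ?cl"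
      then show "wp M (32 ::= NAdd (NAdd (V 32) (V 32)) (NConst 1)) ?Q s3" by simp
    qed (use fr z n a len in auto)
  qed
  then show ?thesis unfolding Sweep_def using b n by (simp add: wp_Mul_eval)
qed

definition Parity :: prog where
  "Parity = For 11 (V 8) (For 12 (V 8) (If (NLess (V 11) (V 12)) Sweep Skip))"

lemma writes_Parity [simp]: "nwrites Parity = {2, 3, 11, 12, 13, 14, 27, 32, 37, 39, 40, 41, 42}" "fwrites Parity = {}"
  by (auto simp: Parity_def)

text \<open>Every pass refines the classes, and monotonicity and windows are inherited by subsets,
  so earlier passes are not spoilt. A pass doubles the number of classes; the exponent
  \<open>k * k\<close> also counts the idle passes with \<open>a \<ge> b\<close>.\<close>

lemma (in read_positions) wp_Parity:
  fixes s :: "'a::field mem"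
  assumes n: "nmem s 5 0 = n" and kk: "nmem s 8 0 = k" "k \<le> M"
    and len: "nmem s 9 0 = length zs" "length zs \<le> M" and cl: "(nmem s 32 0 + 1) * 2 ^ (k * k) \<le> M"
    and yr: "\<forall>l<length zs. nmem s 24 l = first_rank zs (zs ! l) \<and> nmem s 25 l = occurrence zs l"
    and p: "p = (\<lambda>j i. nmem s 26 (j * n + i))"
    and le: "\<And>i. i < n \<Longrightarrow> nmem s 27 i \<le> nmem s 32 0"
    and mono: "\<And>c j. j < k \<Longrightarrow> monotone_read p j {i. i < n \<and> nmem s 27 i = c}"
  shows "wp M Parity (\<lambda>s'. (\<forall>i<n. nmem s' 27 i \<le> nmem s' 32 0) \<and>
    nmem s' 32 0 + 1 \<le> (nmem s 32 0 + 1) * 2 ^ (k * k) \<and>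
    (\<forall>c. regular k p {i. i < n \<and> nmem s' 27 i = c})) s"
proof -
  let ?cl0 = "nmem s 32 0"
  let ?I = "\<lambda>a b s'. (\<forall>i<n. nmem s' 27 i \<le> nmem s' 32 0) \<and> nmem s' 32 0 + 1 \<le> (?cl0 + 1) * 2 ^ (a * k + b) \<and>
    (\<forall>c. \<forall>j<k. monotone_read p j {i. i < n \<and> nmem s' 27 i = c}) \<and>
    (\<forall>a' b'. a' < b' \<and> b' < k \<and> (a' < a \<or> a' = a \<and> b' < b) \<longrightarrow> (\<forall>c. clustered p a' b' {i. i < n \<and> nmem s' 27 i = c}))"
  show ?thesis unfolding Parity_def
  proof (rule wp_For[where n = k and I = "\<lambda>a. ?I a 0"], goal_cases)
    case 5
    show ?case using le mono by simp
  next
    case (6 a s1)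
    note fr1 = agreeD2(1)[OF 6(2)]
    have s1: "nmem s1 5 0 = n" "nmem s1 8 0 = k" "nmem s1 9 0 = length zs" "nmem s1 24 = nmem s 24" "nmem s1 25 = nmem s 25"
      "nmem s1 26 = nmem s 26" "nmem s1 11 0 = a"
      using fr1 n kk len 6(3) by simp_all
    show ?case
    proof (rule wp_For[where n = k and I = "?I a"], goal_cases)
      case 5
      show ?case using 6(4) by simp
    next
      case (6 b s2)
      note fr2 = agreeD2(1)[OF 6(2)]
      have s2: "nmem s2 5 0 = n" "nmem s2 8 0 = k" "nmem s2 9 0 = length zs" "nmem s2 24 = nmem s 24" "nmem s2 25 = nmem s 25"
        "nmem s2 26 = nmem s 26" "nmem s2 11 0 = a" "nmem s2 12 0 = b"
        using fr2 s1 6(3) by simp_all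
      note I = 6(4)
      show ?case
      proof (cases "a < b")
        case False
        have "nmem s2 32 0 + 1 \<le> (?cl0 + 1) * 2 ^ (a * k + b)" using I by blast
        also have "\<dots> \<le> (?cl0 + 1) * 2 ^ (a * k + Suc b)" by simp
        finally have "nmem s2 32 0 + 1 \<le> (?cl0 + 1) * 2 ^ (a * k + Suc b)" .
        moreover have "clustered p a' b' {i. i < n \<and> nmem s2 27 i = c}"
          if "a' < b'" "b' < k" "a' < a \<or> a' = a \<and> b' < Suc b" for a' b' c
        proof -
          have "a' < a \<or> a' = a \<and> b' < b" using that False by auto
          then show ?thesis using I that by blast
        qed
        ultimately have "?I a (Suc b) s2" using I by blast
        then show ?thesis using False by (simp add: s2)
      next
        case True
        have ab: "a * k + Suc b \<le> k * k"
        proof -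
          have "a * k + Suc b \<le> a * k + k" using 6(1) by simp
          also have "\<dots> = Suc a * k" by simp
          also have "\<dots> \<le> k * k" using \<open>a < k\<close> by (intro mult_right_mono) auto
          finally show ?thesis .
        qed
        have "2 * (nmem s2 32 0 + 1) \<le> 2 * ((?cl0 + 1) * 2 ^ (a * k + b))" using I by simp
        also have "\<dots> = (?cl0 + 1) * 2 ^ (a * k + Suc b)" by simp
        finally have cl2: "2 * (nmem s2 32 0 + 1) \<le> (?cl0 + 1) * 2 ^ (a * k + Suc b)" .
        also have "\<dots> \<le> (?cl0 + 1) * 2 ^ (k * k)" using ab by (intro mult_left_mono power_increasing) auto
        also note cl
        finally have "2 * (nmem s2 32 0 + 1) \<le> M" .
        then have clM: "nmem s2 32 0 < M" by arith
        have "wp M Sweep (\<lambda>s3. ?I a (Suc b) s3) s2"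
        proof (rule wp_mono[OF wp_Sweep[where a = a and b = b]])
          fix s3 :: "'a mem" assume post: "(\<exists>bd pr. sweep n p a b (nmem s2 27) (nmem s2 32 0) (length zs) (nmem s3 27) bd pr) \<and>
            nmem s3 32 0 = 2 * nmem s2 32 0 + 1"
          then obtain bd pr where sw: "sweep n p a b (nmem s2 27) (nmem s2 32 0) (length zs) (nmem s3 27) bd pr" by blast
          have le2: "\<And>i. i < n \<Longrightarrow> nmem s2 27 i \<le> nmem s2 32 0" using I by blast
          have mono2: "\<And>c j. j < k \<Longrightarrow> monotone_read p j {i. i < n \<and> nmem s2 27 i = c}" using I by blast
          have res: "\<And>i. i < n \<Longrightarrow> nmem s3 27 i div 2 = nmem s2 27 i" "\<And>c. clustered p a b {i. i < n \<and> nmem s3 27 i = c}"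
            by (rule sweep_result[OF sw True 6(1)]; use le2 mono2 in blast)+
          have sub: "{i. i < n \<and> nmem s3 27 i = c} \<subseteq> {i. i < n \<and> nmem s2 27 i = c div 2}" for c
            using res(1) by auto
          show "?I a (Suc b) s3"
          proof (intro conjI allI impI)
            fix i assume i: "i < n"
            show "nmem s3 27 i \<le> nmem s3 32 0" using res(1)[OF i] le2[OF i] post by linarith
          next
            show "nmem s3 32 0 + 1 \<le> (?cl0 + 1) * 2 ^ (a * k + Suc b)" using cl2 post by simp
          next
            fix c j assume "j < k"
            then show "monotone_read p j {i. i < n \<and> nmem s3 27 i = c}"
              by (rule monotone_read_subset[OF mono2 sub])
          next
            fix a' b' c assume *: "a' < b' \<and> b' < k \<and> (a' < a \<or> a' = a \<and> b' < Suc b)"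
            show "clustered p a' b' {i. i < n \<and> nmem s3 27 i = c}"
            proof (cases "a' = a \<and> b' = b")
              case True
              then show ?thesis using res(2) by blast
            next
              case False
              then have "clustered p a' b' {i. i < n \<and> nmem s2 27 i = c div 2}"
                using I * by (auto simp: less_Suc_eq)
              then show ?thesis by (rule clustered_subset[OF _ sub])
            qed
          qed
        next
          show "b \<le> M" using 6(1) kk by simp
          show "\<And>i. i < n \<Longrightarrow> nmem s2 27 i \<le> nmem s2 32 0" using I by blast
        qed (use s2 len yr p True 6(1) clM in auto)
        then show ?thesis using True by (simp add: s2)
      qed
    next
      case (7 s2)
      from 7(3) have "?I (Suc a) 0 s2"
        by (auto simp: less_Suc_eq algebra_simps)
      then show ?case by simp
    qed (use s1 kk in auto)
  next
    case (7 s')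
    have "regular k p {i. i < n \<and> nmem s' 27 i = c}" for c
      using 7(3) unfolding regular_def monotone_read_def clustered_def by (meson less_trans)
    with 7(3) show ?case by simp
  qed (use kk in auto)
qed

section \<open>Parameters of the generator\<close>

text \<open>The dyadic levels are numbered from 0, hence one more than the logarithm of
  \<open>n\<close> rounded up.\<close>

definition levels :: "nat \<Rightarrow> nat" where "levels n = Suc (LEAST j. n \<le> 2 ^ j)"

lemma levels_props: "n \<le> 2 ^ (levels n - 1)" "levels n = Suc j \<Longrightarrow> j > 0 \<Longrightarrow> 2 ^ (j - 1) < n"
proof -
  have ex: "n \<le> 2 ^ n" by (rule less_imp_le[OF less_exp])
  show "n \<le> 2 ^ (levels n - 1)" unfolding levels_def using LeastI[of "\<lambda>j. n \<le> 2 ^ j", OF ex] by simp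
  assume j: "levels n = Suc j" "j > 0"
  then have "j - 1 < (LEAST j. n \<le> 2 ^ j)" by (simp add: levels_def)
  from not_less_Least[OF this] show "2 ^ (j - 1) < n" by simp
qed

lemma levels_eqI: "n \<le> 2 ^ j \<Longrightarrow> (j = 0 \<or> 2 ^ (j - 1) < n) \<Longrightarrow> levels n = Suc j"
  unfolding levels_def
proof (rule arg_cong[of _ _ Suc], rule Least_equality)
  fix y assume a: "n \<le> 2 ^ j" "j = 0 \<or> 2 ^ (j - 1) < n" "n \<le> 2 ^ y"
  show "j \<le> y"
  proof (rule ccontr)
    assume "\<not> j \<le> y"
    then have "y \<le> j - 1" "j \<noteq> 0" by auto
    then have "(2::nat) ^ y \<le> 2 ^ (j - 1)" by (intro power_increasing) auto
    with a \<open>j \<noteq> 0\<close> show False by linarith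
  qed
qed

text \<open>\<open>N\<close> arises from \<open>(B ^ k) ^ k\<close> by four squarings. Every class,
  including class 0, has at each level one digit for a modulus and one for an element, hence the
  doubling in scalar 48.\<close>

definition Params :: prog where
  "Params = 43 ::= NConst 1 ;; 44 ::= NConst 1 ;;
     For 11 (V 5) (If (NLess (V 44) (V 5)) (44 ::= NAdd (V 44) (V 44) ;; 43 ::= NAdd (V 43) (NConst 1)) Skip) ;;
     45 ::= NConst 1 ;; For 11 (V 8) (Mul 45 (V 45) (V 7)) ;;
     46 ::= NConst 1 ;; For 11 (V 8) (Mul 46 (V 46) (V 45)) ;;
     Mul 46 (V 46) (V 46) ;; Mul 46 (V 46) (V 46) ;; Mul 46 (V 46) (V 46) ;; Mul 46 (V 46) (V 46) ;;
     Mul 47 (NAdd (V 32) (NConst 1)) (V 43) ;; 48 ::= NAdd (V 47) (V 47) ;;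
     49 ::= NConst 1 ;; For 11 (V 48) (Mul 49 (V 49) (V 46))"

lemma writes_Params [simp]: "nwrites Params = {2, 3, 11, 43, 44, 45, 46, 47, 48, 49}" "fwrites Params = {}"
  by (auto simp: Params_def)

lemma wp_NSetI: "nval s e1 = i \<Longrightarrow> nval s e2 = v \<Longrightarrow> Q (upn s x i v) \<Longrightarrow> wp M (NSet x e1 e2) Q s"
  by simp

lemma wp_For_power:
  fixes s :: "'a::field mem"
  assumes z: "nmem s z 0 = 1" and e: "nval s e = k" "nreads e \<inter> {2, 3, 11, z} = {}" and b: "nmem s y 0 = b"
    and le: "k \<le> M" "b ^ k \<le> M" "b \<ge> 1" and ne: "z \<notin> {2, 3, 11}" "y \<notin> {2, 3, 11, z}"
  shows "wp M (For 11 e (Mul z (V z) (V y))) (\<lambda>s'. nmem s' z 0 = b ^ k) s"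
proof (rule wp_For[where n = k and I = "\<lambda>j s'. nmem s' z 0 = b ^ j"], goal_cases)
  case (6 j s')
  have "nmem s' y 0 = b" using agreeD2(1)[OF 6(2)] ne b by simp
  moreover have "b ^ j \<le> M" using le 6(1) power_increasing[of j k b] by linarith
  ultimately show ?case using 6(4) ne by (simp add: wp_Mul_eval)
qed (use assms in auto)

lemma wp_Params:
  fixes s :: "'a::field mem"
  assumes n: "nmem s 5 0 = n" "n \<le> M" "1 \<le> n" and k: "nmem s 8 0 = k" "k \<le> M" "1 \<le> k" and B: "nmem s 7 0 = B" "B \<ge> 1"
    and N: "N = B ^ (16 * (k * k))" and cl: "nmem s 32 0 = cl" "Suc cl \<le> M"
    and K: "K = 2 * (Suc cl * levels n)" "K \<le> M" and NM: "N \<le> M" "N ^ K \<le> M"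
  shows "wp M Params (\<lambda>s'. nmem s' 43 0 = levels n \<and> nmem s' 45 0 = B ^ k \<and> nmem s' 46 0 = N \<and>
    nmem s' 47 0 = Suc cl * levels n \<and> nmem s' 48 0 = K \<and> nmem s' 49 0 = N ^ K) s" (is "wp M Params ?Q s")
proof -
  let ?s0 = "upn (upn s 43 0 1) 44 0 1"
  let ?L = "For 11 (V 5) (If (NLess (V 44) (V 5)) (44 ::= NAdd (V 44) (V 44) ;; 43 ::= NAdd (V 43) (NConst 1)) Skip)"
  have lev: "wp M ?L (\<lambda>s'. nmem s' 43 0 = levels n) ?s0"
  proof (rule wp_For[where n = n and I = "\<lambda>t s'. \<exists>j. nmem s' 43 0 = Suc j \<and> nmem s' 44 0 = 2 ^ j \<and>
      (n \<le> 2 ^ j \<or> j \<ge> t) \<and> (j = 0 \<or> 2 ^ (j - 1) < n)"], goal_cases)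
    case 5
    show ?case by (intro exI[of _ 0]) simp
  next
    case (6 t s')
    then obtain j where j: "nmem s' 43 0 = Suc j" "nmem s' 44 0 = 2 ^ j" "n \<le> 2 ^ j \<or> j \<ge> t" "j = 0 \<or> 2 ^ (j - 1) < n" by blast
    have n': "nmem s' 5 0 = n" using agreeD2(1)[OF 6(2)] n by simp
    show ?case
    proof (cases "2 ^ j < n")
      case True
      then have "\<exists>j'. Suc (Suc j) = Suc j' \<and> 2 ^ j + 2 ^ j = (2::nat) ^ j' \<and> (n \<le> 2 ^ j' \<or> j' \<ge> Suc t) \<and> (j' = 0 \<or> 2 ^ (j' - 1) < n)"
        using j by (intro exI[of _ "Suc j"]) auto
      then show ?thesis using True n' j(1,2) by simp
    next
      case False
      then have "\<exists>j'. Suc j = Suc j' \<and> 2 ^ j = (2::nat) ^ j' \<and> (n \<le> 2 ^ j' \<or> j' \<ge> Suc t) \<and> (j' = 0 \<or> 2 ^ (j' - 1) < n)"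
        using j by (intro exI[of _ j]) auto
      then show ?thesis using False n' j(1,2) by simp
    qed
  next
    case (7 s')
    then obtain j where j: "nmem s' 43 0 = Suc j" "n \<le> 2 ^ j \<or> j \<ge> n" "j = 0 \<or> 2 ^ (j - 1) < n" by blast
    have "n \<le> 2 ^ j"
    proof (cases "j \<ge> n")
      case True
      then have "n \<le> j" by simp
      also have "j \<le> 2 ^ j" by (rule less_imp_le[OF less_exp])
      finally show ?thesis .
    qed (use j in auto)
    with j show ?case by (simp add: levels_eqI)
  qed (use n in auto)
  have G: "B ^ k \<le> N" unfolding N by (intro power_increasing B) (cases k, auto)
  have pow: "(B ^ k) ^ k \<le> N" unfolding N power_mult[symmetric] by (intro power_increasing B) auto
  \<comment> \<open>This bounds the intermediate squares by the last one.\<close>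
  have sq: "x * x \<le> N \<Longrightarrow> x \<le> N" for x :: nat by (cases x) auto
  have N16: "N = (let a = (B ^ k) ^ k; b = a * a; c = b * b; d = c * c in d * d)"
    unfolding N Let_def power_mult[symmetric] power_add[symmetric]
    by (rule arg_cong[of _ _ "\<lambda>x. B ^ x"]) simp
  define x1 where "x1 = (B ^ k) ^ k"
  define x2 where "x2 = x1 * x1"
  define x3 where "x3 = x2 * x2"
  define x4 where "x4 = x3 * x3"
  have x: "N = x4 * x4" unfolding N16 x4_def x3_def x2_def x1_def Let_def ..
  have x4N: "x4 \<le> N" by (rule sq) (simp only: x)
  have x3N: "x3 \<le> N" by (rule sq) (use x4N in \<open>simp only: x4_def\<close>)
  have x2N: "x2 \<le> N" by (rule sq) (use x3N in \<open>simp only: x3_def\<close>)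
  have x4: "x4 \<le> M" and x3: "x3 \<le> M" and x2: "x2 \<le> M" using x4N x3N x2N NM(1) by linarith+
  have x1: "x1 \<le> M" using pow NM by (simp add: x1_def)
  have N1: "N \<ge> 1" using B by (simp add: N)
  let ?L1 = "For 11 (V 8) (Mul 45 (V 45) (V 7))" and ?L2 = "For 11 (V 8) (Mul 46 (V 46) (V 45))"
    and ?L3 = "For 11 (V 48) (Mul 49 (V 49) (V 46))" and ?sq = "wp M (Mul 46 (V 46) (V 46))"
  let ?R3 = "?sq (?sq (?sq (?sq (wp M (Mul 47 (NAdd (V 32) (NConst 1)) (V 43)) (wp M (48 ::= NAdd (V 47) (V 47))
    (wp M (49 ::= NConst 1) (wp M ?L3 ?Q)))))))"
  let ?R2 = "wp M (46 ::= NConst 1) (wp M ?L2 ?R3)"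
  show ?thesis
    unfolding Params_def wp.simps(4)
  proof (simp only: wp_NSet[OF refl refl] nval.simps, rule wp_use[OF lev])
    fix s1 :: "'a mem" assume s1: "nmem s1 43 0 = levels n" and ag1: "agree (nwrites ?L) (fwrites ?L) ?s0 s1"
    note fr1 = agreeD2(1)[OF ag1]
    let ?s1 = "upn s1 45 0 1"
    have f1: "nmem s1 8 0 = k" "nmem s1 7 0 = B" "nmem s1 32 0 = cl" using fr1 k B cl by simp_all
    have w1: "wp M ?L1 (\<lambda>s'. nmem s' 45 0 = B ^ k) ?s1"
      by (rule wp_For_power) (use f1 k B G NM in auto)
    show "wp M (45 ::= NConst 1) (wp M ?L1 ?R2) s1"
    proof (rule wp_NSetI[where i = 0 and v = 1], simp, simp, rule wp_use[OF w1])
      fix s2 :: "'a mem" assume s2: "nmem s2 45 0 = B ^ k"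
        and ag2: "agree (nwrites ?L1) (fwrites ?L1) ?s1 s2"
      note fr2 = agreeD2(1)[OF ag2]
      let ?s2 = "upn s2 46 0 1"
      have f2: "nmem s2 8 0 = k" "nmem s2 32 0 = cl" "nmem s2 43 0 = levels n" using fr2 f1 s1 by simp_all
      have w2: "wp M ?L2 (\<lambda>s'. nmem s' 46 0 = x1) ?s2"
        unfolding x1_def by (rule wp_For_power) (use f2 s2 k B pow NM in auto)
      show "?R2 s2"
      proof (rule wp_NSetI[where i = 0 and v = 1], simp, simp, rule wp_use[OF w2])
        fix s3 :: "'a mem" assume s3: "nmem s3 46 0 = x1"
          and ag3: "agree (nwrites ?L2) (fwrites ?L2) ?s2 s3"
        note fr3 = agreeD2(1)[OF ag3]
        have f3: "nmem s3 32 0 = cl" "nmem s3 43 0 = levels n" "nmem s3 45 0 = B ^ k" using fr3 f2 s2 by simp_all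
        have last: "wp M ?L3 ?Q s4"
          if s4: "nmem s4 43 0 = levels n" "nmem s4 45 0 = B ^ k" "nmem s4 46 0 = N" "nmem s4 47 0 = Suc cl * levels n"
            "nmem s4 48 0 = K" "nmem s4 49 0 = 1" for s4 :: "'a mem"
        proof (rule wp_use)
          show "wp M ?L3 (\<lambda>s'. nmem s' 49 0 = N ^ K) s4"
            by (rule wp_For_power) (use s4 K NM N1 in auto)
          fix s5 :: "'a mem" assume "nmem s5 49 0 = N ^ K"
            and "agree (nwrites ?L3) (fwrites ?L3) s4 s5"
          note this(1) agreeD2(1)[OF this(2)]
          with s4 show "?Q s5" by simp
        qed
        show "?R3 s3"
          using x1 x2 x3 x4 cl(2)
          by (simp add: wp_Mul_eval s3 f3 x2_def[symmetric] x3_def[symmetric] x4_def[symmetric] x[symmetric] del: mult_Suc)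
            (rule last; simp add: f3 K mult_2 del: mult_Suc)
      qed
    qed
  qed
qed

text \<open>The input does not contain the number of reads, so the machine determines it; the
  \<open>k\<close> of the theorem is any upper bound. The value is at least 1 so that
  \<open>k - 1\<close> has its intended meaning.\<close>

definition max_reads :: "nat list \<Rightarrow> nat" where
  "max_reads xs = (LEAST k. 1 \<le> k \<and> (\<forall>v. count_list xs v \<le> k))"

lemma max_reads_props: "1 \<le> max_reads xs" "count_list xs v \<le> max_reads xs"
proof -
  have "1 \<le> Suc (length xs) \<and> (\<forall>v. count_list xs v \<le> Suc (length xs))"
    using count_le_length[of xs] by (auto intro: le_SucI)
  from LeastI[of "\<lambda>k. 1 \<le> k \<and> (\<forall>v. count_list xs v \<le> k)", OF this]
  show "1 \<le> max_reads xs" "count_list xs v \<le> max_reads xs" unfolding max_reads_def by blast+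
qed

lemma max_reads_le: "1 \<le> k \<Longrightarrow> (\<And>v. count_list xs v \<le> k) \<Longrightarrow> max_reads xs \<le> k"
  unfolding max_reads_def by (rule Least_le) blast

lemma length_le_reads: "set xs \<subseteq> {..<n} \<Longrightarrow> length xs \<le> n * max_reads xs"
proof -
  assume "set xs \<subseteq> {..<n}"
  then have "length xs = (\<Sum>v<n. count_list xs v)" using sum_count_set[of xs "{..<n}"] by simp
  also have "\<dots> \<le> (\<Sum>v<n. max_reads xs)" by (intro sum_mono max_reads_props)
  finally show ?thesis by simp
qed

text \<open>Each round opens \<open>2 ^ (k - 1)\<close> classes, and twice the potential bounds the
  number of rounds. The summand 1 is class 0, empty after \<open>Chains\<close> but present in the
  numbering; the last factor is the cost of the parity passes.\<close>

definition class_bound :: "nat \<Rightarrow> nat \<Rightarrow> nat" where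
  "class_bound n k = nat \<lfloor>(2 ^ (k - 1) * (2 * harmonic_sum (1 / 2 ^ (k - 1)) n) + 1) * 2 ^ (k * k)\<rfloor>"

text \<open>A bound for the number of seeds, times N^4. The additional factor leaves room for the
  arrays of the identity test, which has up to \<open>N\<close> vertices with \<open>N ^ 3\<close>
  coefficients each.\<close>

definition iteration_bound :: "nat \<Rightarrow> nat \<Rightarrow> nat \<Rightarrow> nat" where
  "iteration_bound n B k = (B ^ (16 * (k * k))) ^ (2 * (class_bound n k * levels n) + 4)"

lemma harmonic_sum_nonneg: "harmonic_sum \<epsilon> n \<ge> 0"
  unfolding harmonic_sum_def by (intro sum_nonneg) auto

lemma class_boundI:
  assumes "real cl \<le> 2 ^ (k - 1) * (2 * harmonic_sum (1 / 2 ^ (k - 1)) n)"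
  shows "(cl + 1) * 2 ^ (k * k) \<le> class_bound n k"
proof -
  have "real ((cl + 1) * 2 ^ (k * k)) \<le> (2 ^ (k - 1) * (2 * harmonic_sum (1 / 2 ^ (k - 1)) n) + 1) * 2 ^ (k * k)"
  proof -
    have "(real cl + 1) * 2 ^ (k * k) \<le> (2 ^ (k - 1) * (2 * harmonic_sum (1 / 2 ^ (k - 1)) n) + 1) * 2 ^ (k * k)"
      using assms by (intro mult_right_mono add_right_mono) auto
    then show ?thesis by (simp only: of_nat_mult of_nat_add of_nat_1 of_nat_power of_nat_numeral)
  qed
  then show ?thesis unfolding class_bound_def by (simp only: le_nat_floor)
qed

lemma bounds_le_iteration_bound:
  assumes B: "4 \<le> B" "n < B" and n: "1 \<le> n" and k: "1 \<le> k"
  defines "N \<equiv> B ^ (16 * (k * k))"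
  shows "n * k \<le> iteration_bound n B k" "2 ^ (k - 1) \<le> iteration_bound n B k" "class_bound n k \<le> iteration_bound n B k"
    "2 * (class_bound n k * levels n) \<le> iteration_bound n B k"
    "N ^ 4 \<le> iteration_bound n B k" "c \<le> class_bound n k \<Longrightarrow> N ^ (2 * (c * levels n)) \<le> iteration_bound n B k"
    "c \<le> class_bound n k \<Longrightarrow> N ^ (2 * (c * levels n) + 4) \<le> iteration_bound n B k"
    "B ^ k \<le> N" "n * k \<le> N" "n \<le> N" "k \<le> N"
proof -
  let ?M = "iteration_bound n B k" and ?e = "2 * (class_bound n k * levels n)"
  have B1: "1 \<le> B" using B by simp
  have M: "?M = N ^ (?e + 4)" by (simp add: iteration_bound_def N_def)
  have N1: "1 \<le> N" using B1 by (simp add: N_def)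
  have BN: "B ^ j \<le> N" if "j \<le> 16 * (k * k)" for j unfolding N_def using that B1 by (intro power_increasing) auto
  have kk: "k \<le> k * k" "1 \<le> k * k" using k by auto
  show Bk: "B ^ k \<le> N" by (rule BN) (use kk in linarith)
  have k2: "k \<le> 2 ^ k" by (rule less_imp_le[OF less_exp])
  have k2B: "(2::nat) ^ k \<le> B ^ k" using B by (intro power_mono) auto
  have "n * k \<le> B * B ^ k" using B k2 k2B by (intro mult_mono) auto
  also have "\<dots> = B ^ Suc k" by simp
  also have "\<dots> \<le> N" by (rule BN) (use kk in linarith)
  finally show nk: "n * k \<le> N" .
  show "n \<le> N" using nk k by (cases k) auto
  show "k \<le> N" using nk n by (cases n) auto
  have NM: "N ^ j \<le> ?M" if "j \<le> ?e + 4" for j unfolding M using that N1 by (intro power_increasing) auto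
  have N1M: "N \<le> ?M" using NM[of 1] by simp
  show "n * k \<le> ?M" using nk N1M by linarith
  have "(2::nat) ^ (k - 1) \<le> 2 ^ k" by (intro power_increasing) auto
  with k2B Bk N1M show "2 ^ (k - 1) \<le> ?M" by linarith
  have N2: "2 \<le> N" using BN[of 1] kk B by simp
  have "?e < 2 ^ ?e" by (rule less_exp)
  also have "\<dots> \<le> N ^ ?e" using N2 by (intro power_mono) auto
  also have "\<dots> \<le> ?M" by (rule NM) simp
  finally show e: "?e \<le> ?M" by simp
  have "class_bound n k * 1 \<le> class_bound n k * levels n" by (intro mult_left_mono) (auto simp: levels_def)
  with e show "class_bound n k \<le> ?M" by linarith
  show "N ^ 4 \<le> ?M" by (rule NM) simp
  assume c: "c \<le> class_bound n k"
  then have "c * levels n \<le> class_bound n k * levels n" by (rule mult_right_mono) simp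
  then show "N ^ (2 * (c * levels n)) \<le> ?M" "N ^ (2 * (c * levels n) + 4) \<le> ?M" by (intro NM; linarith)+
qed

section \<open>The partition and the parameters as a whole\<close>

definition Setup :: prog where
  "Setup = Count ;; Pad ;; Scan ;; Chains ;; Parity ;; Params"

lemma writes_Setup [simp]:
  "nwrites Setup = {2, 3, 8, 9, 10, 11, 12, 13, 14, 15, 16, 20, 21, 22, 23, 24, 25, 26, 27, 28, 30, 31, 32, 33, 34,
    35, 36, 37, 38, 39, 40, 41, 42, 43, 44, 45, 46, 47, 48, 49}" "fwrites Setup = {}"
  by (auto simp: Setup_def)

text \<open>The interface to the two programs. The times \<open>p\<close> remain existential, since
  only their regularity matters from here on. No field elements occur, so the same memory can
  describe a generator over another field.\<close>

definition setup_done :: "nat \<Rightarrow> nat \<Rightarrow> nat list \<Rightarrow> 'a mem \<Rightarrow> bool" where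
  "setup_done n B xs s \<longleftrightarrow> (let k = max_reads xs; N = B ^ (16 * (k * k)); cl = nmem s 32 0 in
     nmem s 5 0 = n \<and> nmem s 6 0 = length xs \<and> (\<forall>l<length xs. nmem s 20 l = xs ! l) \<and>
     inj_on (nmem s 23) {..<n} \<and> (\<forall>v<n. nmem s 23 v < n) \<and>
     (\<exists>p. (\<forall>j j' i i'. j < k \<and> j' < k \<and> i < n \<and> i' < n \<and> p j i = p j' i' \<longrightarrow> j = j' \<and> i = i') \<and>
        (\<forall>l<length xs. \<exists>j<k. p j (nmem s 23 (xs ! l)) = l) \<and>
        (\<forall>c. regular k p {i. i < n \<and> nmem s 27 i = c})) \<and>
     (\<forall>i<n. nmem s 27 i \<le> cl) \<and> Suc cl \<le> class_bound n k \<and>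
     nmem s 43 0 = levels n \<and> nmem s 45 0 = B ^ k \<and> nmem s 46 0 = N \<and>
     nmem s 47 0 = Suc cl * levels n \<and> nmem s 48 0 = 2 * (Suc cl * levels n) \<and>
     nmem s 49 0 = N ^ (2 * (Suc cl * levels n)))"

lemma wp_Setup:
  fixes s :: "'a::field mem"
  assumes n: "nmem s 5 0 = n" "1 \<le> n" and L: "nmem s 6 0 = length xs" and B: "nmem s 7 0 = B" "4 \<le> B" "n < B"
    and ys: "\<And>l. l < length xs \<Longrightarrow> nmem s 20 l = xs ! l" and xs: "set xs \<subseteq> {..<n}"
    and z: "nmem s 21 = (\<lambda>_. 0)" "nmem s 22 = (\<lambda>_. 0)" "nmem s 27 = (\<lambda>_. 0)"
    and M: "iteration_bound n B (max_reads xs) \<le> M"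
  shows "wp M Setup (setup_done n B xs) s"
proof -
  define k where "k = max_reads xs"
  have k1: "1 \<le> k" and cnt: "\<And>v. count_list xs v \<le> k" unfolding k_def by (rule max_reads_props)+
  note bd = bounds_le_iteration_bound[OF B(2,3) n(2) k1]
  have M': "iteration_bound n B k \<le> M" using M by (simp add: k_def)
  let ?N = "B ^ (16 * (k * k))"
  have N4: "?N ^ 4 \<le> M" using bd(5) M' by linarith
  have N1: "1 \<le> ?N" using B by simp
  have NM: "?N \<le> M" using N4 power_increasing[of 1 4 ?N] N1 by simp
  have nM: "n \<le> M" and kM: "k \<le> M" and nkM: "n * k \<le> M" using bd(9-11) NM by auto
  have Lnk: "length xs \<le> n * k" unfolding k_def by (rule length_le_reads[OF xs])
  show ?thesis unfolding Setup_def wp.simps(4)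
  proof (rule wp_use[OF wp_Count[OF L _ ys z(1) k1 cnt]])
    show "length xs \<le> M" using Lnk nkM by simp
    fix s1 :: "'a mem" assume s1: "nmem s1 21 = count_list xs \<and> 1 \<le> nmem s1 8 0 \<and> nmem s1 8 0 \<le> k \<and>
      (\<forall>v. count_list xs v \<le> nmem s1 8 0)" and ag1: "agree (nwrites Count) (fwrites Count) s s1"
    note fr1 = agreeD2(1)[OF ag1]
    have k': "nmem s1 8 0 = k" using s1 max_reads_le[of "nmem s1 8 0" xs] by (auto simp: k_def)
    have f1: "nmem s1 5 0 = n" "nmem s1 6 0 = length xs" "nmem s1 7 0 = B" "nmem s1 22 = (\<lambda>_. 0)" "nmem s1 27 = (\<lambda>_. 0)"
      and ys1: "\<And>l. l < length xs \<Longrightarrow> nmem s1 20 l = xs ! l" and c1: "nmem s1 21 = count_list xs"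
      using fr1 n L B z ys s1 by simp_all
    show "wp M Pad (wp M Scan (wp M Chains (wp M Parity (wp M Params (setup_done n B xs))))) s1"
    proof (rule wp_use[OF wp_Pad[OF f1(2) ys1 c1 f1(1) nM k' kM cnt xs]])
      fix s2 :: "'a mem" assume s2: "\<exists>zs. nmem s2 9 0 = length zs \<and> (\<forall>l<length zs. nmem s2 20 l = zs ! l) \<and>
        take (length xs) zs = xs \<and> set zs \<subseteq> {..<n} \<and> (\<forall>v<n. count_list zs v = k)"
        and ag2: "agree (nwrites Pad) (fwrites Pad) s1 s2"
      note fr2 = agreeD2(1)[OF ag2]
      from s2 obtain zs where zs: "nmem s2 9 0 = length zs" "\<And>l. l<length zs \<Longrightarrow> nmem s2 20 l = zs ! l"
        "take (length xs) zs = xs" "set zs \<subseteq> {..<n}" "\<And>v. v<n \<Longrightarrow> count_list zs v = k" by blast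
      interpret us: uniform_sequence zs n k by unfold_locales (use zs k1 in auto)
      have lenM: "length zs \<le> M" using us.length_zs nkM by simp
      have f2: "nmem s2 5 0 = n" "nmem s2 6 0 = length xs" "nmem s2 7 0 = B" "nmem s2 22 = (\<lambda>_. 0)" "nmem s2 27 = (\<lambda>_. 0)"
        "nmem s2 8 0 = k" using fr2 f1 k' by simp_all
      have Lz: "length xs \<le> length zs" using zs(3) by (metis length_take min.cobounded1)
      have xz: "zs ! l = xs ! l" if "l < length xs" for l using zs(3) that by (metis nth_take)
      show "wp M Scan (wp M Chains (wp M Parity (wp M Params (setup_done n B xs)))) s2"
      proof (rule wp_use[OF us.wp_Scan[OF zs(1) lenM zs(2) f2(1) kM f2(4)]])
        fix s3 :: "'a mem" assume s3: "(\<forall>v<n. nmem s3 23 v = first_rank zs v) \<and>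
          (\<forall>l<length zs. nmem s3 24 l = first_rank zs (zs ! l) \<and> nmem s3 25 l = occurrence zs l) \<and>
          read_positions zs n k (\<lambda>j i. nmem s3 26 (j * n + i))" and ag3: "agree (nwrites Scan) (fwrites Scan) s2 s3"
        note fr3 = agreeD2(1)[OF ag3]
        define p where "p = (\<lambda>j i. nmem s3 26 (j * n + i))"
        interpret rp: read_positions zs n k p using s3 by (simp add: p_def)
        have f3: "nmem s3 5 0 = n" "nmem s3 6 0 = length xs" "nmem s3 7 0 = B" "nmem s3 27 = (\<lambda>_. 0)"
          "nmem s3 8 0 = k" "nmem s3 9 0 = length zs" "nmem s3 20 = nmem s2 20" using fr3 f2 zs by simp_all
        have col: "colour p (k - 1) = colour (\<lambda>j i. nmem s3 26 (j * n + i)) (k - 1)" by (simp add: p_def)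
        show "wp M Chains (wp M Parity (wp M Params (setup_done n B xs))) s3"
        proof (rule wp_use[OF wp_Chains[OF f3(1) nM f3(5) kM _ col f3(4)]])
          show "2 ^ (k - 1) \<le> M" using bd(2) M' by linarith
          fix s4 :: "'a mem" assume s4: "(\<forall>i<n. nmem s4 27 i \<noteq> 0) \<and> chains n (colour p (k - 1)) (nmem s4 27) (nmem s4 32 0) \<and>
            real (nmem s4 32 0) \<le> 2 ^ (k - 1) * (2 * harmonic_sum (1 / 2 ^ (k - 1)) n)"
            and ag4: "agree (nwrites Chains) (fwrites Chains) s3 s4"
          note fr4 = agreeD2(1)[OF ag4]
          have f4: "nmem s4 5 0 = n" "nmem s4 6 0 = length xs" "nmem s4 7 0 = B"
            "nmem s4 8 0 = k" "nmem s4 9 0 = length zs" "nmem s4 20 = nmem s2 20" "nmem s4 26 = nmem s3 26"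
            "nmem s4 23 = nmem s3 23" "nmem s4 24 = nmem s3 24" "nmem s4 25 = nmem s3 25" using fr4 f3 by simp_all
          have clb: "(nmem s4 32 0 + 1) * 2 ^ (k * k) \<le> class_bound n k" using s4 by (intro class_boundI) blast
          have clM: "(nmem s4 32 0 + 1) * 2 ^ (k * k) \<le> M" using clb bd(3) M' by linarith
          have yr4: "\<forall>l<length zs. nmem s4 24 l = first_rank zs (zs ! l) \<and> nmem s4 25 l = occurrence zs l"
            using s3 f4 by simp
          have p4: "p = (\<lambda>j i. nmem s4 26 (j * n + i))" by (simp add: p_def f4)
          have le4: "\<And>i. i < n \<Longrightarrow> nmem s4 27 i \<le> nmem s4 32 0" using s4 by (auto simp: chains_def)
          have mono4: "\<And>c j. j < k \<Longrightarrow> monotone_read p j {i. i < n \<and> nmem s4 27 i = c}"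
            using s4 by (intro rp.chains_monotone) auto
          show "wp M Parity (wp M Params (setup_done n B xs)) s4"
          proof (rule wp_use[OF rp.wp_Parity[OF f4(1) f4(4) kM f4(5) lenM clM yr4 p4 le4 mono4]])
            fix s5 :: "'a mem" assume s5: "(\<forall>i<n. nmem s5 27 i \<le> nmem s5 32 0) \<and>
              nmem s5 32 0 + 1 \<le> (nmem s4 32 0 + 1) * 2 ^ (k * k) \<and> (\<forall>c. regular k p {i. i < n \<and> nmem s5 27 i = c})"
              and ag5: "agree (nwrites Parity) (fwrites Parity) s4 s5"
            note fr5 = agreeD2(1)[OF ag5]
            have f5: "nmem s5 5 0 = n" "nmem s5 6 0 = length xs" "nmem s5 7 0 = B"
              "nmem s5 8 0 = k" "nmem s5 20 = nmem s2 20" "nmem s5 23 = nmem s3 23" using fr5 f4 by simp_all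
            have cl5: "Suc (nmem s5 32 0) \<le> class_bound n k" using s5 clb by linarith
            have "Suc (nmem s5 32 0) * levels n \<le> class_bound n k * levels n" using cl5 by (rule mult_right_mono) simp
            then have KM: "2 * (Suc (nmem s5 32 0) * levels n) \<le> M" using bd(4) M' by linarith
            have NKM: "?N ^ (2 * (Suc (nmem s5 32 0) * levels n)) \<le> M" using bd(6)[OF cl5] M' by linarith
            have clM5: "Suc (nmem s5 32 0) \<le> M" using cl5 bd(3) M' by linarith
            show "wp M Params (setup_done n B xs) s5"
            proof (rule wp_use[OF wp_Params[OF f5(1) nM n(2) f5(4) kM k1 f5(3) _ refl refl clM5 refl KM NM NKM]])
              show "1 \<le> B" using B by simp
              fix s6 :: "'a mem" assume s6: "nmem s6 43 0 = levels n \<and> nmem s6 45 0 = B ^ k \<and> nmem s6 46 0 = ?N \<and>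
                nmem s6 47 0 = Suc (nmem s5 32 0) * levels n \<and> nmem s6 48 0 = 2 * (Suc (nmem s5 32 0) * levels n) \<and>
                nmem s6 49 0 = ?N ^ (2 * (Suc (nmem s5 32 0) * levels n))" and ag6: "agree (nwrites Params) (fwrites Params) s5 s6"
              note fr6 = agreeD2(1)[OF ag6]
              have f6: "nmem s6 5 0 = n" "nmem s6 6 0 = length xs" "nmem s6 20 = nmem s2 20" "nmem s6 23 = nmem s3 23"
                "nmem s6 32 0 = nmem s5 32 0" "nmem s6 27 = nmem s5 27" using fr6 f5 by simp_all
              have rank: "nmem s3 23 v = first_rank zs v" if "v < n" for v using s3 that by blast
              have xn: "xs ! l < n" if "l < length xs" for l using xs nth_mem[OF that] by blast
              have A1: "inj_on (nmem s3 23) {..<n}" using us.rank_inj rank by (auto simp: inj_on_def)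
              have A2: "\<forall>v<n. nmem s3 23 v < n" using us.rank_less rank by simp
              have A3: "\<forall>l<length xs. \<exists>j<k. p j (nmem s3 23 (xs ! l)) = l"
              proof (intro allI impI)
                fix l assume l: "l < length xs"
                then have lz: "l < length zs" using Lz by simp
                have "p (occurrence zs l) (first_rank zs (zs ! l)) = l" by (rule rp.p[OF lz])
                then show "\<exists>j<k. p j (nmem s3 23 (xs ! l)) = l"
                  using us.occurrence_less_k[OF lz] rank[OF xn[OF l]] xz[OF l] by auto
              qed
              have A4: "\<forall>j j' i i'. j < k \<and> j' < k \<and> i < n \<and> i' < n \<and> p j i = p j' i' \<longrightarrow> j = j' \<and> i = i'"
                using rp.p_inj by blast
              have A5: "\<forall>l<length xs. nmem s2 20 l = xs ! l" using zs(2) xz Lz by simp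
              note s5' = s5[THEN conjunct1] s5[THEN conjunct2, THEN conjunct2]
              from s6 show "setup_done n B xs s6"
                unfolding setup_done_def Let_def k_def[symmetric] f6
                by (intro conjI refl exI[of _ p] A1 A2 A3 A4 A5 cl5 s5') (elim conjE, assumption)+
            qed
          qed
        qed
      qed
    qed
  qed
qed

section \<open>The hitting set\<close>

lemma digits_exist:
  fixes N :: nat
  assumes "\<And>z. z < K \<Longrightarrow> D z < N"
  shows "\<exists>c<N ^ K. \<forall>z<K. (c div N ^ z) mod N = D z"
  using assms
proof (induction K arbitrary: D)
  case 0
  show ?case by simp
next
  case (Suc K)
  have N: "N > 0" using Suc.prems[of 0] by simp
  obtain c where c: "c < N ^ K" "\<And>z. z < K \<Longrightarrow> (c div N ^ z) mod N = D (Suc z)"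
    using Suc.IH[of "\<lambda>z. D (Suc z)"] Suc.prems by auto
  let ?c = "D 0 + N * c"
  have D0: "D 0 < N" using Suc.prems[of 0] by simp
  have "?c < N + N * c" using D0 by simp
  also have "\<dots> = N * Suc c" by simp
  also have "\<dots> \<le> N * N ^ K" using c(1) by (intro mult_left_mono) auto
  finally have "?c < N ^ Suc K" by simp
  moreover have "(?c div N ^ z) mod N = D z" if "z < Suc K" for z
  proof (cases z)
    case 0
    then show ?thesis using D0 by simp
  next
    case (Suc y)
    have "?c div N ^ z = (?c div N) div N ^ y" by (simp add: Suc div_mult2_eq)
    also have "?c div N = c" using D0 N by simp
    finally show ?thesis using c(2)[of y] that Suc by simp
  qed
  ultimately show ?case by blast
qed

definition Digits :: prog where
  "Digits = 51 ::= V 59 ;; For 11 (V 48) (DivMod 51 53 (V 51) (V 46) ;; NSet 50 (V 11) (V 53))"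

lemma writes_Digits [simp]: "nwrites Digits = {2, 3, 4, 11, 50, 51, 53}" "fwrites Digits = {}"
  by (auto simp: Digits_def)

lemma wp_Digits:
  fixes s :: "'a::field mem"
  assumes c: "nmem s 59 0 = c" "c \<le> M" and K: "nmem s 48 0 = K" "K \<le> M" and N: "nmem s 46 0 = N" "N > 0"
  shows "wp M Digits (\<lambda>s'. \<forall>z<K. nmem s' 50 z = (c div N ^ z) mod N) s"
  unfolding Digits_def wp.simps nval.simps
proof (rule wp_For[where n = K and I = "\<lambda>j s'. nmem s' 51 0 = c div N ^ j \<and> (\<forall>z<j. nmem s' 50 z = (c div N ^ z) mod N)"], goal_cases)
  case (6 j s')
  have N': "nmem s' 46 0 = N" using agreeD2(1)[OF 6(2)] N by simp
  have le: "c div N ^ j \<le> M" using c(2) by (meson div_le_dividend le_trans)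
  have step: "c div N ^ j div N = c div N ^ Suc j" by (simp add: div_mult2_eq[symmetric] mult.commute)
  have "wp M (DivMod 51 53 (V 51) (V 46) ;; NSet 50 (V 11) (V 53)) (\<lambda>s''. nmem s'' 51 0 = c div N ^ Suc j \<and>
      nmem s'' 50 = (nmem s' 50)(j := (c div N ^ j) mod N)) s'"
    using 6(3,4) le N(2) by (simp add: wp_DivMod_eval N' step del: power_Suc)
  then show ?case by (rule wp_mono) (use 6(4) in \<open>auto simp: less_Suc_eq\<close>)
qed (use assms in auto)

text \<open>Scalar 57 is the number of the digit for the class and the level, 55 the modulus, which
  is the digit plus 1, and 56 the index of the element. Scalar 54 runs through the values of
  \<open>wt\<close> and is reduced in every step, so it never exceeds the modulus.\<close>

definition Weight :: prog where
  "Weight = Mul 57 (NGet 27 (V 12)) (V 43) ;; 57 ::= NAdd (V 57) (V 13) ;;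
     55 ::= NAdd (NGet 50 (V 57)) (NConst 1) ;; 56 ::= NGet 50 (NAdd (V 47) (V 57)) ;; 54 ::= NConst 1 ;;
     For 14 (V 12) (Mul 40 (V 54) (V 45) ;; DivMod 53 54 (V 40) (V 55))"

lemma writes_Weight [simp]: "nwrites Weight = {2, 3, 4, 14, 40, 53, 54, 55, 56, 57}" "fwrites Weight = {}"
  by (auto simp: Weight_def)

lemma wp_Weight:
  fixes s :: "'a::field mem"
  assumes i: "nmem s 12 0 = i" "i \<le> M" and j: "nmem s 13 0 = j" and ph: "nmem s 27 i \<le> M"
    and z: "z = nmem s 27 i * nmem s 43 0 + j" and G: "nmem s 45 0 = G"
    and q: "Suc (nmem s 50 z) \<le> Q" and bound: "Q \<le> M" "Q * G \<le> M"
  shows "wp M Weight (\<lambda>s'. nmem s' 54 0 = wt G (Suc (nmem s 50 z)) i \<and> nmem s' 56 0 = nmem s 50 (nmem s 47 0 + z)) s"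
proof -
  let ?q = "Suc (nmem s 50 z)"
  have wtq: "wt G ?q t \<le> Q" for t using wt_le[of ?q G t] q by simp
  have loop: "wp M (For 14 (V 12) (Mul 40 (V 54) (V 45) ;; DivMod 53 54 (V 40) (V 55)))
      (\<lambda>s'. nmem s' 54 0 = wt G ?q i \<and> nmem s' 56 0 = nmem s 50 (nmem s 47 0 + z)) s0"
    if s0: "nmem s0 12 0 = i" "nmem s0 54 0 = 1" "nmem s0 55 0 = ?q" "nmem s0 45 0 = G"
      "nmem s0 56 0 = nmem s 50 (nmem s 47 0 + z)" for s0 :: "'a mem"
  proof (rule wp_For[where n = i and I = "\<lambda>t s'. nmem s' 54 0 = wt G ?q t"], goal_cases)
    case (6 t s')
    have s': "nmem s' 55 0 = ?q" "nmem s' 45 0 = G" using agreeD2(1)[OF 6(2)] s0 by simp_all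
    have "wt G ?q t * G \<le> Q * G" using wtq by (rule mult_right_mono) simp
    then have "wt G ?q t * G \<le> M" "wt G ?q t \<le> M" using bound wtq[of t] by linarith+
    then show ?case using 6(4) by (simp add: wp_Mul_eval wp_DivMod_eval s')
  next
    case (7 s')
    have "nmem s' 56 0 = nmem s 50 (nmem s 47 0 + z)" using agreeD2(1)[OF 7(1)] s0 by simp
    with 7(3) show ?case by simp
  qed (use s0 i in auto)
  show ?thesis unfolding Weight_def using ph
    by (simp add: wp_Mul_eval i(1) j z[symmetric]) (rule loop; simp add: i j G z)
qed

text \<open>
  The base is \<open>n + (w + 1) + d + 2\<close>, as the width w may be 0 here.
\<close>

definition Load_order :: prog where
  "Load_order = 5 ::= NGet 0 (NConst 0) ;; 6 ::= NGet 0 (NConst 3) ;;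
     7 ::= NAdd (NAdd (NAdd (NGet 0 (NConst 0)) (NGet 0 (NConst 1))) (NGet 0 (NConst 2))) (NConst 3) ;;
     For 11 (V 6) (NSet 20 (V 11) (NGet 0 (NAdd (V 11) (NConst 5))))"

definition Power_step :: prog where
  "Power_step = Weight ;; For 15 (V 54) (FSet 2 (V 12) (FMul (FGet 2 (V 12)) (FGet 0 (V 56))))"

definition Coordinates :: prog where
  "Coordinates = For 12 (V 5) (FSet 2 (V 12) FOne ;; For 13 (V 43) Power_step)"

definition Emit :: prog where
  "Emit = For 12 (V 5) (FSet 1 (V 60) (FGet 2 (NGet 23 (V 12))) ;; 60 ::= NAdd (V 60) (NConst 1))"

definition Points :: prog where
  "Points = 60 ::= NConst 0 ;; For 59 (V 49) (Digits ;; Coordinates ;; Emit) ;; NSet 1 (NConst 0) (V 49)"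

definition Hitting_set_program :: prog where
  "Hitting_set_program = Load_order ;; Setup ;; Points"

lemma writes_Power_step [simp]: "nwrites Power_step = {2, 3, 4, 14, 15, 40, 53, 54, 55, 56, 57}" "fwrites Power_step = {2}"
  by (auto simp: Power_step_def)

lemma writes_Coordinates [simp]: "nwrites Coordinates = {2, 3, 4, 12, 13, 14, 15, 40, 53, 54, 55, 56, 57}" "fwrites Coordinates = {2}"
  by (auto simp: Coordinates_def)

lemma writes_Emit [simp]: "nwrites Emit = {12, 60}" "fwrites Emit = {1}"
  by (auto simp: Emit_def)

lemma setup_done_agree:
  assumes "setup_done n B xs s"
    and "\<And>x. x \<in> {5, 6, 20, 23, 27, 32, 43, 45, 46, 47, 48, 49} \<Longrightarrow> nmem s' x = nmem s x"
  shows "setup_done n B xs s'"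
  using assms(1) unfolding setup_done_def Let_def by (simp add: assms(2))

text \<open>The seed c, a number written to the base N, determines the exponents of the generator.\<close>

definition seed_digit :: "'a mem \<Rightarrow> nat \<Rightarrow> nat \<Rightarrow> nat" where
  "seed_digit s c z = (c div nmem s 46 0 ^ z) mod nmem s 46 0"

definition seed_index :: "'a mem \<Rightarrow> nat \<Rightarrow> nat \<Rightarrow> nat" where
  "seed_index s i j = nmem s 27 i * nmem s 43 0 + j"

definition seed_weight :: "'a mem \<Rightarrow> nat \<Rightarrow> nat \<Rightarrow> nat \<Rightarrow> nat" where
  "seed_weight s c i j = wt (nmem s 45 0) (Suc (seed_digit s c (seed_index s i j))) i"

definition seed_base :: "'a mem \<Rightarrow> nat \<Rightarrow> nat \<Rightarrow> nat \<Rightarrow> nat" where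
  "seed_base s c i j = seed_digit s c (nmem s 47 0 + seed_index s i j)"

lemma seed_index_less:
  assumes "setup_done n B xs s" "i < n" "j < levels n"
  shows "seed_index s i j < nmem s 47 0" "nmem s 47 0 + seed_index s i j < nmem s 48 0"
proof -
  let ?cl = "nmem s 32 0"
  have s: "nmem s 27 i \<le> ?cl" "nmem s 43 0 = levels n" "nmem s 47 0 = Suc ?cl * levels n" "nmem s 48 0 = 2 * (Suc ?cl * levels n)"
    using assms unfolding setup_done_def Let_def by auto
  have "nmem s 27 i * levels n + j < nmem s 27 i * levels n + levels n" using assms(3) by simp
  also have "\<dots> = Suc (nmem s 27 i) * levels n" by simp
  also have "\<dots> \<le> Suc ?cl * levels n" using s(1) by (intro mult_right_mono) auto
  finally show "seed_index s i j < nmem s 47 0" unfolding seed_index_def s .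
  then show "nmem s 47 0 + seed_index s i j < nmem s 48 0" unfolding s(3,4) by linarith
qed

section \<open>The points given by the seeds\<close>

locale seeded =
  fixes M n B :: nat and xs :: "nat list" and s0 :: "'a::field mem" and k G N :: nat
  assumes ready: "setup_done n B xs s0" and B: "4 \<le> B" "n < B" and n: "1 \<le> n"
    and M: "iteration_bound n B (max_reads xs) \<le> M"
  defines "k \<equiv> max_reads xs" and "G \<equiv> B ^ k" and "N \<equiv> B ^ (16 * (k * k))"
begin

lemma k1: "1 \<le> k" unfolding k_def by (rule max_reads_props)

lemma N1: "1 \<le> N" using B by (simp add: N_def)

lemma s0: "nmem s0 5 0 = n" "nmem s0 43 0 = levels n" "nmem s0 45 0 = G" "nmem s0 46 0 = N"
  "nmem s0 47 0 = Suc (nmem s0 32 0) * levels n" "nmem s0 48 0 = 2 * (Suc (nmem s0 32 0) * levels n)"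
  "nmem s0 49 0 = N ^ nmem s0 48 0" "Suc (nmem s0 32 0) \<le> class_bound n k"
  "\<And>i. i < n \<Longrightarrow> nmem s0 27 i \<le> nmem s0 32 0" "\<And>v. v < n \<Longrightarrow> nmem s0 23 v < n"
  using ready unfolding setup_done_def Let_def G_def N_def k_def by auto

lemma M_bounds: "N ^ 4 \<le> M" "N * N \<le> M" "N \<le> M" "n \<le> M" "N * G \<le> M" "nmem s0 48 0 \<le> M" "nmem s0 49 0 \<le> M" "class_bound n k \<le> M"
  "levels n \<le> M" "G \<le> N" "n * k \<le> N" "N ^ (nmem s0 48 0 + 4) \<le> M"
proof -
  note bd = bounds_le_iteration_bound[OF B n k1]
  have M': "iteration_bound n B k \<le> M" using M by (simp add: k_def)
  show N4: "N ^ 4 \<le> M" using bd(5) M' unfolding N_def by linarith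
  have "N ^ 2 \<le> N ^ 4" using N1 by (intro power_increasing) auto
  then show NN: "N * N \<le> M" using N4 by (simp add: power2_eq_square)
  have "N * 1 \<le> N * N" using N1 by (intro mult_left_mono) auto
  then show N: "N \<le> M" using NN by linarith
  show "n \<le> M" using bd(10) N unfolding N_def by linarith
  show G: "G \<le> N" using bd(8) unfolding N_def G_def .
  then have "N * G \<le> N * N" by (rule mult_left_mono) simp
  then show "N * G \<le> M" using NN by linarith
  have "Suc (nmem s0 32 0) * levels n \<le> class_bound n k * levels n" using s0(8) by (rule mult_right_mono) simp
  then show K: "nmem s0 48 0 \<le> M" using bd(4) M' unfolding s0(6) by linarith
  show "nmem s0 49 0 \<le> M" using bd(6)[OF s0(8)] M' unfolding s0(6,7) N_def by linarith
  show "N ^ (nmem s0 48 0 + 4) \<le> M" using bd(7)[OF s0(8)] M' unfolding s0(6) N_def by linarith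
  show "class_bound n k \<le> M" using bd(3) M' by linarith
  have "levels n \<le> Suc (nmem s0 32 0) * levels n" by simp
  then show "levels n \<le> M" using K unfolding s0(6) by linarith
  show "n * k \<le> N" using bd(9) unfolding N_def .
qed

lemma seed_base_less: "seed_base s0 c i j < N"
  using N1 by (simp add: seed_base_def seed_digit_def s0 Suc_le_eq)

lemma seed_weight_le: "seed_weight s0 c i j \<le> N"
proof -
  let ?q = "Suc (seed_digit s0 c (seed_index s0 i j))"
  have "?q \<le> N" using N1 by (simp add: seed_digit_def s0 Suc_le_eq)
  then show ?thesis using wt_le[of ?q G i] by (simp add: seed_weight_def s0)
qed

lemma wp_seed_weight:
  fixes s :: "'a mem"
  assumes s: "\<And>x. x \<in> {5, 20, 23, 27, 32, 43, 45, 46, 47, 48, 49} \<Longrightarrow> nmem s x = nmem s0 x" and i: "nmem s 12 0 = i" "i < n"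
    and j: "nmem s 13 0 = j" "j < levels n" and dig: "\<And>z. z < nmem s0 48 0 \<Longrightarrow> nmem s 50 z = seed_digit s0 c z"
  shows "wp M Weight (\<lambda>s'. nmem s' 54 0 = seed_weight s0 c i j \<and> nmem s' 56 0 = seed_base s0 c i j) s"
proof -
  have z: "seed_index s0 i j = nmem s 27 i * nmem s 43 0 + j" by (simp add: seed_index_def s)
  have digz: "nmem s 50 (seed_index s0 i j) = seed_digit s0 c (seed_index s0 i j)"
    "nmem s 50 (nmem s 47 0 + seed_index s0 i j) = seed_base s0 c i j"
    using seed_index_less[OF ready i(2) j(2)] dig by (simp_all add: seed_base_def s)
  have q: "Suc (nmem s 50 (seed_index s0 i j)) \<le> N" using N1 by (simp add: digz seed_digit_def s0 Suc_le_eq)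
  have phM: "nmem s 27 i \<le> M" using s0(8) s0(9)[OF i(2)] M_bounds(8) by (simp add: s)
  have iM: "i \<le> M" using i M_bounds(4) by simp
  have Gs: "nmem s 45 0 = G" by (simp add: s s0)
  show ?thesis
    by (rule wp_mono[OF wp_Weight[OF i(1) iM j(1) phM z Gs q M_bounds(3) M_bounds(5)]])
      (simp add: digz seed_weight_def s0)
qed

lemma wp_Power_step:
  fixes s :: "'a mem"
  assumes s: "\<And>x. x \<in> {5, 20, 23, 27, 32, 43, 45, 46, 47, 48, 49} \<Longrightarrow> nmem s x = nmem s0 x" and i: "nmem s 12 0 = i" "i < n"
    and j: "nmem s 13 0 = j" "j < levels n" and dig: "\<And>z. z < nmem s0 48 0 \<Longrightarrow> nmem s 50 z = seed_digit s0 c z"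
    and e: "fmem s 0 = e"
  shows "wp M Power_step (\<lambda>s'. fmem s' 2 = (fmem s 2)(i := fmem s 2 i * e (seed_base s0 c i j) ^ seed_weight s0 c i j)) s"
  unfolding Power_step_def wp.simps(4)
proof (rule wp_use[OF wp_seed_weight[OF s i j dig]])
  fix s1 :: "'a mem" assume s1: "nmem s1 54 0 = seed_weight s0 c i j \<and> nmem s1 56 0 = seed_base s0 c i j"
    and ag: "agree (nwrites Weight) (fwrites Weight) s s1"
  note fr = agreeD2[OF ag]
  have f1: "nmem s1 12 0 = i" "fmem s1 0 = e" "fmem s1 2 = fmem s 2" using fr i e by simp_all
  have wM: "seed_weight s0 c i j \<le> M" using seed_weight_le M_bounds(3) le_trans by blast
  show "wp M (For 15 (V 54) (FSet 2 (V 12) (FMul (FGet 2 (V 12)) (FGet 0 (V 56))))) (\<lambda>s'. fmem s' 2 =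
    (fmem s 2)(i := fmem s 2 i * e (seed_base s0 c i j) ^ seed_weight s0 c i j)) s1"
  proof (rule wp_For[where n = "seed_weight s0 c i j" and I = "\<lambda>t s'. fmem s' 2 =
      (fmem s 2)(i := fmem s 2 i * e (seed_base s0 c i j) ^ t)"], goal_cases)
    case (6 t s2)
    have "nmem s2 12 0 = i" "nmem s2 56 0 = seed_base s0 c i j" "fmem s2 0 = e" using agreeD2[OF 6(2)] f1 s1 by simp_all
    then show ?case using 6(4) by (simp add: mult_ac)
  qed (use s1 wM f1 in auto)
qed

definition coordinate :: "(nat \<Rightarrow> 'a) \<Rightarrow> nat \<Rightarrow> nat \<Rightarrow> 'a" where
  "coordinate e c i = (\<Prod>j<levels n. e (seed_base s0 c i j) ^ seed_weight s0 c i j)"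

lemma wp_Coordinates:
  fixes s :: "'a mem"
  assumes s: "\<And>x. x \<in> {5, 20, 23, 27, 32, 43, 45, 46, 47, 48, 49} \<Longrightarrow> nmem s x = nmem s0 x"
    and dig: "\<And>z. z < nmem s0 48 0 \<Longrightarrow> nmem s 50 z = seed_digit s0 c z" and e: "fmem s 0 = e"
  shows "wp M Coordinates (\<lambda>s'. \<forall>i<n. fmem s' 2 i = coordinate e c i) s"
  unfolding Coordinates_def
proof (rule wp_For[where n = n and I = "\<lambda>i s'. \<forall>i'<i. fmem s' 2 i' = coordinate e c i'"], goal_cases)
  case (6 i s1)
  note fr = agreeD2[OF 6(2)]
  let ?s = "upf s1 2 i 1"
  have "wp M (For 13 (V 43) Power_step) (\<lambda>s'. fmem s' 2 = (fmem s1 2)(i := coordinate e c i)) ?s"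
  proof (rule wp_For[where n = "levels n" and I = "\<lambda>j s'. fmem s' 2 =
      (fmem s1 2)(i := \<Prod>j<j. e (seed_base s0 c i j) ^ seed_weight s0 c i j)"], goal_cases)
    case (6 j s2)
    note fr2 = agreeD2[OF 6(2)]
    have "wp M Power_step (\<lambda>s'. fmem s' 2 = (fmem s2 2)(i := fmem s2 2 i * e (seed_base s0 c i j) ^ seed_weight s0 c i j)) s2"
    proof (rule wp_Power_step)
      show "nmem s2 x = nmem s0 x" if "x \<in> {5, 20, 23, 27, 32, 43, 45, 46, 47, 48, 49}" for x
        using that fr2(1)[of x] fr(1)[of x] s[of x] by auto
      show "nmem s2 12 0 = i" "fmem s2 0 = e" using fr2 fr \<open>nmem s1 12 0 = i\<close> e by simp_all
      show "nmem s2 50 z = seed_digit s0 c z" if "z < nmem s0 48 0" for z using fr2 fr dig[OF that] by simp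
    qed (use 6 \<open>i < n\<close> in auto)
    then show ?case by (rule wp_mono) (use 6(4) in \<open>auto simp: fun_eq_iff\<close>)
  next
    case (7 s2)
    then show ?case by (simp add: coordinate_def)
  qed (use fr s s0 M_bounds in auto)
  then have "wp M (For 13 (V 43) Power_step) (\<lambda>s''. \<forall>i'<Suc i. fmem (upn s'' 12 0 (Suc i)) 2 i' = coordinate e c i') ?s"
    by (rule wp_mono) (use 6(4) in \<open>auto simp: less_Suc_eq\<close>)
  then show ?case using 6(3) by simp
qed (use s s0 M_bounds in auto)

lemma wp_Emit:
  fixes s :: "'a mem"
  assumes s: "nmem s 5 0 = n" "nmem s 23 = nmem s0 23" and o: "nmem s 60 0 = c * n"
  shows "wp M Emit (\<lambda>s'. nmem s' 60 0 = Suc c * n \<and>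
    fmem s' 1 = (\<lambda>x. if c * n \<le> x \<and> x < Suc c * n then fmem s 2 (nmem s0 23 (x - c * n)) else fmem s 1 x)) s"
  unfolding Emit_def
proof (rule wp_For[where n = n and I = "\<lambda>v s'. nmem s' 60 0 = c * n + v \<and>
    fmem s' 1 = (\<lambda>x. if c * n \<le> x \<and> x < c * n + v then fmem s 2 (nmem s0 23 (x - c * n)) else fmem s 1 x)"], goal_cases)
  case (6 v s1)
  have f: "nmem s1 23 = nmem s0 23" "fmem s1 2 = fmem s 2" using agreeD2[OF 6(2)] s by simp_all
  show ?case using 6(3,4) f by (auto simp: fun_eq_iff)
next
  case (7 s1)
  have eq: "c * n + n = Suc c * n" by simp
  from 7(3) show ?case unfolding eq by blast
next
  case 5
  show ?case using o by (auto simp: fun_eq_iff)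
qed (use assms M_bounds in auto)

lemma wp_Points:
  fixes s :: "'a mem"
  assumes s: "s = s0"
  shows "wp M Points (\<lambda>s'. nmem s' 1 0 = nmem s0 49 0 \<and> (\<forall>c<nmem s0 49 0. \<forall>v<n.
    fmem s' 1 (c * n + v) = coordinate (fmem s0 0) c (nmem s0 23 v))) s"
  unfolding Points_def wp.simps(4) wp_NSet[OF refl refl] nval.simps
proof (rule wp_For[where n = "nmem s0 49 0" and I = "\<lambda>c s'. nmem s' 60 0 = c * n \<and> (\<forall>c'<c. \<forall>v<n.
    fmem s' 1 (c' * n + v) = coordinate (fmem s0 0) c' (nmem s0 23 v))"], goal_cases)
  case (6 c s1)
  note fr = agreeD2[OF 6(2)]
  have f1: "nmem s1 x = nmem s0 x" if "x \<in> {5, 20, 23, 27, 32, 43, 45, 46, 47, 48, 49}" for x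
    using that fr(1)[of x] s by auto
  have e1: "fmem s1 0 = fmem s0 0" using fr s by simp
  have cM: "c \<le> M" using 6(1) M_bounds(7) by simp
  have K1: "nmem s1 48 0 = nmem s0 48 0" "nmem s1 46 0 = N" by (simp_all add: f1 s0)
  have Npos: "0 < N" using N1 by simp
  show ?case unfolding wp.simps(4)
  proof (rule wp_use[OF wp_Digits[OF 6(3) cM K1(1) M_bounds(6) K1(2) Npos]])
    fix s2 :: "'a mem" assume dig: "\<forall>z<nmem s0 48 0. nmem s2 50 z = (c div N ^ z) mod N"
      and ag2: "agree (nwrites Digits) (fwrites Digits) s1 s2"
    note fr2 = agreeD2[OF ag2]
    have f2: "nmem s2 x = nmem s0 x" if "x \<in> {5, 20, 23, 27, 32, 43, 45, 46, 47, 48, 49}" for x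
      using that fr2(1)[of x] f1[of x] by auto
    have e2: "fmem s2 0 = fmem s0 0" using fr2 e1 by simp
    have dig2: "\<And>z. z < nmem s0 48 0 \<Longrightarrow> nmem s2 50 z = seed_digit s0 c z" using dig by (simp add: seed_digit_def s0)
    show "wp M Coordinates (wp M Emit (\<lambda>s''. nmem (upn s'' 59 0 (Suc c)) 60 0 = Suc c * n \<and> (\<forall>c'<Suc c. \<forall>v<n.
      fmem (upn s'' 59 0 (Suc c)) 1 (c' * n + v) = coordinate (fmem s0 0) c' (nmem s0 23 v)))) s2"
    proof (rule wp_use[OF wp_Coordinates[OF f2 dig2 e2]])
      fix s3 :: "'a mem" assume co: "\<forall>i<n. fmem s3 2 i = coordinate (fmem s0 0) c i"
        and ag3: "agree (nwrites Coordinates) (fwrites Coordinates) s2 s3"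
      note fr3 = agreeD2[OF ag3]
      have f3: "nmem s3 5 0 = n" "nmem s3 23 = nmem s0 23" "nmem s3 60 0 = c * n" "fmem s3 1 = fmem s1 1"
        using fr3 fr2 f1[of 5] f1[of 23] 6(4) s0(1) by simp_all
      show "wp M Emit (\<lambda>s''. nmem (upn s'' 59 0 (Suc c)) 60 0 = Suc c * n \<and> (\<forall>c'<Suc c. \<forall>v<n.
        fmem (upn s'' 59 0 (Suc c)) 1 (c' * n + v) = coordinate (fmem s0 0) c' (nmem s0 23 v))) s3"
      proof (rule wp_mono[OF wp_Emit[OF f3(1-3)]])
        fix s4 :: "'a mem" assume s4: "nmem s4 60 0 = Suc c * n \<and> fmem s4 1 = (\<lambda>x. if c * n \<le> x \<and> x < Suc c * n
          then fmem s3 2 (nmem s0 23 (x - c * n)) else fmem s3 1 x)"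
        have "fmem s4 1 (c' * n + v) = coordinate (fmem s0 0) c' (nmem s0 23 v)" if c': "c' < Suc c" and v: "v < n" for c' v
        proof (cases "c' = c")
          case True
          then show ?thesis using s4 v co s0(10)[OF v] by simp
        next
          case False
          then have "Suc c' \<le> c" using c' by simp
          then have "Suc c' * n \<le> c * n" by (rule mult_right_mono) simp
          then have "c' * n + v < c * n" using v by simp
          then show ?thesis using s4 6(4) False c' v f3(4) by simp
        qed
        with s4 show "nmem (upn s4 59 0 (Suc c)) 60 0 = Suc c * n \<and> (\<forall>c'<Suc c. \<forall>v<n.
          fmem (upn s4 59 0 (Suc c)) 1 (c' * n + v) = coordinate (fmem s0 0) c' (nmem s0 23 v))" by simp
      qed
    qed
  qed
next
  case (7 s1)
  have "nmem s1 49 0 = nmem s0 49 0" using agreeD2[OF 7(1)] s by simp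
  with 7(3) show ?case by simp
qed (use s M_bounds in auto)

end

section \<open>A good seed for every nonzero program\<close>

lemma keys_abp_poly:
  assumes "is_oabp n A" "m \<in> Poly_Mapping.keys (abp_poly A)"
  shows "Poly_Mapping.keys m \<subseteq> set (var_order A)"
proof
  fix i assume "i \<in> Poly_Mapping.keys m"
  then have "Poly_Mapping.lookup m i \<noteq> 0" by (simp add: in_keys_iff)
  with lookup_abp_poly_le[OF assms, of i] have "count_list (var_order A) i \<noteq> 0" by (cases "count_list (var_order A) i") auto
  then show "i \<in> set (var_order A)" by (simp add: count_list_0_iff)
qed

lemma (in coefficient_hom) evalh_abp_poly_cong:
  assumes "is_oabp n A" "\<And>i. i \<in> set (var_order A) \<Longrightarrow> x i = y i"
  shows "evalh (abp_poly A) x = evalh (abp_poly A) y"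
  unfolding evalh_def mon_val_def
proof (rule sum.cong[OF refl])
  fix m assume "m \<in> Poly_Mapping.keys (abp_poly A)"
  from keys_abp_poly[OF assms(1) this]
  have "(\<Prod>i\<in>Poly_Mapping.keys m. x i ^ Poly_Mapping.lookup m i) = (\<Prod>i\<in>Poly_Mapping.keys m. y i ^ Poly_Mapping.lookup m i)"
    using assms(2) by (intro prod.cong) auto
  then show "\<phi> (Poly_Mapping.lookup (abp_poly A) m) * (\<Prod>i\<in>Poly_Mapping.keys m. x i ^ Poly_Mapping.lookup m i) =
    \<phi> (Poly_Mapping.lookup (abp_poly A) m) * (\<Prod>i\<in>Poly_Mapping.keys m. y i ^ Poly_Mapping.lookup m i)" by simp
qed

text \<open>Any table of moduli and indices is the digit sequence of some seed. The memory is over a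
  type of its own, so the elements \<open>e\<close> may come from an extension of the field of the
  machine.\<close>

lemma (in coefficient_embedding) seed_nonzero:
  fixes s0 :: "'c mem" and e :: "nat \<Rightarrow> 'b"
  assumes sd: "setup_done n (n + w + d + 3) (var_order A) s0" and A: "is_oabp n A" and nz: "abp_poly A \<noteq> 0"
    and w: "abp_width A \<le> w" and d: "abp_degree A \<le> d" and n: "1 \<le> n"
    and e: "inj_on e {..<nmem s0 46 0}"
  shows "\<exists>c<nmem s0 49 0. evalh (abp_poly A) (\<lambda>v. \<Prod>j<levels n.
    e (seed_base s0 c (nmem s0 23 v) j) ^ seed_weight s0 c (nmem s0 23 v) j) \<noteq> 0"
proof -
  define k where "k = max_reads (var_order A)"
  let ?B = "n + w + d + 3" and ?xs = "var_order A" and ?cl = "nmem s0 32 0" and ?m = "levels n"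
  let ?rk = "nmem s0 23" and ?ph = "nmem s0 27"
  define N where "N = ?B ^ (16 * (k * k))"
  define G where "G = ?B ^ k"
  have B': "n + Suc w + d + 2 = ?B" by simp
  have k1: "1 \<le> k" and rdk: "\<And>i. count_list ?xs i \<le> k" unfolding k_def by (rule max_reads_props)+
  from sd have "(\<exists>p. (\<forall>j j' i i'. j < k \<and> j' < k \<and> i < n \<and> i' < n \<and> p j i = p j' i' \<longrightarrow> j = j' \<and> i = i') \<and>
        (\<forall>l<length ?xs. \<exists>j<k. p j (?rk (?xs ! l)) = l) \<and>
        (\<forall>c. regular k p {i. i < n \<and> ?ph i = c}))"
    unfolding setup_done_def Let_def k_def by (elim conjE)
  then obtain p where p1: "\<forall>j j' i i'. j < k \<and> j' < k \<and> i < n \<and> i' < n \<and> p j i = p j' i' \<longrightarrow> j = j' \<and> i = i'"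
    and p2: "\<forall>l<length ?xs. \<exists>j<k. p j (?rk (?xs ! l)) = l"
    and p3: "\<forall>c. regular k p {i. i < n \<and> ?ph i = c}" by (elim exE conjE) (rule that; assumption)
  have s: "inj_on ?rk {..<n}" "\<forall>v<n. ?rk v < n" "\<forall>i<n. ?ph i \<le> ?cl" "nmem s0 43 0 = ?m" "nmem s0 45 0 = G" "nmem s0 46 0 = N"
    "nmem s0 47 0 = Suc ?cl * ?m" "nmem s0 48 0 = 2 * (Suc ?cl * ?m)" "nmem s0 49 0 = N ^ (2 * (Suc ?cl * ?m))"
    using sd unfolding setup_done_def Let_def k_def N_def G_def by - (elim conjE, assumption)+
  have ph: "?ph i < Suc ?cl" if "i < n" for i using s(3) that by (simp add: less_Suc_eq_le)
  have lv: "?m = Suc (?m - 1)" by (simp add: levels_def)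
  have "\<exists>q a. (\<forall>c j. j \<le> ?m - 1 \<longrightarrow> q c j < N \<and> a c j < N) \<and>
    evalh (abp_poly A) (\<lambda>v. \<Prod>j\<le>?m - 1. e (a (?ph (?rk v)) j) ^ wt G (Suc (q (?ph (?rk v)) j)) (?rk v)) \<noteq> 0"
    unfolding N_def G_def B'[symmetric]
  proof (rule nonzero_generator[where p = p and P = "Suc ?cl"])
    show "abp_width A \<le> Suc w" using w by simp
    show "inj_on e {..<(n + Suc w + d + 2) ^ (16 * (k * k))}" using e unfolding s(6) N_def B' .
    show "n \<le> 2 ^ (?m - 1)" by (rule levels_props)
    show "\<And>j j' i i'. j < k \<Longrightarrow> j' < k \<Longrightarrow> i < n \<Longrightarrow> i' < n \<Longrightarrow> p j i = p j' i' \<Longrightarrow> j = j' \<and> i = i'"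
      by (rule p1[rule_format]) (intro conjI)
    show "\<And>l. l < depth A \<Longrightarrow> \<exists>j<k. p j (?rk (?xs ! l)) = l" by (rule p2[rule_format])
    show "\<And>c. regular k p {i. i < n \<and> ?ph i = c}" by (rule p3[rule_format])
    show "\<And>v. v < n \<Longrightarrow> ?rk v < n" by (rule s(2)[rule_format])
  qed (rule A nz d n k1 rdk s(1) ph; assumption?)+
  then obtain q a where qa: "\<And>c j. j \<le> ?m - 1 \<Longrightarrow> q c j < N" "\<And>c j. j \<le> ?m - 1 \<Longrightarrow> a c j < N"
    and ev: "evalh (abp_poly A) (\<lambda>v. \<Prod>j\<le>?m - 1. e (a (?ph (?rk v)) j) ^ wt G (Suc (q (?ph (?rk v)) j)) (?rk v)) \<noteq> 0"
    by blast
  define MM where "MM = Suc ?cl * ?m"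
  \<comment> \<open>The lower half of the digits holds the moduli and the upper half the indices,
    both in the order of \<open>seed_index\<close>: class times \<open>?m\<close> plus
    level.\<close>
  define D where "D z = (if z < MM then q (z div ?m) (z mod ?m) else a ((z - MM) div ?m) ((z - MM) mod ?m))" for z
  have mod: "z mod ?m \<le> ?m - 1" for z
  proof -
    have "z mod ?m < ?m" by (rule mod_less_divisor) (simp add: levels_def)
    then show ?thesis by simp
  qed
  have "D z < N" for z unfolding D_def using qa mod by simp
  then obtain c where c: "c < N ^ (2 * MM)" "\<And>z. z < 2 * MM \<Longrightarrow> (c div N ^ z) mod N = D z"
    using digits_exist[of "2 * MM" D N] by blast
  have dig: "seed_digit s0 c z = D z" if "z < 2 * MM" for z using c(2)[OF that] by (simp add: seed_digit_def s(6))
  have idx: "seed_index s0 i j < MM" "seed_index s0 i j div ?m = ?ph i" "seed_index s0 i j mod ?m = j"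
    if "i < n" "j < ?m" for i j
    using seed_index_less(1)[OF sd that] that unfolding s(7) MM_def by (simp_all add: seed_index_def s(4))
  have base: "seed_base s0 c i j = a (?ph i) j" if "i < n" "j < ?m" for i j
  proof -
    have "MM + seed_index s0 i j < 2 * MM" using idx(1)[OF that] by linarith
    from dig[OF this] show ?thesis unfolding seed_base_def s(7) MM_def[symmetric] by (simp add: D_def idx that)
  qed
  have weight: "seed_weight s0 c i j = wt G (Suc (q (?ph i) j)) i" if "i < n" "j < ?m" for i j
  proof -
    have "seed_index s0 i j < 2 * MM" using idx(1)[OF that] by linarith
    from dig[OF this] show ?thesis unfolding seed_weight_def s(5) by (simp add: D_def idx that)
  qed
  have set: "{..?m - 1} = {..<?m}" using lv lessThan_Suc_atMost[of "?m - 1"] by simp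
  have "evalh (abp_poly A) (\<lambda>v. \<Prod>j<?m. e (seed_base s0 c (?rk v) j) ^ seed_weight s0 c (?rk v) j) =
    evalh (abp_poly A) (\<lambda>v. \<Prod>j\<le>?m - 1. e (a (?ph (?rk v)) j) ^ wt G (Suc (q (?ph (?rk v)) j)) (?rk v))"
    unfolding set
  proof (rule evalh_abp_poly_cong[OF A], rule prod.cong[OF refl])
    fix v j assume "v \<in> set ?xs" "j \<in> {..<?m}"
    then have "?rk v < n" "j < ?m" using A s(2) by (auto simp: is_oabp_def)
    then show "e (seed_base s0 c (?rk v) j) ^ seed_weight s0 c (?rk v) j =
      e (a (?ph (?rk v)) j) ^ wt G (Suc (q (?ph (?rk v)) j)) (?rk v)" by (simp add: base weight)
  qed
  with ev have "evalh (abp_poly A) (\<lambda>v. \<Prod>j<?m. e (seed_base s0 c (?rk v) j) ^ seed_weight s0 c (?rk v) j) \<noteq> 0" by simp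
  with c(1) show ?thesis unfolding s(9) MM_def by blast
qed

lemma writes_Load_order [simp]: "nwrites Load_order = {5, 6, 7, 11, 20}" "fwrites Load_order = {}"
  by (auto simp: Load_order_def)

lemma length_le_iteration_bound:
  assumes "set xs \<subseteq> {..<n}" "1 \<le> n" "n < B" "4 \<le> B"
  shows "length xs \<le> iteration_bound n B (max_reads xs)"
proof -
  have "length xs \<le> n * max_reads xs" by (rule length_le_reads[OF assms(1)])
  also have "\<dots> \<le> iteration_bound n B (max_reads xs)" using assms by (intro bounds_le_iteration_bound max_reads_props)
  finally show ?thesis .
qed

lemma wp_Hitting_set_program:
  fixes es :: "'a::field list"
  assumes n: "1 \<le> n" and xs: "set xs \<subseteq> {..<n}" and M: "iteration_bound n (n + w + d + 3) (max_reads xs) \<le> M"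
  shows "wp M Hitting_set_program (\<lambda>s. \<exists>s0 :: 'a mem. setup_done n (n + w + d + 3) xs s0 \<and> nmem s 1 0 = nmem s0 49 0 \<and>
    nmem s0 49 0 \<le> M \<and> (\<forall>c<nmem s0 49 0. \<forall>v<n. fmem s 1 (c * n + v) = (\<Prod>j<levels n.
      fmem (order_input n w d xs es) 0 (seed_base s0 c (nmem s0 23 v) j) ^ seed_weight s0 c (nmem s0 23 v) j)))
    (order_input n w d xs es)"
proof -
  let ?s = "order_input n w d xs es" and ?B = "n + w + d + 3"
  have B: "4 \<le> ?B" "n < ?B" using n by auto
  have LM: "length xs \<le> M" using length_le_iteration_bound[OF xs n B(2,1)] M by linarith
  have mem: "nmem ?s 0 0 = n" "nmem ?s 0 (Suc 0) = w" "nmem ?s 0 2 = d" "nmem ?s 0 3 = length xs"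
    "\<And>l. l < length xs \<Longrightarrow> nmem ?s 0 (l + 5) = xs ! l" "\<And>x. x \<noteq> 0 \<Longrightarrow> nmem ?s x = (\<lambda>_. 0)"
    by (auto simp: order_input_def input_mem_def nth_append)
  have load: "wp M Load_order (\<lambda>s. nmem s 5 0 = n \<and> nmem s 6 0 = length xs \<and> nmem s 7 0 = ?B \<and>
    (\<forall>l<length xs. nmem s 20 l = xs ! l)) ?s"
    unfolding Load_order_def
  proof (simp add: mem, rule wp_For[where n = "length xs" and I = "\<lambda>j s. \<forall>l<j. nmem s 20 l = xs ! l"], goal_cases)
    case (6 j s)
    have "nmem s 0 (j + 5) = xs ! j" using agreeD2(1)[OF 6(2), of 0] mem(5)[OF 6(1)] by simp
    then show ?case using 6(3,4) by (auto simp: less_Suc_eq)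
  next
    case (7 s)
    then show ?case using agreeD2(1)[OF 7(1)] by (simp add: add_ac)
  qed (use LM in auto)
  show ?thesis unfolding Hitting_set_program_def wp.simps(4)
  proof (rule wp_use[OF load], elim conjE)
    fix s1 :: "'a mem" assume s1: "nmem s1 5 0 = n" "nmem s1 6 0 = length xs" "nmem s1 7 0 = ?B" "\<forall>l<length xs. nmem s1 20 l = xs ! l"
      and ag1: "agree (nwrites Load_order) (fwrites Load_order) ?s s1"
    note fr1 = agreeD2[OF ag1]
    have f1: "nmem s1 21 = (\<lambda>_. 0)" "nmem s1 22 = (\<lambda>_. 0)" "nmem s1 27 = (\<lambda>_. 0)" using fr1 mem(6) by simp_all
    show "wp M Setup (wp M Points (\<lambda>s. \<exists>s0 :: 'a mem. setup_done n ?B xs s0 \<and> nmem s 1 0 = nmem s0 49 0 \<and>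
      nmem s0 49 0 \<le> M \<and> (\<forall>c<nmem s0 49 0. \<forall>v<n. fmem s 1 (c * n + v) = (\<Prod>j<levels n.
        fmem ?s 0 (seed_base s0 c (nmem s0 23 v) j) ^ seed_weight s0 c (nmem s0 23 v) j)))) s1"
    proof (rule wp_use[OF wp_Setup[OF s1(1) n s1(2,3) B s1(4)[rule_format] xs f1 M]])
      fix s2 :: "'a mem" assume s2: "setup_done n ?B xs s2" and ag2: "agree (nwrites Setup) (fwrites Setup) s1 s2"
      have e: "fmem s2 0 = fmem ?s 0" using agreeD2[OF ag2] fr1 by simp
      interpret sd: seeded M n ?B xs s2 "max_reads xs" "?B ^ max_reads xs" "?B ^ (16 * (max_reads xs * max_reads xs))"
        by unfold_locales (use s2 B n M in auto)
      show "wp M Points (\<lambda>s. \<exists>s0 :: 'a mem. setup_done n ?B xs s0 \<and> nmem s 1 0 = nmem s0 49 0 \<and>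
        nmem s0 49 0 \<le> M \<and> (\<forall>c<nmem s0 49 0. \<forall>v<n. fmem s 1 (c * n + v) = (\<Prod>j<levels n.
          fmem ?s 0 (seed_base s0 c (nmem s0 23 v) j) ^ seed_weight s0 c (nmem s0 23 v) j))) s2"
        by (rule wp_mono[OF sd.wp_Points[OF refl]], rule exI[of _ s2])
          (simp add: s2 sd.M_bounds(7) sd.coordinate_def e)
    qed
  qed
qed


interpretation self: coefficient_embedding "\<lambda>x. x :: 'a::field"
  by unfold_locales auto

lemma eval_mpoly_eq: "eval_mpoly f a = self.evalh f ((!) a)"
  by (simp add: eval_mpoly_def self.evalh_def mon_val_def)

theorem hitting_set_program:
  fixes es :: "'a::field list"
  assumes n: "1 \<le> n" and xs: "set xs \<subseteq> {..<n}" and es: "distinct es"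
    "(n + w + d + 3) ^ (16 * (max_reads xs * max_reads xs)) \<le> length es"
  defines "M \<equiv> iteration_bound n (n + w + d + 3) (max_reads xs)"
  shows "\<exists>t s. runs Hitting_set_program (order_input n w d xs es) t s \<and> t \<le> time_bound M Hitting_set_program \<and>
    card (output_points n s) \<le> M \<and>
    hitting_set n (abp_poly ` {A \<in> read_k_oabps n k w d. var_order A = xs}) (output_points n s)"
proof -
  let ?s = "order_input n w d xs es" and ?B = "n + w + d + 3"
  from wp_sound[OF wp_Hitting_set_program[OF n xs, of w d M es]] obtain t s s0 where
    run: "runs Hitting_set_program ?s t s" "t \<le> time_bound M Hitting_set_program" and s0: "setup_done n ?B xs (s0 :: 'a mem)"
    and s: "nmem s 1 0 = nmem s0 49 0" "nmem s0 49 0 \<le> M"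
      "\<And>c v. c < nmem s0 49 0 \<Longrightarrow> v < n \<Longrightarrow> fmem s 1 (c * n + v) = (\<Prod>j<levels n.
        fmem ?s 0 (seed_base s0 c (nmem s0 23 v) j) ^ seed_weight s0 c (nmem s0 23 v) j)"
    by (auto simp: M_def)
  have "card (output_points n s) \<le> card {..<nmem s 1 0}" unfolding output_points_def by (rule card_image_le) simp
  then have card: "card (output_points n s) \<le> M" using s(1,2) by simp
  have N: "nmem s0 46 0 \<le> length es" using s0 es(2) unfolding setup_done_def Let_def by simp
  \<comment> \<open>The list \<open>es\<close> provides the \<open>N\<close> distinct elements of
    the grid.\<close>
  have inj: "inj_on (fmem ?s 0) {..<nmem s0 46 0}"
    using N es(1) by (auto simp: inj_on_def order_input_def input_mem_def nth_eq_iff_index_eq)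
  have "hitting_set n (abp_poly ` {A \<in> read_k_oabps n k w d. var_order A = xs}) (output_points n s)"
    unfolding hitting_set_def
  proof (intro conjI ballI impI)
    show "output_points n s \<subseteq> {a. length a = n}" by (auto simp: output_points_def)
    fix f :: "'a mpoly" assume "f \<in> abp_poly ` {A \<in> read_k_oabps n k w d. var_order A = xs}" "f \<noteq> 0"
    then obtain A where A: "is_oabp n A" "abp_width A \<le> w" "abp_degree A \<le> d" "var_order A = xs" "f = abp_poly A" "abp_poly A \<noteq> 0"
      by (auto simp: read_k_oabps_def)
    have s0': "setup_done n ?B (var_order A) s0" using s0 by (simp add: A(4))
    obtain c where c: "c < nmem s0 49 0" "self.evalh (abp_poly A) (\<lambda>v. \<Prod>j<levels n.
        fmem ?s 0 (seed_base s0 c (nmem s0 23 v) j) ^ seed_weight s0 c (nmem s0 23 v) j) \<noteq> 0"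
      using self.seed_nonzero[OF s0' A(1,6,2,3) n inj] by blast
    let ?a = "map (\<lambda>i. fmem s 1 (c * n + i)) [0..<n]"
    have "eval_mpoly f ?a = self.evalh (abp_poly A) (\<lambda>v. \<Prod>j<levels n.
        fmem ?s 0 (seed_base s0 c (nmem s0 23 v) j) ^ seed_weight s0 c (nmem s0 23 v) j)"
      unfolding eval_mpoly_eq A(5)
    proof (rule self.evalh_abp_poly_cong[OF A(1)])
      fix v assume "v \<in> set (var_order A)"
      then have "v < n" using xs A(4) by auto
      then show "?a ! v = (\<Prod>j<levels n. fmem ?s 0 (seed_base s0 c (nmem s0 23 v) j) ^ seed_weight s0 c (nmem s0 23 v) j)"
        using s(3)[OF c(1)] by simp
    qed
    moreover have "?a \<in> output_points n s" unfolding output_points_def using c(1) s(1) by auto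
    ultimately show "\<exists>a\<in>output_points n s. eval_mpoly f a \<noteq> 0" using c(2) by (intro bexI[of _ ?a]) auto
  qed
  with run card show ?thesis by (intro exI[of _ t] exI[of _ s] conjI)
qed

section \<open>The bounds\<close>

lemma levels_le:
  assumes "1 \<le> n"
  shows "real (levels n) \<le> 2 * (1 + log 2 (real n))"
proof -
  obtain j where j: "levels n = Suc j" by (auto simp: levels_def)
  have l0: "0 \<le> log 2 (real n)" using assms by simp
  show ?thesis
  proof (cases "j = 0")
    case True
    with j l0 show ?thesis by simp
  next
    case False
    then have "(2::nat) ^ (j - 1) < n" using levels_props(2)[OF j] by simp
    then have "(2::real) ^ (j - 1) \<le> real n" by (metis less_imp_le of_nat_le_iff of_nat_numeral of_nat_power)
    then have "real (j - 1) \<le> log 2 (real n)" using assms by (simp add: le_log_iff powr_realpow)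
    then show ?thesis using j False l0 by simp
  qed
qed

text \<open>The exponent of \<open>n\<close> increases with the number of reads, so
  \<open>k0\<close> may be replaced by \<open>k\<close>. In the factor 3, twice the potential counts
  for 2 and class 0 for 1; \<open>2 ^ (k * k)\<close> bounds both \<open>2 ^ (k0 - 1)\<close> and
  the cost of the parity passes.\<close>

lemma class_bound_le:
  assumes "1 \<le> n" "1 \<le> k0" "k0 \<le> k"
  shows "real (class_bound n k0) \<le> 3 * 4 ^ (k * k) * (real n powr (1 - 1 / 2 ^ (k - 1)) * (1 + log 2 (real n)))"
proof -
  let ?\<delta> = "\<lambda>k. 1 - 1 / 2 ^ (k - 1) :: real" and ?\<Lambda> = "1 + log 2 (real n)"
  let ?X = "real n powr ?\<delta> k"
  have l0: "0 \<le> log 2 (real n)" using assms by simp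
  have ln: "ln (real n) \<le> log 2 (real n)"
  proof -
    have "ln (2::real) \<le> 1" using ln_le_minus_one[of 2] by simp
    moreover have "0 < ln (2::real)" by simp
    moreover have "0 \<le> ln (real n)" using assms by simp
    ultimately have "ln (real n) * ln 2 \<le> ln (real n)" by (intro mult_left_le)
    then show ?thesis using \<open>0 < ln (2::real)\<close> by (simp add: log_def field_simps)
  qed
  have \<delta>: "?\<delta> k0 \<le> ?\<delta> k" using assms by (simp add: frac_le)
  have "harmonic_sum (1 / 2 ^ (k0 - 1)) n \<le> real n powr ?\<delta> k0 * (1 + ln (real n))"
    using assms by (intro harmonic_sum_le) auto
  also have "\<dots> \<le> ?X * ?\<Lambda>" using \<delta> ln assms l0 by (intro mult_mono powr_mono) auto
  finally have hs: "harmonic_sum (1 / 2 ^ (k0 - 1)) n \<le> ?X * ?\<Lambda>" .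
  have "?\<delta> k \<ge> 0" by simp
  then have "1 \<le> ?X" using assms by (intro ge_one_powr_ge_zero) auto
  then have X1: "1 * 1 \<le> ?X * ?\<Lambda>" using l0 by (intro mult_mono) auto
  have kk: "k0 * k0 \<le> k * k" using assms by (intro mult_mono) auto
  have "k0 - 1 \<le> k * k" using assms kk by (cases k0) auto
  then have p1: "(2::real) ^ (k0 - 1) \<le> 2 ^ (k * k)" by (intro power_increasing) auto
  have p2: "(2::real) ^ (k0 * k0) \<le> 2 ^ (k * k)" using kk by (intro power_increasing) auto
  have p3: "(1::real) \<le> 2 ^ (k * k)" by simp
  have Y: "0 \<le> 2 * harmonic_sum (1 / 2 ^ (k0 - 1)) n" using harmonic_sum_nonneg by simp
  have "real (class_bound n k0) \<le> (2 ^ (k0 - 1) * (2 * harmonic_sum (1 / 2 ^ (k0 - 1)) n) + 1) * 2 ^ (k0 * k0)"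
    unfolding class_bound_def using Y by (intro of_nat_floor) auto
  also have "\<dots> \<le> (2 ^ (k * k) * (2 * (?X * ?\<Lambda>)) + 2 ^ (k * k) * (?X * ?\<Lambda>)) * 2 ^ (k * k)"
  proof (intro mult_mono add_mono p1 p2)
    show "1 \<le> 2 ^ (k * k) * (?X * ?\<Lambda>)" using mult_mono[OF p3 X1] by simp
  qed (use hs Y X1 l0 in \<open>auto intro!: mult_nonneg_nonneg\<close>)
  also have "\<dots> = 3 * (2 * 2) ^ (k * k) * (?X * ?\<Lambda>)" unfolding power_mult_distrib by (simp add: algebra_simps)
  finally show ?thesis by simp
qed

text \<open>Let S = n + w + d + 2. The estimates \<open>?M + 3 \<le> ?M * ?M\<close> and
  \<open>B \<le> ?S * ?S\<close> double the exponent twice, and \<open>e\<close> is at most 256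
  times the main term, which gives 1024. The summand 32 is more than enough for
  \<open>8 \<le> exp 3\<close> and for the square of the logarithm; it is dictated by
  \<open>power_le_field_bound\<close>.\<close>

lemma power_le_pit_bound:
  assumes "1 \<le> n" "1 \<le> k0" "k0 \<le> k" "4 \<le> B" "n < B" "B \<le> n + w + d + 3" and c: "1024 * h + 32 \<le> c"
  shows "(real (iteration_bound n B k0) + 3) ^ h \<le> pit_bound c n k w d"
proof -
  let ?\<Lambda> = "1 + log 2 (real n)" and ?X = "real n powr (1 - 1 / 2 ^ (k - 1))" and ?S = "n + w + d + 2"
  let ?M = "iteration_bound n B k0"
  define e where "e = 16 * (k0 * k0) * (2 * (class_bound n k0 * levels n) + 4)"
  have \<Lambda>: "1 \<le> ?\<Lambda>" using assms by simp
  have X: "1 \<le> ?X" using assms by (intro ge_one_powr_ge_zero) auto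
  have M: "?M = B ^ e" by (simp add: iteration_bound_def e_def power_mult)
  have e1: "1 \<le> e" using assms by (simp add: e_def Suc_le_eq)
  have "B ^ 1 \<le> ?M" unfolding M using e1 assms by (intro power_increasing) auto
  then have M4: "4 \<le> ?M" using assms by simp
  then have "?M * 4 \<le> ?M * ?M" by (intro mult_left_mono) auto
  with M4 have "?M + 3 \<le> ?M * ?M" by linarith
  then have "(?M + 3) ^ h \<le> (?M * ?M) ^ h" by (rule power_mono) simp
  also have "\<dots> = B ^ (2 * e * h)" by (simp add: M power_add[symmetric] power_mult[symmetric] flip: mult_2)
  also have "\<dots> \<le> (?S * ?S) ^ (2 * e * h)"
  proof (intro power_mono)
    have "B \<le> ?S * 2" using assms by simp
    also have "?S * 2 \<le> ?S * ?S" by (intro mult_left_mono) auto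
    finally show "B \<le> ?S * ?S" .
  qed simp
  also have "\<dots> = ?S ^ (4 * e * h)" by (simp add: power_add[symmetric] power_mult[symmetric] flip: power2_eq_square)
  finally have "(?M + 3) ^ h \<le> ?S ^ (4 * e * h)" .
  then have "real ((?M + 3) ^ h) \<le> real (?S ^ (4 * e * h))" by (simp only: of_nat_le_iff)
  then have "(real ?M + 3) ^ h \<le> real ?S ^ (4 * e * h)" by simp
  also have "\<dots> = real ?S powr real (4 * e * h)" by (rule powr_realpow[symmetric]) simp
  also have "\<dots> \<le> pit_bound c n k w d" unfolding pit_bound_def
  proof (rule powr_mono)
    have kk: "real (k0 * k0) \<le> 2 ^ (k * k)"
    proof -
      have "k0 * k0 \<le> k * k" using assms by (intro mult_mono) auto
      also have "\<dots> \<le> 2 ^ (k * k)" by (rule less_imp_le[OF less_exp])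
      finally have "k0 * k0 \<le> 2 ^ (k * k)" .
      then have "real (k0 * k0) \<le> real (2 ^ (k * k))" by (simp only: of_nat_le_iff)
      then show ?thesis by simp
    qed
    have lv: "real (levels n) \<le> 2 * ?\<Lambda>" by (rule levels_le) fact
    have cb: "real (class_bound n k0) \<le> 3 * 4 ^ (k * k) * (?X * ?\<Lambda>)" by (rule class_bound_le) fact+
    have one: "1 * (1 * 1) \<le> 4 ^ (k * k) * (?X * ?\<Lambda> ^ 2)" using X \<Lambda> by (intro mult_mono one_le_power) auto
    have "real (2 * (class_bound n k0 * levels n) + 4) \<le> 2 * ((3 * 4 ^ (k * k) * (?X * ?\<Lambda>)) * (2 * ?\<Lambda>)) + 4"
    proof -
      have "real (class_bound n k0) * real (levels n) \<le> (3 * 4 ^ (k * k) * (?X * ?\<Lambda>)) * (2 * ?\<Lambda>)"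
        using X \<Lambda> by (intro mult_mono cb lv) auto
      then show ?thesis unfolding of_nat_add of_nat_mult of_nat_numeral by (intro add_right_mono mult_left_mono) auto
    qed
    also have "\<dots> \<le> 16 * (4 ^ (k * k) * (?X * ?\<Lambda> ^ 2))"
      using one by (simp add: power2_eq_square algebra_simps)
    finally have "real (k0 * k0) * real (2 * (class_bound n k0 * levels n) + 4) \<le> 2 ^ (k * k) * (16 * (4 ^ (k * k) * (?X * ?\<Lambda> ^ 2)))"
      by (intro mult_mono kk) auto
    also have "\<dots> = 16 * ((2 * 4) ^ (k * k) * (?X * ?\<Lambda> ^ 2))" unfolding power_mult_distrib by simp
    finally have A: "real (k0 * k0) * real (2 * (class_bound n k0 * levels n) + 4) \<le> 16 * ((2 * 4) ^ (k * k) * (?X * ?\<Lambda> ^ 2))" .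
    have "real e = 16 * (real (k0 * k0) * real (2 * (class_bound n k0 * levels n) + 4))"
      unfolding e_def by (simp only: of_nat_mult of_nat_numeral mult.assoc)
    also have "\<dots> \<le> 16 * (16 * ((2 * 4) ^ (k * k) * (?X * ?\<Lambda> ^ 2)))" by (rule mult_left_mono[OF A]) simp
    also have "\<dots> = 256 * (8 ^ (k * k) * (?X * ?\<Lambda> ^ 2))" by simp
    finally have e: "real e \<le> 256 * (8 ^ (k * k) * (?X * ?\<Lambda> ^ 2))" .
    have "real (4 * e * h) = 4 * real h * real e" by simp
    also have "\<dots> \<le> 4 * real h * (256 * (8 ^ (k * k) * (?X * ?\<Lambda> ^ 2)))" by (rule mult_left_mono[OF e]) simp
    also have "\<dots> = (1024 * real h) * (8 ^ (k * k) * (?X * ?\<Lambda> ^ 2))" by simp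
    also have "\<dots> \<le> real c * (exp (real c * real k ^ 2) * (?X * ?\<Lambda> ^ c))"
    proof (intro mult_mono)
      have "real (1024 * h) \<le> real c" using c by (simp only: of_nat_le_iff)
      then show "1024 * real h \<le> real c" by simp
      have "(8::real) \<le> exp 3"
      proof -
        have "(2::real) \<le> exp 1" using exp_ge_add_one_self[of 1] by simp
        then have "(2::real) ^ 3 \<le> exp 1 ^ 3" by (rule power_mono) simp
        then show ?thesis by (simp add: exp_of_nat_mult[symmetric])
      qed
      then have "(8::real) ^ (k * k) \<le> exp 3 ^ (k * k)" by (rule power_mono) simp
      also have "\<dots> = exp (real (k * k) * 3)" by (simp only: exp_of_nat_mult)
      also have "\<dots> \<le> exp (real c * real k ^ 2)"
      proof -
        have "3 * real k ^ 2 \<le> real c * real k ^ 2" using c by (intro mult_right_mono) auto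
        then show ?thesis by (simp add: power2_eq_square mult.commute)
      qed
      finally show "8 ^ (k * k) \<le> exp (real c * (real k)\<^sup>2)" .
      show "?\<Lambda> ^ 2 \<le> ?\<Lambda> ^ c" using \<Lambda> c by (intro power_increasing) auto
    qed (use X \<Lambda> in auto)
    finally show "real (4 * e * h) \<le> real c * ?X * exp (real c * real k ^ 2) * ?\<Lambda> ^ c" by (simp add: mult_ac)
  qed simp
  finally show ?thesis .
qed

text \<open>Passing from the base n + w + d + 3 to n + w + d + 2 doubles the exponent 16, hence the
  condition on \<open>c\<close>; the factor \<open>k0 * k0\<close> disappears in the
  exponential.\<close>

lemma power_le_field_bound:
  assumes "1 \<le> k0" "k0 \<le> k" "32 \<le> c"
  shows "real ((n + w + d + 3) ^ (16 * (k0 * k0))) \<le> field_bound c n k w d"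
proof -
  let ?S = "n + w + d + 2"
  have "n + w + d + 3 \<le> ?S * 2" by simp
  also have "?S * 2 \<le> ?S * ?S" by (intro mult_left_mono) auto
  finally have "(n + w + d + 3) ^ (16 * (k0 * k0)) \<le> (?S * ?S) ^ (16 * (k0 * k0))" by (rule power_mono) simp
  also have "\<dots> = ?S ^ (32 * (k0 * k0))" by (simp add: power_mult[symmetric] flip: power2_eq_square)
  finally have "real ((n + w + d + 3) ^ (16 * (k0 * k0))) \<le> real (?S ^ (32 * (k0 * k0)))" by (simp only: of_nat_le_iff)
  also have "\<dots> = real ?S powr real (32 * (k0 * k0))" by (simp only: of_nat_power, rule powr_realpow[symmetric]) simp
  also have "\<dots> \<le> field_bound c n k w d" unfolding field_bound_def
  proof (rule powr_mono)
    have "k0 * k0 \<le> k * k" using assms by (intro mult_mono) auto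
    then have "real (k0 * k0) \<le> real (k * k)" by (simp only: of_nat_le_iff)
    then have "real (k0 * k0) \<le> real k ^ 2" by (simp add: power2_eq_square)
    also have "\<dots> \<le> exp (real k ^ 2)" using exp_ge_add_one_self[of "real k ^ 2"] by linarith
    also have "\<dots> \<le> exp (real c * real k ^ 2)"
    proof -
      have "1 * real k ^ 2 \<le> real c * real k ^ 2" using assms by (intro mult_right_mono) auto
      then show ?thesis by simp
    qed
    finally have "real 32 * real (k0 * k0) \<le> real c * exp (real c * real k ^ 2)" using assms by (intro mult_mono) auto
    then show "real (32 * (k0 * k0)) \<le> real c * exp (real c * real k ^ 2)" by simp
  qed simp
  finally show ?thesis .
qed

section \<open>Reading a branching program\<close>

definition edge_coeffs :: "'a::zero oabp \<Rightarrow> nat \<times> nat \<times> nat \<Rightarrow> 'a list" where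
  "edge_coeffs A = (\<lambda>(l, u, v). if (l, u, v) \<in> edges A then coeffs (label A l u v) else [])"

definition edge_code :: "'a::zero oabp \<Rightarrow> nat \<times> nat \<times> nat \<Rightarrow> nat" where
  "edge_code A = (\<lambda>(l, u, v). if (l, u, v) \<in> edges A then Suc (length (coeffs (label A l u v))) else 0)"

text \<open>Truncated subtraction treats a missing edge like an edge with label 0, so the evaluation
  needs no case distinction.\<close>

lemma edge_code_minus_1: "edge_code A e - Suc 0 = length (edge_coeffs A e)"
  by (cases e) (simp add: edge_code_def edge_coeffs_def)

definition layer_pairs :: "'a::zero oabp \<Rightarrow> nat \<Rightarrow> nat \<Rightarrow> (nat \<times> nat \<times> nat) list" where
  "layer_pairs A l u = concat (map (\<lambda>u. map (\<lambda>v. (l, u, v)) [0..<layer_size A (Suc l)]) [0..<u])"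

text \<open>The state of three nested loops. The end of a row is the start of the next row, and the
  end of a layer the start of the next layer, so it is an invariant for all three of them.\<close>

definition pairs_before :: "'a::zero oabp \<Rightarrow> nat \<Rightarrow> nat \<Rightarrow> nat \<Rightarrow> (nat \<times> nat \<times> nat) list" where
  "pairs_before A l u v = concat (map (\<lambda>l. layer_pairs A l (layer_size A l)) [0..<l]) @ layer_pairs A l u @
     map (\<lambda>v. (l, u, v)) [0..<v]"

lemma pairs_before_simps:
  "pairs_before A 0 0 0 = []"
  "pairs_before A l u (Suc v) = pairs_before A l u v @ [(l, u, v)]"
  "pairs_before A l u (layer_size A (Suc l)) = pairs_before A l (Suc u) 0"
  "pairs_before A l (layer_size A l) 0 = pairs_before A (Suc l) 0 0"
  by (simp_all add: pairs_before_def layer_pairs_def)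

lemma pairs_before_Suc: "pairs_before A (Suc l) 0 0 = pairs_before A l 0 0 @ layer_pairs A l (layer_size A l)"
  by (simp add: pairs_before_def layer_pairs_def)

lemma vertex_pairs_eq: "vertex_pairs A = pairs_before A (depth A) 0 0"
  by (simp add: vertex_pairs_def pairs_before_def layer_pairs_def)

lemma upt_split: "i < n \<Longrightarrow> [0..<n] = [0..<i] @ i # [Suc i..<n]"
  by (metis le0 less_imp_le upt_add_eq_append upt_conv_Cons le_add_diff_inverse add_0)

lemma vertex_pairs_split:
  assumes "l < depth A" "u < layer_size A l" "v < layer_size A (Suc l)"
  shows "\<exists>es. vertex_pairs A = pairs_before A l u v @ (l, u, v) # es"
proof -
  let ?f = "\<lambda>l. layer_pairs A l (layer_size A l)"
  have row: "map (\<lambda>v. (l, u, v)) [0..<layer_size A (Suc l)] = map (\<lambda>v. (l, u, v)) [0..<v] @ (l, u, v) #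
      map (\<lambda>v. (l, u, v)) [Suc v..<layer_size A (Suc l)]"
    by (simp add: upt_split[OF assms(3)])
  obtain es where layer: "?f l = layer_pairs A l u @ map (\<lambda>v. (l, u, v)) [0..<layer_size A (Suc l)] @ es"
    unfolding layer_pairs_def by (simp add: upt_split[OF assms(2)])
  have empty: "layer_pairs A l 0 = []" for l by (simp add: layer_pairs_def)
  have "vertex_pairs A = concat (map ?f [0..<l]) @ ?f l @ concat (map ?f [Suc l..<depth A])"
    unfolding vertex_pairs_eq pairs_before_def by (simp add: empty upt_split[OF assms(1)])
  then show ?thesis unfolding layer row pairs_before_def by simp
qed

lemma length_pairs_before:
  assumes "\<And>l. l \<le> depth A \<Longrightarrow> layer_size A l \<le> w" "l \<le> depth A"
  shows "length (pairs_before A l 0 0) \<le> l * (w * w)"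
  using assms(2)
proof (induction l)
  case (Suc l)
  have len: "length (layer_pairs A l u) = u * layer_size A (Suc l)" for u
    by (induction u) (simp_all add: layer_pairs_def)
  have "layer_size A l * layer_size A (Suc l) \<le> w * w" using Suc.prems by (intro mult_mono assms(1)) auto
  then show ?case using Suc by (simp add: pairs_before_Suc len)
qed (simp add: pairs_before_simps)

lemma set_vertex_pairs: "set (vertex_pairs A) = {(l, u, v). l < depth A \<and> u < layer_size A l \<and> v < layer_size A (Suc l)}"
proof (intro equalityI subsetI)
  fix e assume "e \<in> {(l, u, v). l < depth A \<and> u < layer_size A l \<and> v < layer_size A (Suc l)}"
  then show "e \<in> set (vertex_pairs A)" using vertex_pairs_split[of _ A] by fastforce
qed (auto simp: vertex_pairs_def)

section \<open>The input format\<close>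

lemma encode_nats_eq:
  "encode_nats n A = [n, depth A] @ var_order A @ map (layer_size A) [0..<Suc (depth A)] @ map (edge_code A) (vertex_pairs A)"
  by (simp add: encode_nats_def edge_code_def)

lemma abp_input_nats:
  fixes A :: "'a::field oabp"
  shows "nmem (abp_input n A :: 'a mem) 0 0 = n" "nmem (abp_input n A :: 'a mem) 0 (Suc 0) = depth A"
    "\<And>l. l < depth A \<Longrightarrow> nmem (abp_input n A :: 'a mem) 0 (l + 2) = var_order A ! l"
    "\<And>l. l \<le> depth A \<Longrightarrow> nmem (abp_input n A :: 'a mem) 0 (l + depth A + 2) = layer_size A l"
    "\<And>es e es'. vertex_pairs A = es @ e # es' \<Longrightarrow>
      nmem (abp_input n A :: 'a mem) 0 (length es + (depth A + depth A + 3)) = edge_code A e"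
    "\<And>x. x \<noteq> 0 \<Longrightarrow> nmem (abp_input n A :: 'a mem) x = (\<lambda>_. 0)"
proof -
  show "nmem (abp_input n A :: 'a mem) 0 0 = n" "nmem (abp_input n A :: 'a mem) 0 (Suc 0) = depth A"
    "\<And>x. x \<noteq> 0 \<Longrightarrow> nmem (abp_input n A :: 'a mem) x = (\<lambda>_. 0)"
    by (auto simp: abp_input_def input_mem_def encode_nats_eq)
  show "nmem (abp_input n A :: 'a mem) 0 (l + 2) = var_order A ! l" if "l < depth A" for l
    using that by (simp add: abp_input_def input_mem_def encode_nats_eq nth_append)
  have sz: "(map (layer_size A) [0..<depth A] @ [layer_size A (depth A)]) ! l = layer_size A l" if "l \<le> depth A" for l
  proof -
    have "(map (layer_size A) [0..<Suc (depth A)]) ! l = layer_size A l" using that by (subst nth_map) (auto simp del: upt_Suc)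
    then show ?thesis by simp
  qed
  show "nmem (abp_input n A :: 'a mem) 0 (l + depth A + 2) = layer_size A l" if "l \<le> depth A" for l
  proof -
    have "encode_nats n A = (n # depth A # var_order A) @ map (layer_size A) [0..<Suc (depth A)] @ map (edge_code A) (vertex_pairs A)"
      by (simp add: encode_nats_eq)
    moreover have "l + depth A + 2 = length (n # depth A # var_order A) + l" by simp
    ultimately have "encode_nats n A ! (l + depth A + 2) = (map (layer_size A) [0..<Suc (depth A)] @ map (edge_code A) (vertex_pairs A)) ! l"
      by (simp only: nth_append_length_plus)
    also have "\<dots> = layer_size A l" using that by (subst nth_append) (auto simp: sz)
    finally show ?thesis using that by (simp add: abp_input_def input_mem_def encode_nats_eq)
  qed
  fix es e es' assume vp: "vertex_pairs A = es @ e # es'"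
  let ?pre = "[n, depth A] @ var_order A @ map (layer_size A) [0..<Suc (depth A)]"
  have "encode_nats n A = ?pre @ map (edge_code A) (vertex_pairs A)" by (simp add: encode_nats_eq)
  moreover have "length es + (depth A + depth A + 3) = length ?pre + length es" by simp
  ultimately have "encode_nats n A ! (length es + (depth A + depth A + 3)) = map (edge_code A) (vertex_pairs A) ! length es"
    by (simp only: nth_append_length_plus)
  also have "\<dots> = edge_code A e" unfolding vp by (simp add: nth_append)
  finally show "nmem (abp_input n A :: 'a mem) 0 (length es + (depth A + depth A + 3)) = edge_code A e"
    by (simp add: abp_input_def input_mem_def encode_nats_eq vp)
qed

lemma abp_input_coeffs:
  fixes A :: "'a::field oabp"
  assumes "vertex_pairs A = es @ e # es'" "j < length (edge_coeffs A e)"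
  shows "fmem (abp_input n A :: 'a mem) 0 (length (concat (map (edge_coeffs A) es)) + j) = edge_coeffs A e ! j"
proof -
  have "encode_coeffs A = concat (map (edge_coeffs A) (vertex_pairs A))" by (simp add: encode_coeffs_def edge_coeffs_def)
  then show ?thesis using assms(2) by (simp add: abp_input_def input_mem_def assms(1) nth_append)
qed

text \<open>A nonzero label of degree D has code D + 2. So the last two conditions make scalar 77
  the degree of the program once all pairs are loaded.\<close>

definition loaded :: "'a::field oabp \<Rightarrow> nat \<Rightarrow> (nat \<times> nat \<times> nat) list \<Rightarrow> 'a mem \<Rightarrow> bool" where
  "loaded A w es s \<longleftrightarrow> nmem s 75 0 = length es \<and> nmem s 78 0 = length (concat (map (edge_coeffs A) es)) \<and>
     (\<forall>i<length es. \<forall>l u v. es ! i = (l, u, v) \<longrightarrow> nmem s 70 i = l \<and> nmem s 71 i = l * w + u \<and>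
        nmem s 72 i = Suc l * w + v \<and> nmem s 73 i = edge_code A (l, u, v) \<and>
        nmem s 74 i = length (concat (map (edge_coeffs A) (take i es)))) \<and>
     (\<forall>e\<in>set es. edge_code A e \<le> nmem s 77 0 + 2) \<and> nmem s 77 0 \<le> abp_degree A"

lemma loaded_upn [simp]: "x \<notin> {70, 71, 72, 73, 74, 75, 77, 78} \<Longrightarrow> loaded A w es (upn s x i v) = loaded A w es s"
  by (simp add: loaded_def)

text \<open>Scalar 75 counts the pairs, 78 the coefficients read so far, and 77 is the largest
  degree so far. Scalars 79 and 80 are the numbers of the first vertices of the two layers, kept up
  to date by additions of the width in 76.\<close>

definition Load_pair :: prog where
  "Load_pair = NSet 73 (V 75) (NGet 0 (NAdd (V 75) (NAdd (NAdd (V 6) (V 6)) (NConst 3)))) ;;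
     NSet 70 (V 75) (V 11) ;; NSet 71 (V 75) (NAdd (V 79) (V 12)) ;; NSet 72 (V 75) (NAdd (V 80) (V 13)) ;;
     NSet 74 (V 75) (V 78) ;;
     If (NLess (V 77) (NSub (NGet 73 (V 75)) (NConst 2))) (77 ::= NSub (NGet 73 (V 75)) (NConst 2)) Skip ;;
     78 ::= NAdd (V 78) (NSub (NGet 73 (V 75)) (NConst 1)) ;; 75 ::= NAdd (V 75) (NConst 1)"

definition Load_row :: prog where
  "Load_row = For 13 (NGet 0 (NAdd (NAdd (V 11) (V 6)) (NConst 3))) Load_pair"

definition Load_layer :: prog where
  "Load_layer = 80 ::= NAdd (V 79) (V 76) ;; For 12 (NGet 0 (NAdd (NAdd (V 11) (V 6)) (NConst 2))) Load_row ;; 79 ::= V 80"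

definition Load_pairs :: prog where
  "Load_pairs = 75 ::= NConst 0 ;; 77 ::= NConst 0 ;; 78 ::= NConst 0 ;; 79 ::= NConst 0 ;; For 11 (V 6) Load_layer"

definition Load_width :: prog where
  "Load_width = 76 ::= NConst 0 ;; For 11 (NAdd (V 6) (NConst 1))
     (If (NLess (V 76) (NGet 0 (NAdd (NAdd (V 11) (V 6)) (NConst 2)))) (76 ::= NGet 0 (NAdd (NAdd (V 11) (V 6)) (NConst 2))) Skip)"

definition Load_abp :: prog where
  "Load_abp = 5 ::= NGet 0 (NConst 0) ;; 6 ::= NGet 0 (NConst 1) ;;
     For 11 (V 6) (NSet 20 (V 11) (NGet 0 (NAdd (V 11) (NConst 2)))) ;; Load_width ;; Load_pairs ;;
     7 ::= NAdd (NAdd (NAdd (V 5) (V 76)) (V 77)) (NConst 3)"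

lemma writes_Load_pair [simp]: "nwrites Load_pair = {70, 71, 72, 73, 74, 75, 77, 78}" "fwrites Load_pair = {}"
  by (auto simp: Load_pair_def)

lemma writes_Load_row [simp]: "nwrites Load_row = {13, 70, 71, 72, 73, 74, 75, 77, 78}" "fwrites Load_row = {}"
  by (auto simp: Load_row_def)

lemma writes_Load_layer [simp]: "nwrites Load_layer = {12, 13, 70, 71, 72, 73, 74, 75, 77, 78, 79, 80}" "fwrites Load_layer = {}"
  by (auto simp: Load_layer_def)

lemma writes_Load_pairs [simp]: "nwrites Load_pairs = {11, 12, 13, 70, 71, 72, 73, 74, 75, 77, 78, 79, 80}" "fwrites Load_pairs = {}"
  by (auto simp: Load_pairs_def)

lemma writes_Load_width [simp]: "nwrites Load_width = {11, 76}" "fwrites Load_width = {}"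
  by (auto simp: Load_width_def)

lemma writes_Load_abp [simp]: "nwrites Load_abp = {5, 6, 7, 11, 12, 13, 20, 70, 71, 72, 73, 74, 75, 76, 77, 78, 79, 80}" "fwrites Load_abp = {}"
  by (auto simp: Load_abp_def)

lemma wp_Load_pair:
  fixes s :: "'a::field mem"
  assumes ld: "loaded A w es s" and c: "nmem s 11 0 = l" "nmem s 12 0 = u" "nmem s 13 0 = v" "nmem s 79 0 = l * w" "nmem s 80 0 = Suc l * w"
    and code: "nmem s 0 (length es + (nmem s 6 0 + nmem s 6 0 + 3)) = edge_code A (l, u, v)" and deg: "edge_code A (l, u, v) \<le> abp_degree A + 2"
  shows "wp M Load_pair (loaded A w (es @ [(l, u, v)])) s"
proof -
  let ?c = "edge_code A (l, u, v)" and ?e = "length es"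
  let ?s = "upn (upn (upn (upn (upn s 73 ?e ?c) 70 ?e l) 71 ?e (l * w + u)) 72 ?e (Suc l * w + v)) 74 ?e (length (concat (map (edge_coeffs A) es)))"
  have 1: "nmem s 75 0 = ?e" "nmem s 78 0 = length (concat (map (edge_coeffs A) es))" using ld by (simp_all add: loaded_def)
  have fin: "loaded A w (es @ [(l, u, v)])
      (upn (upn s1 78 0 (length (concat (map (edge_coeffs A) es)) + (?c - 1))) 75 0 (Suc ?e))"
    if s1: "s1 = upn ?s 77 0 d" "nmem s 77 0 \<le> d" "?c \<le> d + 2" "d \<le> abp_degree A" for s1 d
    unfolding loaded_def
  proof (intro conjI)
    show "\<forall>e\<in>set (es @ [(l, u, v)]). edge_code A e \<le> nmem (upn (upn s1 78 0 (length (concat (map (edge_coeffs A) es)) + (?c - 1))) 75 0 (Suc ?e)) 77 0 + 2"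
      using ld that by (fastforce simp: loaded_def)
  qed (use ld that in \<open>auto simp: loaded_def nth_append less_Suc_eq edge_code_minus_1\<close>)
  have dd: "nmem s 77 0 \<le> abp_degree A" using ld by (simp add: loaded_def)
  have id: "upn ?s 77 0 (nmem s 77 0) = ?s" by (simp add: upn_def fun_eq_iff)
  show ?thesis
  proof (cases "nmem s 77 0 < ?c - 2")
    case True
    then show ?thesis unfolding Load_pair_def using fin[of _ "?c - 2", OF refl] deg code by (simp add: 1 c)
  next
    case False
    then show ?thesis unfolding Load_pair_def using fin[OF id[symmetric]] dd code by (simp add: 1 c)
  qed
qed

lemma wp_Load_pairs:
  fixes s :: "'a::field mem"
  assumes A: "is_oabp n A" and inp: "nmem s 0 = nmem (abp_input n A :: 'a mem) 0" and L: "nmem s 6 0 = depth A" "depth A \<le> M"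
    and w: "nmem s 76 0 = w" "\<And>l. l \<le> depth A \<Longrightarrow> layer_size A l \<le> M"
  shows "wp M Load_pairs (loaded A w (vertex_pairs A)) s"
  unfolding Load_pairs_def
proof (simp, rule wp_For[where n = "depth A" and I = "\<lambda>l s'. loaded A w (pairs_before A l 0 0) s' \<and> nmem s' 79 0 = l * w"], goal_cases)
  case (6 l s1)
  note fr1 = agreeD2(1)[OF 6(2)]
  have f1: "nmem s1 0 = nmem (abp_input n A :: 'a mem) 0" "nmem s1 6 0 = depth A" "nmem s1 76 0 = w" using fr1 inp L w by simp_all
  have sz: "nmem (abp_input n A :: 'a mem) 0 (l + depth A + 2) = layer_size A l" using 6(1) by (intro abp_input_nats) simp
  have sz': "nmem (abp_input n A :: 'a mem) 0 (l + depth A + 3) = layer_size A (Suc l)"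
  proof -
    have "l + depth A + 3 = Suc l + depth A + 2" by simp
    then show ?thesis using 6(1) abp_input_nats(4)[of "Suc l" A n] by (simp only:) 
  qed
  let ?s1 = "upn s1 80 0 (l * w + w)"
  let ?c = "For 12 (NGet 0 (NAdd (NAdd (V 11) (V 6)) (NConst 2))) Load_row"
  have W: "wp M ?c (loaded A w (pairs_before A (Suc l) 0 0)) ?s1"
  proof (rule wp_For[where n = "layer_size A l" and I = "\<lambda>u s'. loaded A w (pairs_before A l u 0) s'"], goal_cases)
    case (6 u s2)
    note fr2 = agreeD2(1)[OF 6(2)]
    have f2: "nmem s2 0 = nmem (abp_input n A :: 'a mem) 0" "nmem s2 6 0 = depth A" "nmem s2 11 0 = l" "nmem s2 79 0 = l * w" "nmem s2 80 0 = Suc l * w"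
      using fr2 f1 \<open>nmem s1 11 0 = l\<close> \<open>loaded A w (pairs_before A l 0 0) s1 \<and> nmem s1 79 0 = l * w\<close> by simp_all
    have "wp M Load_row (loaded A w (pairs_before A l (Suc u) 0)) s2" unfolding Load_row_def
    proof (rule wp_For[where n = "layer_size A (Suc l)" and I = "\<lambda>v s'. loaded A w (pairs_before A l u v) s'"], goal_cases)
      case (6 v s3)
      note fr3 = agreeD2(1)[OF 6(2)]
      have f3: "nmem s3 0 = nmem (abp_input n A :: 'a mem) 0" "nmem s3 6 0 = depth A" "nmem s3 11 0 = l" "nmem s3 79 0 = l * w" "nmem s3 80 0 = Suc l * w"
        "nmem s3 12 0 = u" using fr3 f2 \<open>nmem s2 12 0 = u\<close> by simp_all
      obtain es where es: "vertex_pairs A = pairs_before A l u v @ (l, u, v) # es"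
        using vertex_pairs_split[OF \<open>l < depth A\<close> \<open>u < layer_size A l\<close> 6(1)] by blast
      have code: "nmem s3 0 (length (pairs_before A l u v) + (nmem s3 6 0 + nmem s3 6 0 + 3)) = edge_code A (l, u, v)"
        unfolding f3(1,2) by (rule abp_input_nats(5)[OF es])
      have deg: "edge_code A (l, u, v) \<le> abp_degree A + 2"
        using degree_label_le[OF A, of l u v] by (cases "label A l u v = 0") (auto simp: edge_code_def length_coeffs_degree)
      have "wp M Load_pair (loaded A w (pairs_before A l u (Suc v))) s3" unfolding pairs_before_simps(2)
        by (rule wp_Load_pair[OF 6(4) f3(3,6) 6(3) f3(4,5) code deg])
      then show ?case by simp
    next
      case (7 s3)
      then show ?case by (simp add: pairs_before_simps)
    qed (use f2 6 sz' w(2)[of "Suc l"] \<open>l < depth A\<close> in auto)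
    then show ?case by simp
  next
    case (7 s2)
    then show ?case by (simp add: pairs_before_simps)
  qed (use f1 sz 6 w(2)[of l] in auto)
  show ?case unfolding Load_layer_def wp.simps(4)
  proof (rule wp_NSetI[where i = 0 and v = "l * w + w"], simp, simp add: f1 6(4), rule wp_use[OF W])
    fix s' assume "loaded A w (pairs_before A (Suc l) 0 0) s'" and ag: "agree (nwrites ?c) (fwrites ?c) ?s1 s'"
    then show "wp M (79 ::= V 80) (\<lambda>s'. loaded A w (pairs_before A (Suc l) 0 0) (upn s' 11 0 (Suc l)) \<and>
        nmem (upn s' 11 0 (Suc l)) 79 0 = Suc l * w) s'"
      using agreeD2(1)[OF ag, of 80] by (simp add: loaded_def)
  qed
qed (use L in \<open>auto simp: vertex_pairs_eq loaded_def pairs_before_simps\<close>)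

lemma wp_Load_width:
  fixes s :: "'a::field mem"
  assumes inp: "nmem s 0 = nmem (abp_input n A :: 'a mem) 0" and L: "nmem s 6 0 = depth A" "Suc (depth A) \<le> M"
  shows "wp M Load_width (\<lambda>s'. nmem s' 76 0 = abp_width A) s"
  unfolding Load_width_def
proof (simp, rule wp_For[where n = "Suc (depth A)" and I = "\<lambda>l s'. nmem s' 76 0 \<le> abp_width A \<and> (\<forall>l'<l. layer_size A l' \<le> nmem s' 76 0)"], goal_cases)
  case (6 l s1)
  have f1: "nmem s1 0 = nmem (abp_input n A :: 'a mem) 0" "nmem s1 6 0 = depth A" using agreeD2(1)[OF 6(2)] inp L by simp_all
  have "layer_size A l \<le> abp_width A" using 6(1) by (intro layer_size_le) simp
  moreover have "nmem (abp_input n A :: 'a mem) 0 (l + depth A + 2) = layer_size A l" using 6(1) by (intro abp_input_nats) simp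
  ultimately show ?case using 6(3,4) by (auto simp: f1 less_Suc_eq)
next
  case (7 s1)
  have "abp_width A \<le> nmem s1 76 0" unfolding abp_width_def using 7 by (subst Max_le_iff) (auto simp: less_Suc_eq_le)
  with 7 show ?case by simp
qed (use L in auto)

lemma wp_Load_abp:
  fixes A :: "'a::field oabp"
  assumes A: "is_oabp n A" and M: "Suc (depth A) \<le> M" "abp_width A \<le> M"
  shows "wp M Load_abp (\<lambda>s'. nmem s' 5 0 = n \<and> nmem s' 6 0 = depth A \<and> nmem s' 76 0 = abp_width A \<and>
    nmem s' 7 0 = n + abp_width A + abp_degree A + 3 \<and> (\<forall>l<depth A. nmem s' 20 l = var_order A ! l) \<and>
    loaded A (abp_width A) (vertex_pairs A) s') (abp_input n A)"
proof -
  let ?s = "abp_input n A :: 'a mem" and ?w = "abp_width A"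
  let ?c = "For 11 (V 6) (NSet 20 (V 11) (NGet 0 (NAdd (V 11) (NConst 2))))"
  have size: "layer_size A l \<le> M" if "l \<le> depth A" for l using layer_size_le[OF that] M by linarith
  have deg: "nmem s' 77 0 = abp_degree A" if ld: "loaded A ?w (vertex_pairs A) s'" for s' :: "'a mem"
  proof (rule antisym)
    show "nmem s' 77 0 \<le> abp_degree A" using ld by (simp add: loaded_def)
    have "degree (label A l u v) \<le> nmem s' 77 0" if e: "(l, u, v) \<in> edges A" for l u v
    proof (cases "label A l u v = 0")
      case False
      have "(l, u, v) \<in> set (vertex_pairs A)" using A e by (auto simp: set_vertex_pairs is_oabp_def)
      then have "edge_code A (l, u, v) \<le> nmem s' 77 0 + 2" using ld by (auto simp: loaded_def)
      then show ?thesis using False e by (simp add: edge_code_def length_coeffs_degree)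
    qed simp
    then show "abp_degree A \<le> nmem s' 77 0" unfolding abp_degree_def using finite_edges[OF A] by (subst Max_le_iff) auto
  qed
  have order: "wp M ?c (\<lambda>s'. \<forall>l<depth A. nmem s' 20 l = var_order A ! l) (upn (upn ?s 5 0 n) 6 0 (depth A))"
  proof (rule wp_For[where n = "depth A" and I = "\<lambda>j s'. \<forall>l<j. nmem s' 20 l = var_order A ! l"], goal_cases)
    case (6 j s')
    have "nmem s' 0 = nmem ?s 0" using agreeD2(1)[OF 6(2)] by simp
    then show ?case using 6(1,3,4) abp_input_nats(3)[of j A n] by (auto simp: less_Suc_eq)
  qed (use M in auto)
  let ?c7 = "7 ::= NAdd (NAdd (NAdd (V 5) (V 76)) (V 77)) (NConst 3)"
  let ?Q = "\<lambda>s'. nmem s' 5 0 = n \<and> nmem s' 6 0 = depth A \<and> nmem s' 76 0 = abp_width A \<and>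
    nmem s' 7 0 = n + abp_width A + abp_degree A + 3 \<and> (\<forall>l<depth A. nmem s' 20 l = var_order A ! l) \<and>
    loaded A (abp_width A) (vertex_pairs A) s'"
  show ?thesis unfolding Load_abp_def wp.simps(4)
  proof (rule wp_NSetI[where i = 0 and v = n], simp, simp add: abp_input_nats, rule wp_NSetI[where i = 0 and v = "depth A"],
      simp, simp add: abp_input_nats, rule wp_use[OF order])
    fix s1 :: "'a mem" assume s1: "\<forall>l<depth A. nmem s1 20 l = var_order A ! l"
      and ag1: "agree (nwrites ?c) (fwrites ?c) (upn (upn ?s 5 0 n) 6 0 (depth A)) s1"
    note fr1 = agreeD2(1)[OF ag1]
    have f1: "nmem s1 0 = nmem ?s 0" "nmem s1 6 0 = depth A" "nmem s1 5 0 = n" using fr1 by simp_all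
    show "wp M Load_width (wp M Load_pairs (wp M ?c7 ?Q)) s1"
    proof (rule wp_use[OF wp_Load_width[OF f1(1,2) M(1)]])
      fix s2 :: "'a mem" assume s2: "nmem s2 76 0 = ?w" and ag2: "agree (nwrites Load_width) (fwrites Load_width) s1 s2"
      note fr2 = agreeD2(1)[OF ag2]
      have f2: "nmem s2 0 = nmem ?s 0" "nmem s2 6 0 = depth A" "nmem s2 5 0 = n" "nmem s2 20 = nmem s1 20" using fr2 f1 by simp_all
      have LM: "depth A \<le> M" using M by simp
      show "wp M Load_pairs (wp M ?c7 ?Q) s2"
      proof (rule wp_use[OF wp_Load_pairs[OF A f2(1,2) LM s2 size]])
        fix s3 :: "'a mem" assume s3: "loaded A ?w (vertex_pairs A) s3" and ag3: "agree (nwrites Load_pairs) (fwrites Load_pairs) s2 s3"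
        note fr3 = agreeD2(1)[OF ag3]
        show "wp M ?c7 ?Q s3" using s3 deg[OF s3] fr3 f2 s2 s1 by simp
      qed
    qed
  qed
qed

section \<open>The identity test\<close>

interpretation const: coefficient_hom "\<lambda>c. [:c:] :: 'a::field poly"
  by unfold_locales (auto simp: one_pCons)

text \<open>The label after every variable i has been replaced by the power \<open>X i\<close> of
  one new variable. It is given by the stored coefficients, of which a missing edge has
  none.\<close>

definition edge_poly :: "'a::field oabp \<Rightarrow> (nat \<Rightarrow> nat) \<Rightarrow> nat \<times> nat \<times> nat \<Rightarrow> 'a poly" where
  "edge_poly A X e = (\<Sum>j<length (edge_coeffs A e). monom (edge_coeffs A e ! j) (j * X (var_order A ! fst e)))"

text \<open>The vertex (l, u) has the number \<open>l * w + u\<close>, where w is the width.\<close>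

fun edge_step :: "'a::field oabp \<Rightarrow> (nat \<Rightarrow> nat) \<Rightarrow> nat \<Rightarrow> (nat \<Rightarrow> 'a poly) \<Rightarrow> nat \<times> nat \<times> nat \<Rightarrow> (nat \<Rightarrow> 'a poly)" where
  "edge_step A X w F (l, u, v) = F(Suc l * w + v := F (Suc l * w + v) + edge_poly A X (l, u, v) * F (l * w + u))"

lemma edge_poly_eq:
  "edge_poly A X (l, u, v) = (if (l, u, v) \<in> edges A then const.label_val A (\<lambda>i. monom 1 (X i)) l u v else 0)"
proof (cases "(l, u, v) \<in> edges A \<and> label A l u v \<noteq> 0")
  case True
  let ?p = "label A l u v"
  have c: "edge_coeffs A (l, u, v) = coeffs ?p" using True by (simp add: edge_coeffs_def)
  have len: "length (coeffs ?p) = Suc (degree ?p)" using True by (simp add: length_coeffs_degree)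
  have "edge_poly A X (l, u, v) = (\<Sum>j\<le>degree ?p. monom (coeff ?p j) (j * X (var_order A ! l)))"
    unfolding edge_poly_def c len lessThan_Suc_atMost by (intro sum.cong refl) (use True in \<open>auto simp: coeffs_nth\<close>)
  also have "\<dots> = const.label_val A (\<lambda>i. monom 1 (X i)) l u v"
    by (simp add: const.label_val_def monom_power smult_monom mult.commute)
  finally show ?thesis using True by simp
next
  case False
  then show ?thesis by (auto simp: edge_poly_def edge_coeffs_def const.label_val_def)
qed

text \<open>Edges between layers l and l + 1 change only polynomials of layer l + 1. So, although
  the updates are made in place, all of them read the source polynomials from before the
  layer.\<close>

lemma layer_fold:
  fixes F :: "nat \<Rightarrow> 'a::field poly"
  assumes "\<And>e. e \<in> set es \<Longrightarrow> \<exists>u v. e = (l, u, v) \<and> u < w \<and> v < w" "v < w"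
  shows "foldl (edge_step A X w) F es (l' * w + v) = F (l' * w + v) + (if l' = Suc l then
    (\<Sum>e\<leftarrow>es. if snd (snd e) = v then edge_poly A X e * F (l * w + fst (snd e)) else 0) else 0)"
  using assms
proof (induction es arbitrary: F)
  case (Cons e es)
  obtain u' v' where e: "e = (l, u', v')" "u' < w" "v' < w" using Cons.prems(1)[of e] by auto
  have src: "edge_step A X w F e (l * w + u) = F (l * w + u)" if "u < w" for u
    using pair_index_inj[of l w u "Suc l" v'] that e by auto
  have tgt: "edge_step A X w F e (l' * w + v) = F (l' * w + v) +
      (if l' = Suc l \<and> v' = v then edge_poly A X e * F (l * w + u') else 0)"
  proof (cases "l' = Suc l \<and> v' = v")
    case False
    then have "l' * w + v \<noteq> Suc l * w + v'" using pair_index_inj[of l' w v "Suc l" v'] e Cons.prems(2) by metis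
    with False show ?thesis by (auto simp: e)
  qed (simp add: e)
  have sum: "(\<Sum>e'\<leftarrow>es. if snd (snd e') = v then edge_poly A X e' * edge_step A X w F e (l * w + fst (snd e')) else 0) =
      (\<Sum>e'\<leftarrow>es. if snd (snd e') = v then edge_poly A X e' * F (l * w + fst (snd e')) else 0)"
  proof (intro arg_cong[of _ _ sum_list] map_cong refl)
    fix e' assume "e' \<in> set es"
    then obtain u'' v'' where "e' = (l, u'', v'')" "u'' < w" using Cons.prems(1)[of e'] by auto
    then show "(if snd (snd e') = v then edge_poly A X e' * edge_step A X w F e (l * w + fst (snd e')) else 0) =
      (if snd (snd e') = v then edge_poly A X e' * F (l * w + fst (snd e')) else 0)" using src by simp
  qed
  have IH: "foldl (edge_step A X w) (edge_step A X w F e) es (l' * w + v) = edge_step A X w F e (l' * w + v) + (if l' = Suc l then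
    (\<Sum>e'\<leftarrow>es. if snd (snd e') = v then edge_poly A X e' * edge_step A X w F e (l * w + fst (snd e')) else 0) else 0)"
    by (rule Cons.IH) (use Cons.prems in auto)
  have proj: "fst (snd e) = u'" "snd (snd e) = v'" by (simp_all add: e)
  show ?case unfolding foldl_Cons IH sum tgt by (simp add: proj add.assoc)
qed simp

lemma sum_list_layer_pairs:
  fixes f :: "nat \<Rightarrow> 'b::comm_semiring_0"
  assumes "v < layer_size A (Suc l)"
  shows "(\<Sum>e\<leftarrow>layer_pairs A l m. if snd (snd e) = v then g e * f (fst (snd e)) else 0) =
    (\<Sum>u<m. g (l, u, v) * f u)"
proof (induction m)
  case (Suc m)
  have "(\<Sum>x\<leftarrow>[0..<n]. if x = v then h x else 0) = (if v < n then h v else 0)" for n and h :: "nat \<Rightarrow> 'b"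
    by (induction n) auto
  from this[where n = "layer_size A (Suc l)" and h = "\<lambda>x. g (l, m, x) * f (fst (snd (l, m, x)))"]
  have "(\<Sum>x\<leftarrow>[0..<layer_size A (Suc l)]. if x = v then g (l, m, x) * f (fst (snd (l, m, x))) else 0) = g (l, m, v) * f m"
    using assms by simp
  then show ?case using Suc by (simp add: layer_pairs_def comp_def)
qed (simp add: layer_pairs_def)

text \<open>Adding up the contributions is correct because a layer is still zero when its first
  incoming edge is processed.\<close>

lemma fold_pairs:
  fixes A :: "'a::field oabp"
  assumes w: "\<And>l. l \<le> depth A \<Longrightarrow> layer_size A l \<le> w" and w1: "0 < w" and F0: "F0 = (\<lambda>i. if i = 0 then 1 else 0 :: 'a poly)"
    and l: "l \<le> depth A"
  shows "(\<forall>l'\<le>l. \<forall>u<layer_size A l'. foldl (edge_step A X w) F0 (pairs_before A l 0 0) (l' * w + u) =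
      const.abp_val A (\<lambda>i. monom 1 (X i)) l' u) \<and>
    (\<forall>l'>l. \<forall>u<w. foldl (edge_step A X w) F0 (pairs_before A l 0 0) (l' * w + u) = 0)"
  using l
proof (induction l)
  case 0
  show ?case using w1 by (simp add: pairs_before_simps F0)
next
  case (Suc l)
  let ?F = "foldl (edge_step A X w) F0 (pairs_before A l 0 0)" and ?G = "foldl (edge_step A X w) F0 (pairs_before A (Suc l) 0 0)"
  let ?es = "layer_pairs A l (layer_size A l)" and ?x = "\<lambda>i. monom 1 (X i) :: 'a poly"
  have IH: "\<forall>l'\<le>l. \<forall>u<layer_size A l'. ?F (l' * w + u) = const.abp_val A ?x l' u" "\<forall>l'>l. \<forall>u<w. ?F (l' * w + u) = 0"
    using Suc by simp_all
  have es: "\<exists>u v. e = (l, u, v) \<and> u < w \<and> v < w" if "e \<in> set ?es" for e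
    using that w[of l] w[of "Suc l"] Suc.prems by (force simp: layer_pairs_def)
  have G: "?G (l' * w + v) = ?F (l' * w + v) + (if l' = Suc l then
    (\<Sum>e\<leftarrow>?es. if snd (snd e) = v then edge_poly A X e * ?F (l * w + fst (snd e)) else 0) else 0)" if "v < w" for l' v
    unfolding pairs_before_Suc foldl_append by (rule layer_fold[OF es that])
  have new: "?G (Suc l * w + v) = const.abp_val A ?x (Suc l) v" if v: "v < layer_size A (Suc l)" for v
  proof -
    have vw: "v < w" using v w[of "Suc l"] Suc.prems by simp
    have z: "?F (Suc l * w + v) = 0" by (rule IH(2)[rule_format, OF _ vw]) simp
    have "?G (Suc l * w + v) = (\<Sum>u<layer_size A l. edge_poly A X (l, u, v) * ?F (l * w + u))"
      unfolding G[OF vw] z using sum_list_layer_pairs[OF v, of "edge_poly A X" "\<lambda>u. ?F (l * w + u)" "layer_size A l"] by simp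
    also have "\<dots> = const.abp_val A ?x (Suc l) v"
      unfolding const.abp_val.simps edge_poly_eq by (intro sum.cong refl) (use IH(1) in simp)
    finally show ?thesis .
  qed
  show ?case
  proof (intro conjI allI impI)
    fix l' u assume "l' \<le> Suc l" and u: "u < layer_size A l'"
    show "?G (l' * w + u) = const.abp_val A ?x l' u"
    proof (cases "l' = Suc l")
      case True
      then show ?thesis using new u by simp
    next
      case False
      then have "l' \<le> l" using \<open>l' \<le> Suc l\<close> by simp
      moreover have "u < w" using u w[of l'] \<open>l' \<le> Suc l\<close> Suc.prems by simp
      ultimately show ?thesis using G[of u l'] False IH(1) u by simp
    qed
  next
    fix l' u assume "l' > Suc l" "u < w"
    then show "?G (l' * w + u) = 0" using G[of u l'] IH(2) by simp
  qed
qed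

lemma fold_vertex_pairs:
  fixes A :: "'a::field oabp"
  assumes A: "is_oabp n A" and F0: "F0 = (\<lambda>i. if i = 0 then 1 else 0 :: 'a poly)"
  shows "foldl (edge_step A X (abp_width A)) F0 (vertex_pairs A) (depth A * abp_width A) =
    const.evalh (abp_poly A) (\<lambda>i. monom 1 (X i))"
proof -
  have "0 < abp_width A" using layer_size_le[of 0 A] A by (simp add: is_oabp_def)
  then have "foldl (edge_step A X (abp_width A)) F0 (pairs_before A (depth A) 0 0) (depth A * abp_width A + 0) =
      const.abp_val A (\<lambda>i. monom 1 (X i)) (depth A) 0"
    by (intro fold_pairs[THEN conjunct1, rule_format, OF layer_size_le _ F0 order_refl order_refl])
      (use A in \<open>simp_all add: is_oabp_def\<close>)
  then show ?thesis by (simp add: vertex_pairs_eq const.evalh_abp_poly[OF A])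
qed

lemma degree_edge_poly:
  assumes A: "is_oabp n A" and X: "\<And>i. i < n \<Longrightarrow> abp_degree A * X i \<le> Q" and e: "fst e < depth A"
  shows "j < length (edge_coeffs A e) \<Longrightarrow> j * X (var_order A ! fst e) \<le> Q" "degree (edge_poly A X e) \<le> Q"
proof -
  obtain l u v where e': "e = (l, u, v)" by (cases e)
  have "var_order A ! fst e < n" using A e nth_mem by (fastforce simp: is_oabp_def)
  note X' = X[OF this]
  show 1: "j * X (var_order A ! fst e) \<le> Q" if "j < length (edge_coeffs A e)" for j
  proof -
    have "j \<le> abp_degree A" using that degree_label_le[OF A, of l u v]
      by (cases "label A l u v = 0") (auto simp: e' edge_coeffs_def length_coeffs_degree split: if_splits)
    then have "j * X (var_order A ! fst e) \<le> abp_degree A * X (var_order A ! fst e)" by (rule mult_right_mono) simp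
    with X' show ?thesis by linarith
  qed
  show "degree (edge_poly A X e) \<le> Q" unfolding edge_poly_def
    by (rule degree_sum_le) (use 1 degree_monom_le le_trans in blast)+
qed

text \<open>The bound also holds in the middle of the pass, for partial sums, because every single
  contribution to layer l has degree at most \<open>l * Q\<close>.\<close>

lemma degree_foldl_edge_step:
  fixes A :: "'a::field oabp"
  assumes A: "is_oabp n A" and X: "\<And>i. i < n \<Longrightarrow> abp_degree A * X i \<le> Q"
    and es: "\<And>e. e \<in> set es \<Longrightarrow> fst e < depth A \<and> fst (snd e) < w \<and> snd (snd e) < w"
    and F: "\<And>l u. u < w \<Longrightarrow> degree (F (l * w + u)) \<le> l * Q" and u: "u < w"
  shows "degree (foldl (edge_step A X w) F es (l * w + u)) \<le> l * Q"
  using es F u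
proof (induction es arbitrary: F l u)
  case (Cons e es)
  obtain l' u' v' where e: "e = (l', u', v')" by (cases e)
  have e': "l' < depth A" "u' < w" "v' < w" using Cons.prems(1)[of e] e by auto
  have "degree (edge_step A X w F e (l * w + u)) \<le> l * Q" if u: "u < w" for l u
  proof (cases "l * w + u = Suc l' * w + v'")
    case True
    then have eq: "l = Suc l'" "u = v'" using pair_index_inj[OF _ u e'(3)] by blast+
    have "degree (edge_poly A X e * F (l' * w + u')) \<le> Q + l' * Q"
      using degree_mult_le[of "edge_poly A X e" "F (l' * w + u')"] degree_edge_poly(2)[where e = e and X = X, OF A X] e' Cons.prems(2)[of u' l'] e
      by (simp) 
    then show ?thesis using Cons.prems(2)[OF u, of l] unfolding e eq
      by (simp del: mult_Suc add: mult_Suc[symmetric]) (auto intro!: degree_add_le)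
  next
    case False
    then show ?thesis using Cons.prems(2)[OF u] by (simp add: e)
  qed
  then show ?case using Cons.IH[of "edge_step A X w F e"] Cons.prems by simp
qed simp

text \<open>
  A polynomial per vertex, stored in consecutive blocks of E coefficients. A product that would
  not fit into its block only writes zeros beyond it.
\<close>

definition stores :: "nat \<Rightarrow> nat \<Rightarrow> (nat \<Rightarrow> 'a::zero poly) \<Rightarrow> (nat \<Rightarrow> 'a) \<Rightarrow> bool" where
  "stores E m F D \<longleftrightarrow> (\<forall>i<m. \<forall>t<E. D (i * E + t) = coeff (F i) t)"

lemma stores_step:
  fixes F :: "nat \<Rightarrow> 'a::field poly"
  assumes st: "stores E m F D" and a: "a < m" "degree (F a) + y < E"
    and D': "D' = (\<lambda>x. if b * E + y \<le> x \<and> x < b * E + y + E then D x + c * D (a * E + (x - (b * E + y))) else D x)"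
  shows "stores E m (F(b := F b + monom c y * F a)) D'"
  unfolding stores_def
proof (intro allI impI)
  fix i t assume i: "i < m" and t: "t < E"
  have Da: "D (a * E + r) = coeff (F a) r" if "r < E" for r using st a that by (simp add: stores_def)
  have Di: "D (i * E + t) = coeff (F i) t" using st i t by (simp add: stores_def)
  consider "i < b" | "i = b" | "i > b" by linarith
  then show "D' (i * E + t) = coeff ((F(b := F b + monom c y * F a)) i) t"
  proof cases
    case 1
    then have "Suc i * E \<le> b * E" by (intro mult_right_mono) auto
    then have "i * E + t < b * E + y" using t by simp
    with 1 show ?thesis by (simp add: D' Di)
  next
    case 2
    show ?thesis
    proof (cases "t < y")
      case True
      with 2 Di show ?thesis by (simp add: D' coeff_monom_mult)
    next
      case False
      then have "i * E + t - (b * E + y) = t - y" using 2 by simp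
      with 2 False t Di Da[of "t - y"] show ?thesis by (simp add: D' coeff_monom_mult)
    qed
  next
    case 3
    then have "Suc b * E \<le> i * E" by (intro mult_right_mono) auto
    then have ge: "b * E + E \<le> i * E + t" by simp
    have "D (a * E + (i * E + t - (b * E + y))) = 0" if "b * E + y \<le> i * E + t" "i * E + t < b * E + y + E"
    proof -
      let ?r = "i * E + t - (b * E + y)"
      have "?r < E" "degree (F a) < ?r" using that ge a(2) by linarith+
      then show ?thesis using Da[of ?r] by (simp only: coeff_eq_0)
    qed
    with 3 show ?thesis by (simp add: D' Di)
  qed
qed

text \<open>Scalar 81 is the length \<open>N ^ 3\<close> of a block, 82 the number of cells in all
  blocks and 87 the start of the block of the sink.\<close>

definition Sizes :: prog where
  "Sizes = Mul 81 (V 46) (V 46) ;; Mul 81 (V 81) (V 46) ;; Mul 82 (NAdd (V 6) (NConst 1)) (V 76) ;; Mul 82 (V 82) (V 81) ;;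
     Mul 87 (V 6) (V 76) ;; Mul 87 (V 87) (V 81)"

definition Exponent_step :: prog where
  "Exponent_step = Weight ;; Mul 40 (V 54) (V 56) ;; 88 ::= NAdd (V 88) (V 40)"

definition Exponents :: prog where
  "Exponents = For 12 (V 5) (88 ::= NConst 0 ;; For 13 (V 43) Exponent_step ;; NSet 64 (V 12) (V 88))"

definition Add_term :: prog where
  "Add_term = For 14 (V 81) (FSet 2 (NAdd (V 86) (V 14)) (FAdd (FGet 2 (NAdd (V 86) (V 14)))
     (FMul (FGet 0 (NAdd (NGet 74 (V 12)) (V 13))) (FGet 2 (NAdd (V 85) (V 14)))))) ;; 86 ::= NAdd (V 86) (V 84)"

definition Add_edge :: prog where
  "Add_edge = 84 ::= NGet 64 (NGet 23 (NGet 20 (NGet 70 (V 12)))) ;; Mul 85 (NGet 71 (V 12)) (V 81) ;; Mul 86 (NGet 72 (V 12)) (V 81) ;;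
     For 13 (NSub (NGet 73 (V 12)) (NConst 1)) Add_term"

definition Evaluate :: prog where
  "Evaluate = For 11 (V 82) (FSet 2 (V 11) FZero) ;; FSet 2 (NConst 0) FOne ;; For 12 (V 75) Add_edge"

definition Check :: prog where
  "Check = For 11 (V 81) (If (FIsZero (FGet 2 (NAdd (V 87) (V 11)))) Skip (NSet 1 (NConst 0) (NConst 0)))"

definition Tests :: prog where
  "Tests = NSet 1 (NConst 0) (NConst 1) ;; For 59 (V 49) (Digits ;; Exponents ;; Evaluate ;; Check)"

definition Identity_test_program :: prog where
  "Identity_test_program = Load_abp ;; Setup ;; Sizes ;; Tests"

lemma writes_Sizes [simp]: "nwrites Sizes = {2, 3, 81, 82, 87}" "fwrites Sizes = {}"
  by (auto simp: Sizes_def)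

lemma writes_Exponent_step [simp]: "nwrites Exponent_step = {2, 3, 4, 14, 40, 53, 54, 55, 56, 57, 88}" "fwrites Exponent_step = {}"
  by (auto simp: Exponent_step_def)

lemma writes_Exponents [simp]: "nwrites Exponents = {2, 3, 4, 12, 13, 14, 40, 53, 54, 55, 56, 57, 64, 88}" "fwrites Exponents = {}"
  by (auto simp: Exponents_def)

lemma writes_Add_term [simp]: "nwrites Add_term = {14, 86}" "fwrites Add_term = {2}"
  by (auto simp: Add_term_def)

lemma writes_Add_edge [simp]: "nwrites Add_edge = {2, 3, 13, 14, 84, 85, 86}" "fwrites Add_edge = {2}"
  by (auto simp: Add_edge_def)

lemma writes_Evaluate [simp]: "nwrites Evaluate = {2, 3, 11, 12, 13, 14, 84, 85, 86}" "fwrites Evaluate = {2}"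
  by (auto simp: Evaluate_def)

lemma writes_Check [simp]: "nwrites Check = {1, 11}" "fwrites Check = {}"
  by (auto simp: Check_def)

definition (in seeded) exponent :: "nat \<Rightarrow> nat \<Rightarrow> nat" where
  "exponent c i = (\<Sum>j<levels n. seed_weight s0 c i j * seed_base s0 c i j)"

lemma (in seeded) exponent_le: "exponent c i \<le> levels n * (N * N)"
proof -
  have "exponent c i \<le> (\<Sum>j<levels n. N * N)" unfolding exponent_def
    by (intro sum_mono mult_mono seed_weight_le less_imp_le[OF seed_base_less]) auto
  then show ?thesis by simp
qed

lemma (in seeded) wp_Exponents:
  fixes s :: "'a mem"
  assumes s: "\<And>x. x \<in> {5, 20, 23, 27, 32, 43, 45, 46, 47, 48, 49} \<Longrightarrow> nmem s x = nmem s0 x"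
    and dig: "\<And>z. z < nmem s0 48 0 \<Longrightarrow> nmem s 50 z = seed_digit s0 c z"
  shows "wp M Exponents (\<lambda>s'. \<forall>i<n. nmem s' 64 i = exponent c i) s"
  unfolding Exponents_def
proof (rule wp_For[where n = n and I = "\<lambda>i s'. \<forall>i'<i. nmem s' 64 i' = exponent c i'"], goal_cases)
  case (6 i s1)
  note fr1 = agreeD2(1)[OF 6(2)]
  let ?s = "upn s1 88 0 0" and ?c = "For 13 (V 43) Exponent_step"
  have W: "wp M ?c (\<lambda>s'. nmem s' 88 0 = exponent c i) ?s"
  proof (rule wp_For[where n = "levels n" and I = "\<lambda>j s'. nmem s' 88 0 = (\<Sum>j<j. seed_weight s0 c i j * seed_base s0 c i j)"], goal_cases)
    case (6 j s2)
    note fr2 = agreeD2(1)[OF 6(2)]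
    have W: "wp M Weight (\<lambda>s'. nmem s' 54 0 = seed_weight s0 c i j \<and> nmem s' 56 0 = seed_base s0 c i j) s2"
    proof (rule wp_seed_weight)
      show "nmem s2 x = nmem s0 x" if "x \<in> {5, 20, 23, 27, 32, 43, 45, 46, 47, 48, 49}" for x
        using that fr2[of x] fr1[of x] s[of x] by auto
      show "nmem s2 12 0 = i" using fr2 \<open>nmem s1 12 0 = i\<close> by simp
      show "nmem s2 50 z = seed_digit s0 c z" if "z < nmem s0 48 0" for z using fr2 fr1 dig[OF that] by simp
    qed (use 6 \<open>i < n\<close> in auto)
    show ?case unfolding Exponent_step_def wp.simps(4)
    proof (rule wp_use[OF W], elim conjE)
      fix s3 :: "'a mem" assume s3: "nmem s3 54 0 = seed_weight s0 c i j" "nmem s3 56 0 = seed_base s0 c i j"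
        and ag: "agree (nwrites Weight) (fwrites Weight) s2 s3"
      have "nmem s3 88 0 = (\<Sum>j<j. seed_weight s0 c i j * seed_base s0 c i j)" using agreeD2(1)[OF ag] 6(4) by simp
      moreover have "seed_weight s0 c i j \<le> M" using seed_weight_le M_bounds(3) le_trans by blast
      ultimately show "wp M (Mul 40 (V 54) (V 56)) (wp M (88 ::= NAdd (V 88) (V 40)) (\<lambda>s''. nmem (upn s'' 13 0 (Suc j)) 88 0 =
          (\<Sum>j<Suc j. seed_weight s0 c i j * seed_base s0 c i j))) s3"
        using s3 by (simp add: wp_Mul_eval)
    qed
  next
    case (7 s2)
    then show ?case by (simp add: exponent_def)
  qed (use fr1 s s0 M_bounds in auto)
  show ?case unfolding wp.simps(4)
  proof (rule wp_NSetI[where i = 0 and v = 0], simp, simp, rule wp_use[OF W])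
    fix s3 :: "'a mem" assume s3: "nmem s3 88 0 = exponent c i" and ag: "agree (nwrites ?c) (fwrites ?c) ?s s3"
    have "nmem s3 64 = nmem s1 64" "nmem s3 12 0 = i" using agreeD2(1)[OF ag] 6(3) by simp_all
    then show "wp M (NSet 64 (V 12) (V 88)) (\<lambda>s''. \<forall>i'<Suc i. nmem (upn s'' 12 0 (Suc i)) 64 i' = exponent c i') s3"
      using s3 6(4) by (auto simp: less_Suc_eq)
  qed
qed (use s s0 M_bounds in auto)

lemma le_power_self: "2 \<le> b \<Longrightarrow> k \<le> b ^ k" for b k :: nat
  using less_exp[of k] power_mono[of 2 b k] by linarith

lemma power_le_power:
  fixes b k :: nat
  assumes "j \<le> k + 3" "1 \<le> k" "1 \<le> b"
  shows "b ^ j \<le> b ^ (16 * (k * k))"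
proof (rule power_increasing)
  have "k * 1 \<le> k * k" using assms by (intro mult_left_mono) auto
  then show "j \<le> 16 * (k * k)" using assms by linarith
qed (use assms in simp)

text \<open>The depth contains the factor \<open>k\<close>, which no fixed power of the base bounds;
  it is estimated by \<open>B ^ k\<close> and absorbed by the exponent of \<open>N\<close>.\<close>

lemma vertex_count_le:
  assumes A: "is_oabp n A" and "1 \<le> n"
  defines "k \<equiv> max_reads (var_order A)" and "B \<equiv> n + abp_width A + abp_degree A + 3"
  shows "Suc (depth A) * abp_width A \<le> B ^ (16 * (k * k))"
proof -
  have k1: "1 \<le> k" unfolding k_def by (rule max_reads_props)
  have kB: "k \<le> B ^ k" by (rule le_power_self) (simp add: B_def)
  have "depth A \<le> n * k" unfolding k_def by (rule length_le_reads) (use A in \<open>simp add: is_oabp_def\<close>)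
  moreover have "n * k + k \<le> B * k" using mult_right_mono[of "Suc n" B k] by (simp add: B_def)
  ultimately have "Suc (depth A) \<le> B * k" using k1 by linarith
  also have "\<dots> \<le> B * B ^ k" using kB by (rule mult_left_mono) simp
  finally have "Suc (depth A) * abp_width A \<le> (B * B ^ k) * B" by (intro mult_mono) (auto simp: B_def)
  also have "\<dots> = B ^ (k + 2)" by simp
  also have "\<dots> \<le> B ^ (16 * (k * k))" by (rule power_le_power) (use k1 in \<open>auto simp: B_def\<close>)
  finally show ?thesis .
qed

section \<open>Correctness of the identity test\<close>

locale evaluation = seeded M n B xs s0 k G N
  for M n B :: nat and xs :: "nat list" and s0 :: "'a::field mem" and k G N :: nat +
  fixes A :: "'a oabp"
  assumes A: "is_oabp n A" and xs_eq: "xs = var_order A" and B_eq: "B = n + abp_width A + abp_degree A + 3"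
    and loaded: "loaded A (abp_width A) (vertex_pairs A) s0"
    and sizes: "nmem s0 76 0 = abp_width A" "nmem s0 81 0 = N ^ 3" "nmem s0 82 0 = Suc (depth A) * abp_width A * N ^ 3"
      "nmem s0 87 0 = depth A * abp_width A * N ^ 3"
    and input: "fmem s0 0 = fmem (abp_input n A :: 'a mem) 0"
begin

abbreviation "w \<equiv> abp_width A"
abbreviation "L \<equiv> depth A"
abbreviation "E \<equiv> N ^ 3"
abbreviation "m \<equiv> Suc L * w"
abbreviation "Q \<equiv> abp_degree A * (levels n * (N * N))"

lemma frame: "nmem s0 5 0 = n" "nmem s0 6 0 = L" "\<And>l. l < L \<Longrightarrow> nmem s0 20 l = var_order A ! l" "nmem s0 75 0 = length (vertex_pairs A)"
  using ready loaded unfolding setup_done_def Let_def xs_eq loaded_def by auto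

lemma w_pos: "0 < w"
  using layer_size_le[of 0 A] A by (simp add: is_oabp_def)

lemma L_le: "L \<le> n * k"
  using length_le_reads[of xs n] A xs_eq by (simp add: is_oabp_def k_def)

lemma power_B_le: "j \<le> k + 3 \<Longrightarrow> B ^ j \<le> N"
  unfolding N_def by (rule power_le_power) (use k1 B in auto)

lemma k_le: "k \<le> B ^ k"
  by (rule le_power_self) (use B in simp)

lemma m_le: "m \<le> N"
  unfolding N_def k_def using vertex_count_le[OF A] n B_eq by (simp only: xs_eq)

text \<open>In an exponent of the generator, the weight and the index of the element count for one
  factor \<open>N\<close> each; the third one covers the depth, the degree of the labels and the
  number of levels.\<close>

lemma E_less: "L * Q < E"
proof -
  have lv: "levels n \<le> B"
  proof -
    have "levels n \<le> Suc n" unfolding levels_def by (intro Suc_le_mono[THEN iffD2] Least_le less_imp_le less_exp)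
    then show ?thesis using B by simp
  qed
  have "n * k \<le> B * B ^ k" using B k_le by (intro mult_mono) auto
  then have "L \<le> B * B ^ k" using L_le by linarith
  then have "L * levels n \<le> (B * B ^ k) * B" using lv by (intro mult_mono) auto
  then have "abp_degree A * (L * levels n) \<le> abp_degree A * ((B * B ^ k) * B)" by (rule mult_left_mono) simp
  also have "\<dots> < B * ((B * B ^ k) * B)" using B_eq B by (intro mult_strict_right_mono) auto
  also have "\<dots> = B ^ (k + 3)" by (simp add: power_add numeral_3_eq_3)
  also have "\<dots> \<le> N" by (rule power_B_le) simp
  finally have "abp_degree A * (L * levels n) * (N * N) < N * (N * N)" using N1 by (intro mult_strict_right_mono) auto
  then show ?thesis by (simp add: power3_eq_cube mult_ac)
qed

lemma M_bounds2: "E \<le> M" "m * E \<le> M" "m \<le> M" "length (vertex_pairs A) \<le> M" "abp_degree A + 1 \<le> M"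
proof -
  have "N ^ 3 \<le> N ^ 4" using N1 by (intro power_increasing) auto
  then show "E \<le> M" using M_bounds(1) by linarith
  have "m * E \<le> N * E" using m_le by (rule mult_right_mono) simp
  also have "\<dots> = N ^ 4" by (simp add: power3_eq_cube power4_eq_xxxx)
  finally show "m * E \<le> M" using M_bounds(1) by linarith
  show "m \<le> M" using m_le M_bounds(3) by linarith
  have BN: "B \<le> N" using power_B_le[of 1] by simp
  then show "abp_degree A + 1 \<le> M" using B_eq M_bounds(3) by linarith
  have "length (vertex_pairs A) \<le> L * (w * w)" unfolding vertex_pairs_eq by (rule length_pairs_before[OF layer_size_le]) auto
  also have "\<dots> = L * w * w" by simp
  also have "\<dots> \<le> N * N" using m_le B_eq BN by (intro mult_mono) auto
  finally show "length (vertex_pairs A) \<le> M" using M_bounds(2) by linarith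
qed

lemma degree_exponent: "abp_degree A * exponent c i \<le> Q"
  by (intro mult_left_mono exponent_le) simp

text \<open>The label is used one coefficient at a time: the product of a monomial with the source
  polynomial is a scaled and shifted copy of its block, and the shift advances by \<open>y\<close>
  from one coefficient to the next.\<close>

lemma wp_Add_edge:
  fixes s :: "'a mem"
  assumes s: "\<And>x. x \<in> {20, 23, 70, 71, 72, 73, 74, 81} \<Longrightarrow> nmem s x = nmem s0 x" and X: "\<forall>i<n. nmem s 64 i = exponent c i"
    and inp: "fmem s 0 = fmem s0 0" and e: "nmem s 12 0 = e" "e < length (vertex_pairs A)" "vertex_pairs A ! e = (l, u, v)"
    and st: "stores E m F (fmem s 2)" and deg: "degree (F (l * w + u)) \<le> l * Q"
  shows "wp M Add_edge (\<lambda>s'. stores E m (edge_step A (\<lambda>i. exponent c (nmem s0 23 i)) w F (l, u, v)) (fmem s' 2)) s"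
proof -
  let ?a = "l * w + u" and ?b = "Suc l * w + v" and ?cs = "edge_coeffs A (l, u, v)"
  define y where "y = exponent c (nmem s0 23 (var_order A ! l))"
  define off where "off = length (concat (map (edge_coeffs A) (take e (vertex_pairs A))))"
  have "(l, u, v) \<in> set (vertex_pairs A)" using nth_mem[OF e(2)] e(3) by simp
  then have l: "l < L" "u < layer_size A l" "v < layer_size A (Suc l)" by (auto simp: set_vertex_pairs)
  have u: "u < w" "v < w" using l layer_size_le[of l A] layer_size_le[of "Suc l" A] by auto
  have rd: "nmem s0 70 e = l" "nmem s0 71 e = ?a" "nmem s0 72 e = ?b" "nmem s0 73 e - Suc 0 = length ?cs" "nmem s0 74 e = off"
    using loaded e unfolding loaded_def off_def by (simp_all add: edge_code_minus_1)
  have vn: "var_order A ! l < n" using A l(1) nth_mem by (fastforce simp: is_oabp_def)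
  have ab: "?a < ?b" using u by simp
  have "?b < Suc (Suc l) * w" using u by simp
  also have "\<dots> \<le> m" using l by (intro mult_right_mono) auto
  finally have bm: "?b < m" .
  then have am: "?a < m" using ab by linarith
  have xv: "nmem s 64 (nmem s 23 (nmem s 20 (nmem s 70 e))) = y"
    using X s0(10)[OF vn] frame(3)[OF l(1)] by (simp add: s rd y_def)
  have coeff: "fmem s0 0 (off + j) = ?cs ! j" if "j < length ?cs" for j
  proof -
    have "vertex_pairs A = take e (vertex_pairs A) @ (l, u, v) # drop (Suc e) (vertex_pairs A)"
      using id_take_nth_drop[OF e(2)] e(3) by simp
    from abp_input_coeffs[OF this that, of n] show ?thesis by (simp add: input off_def)
  qed
  have jy: "j * y \<le> Q" if "j < length ?cs" for j
    using degree_edge_poly(1)[where X = "\<lambda>i. exponent c (nmem s0 23 i)" and e = "(l, u, v)", OF A _ _ that] l(1) degree_exponent by (simp add: y_def)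
  have len: "length ?cs \<le> M"
  proof (cases "label A l u v = 0 \<or> (l, u, v) \<notin> edges A")
    case False
    then show ?thesis using degree_label_le[OF A, of l u v] M_bounds2(5) by (simp add: edge_coeffs_def length_coeffs_degree)
  qed (auto simp: edge_coeffs_def)
  \<comment> \<open>The state after \<open>j\<close> coefficients. The source polynomial stays the
    same because \<open>?a < ?b\<close>.\<close>
  define F' where "F' j = F(?b := F ?b + (\<Sum>j'<j. monom (?cs ! j') (j' * y)) * F ?a)" for j
  have step: "edge_step A (\<lambda>i. exponent c (nmem s0 23 i)) w F (l, u, v) = F' (length ?cs)"
    by (simp add: F'_def edge_poly_def y_def)
  have F'_Suc: "F' (Suc j) = (F' j)(?b := F' j ?b + monom (?cs ! j) (j * y) * F' j ?a)" for j
    using ab by (simp add: F'_def fun_eq_iff algebra_simps)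
  have F'0: "F' 0 = F" by (simp add: F'_def)
  let ?s = "upn (upn (upn (upn (upn (upn (upn s 84 0 y) 3 0 (?a * E)) 2 0 ?a) 85 0 (?a * E)) 3 0 (?b * E)) 2 0 ?b) 86 0 (?b * E)"
  have loop: "wp M (For 13 (NSub (NGet 73 (V 12)) (NConst 1)) Add_term) (\<lambda>s'. stores E m (F' (length ?cs)) (fmem s' 2)) ?s"
  proof (rule wp_For[where n = "length ?cs" and I = "\<lambda>j s'. nmem s' 86 0 = ?b * E + j * y \<and> stores E m (F' j) (fmem s' 2)"], goal_cases)
    case (6 j s1)
    note fr1 = agreeD2[OF 6(2)]
    have f1: "nmem s1 81 0 = E" "nmem s1 12 0 = e" "nmem s1 74 e = off" "fmem s1 0 = fmem s0 0" "nmem s1 85 0 = ?a * E" "nmem s1 84 0 = y"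
      using fr1 s inp e rd sizes by simp_all
    let ?y0 = "?b * E + j * y" and ?D = "fmem s1 2" and ?c = "?cs ! j"
    let ?loop = "For 14 (V 81) (FSet 2 (NAdd (V 86) (V 14)) (FAdd (FGet 2 (NAdd (V 86) (V 14)))
     (FMul (FGet 0 (NAdd (NGet 74 (V 12)) (V 13))) (FGet 2 (NAdd (V 85) (V 14))))))"
    have cj: "fmem s0 0 (off + j) = ?c" by (rule coeff[OF 6(1)])
    have inner: "wp M ?loop (\<lambda>s'. fmem s' 2 = (\<lambda>x. if ?y0 \<le> x \<and> x < ?y0 + E then ?D x + ?c * ?D (?a * E + (x - ?y0)) else ?D x)) s1"
    proof (rule wp_For[where n = E and I = "\<lambda>t s'. fmem s' 2 =
        (\<lambda>x. if ?y0 \<le> x \<and> x < ?y0 + t then ?D x + ?c * ?D (?a * E + (x - ?y0)) else ?D x)"], goal_cases)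
      case (6 t s2)
      note fr2 = agreeD2[OF 6(2)]
      have f2: "nmem s2 12 0 = e" "nmem s2 74 e = off" "fmem s2 0 = fmem s0 0" "nmem s2 85 0 = ?a * E" "nmem s2 86 0 = ?y0" "nmem s2 13 0 = j"
        using fr2 f1 \<open>nmem s1 86 0 = ?y0 \<and> _\<close> \<open>nmem s1 13 0 = j\<close> by simp_all
      \<comment> \<open>The source block ends before the first cell that is written, so copying in
        place never reads a changed cell.\<close>
      have "Suc ?a * E \<le> ?b * E" using ab by (intro mult_right_mono) auto
      then have lt: "\<not> ?y0 \<le> ?a * E + t" using 6(1) by simp
      have D1: "fmem s2 2 (?y0 + t) = ?D (?y0 + t)" "fmem s2 2 (?a * E + t) = ?D (?a * E + t)" using lt unfolding 6(4) by simp_all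
      have "fmem (upn (upf s2 2 (?y0 + t) (?D (?y0 + t) + ?c * ?D (?a * E + t))) 14 0 (Suc t)) 2 =
          (\<lambda>x. if ?y0 \<le> x \<and> x < ?y0 + Suc t then ?D x + ?c * ?D (?a * E + (x - ?y0)) else ?D x)"
        using 6(4) by (auto simp: fun_eq_iff less_Suc_eq)
      then show ?case using D1 cj by (simp only: wp_FSet[OF refl refl] fval.simps nval.simps f2 6(3))
    qed (use f1 M_bounds2 in \<open>auto simp: fun_eq_iff\<close>)
    show ?case unfolding Add_term_def wp.simps(4)
    proof (rule wp_use[OF inner])
      fix s2 :: "'a mem" assume s2: "fmem s2 2 = (\<lambda>x. if ?y0 \<le> x \<and> x < ?y0 + E then ?D x + ?c * ?D (?a * E + (x - ?y0)) else ?D x)"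
        and ag: "agree (nwrites ?loop) (fwrites ?loop) s1 s2"
      have f2: "nmem s2 86 0 = ?y0" "nmem s2 84 0 = y" using agreeD2(1)[OF ag] f1 6(4) by simp_all
      have Fa: "F' j ?a = F ?a" using ab by (simp add: F'_def)
      have "degree (F' j ?a) + j * y \<le> l * Q + Q" unfolding Fa by (rule add_mono[OF deg jy[OF 6(1)]])
      also have "\<dots> = Suc l * Q" by simp
      also have "\<dots> \<le> L * Q" using l by (intro mult_right_mono) auto
      also note E_less
      finally have "stores E m (F' (Suc j)) (fmem s2 2)" unfolding F'_Suc
        by (intro stores_step[OF conjunct2[OF 6(4)] am _ s2])
      then show "wp M (86 ::= NAdd (V 86) (V 84)) (\<lambda>s''. nmem (upn s'' 13 0 (Suc j)) 86 0 = ?b * E + Suc j * y \<and>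
          stores E m (F' (Suc j)) (fmem (upn s'' 13 0 (Suc j)) 2)) s2"
        by (simp add: f2)
    qed
  qed (use s st len F'0 rd e in auto)
  have aM: "?a \<le> M" "?b \<le> M" using am bm M_bounds2(3) by linarith+
  show ?thesis unfolding step Add_edge_def using loop aM xv
    by (simp add: wp_Mul_eval e s rd sizes)
qed

definition result :: "nat \<Rightarrow> 'a poly" where
  "result c = foldl (edge_step A (\<lambda>i. exponent c (nmem s0 23 i)) w) (\<lambda>i. if i = 0 then 1 else 0) (vertex_pairs A) (L * w)"

lemma fold_degree:
  "u < w \<Longrightarrow> degree (foldl (edge_step A (\<lambda>i. exponent c (nmem s0 23 i)) w) (\<lambda>i. if i = 0 then 1 else 0)
    (take e (vertex_pairs A)) (l * w + u)) \<le> l * Q"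
proof (rule degree_foldl_edge_step[OF A])
  show "abp_degree A * exponent c (nmem s0 23 i) \<le> Q" for i by (rule degree_exponent)
  fix x assume "x \<in> set (take e (vertex_pairs A))"
  then have "x \<in> set (vertex_pairs A)" by (rule in_set_takeD)
  then show "fst x < L \<and> fst (snd x) < w \<and> snd (snd x) < w"
    using layer_size_le[of "fst x" A] layer_size_le[of "Suc (fst x)" A] by (auto simp: set_vertex_pairs)
qed auto

lemma wp_Evaluate:
  fixes s :: "'a mem"
  assumes s: "\<And>x. x \<in> {20, 23, 70, 71, 72, 73, 74, 75, 81, 82} \<Longrightarrow> nmem s x = nmem s0 x" and X: "\<forall>i<n. nmem s 64 i = exponent c i"
    and inp: "fmem s 0 = fmem s0 0"
  shows "wp M Evaluate (\<lambda>s'. \<forall>t<E. fmem s' 2 (L * w * E + t) = coeff (result c) t) s"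
proof -
  let ?F0 = "\<lambda>i. if i = 0 then 1 else 0 :: 'a poly" and ?X = "\<lambda>i. exponent c (nmem s0 23 i)"
  let ?clear = "For 11 (V 82) (FSet 2 (V 11) FZero)"
  have clear: "wp M ?clear (\<lambda>s'. \<forall>x<m * E. fmem s' 2 x = 0) s"
    by (rule wp_For[where n = "m * E" and I = "\<lambda>j s'. \<forall>x<j. fmem s' 2 x = 0"])
      (use s sizes M_bounds2 in \<open>auto simp: less_Suc_eq\<close>)
  show ?thesis unfolding Evaluate_def wp.simps(4)
  proof (rule wp_use[OF clear])
    fix s1 :: "'a mem" assume s1: "\<forall>x<m * E. fmem s1 2 x = 0" and ag1: "agree (nwrites ?clear) (fwrites ?clear) s s1"
    note fr1 = agreeD2[OF ag1]
    let ?s = "upf s1 2 0 1"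
    have "stores E m ?F0 (fmem ?s 2)" unfolding stores_def
    proof (intro allI impI)
      fix i t assume i: "i < m" and t: "t < E"
      have "i * E + t < Suc i * E" using t by simp
      also have "\<dots> \<le> m * E" using i by (intro mult_right_mono) auto
      finally have "fmem s1 2 (i * E + t) = 0" using s1 by blast
      then show "fmem ?s 2 (i * E + t) = coeff (?F0 i) t" using N1 by (auto simp: coeff_1)
    qed
    then have "wp M (For 12 (V 75) Add_edge) (\<lambda>s'. stores E m (foldl (edge_step A ?X w) ?F0 (vertex_pairs A)) (fmem s' 2)) ?s"
    proof (intro wp_For[where n = "length (vertex_pairs A)" and
        I = "\<lambda>e s'. stores E m (foldl (edge_step A ?X w) ?F0 (take e (vertex_pairs A))) (fmem s' 2)"], goal_cases)
      case (6 e s2)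
      note fr2 = agreeD2[OF 6(3)]
      obtain l u v where e: "vertex_pairs A ! e = (l, u, v)" by (cases "vertex_pairs A ! e")
      have "(l, u, v) \<in> set (vertex_pairs A)" using nth_mem[OF 6(2)] e by simp
      then have uw: "u < w" using layer_size_le[of l A] by (auto simp: set_vertex_pairs)
      have "wp M Add_edge (\<lambda>s'. stores E m (edge_step A ?X w (foldl (edge_step A ?X w) ?F0 (take e (vertex_pairs A))) (l, u, v))
        (fmem s' 2)) s2"
      proof (rule wp_Add_edge[OF _ _ _ 6(4,2) e 6(5) fold_degree[OF uw]])
        show "nmem s2 x = nmem s0 x" if "x \<in> {20, 23, 70, 71, 72, 73, 74, 81}" for x
          using that fr2(1)[of x] fr1(1)[of x] s[of x] by auto
        show "\<forall>i<n. nmem s2 64 i = exponent c i" "fmem s2 0 = fmem s0 0" using fr2 fr1 X inp by simp_all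
      qed
      then show ?case using 6(2) by (simp add: take_Suc_conv_app_nth e del: edge_step.simps)
    next
      case (7 s2)
      then show ?case by simp
    qed (use fr1 s frame M_bounds2 in auto)
    then show "wp M (FSet 2 (NConst 0) FOne) (wp M (For 12 (V 75) Add_edge) (\<lambda>s'. \<forall>t<E. fmem s' 2 (L * w * E + t) = coeff (result c) t)) s1"
      using w_pos by (simp add: stores_def result_def) (erule wp_mono, simp)
  qed
qed

lemma wp_Check:
  fixes s :: "'a mem"
  assumes s: "nmem s 81 0 = E" "nmem s 87 0 = L * w * E" and r: "\<forall>t<E. fmem s 2 (L * w * E + t) = coeff (result c) t"
  shows "wp M Check (\<lambda>s'. nmem s' 1 0 = (if result c = 0 then nmem s 1 0 else 0)) s"
  unfolding Check_def
proof (rule wp_For[where n = E and I = "\<lambda>t s'. nmem s' 1 0 = (if \<forall>t'<t. coeff (result c) t' = 0 then nmem s 1 0 else 0)"], goal_cases)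
  case (6 t s1)
  have "nmem s1 87 0 = L * w * E" "fmem s1 2 = fmem s 2" using agreeD2[OF 6(2)] s by simp_all
  then show ?case using 6 r by (auto simp: less_Suc_eq)
next
  case (7 s1)
  have "degree (result c) \<le> L * Q" using fold_degree[of 0 c "length (vertex_pairs A)" L] w_pos by (simp add: result_def)
  then have "degree (result c) < E" using E_less by simp
  then have "(\<forall>t'<E. coeff (result c) t' = 0) \<Longrightarrow> result c = 0" by (simp flip: leading_coeff_0_iff)
  then have "(\<forall>t'<E. coeff (result c) t' = 0) \<longleftrightarrow> result c = 0" by auto
  with 7 show ?case by simp
qed (use s M_bounds2 in auto)

lemma wp_Tests: "wp M Tests (\<lambda>s'. nmem s' 1 0 = (if \<forall>c<nmem s0 49 0. result c = 0 then 1 else 0)) s0"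
  unfolding Tests_def wp.simps(4) wp_NSet[OF refl refl] nval.simps
proof (rule wp_For[where n = "nmem s0 49 0" and I = "\<lambda>c s'. nmem s' 1 0 = (if \<forall>c'<c. result c' = 0 then 1 else 0)"], goal_cases)
  case (6 c s1)
  let ?K = "{5, 20, 23, 27, 32, 43, 45, 46, 47, 48, 49, 70, 71, 72, 73, 74, 75, 81, 82, 87}"
  note fr1 = agreeD2[OF 6(2)]
  have f1: "nmem s1 x = nmem s0 x" if "x \<in> ?K" for x using that fr1(1)[of x] by auto
  have e1: "fmem s1 0 = fmem s0 0" using fr1 by simp
  have cM: "c \<le> M" using 6(1) M_bounds(7) by simp
  have K1: "nmem s1 48 0 = nmem s0 48 0" "nmem s1 46 0 = N" by (simp_all add: f1 s0)
  have Npos: "0 < N" using N1 by simp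
  let ?R = "\<lambda>s'. nmem (upn s' 59 0 (Suc c)) 1 0 = (if \<forall>c'<Suc c. result c' = 0 then 1 else 0)"
  show ?case unfolding wp.simps(4)
  proof (rule wp_use[OF wp_Digits[OF 6(3) cM K1(1) M_bounds(6) K1(2) Npos]])
    fix s2 :: "'a mem" assume dig: "\<forall>z<nmem s0 48 0. nmem s2 50 z = (c div N ^ z) mod N"
      and ag2: "agree (nwrites Digits) (fwrites Digits) s1 s2"
    note fr2 = agreeD2[OF ag2]
    have f2: "nmem s2 x = nmem s0 x" if "x \<in> ?K" for x using that fr2(1)[of x] f1[of x] by auto
    have dig2: "\<And>z. z < nmem s0 48 0 \<Longrightarrow> nmem s2 50 z = seed_digit s0 c z" using dig by (simp add: seed_digit_def s0)
    show "wp M Exponents (wp M Evaluate (wp M Check ?R)) s2"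
    proof (rule wp_use[OF wp_Exponents[OF _ dig2]])
      show "nmem s2 x = nmem s0 x" if "x \<in> {5, 20, 23, 27, 32, 43, 45, 46, 47, 48, 49}" for x
        by (rule f2) (use that in blast)
      fix s3 :: "'a mem" assume X: "\<forall>i<n. nmem s3 64 i = exponent c i" and ag3: "agree (nwrites Exponents) (fwrites Exponents) s2 s3"
      note fr3 = agreeD2[OF ag3]
      have f3: "nmem s3 x = nmem s0 x" if "x \<in> ?K" for x using that fr3(1)[of x] f2[of x] by auto
      have e3: "fmem s3 0 = fmem s0 0" using fr3 fr2 e1 by simp
      show "wp M Evaluate (wp M Check ?R) s3"
      proof (rule wp_use[OF wp_Evaluate[OF _ X e3]])
        show "nmem s3 x = nmem s0 x" if "x \<in> {20, 23, 70, 71, 72, 73, 74, 75, 81, 82}" for x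
          by (rule f3) (use that in blast)
        fix s4 :: "'a mem" assume r: "\<forall>t<E. fmem s4 2 (L * w * E + t) = coeff (result c) t"
          and ag4: "agree (nwrites Evaluate) (fwrites Evaluate) s3 s4"
        note fr4 = agreeD2[OF ag4]
        have f4: "nmem s4 81 0 = E" "nmem s4 87 0 = L * w * E" using fr4(1) f3 sizes by simp_all
        have r1: "nmem s4 1 0 = nmem s1 1 0" using fr4 fr3 fr2 by simp
        show "wp M Check ?R s4"
        proof (rule wp_mono[OF wp_Check[OF f4 r]])
          fix s5 :: "'a mem" assume "nmem s5 1 0 = (if result c = 0 then nmem s4 1 0 else 0)"
          then show "?R s5" using 6(4) r1 by (auto simp: less_Suc_eq)
        qed
      qed
    qed
  qed
qed (use M_bounds in auto)

end

text \<open>The field of the program may have too few elements for the grid. In the field of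
  fractions of its univariate polynomials the powers of the variable are distinct elements, as many
  as needed, whatever the size of the field.\<close>

interpretation frac: coefficient_embedding "\<lambda>c. Fract [:c:] 1 :: 'a::field poly fract"
  by unfold_locales (auto simp: one_pCons Zero_fract_def One_fract_def eq_fract)

lemma Fract_add: "Fract (a + b) 1 = (Fract a 1 + Fract b 1 :: 'a::idom fract)"
  and Fract_mult: "Fract (a * b) 1 = (Fract a 1 * Fract b 1 :: 'a::idom fract)"
  by simp_all

lemma Fract_sum: "Fract (sum f I) 1 = (\<Sum>i\<in>I. Fract (f i) 1 :: 'a::idom fract)"
  by (induction I rule: infinite_finite_induct) (simp_all add: Zero_fract_def Fract_add del: add_fract)

lemma Fract_prod: "Fract (prod f I) 1 = (\<Prod>i\<in>I. Fract (f i) 1 :: 'a::idom fract)"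
  by (induction I rule: infinite_finite_induct) (simp_all add: One_fract_def Fract_mult del: mult_fract)

lemma Fract_power: "Fract (a ^ j) 1 = (Fract a 1 :: 'a::idom fract) ^ j"
  by (induction j) (simp_all add: One_fract_def Fract_mult del: mult_fract)

text \<open>Fractions occur only in the argument: at points that are polynomials, the value is the
  polynomial which the machine computes.\<close>

lemma evalh_Fract: "frac.evalh f (\<lambda>v. Fract (x v) 1) = Fract (const.evalh f x) 1"
  by (simp only: frac.evalh_def const.evalh_def mon_val_def Fract_sum Fract_prod Fract_power Fract_mult)

lemma wp_Sizes:
  fixes s :: "'a::field mem"
  assumes "nmem s 46 0 = N" "nmem s 6 0 = L" "nmem s 76 0 = w" and M: "N * N \<le> M" "1 \<le> N" "Suc L * w \<le> M" "Suc L \<le> M" "1 \<le> w"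
  shows "wp M Sizes (\<lambda>s'. nmem s' 81 0 = N ^ 3 \<and> nmem s' 82 0 = Suc L * w * N ^ 3 \<and> nmem s' 87 0 = L * w * N ^ 3) s"
proof -
  have N: "N \<le> M" using M(1) le_square[of N] by linarith
  have Lw: "L * w \<le> M" using M(3) by simp
  show ?thesis unfolding Sizes_def using assms N Lw
    by (simp add: wp_Mul_eval power3_eq_cube del: mult_Suc)
qed

lemma wp_Identity_test_program:
  fixes A :: "'a::field oabp"
  assumes A: "is_oabp n A" and n: "1 \<le> n"
    and M: "iteration_bound n (n + abp_width A + abp_degree A + 3) (max_reads (var_order A)) \<le> M"
  shows "wp M Identity_test_program (\<lambda>s. accepts s \<longleftrightarrow> abp_poly A = 0) (abp_input n A)"
proof -
  let ?w = "abp_width A" and ?d = "abp_degree A" and ?xs = "var_order A" and ?L = "depth A"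
  let ?B = "n + ?w + ?d + 3" and ?s = "abp_input n A :: 'a mem"
  define k where "k = max_reads ?xs"
  define N where "N = ?B ^ (16 * (k * k))"
  have B: "4 \<le> ?B" "n < ?B" using n by auto
  have xs: "set ?xs \<subseteq> {..<n}" using A by (simp add: is_oabp_def)
  have k1: "1 \<le> k" unfolding k_def by (rule max_reads_props)
  note bd = bounds_le_iteration_bound[OF B n k1, folded N_def]
  have M': "iteration_bound n ?B k \<le> M" using M by (simp add: k_def)
  have N1: "1 \<le> N" using B by (simp add: N_def)
  have "N ^ 2 \<le> N ^ 4" "N ^ 1 \<le> N ^ 4" using N1 by (intro power_increasing; simp)+
  then have NM: "N * N \<le> M" "N \<le> M" using bd(5) M' unfolding power2_eq_square by simp_all
  have BN: "?B ^ 1 \<le> N" unfolding N_def using k1 B by (intro power_increasing) (auto simp: Suc_le_eq)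
  have w: "1 \<le> ?w" using layer_size_le[of 0 A] A by (simp add: is_oabp_def)
  have size: "Suc ?L * ?w \<le> N" unfolding N_def k_def by (rule vertex_count_le[OF A n])
  have "Suc ?L * 1 \<le> Suc ?L * ?w" using w by (rule mult_left_mono) simp
  also note size
  also note NM(2)
  finally have LM: "Suc ?L \<le> M" by simp
  have wM: "?w \<le> M" using BN NM(2) by simp
  let ?R = "\<lambda>s :: 'a mem. accepts s \<longleftrightarrow> abp_poly A = 0"
  show ?thesis unfolding Identity_test_program_def wp.simps(4)
  proof (rule wp_use[OF wp_Load_abp[OF A LM wM]], elim conjE)
    fix s1 :: "'a mem" assume s1: "nmem s1 5 0 = n" "nmem s1 6 0 = ?L" "nmem s1 76 0 = ?w" "nmem s1 7 0 = ?B"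
      "\<forall>l<?L. nmem s1 20 l = ?xs ! l" "loaded A ?w (vertex_pairs A) s1"
      and ag1: "agree (nwrites Load_abp) (fwrites Load_abp) ?s s1"
    note fr1 = agreeD2[OF ag1]
    have z1: "nmem s1 21 = (\<lambda>_. 0)" "nmem s1 22 = (\<lambda>_. 0)" "nmem s1 27 = (\<lambda>_. 0)" "fmem s1 0 = fmem ?s 0"
      using fr1 by (simp_all add: abp_input_nats(6))
    show "wp M Setup (wp M Sizes (wp M Tests ?R)) s1"
    proof (rule wp_use[OF wp_Setup[OF s1(1) n s1(2,4) B s1(5)[rule_format] xs z1(1-3) M]])
      fix s2 :: "'a mem" assume s2: "setup_done n ?B ?xs s2" and ag2: "agree (nwrites Setup) (fwrites Setup) s1 s2"
      note fr2 = agreeD2[OF ag2]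
      have f2: "nmem s2 46 0 = N" "nmem s2 6 0 = ?L" using s2 unfolding setup_done_def Let_def N_def k_def by - (elim conjE, assumption)+
      have w2: "nmem s2 76 0 = ?w" using fr2 s1 by simp
      have sM: "Suc ?L * ?w \<le> M" using size NM(2) by linarith
      show "wp M Sizes (wp M Tests ?R) s2"
      proof (rule wp_use[OF wp_Sizes[OF f2 w2 NM(1) N1 sM LM w]], elim conjE)
        fix s3 :: "'a mem" assume s3: "nmem s3 81 0 = N ^ 3" "nmem s3 82 0 = Suc ?L * ?w * N ^ 3" "nmem s3 87 0 = ?L * ?w * N ^ 3"
          and ag3: "agree (nwrites Sizes) (fwrites Sizes) s2 s3"
        note fr3 = agreeD2[OF ag3]
        have sd: "setup_done n ?B ?xs s3" by (rule setup_done_agree[OF s2]) (use fr3(1) in auto)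
        have ld: "loaded A ?w (vertex_pairs A) s3" using s1(6) fr2 fr3 unfolding loaded_def by simp
        have f3: "nmem s3 76 0 = ?w" "fmem s3 0 = fmem ?s 0" using fr3 fr2 s1(3) z1(4) by simp_all
        interpret ev: evaluation M n ?B ?xs s3 k "?B ^ k" N A
          by unfold_locales (use sd B n M A ld f3 s3 in \<open>auto simp: k_def N_def\<close>)
        have res: "ev.result c = const.evalh (abp_poly A) (\<lambda>i. monom 1 (ev.exponent c (nmem s3 23 i)))" for c
          unfolding ev.result_def by (rule fold_vertex_pairs[OF A refl])
        have iff: "(\<forall>c<nmem s3 49 0. ev.result c = 0) \<longleftrightarrow> abp_poly A = 0"
        proof
          assume all: "\<forall>c<nmem s3 49 0. ev.result c = 0"
          show "abp_poly A = 0"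
          proof (rule ccontr)
            assume nz: "abp_poly A \<noteq> 0"
            \<comment> \<open>The index \<open>a\<close> of an element is now the exponent of the
              new variable, so the product over the levels is the power with exponent
              \<open>ev.exponent\<close>.\<close>
            let ?e = "\<lambda>a. Fract (monom 1 a) 1 :: 'a poly fract"
            have inj: "inj_on ?e {..<nmem s3 46 0}" by (auto simp: inj_on_def eq_fract dest: arg_cong[of _ _ degree] simp: degree_monom_eq)
            obtain c where c: "c < nmem s3 49 0" and ne: "frac.evalh (abp_poly A) (\<lambda>v. \<Prod>j<levels n.
                ?e (seed_base s3 c (nmem s3 23 v) j) ^ seed_weight s3 c (nmem s3 23 v) j) \<noteq> 0"
              using frac.seed_nonzero[OF sd A nz order_refl order_refl n inj] by blast
            have "(\<Prod>j<levels n. ?e (seed_base s3 c i j) ^ seed_weight s3 c i j) = Fract (monom 1 (ev.exponent c i)) 1" for i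
            proof -
              have "(\<Prod>j<m. ?e (seed_base s3 c i j) ^ seed_weight s3 c i j) =
                Fract (monom 1 (\<Sum>j<m. seed_weight s3 c i j * seed_base s3 c i j)) 1" for m
                by (induction m) (simp_all add: One_fract_def Fract_power[symmetric] monom_power mult_monom mult.commute add.commute)
              then show ?thesis unfolding ev.exponent_def .
            qed
            with ne have "Fract (ev.result c) 1 \<noteq> (0 :: 'a poly fract)" by (simp add: res evalh_Fract)
            with all c show False by (simp add: Zero_fract_def)
          qed
        qed (simp add: res)
        show "wp M Tests ?R s3"
          by (rule wp_mono[OF ev.wp_Tests]) (simp add: accepts_def iff split: if_splits)
      qed
    qed
  qed
qed

theorem theorem5p13:
  shows
    "(\<exists>(P :: prog) (c :: nat). \<forall>(n :: nat) (k :: nat) (w :: nat) (d :: nat). n \<ge> 1 \<longrightarrow> k \<ge> 1 \<longrightarrow>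
        (\<forall>A \<in> (read_k_oabps n k w d :: 'a::field oabp set).
           \<exists>t s. runs P (abp_input n A) t s \<and>
                 real t \<le> pit_bound c n k w d \<and>
                 (accepts s \<longleftrightarrow> abp_poly A = 0)))
     \<and>
     (\<exists>(P :: prog) (c :: nat). \<forall>(n :: nat) (k :: nat) (w :: nat) (d :: nat). n \<ge> 1 \<longrightarrow> k \<ge> 1 \<longrightarrow>
        (\<forall>(xs :: nat list) (es :: 'a list).
           set xs \<subseteq> {..<n} \<longrightarrow> read_at_most k xs \<longrightarrow>
           distinct es \<longrightarrow> real (length es) \<ge> field_bound c n k w d \<longrightarrow>
           (\<exists>t s. runs P (order_input n w d xs es) t s \<and>
                  real t \<le> pit_bound c n k w d \<and>
                  real (card (output_points n s)) \<le> pit_bound c n k w d \<and>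
                  hitting_set n
                    (abp_poly ` {A \<in> read_k_oabps n k w d. var_order A = xs})
                    (output_points n s))))"
proof (intro conjI)
  \<comment> \<open>The successor makes the exponent positive, so the same power also bounds the
    number of points.\<close>
  define h where "h P = Suc (prog_height P)" for P
  have time: "real (time_bound (iteration_bound n B k0) P) \<le> pit_bound (1024 * h P + 32) n k w d"
    and size: "real (iteration_bound n B k0) \<le> pit_bound (1024 * h P + 32) n k w d"
    if b: "1 \<le> n" "1 \<le> k0" "k0 \<le> k" "4 \<le> B" "n < B" "B \<le> n + w + d + 3" for n B k0 k w d P
  proof -
    let ?M = "iteration_bound n B k0"
    have pit: "(real ?M + 3) ^ h P \<le> pit_bound (1024 * h P + 32) n k w d" by (rule power_le_pit_bound[OF b order_refl])
    have "time_bound ?M P \<le> (?M + 3) ^ prog_height P" by (rule time_bound_le)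
    also have "\<dots> \<le> (?M + 3) ^ h P" unfolding h_def by (intro power_increasing) auto
    finally have "real (time_bound ?M P) \<le> real ((?M + 3) ^ h P)" by (simp only: of_nat_le_iff)
    with pit show "real (time_bound ?M P) \<le> pit_bound (1024 * h P + 32) n k w d" by simp
    have "(real ?M + 3) ^ 1 \<le> (real ?M + 3) ^ h P" unfolding h_def by (intro power_increasing) auto
    with pit show "real ?M \<le> pit_bound (1024 * h P + 32) n k w d" by simp
  qed
  show "\<exists>(P :: prog) (c :: nat). \<forall>(n :: nat) (k :: nat) (w :: nat) (d :: nat). n \<ge> 1 \<longrightarrow> k \<ge> 1 \<longrightarrow>
        (\<forall>A \<in> (read_k_oabps n k w d :: 'a::field oabp set).
           \<exists>t s. runs P (abp_input n A) t s \<and> real t \<le> pit_bound c n k w d \<and> (accepts s \<longleftrightarrow> abp_poly A = 0))"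
  proof (rule exI[of _ Identity_test_program], rule exI[of _ "1024 * h Identity_test_program + 32"], intro allI impI ballI)
    fix n k w d :: nat and A :: "'a oabp" assume n: "n \<ge> 1" and k: "k \<ge> 1" and "A \<in> read_k_oabps n k w d"
    then have A: "is_oabp n A" "max_reads (var_order A) \<le> k" "abp_width A \<le> w" "abp_degree A \<le> d"
      by (auto simp: read_k_oabps_def read_at_most_def intro!: max_reads_le)
    \<comment> \<open>The program computes with its actual width, degree and number of reads, which
      are at most \<open>w\<close>, \<open>d\<close> and \<open>k\<close>.\<close>
    let ?B = "n + abp_width A + abp_degree A + 3"
    obtain t s where r: "runs Identity_test_program (abp_input n A) t s"
      "t \<le> time_bound (iteration_bound n ?B (max_reads (var_order A))) Identity_test_program" "accepts s \<longleftrightarrow> abp_poly A = 0"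
      using wp_sound[OF wp_Identity_test_program[OF A(1) n order_refl]] by blast
    have "real t \<le> real (time_bound (iteration_bound n ?B (max_reads (var_order A))) Identity_test_program)" using r(2) by simp
    also have "\<dots> \<le> pit_bound (1024 * h Identity_test_program + 32) n k w d"
      by (rule time) (use n A max_reads_props in auto)
    finally show "\<exists>t s. runs Identity_test_program (abp_input n A) t s \<and>
        real t \<le> pit_bound (1024 * h Identity_test_program + 32) n k w d \<and> (accepts s \<longleftrightarrow> abp_poly A = 0)"
      using r(1,3) by blast
  qed
  show "\<exists>(P :: prog) (c :: nat). \<forall>(n :: nat) (k :: nat) (w :: nat) (d :: nat). n \<ge> 1 \<longrightarrow> k \<ge> 1 \<longrightarrow>
        (\<forall>(xs :: nat list) (es :: 'a list).
           set xs \<subseteq> {..<n} \<longrightarrow> read_at_most k xs \<longrightarrow> distinct es \<longrightarrow> real (length es) \<ge> field_bound c n k w d \<longrightarrow>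
           (\<exists>t s. runs P (order_input n w d xs es) t s \<and> real t \<le> pit_bound c n k w d \<and>
                  real (card (output_points n s)) \<le> pit_bound c n k w d \<and>
                  hitting_set n (abp_poly ` {A \<in> read_k_oabps n k w d. var_order A = xs}) (output_points n s)))"
  proof (rule exI[of _ Hitting_set_program], rule exI[of _ "1024 * h Hitting_set_program + 32"], intro allI impI)
    let ?c = "1024 * h Hitting_set_program + 32"
    fix n k w d :: nat and xs :: "nat list" and es :: "'a list"
    assume n: "n \<ge> 1" and k: "k \<ge> 1" and xs: "set xs \<subseteq> {..<n}" and rd: "read_at_most k xs" and es: "distinct es"
      and len: "real (length es) \<ge> field_bound ?c n k w d"
    let ?k = "max_reads xs" and ?B = "n + w + d + 3"
    have k0: "?k \<le> k" "1 \<le> ?k" using rd k max_reads_props by (auto simp: read_at_most_def intro!: max_reads_le)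
    have "real (?B ^ (16 * (?k * ?k))) \<le> field_bound ?c n k w d" by (rule power_le_field_bound) (use k0 in auto)
    then have "real (?B ^ (16 * (?k * ?k))) \<le> real (length es)" using len by linarith
    then have "?B ^ (16 * (?k * ?k)) \<le> length es" by (simp only: of_nat_le_iff)
    from hitting_set_program[OF n xs es this, of k] obtain t s where r: "runs Hitting_set_program (order_input n w d xs es) t s"
      "t \<le> time_bound (iteration_bound n ?B ?k) Hitting_set_program" "card (output_points n s) \<le> iteration_bound n ?B ?k"
      "hitting_set n (abp_poly ` {A \<in> read_k_oabps n k w d. var_order A = xs}) (output_points n s)" by blast
    have "real t \<le> real (time_bound (iteration_bound n ?B ?k) Hitting_set_program)" using r(2) by simp
    also have "\<dots> \<le> pit_bound ?c n k w d" by (rule time) (use n k0 in auto)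
    finally have 1: "real t \<le> pit_bound ?c n k w d" .
    have "real (card (output_points n s)) \<le> real (iteration_bound n ?B ?k)" using r(3) by simp
    also have "\<dots> \<le> pit_bound ?c n k w d" by (rule size) (use n k0 in auto)
    finally have 2: "real (card (output_points n s)) \<le> pit_bound ?c n k w d" .
    show "\<exists>t s. runs Hitting_set_program (order_input n w d xs es) t s \<and> real t \<le> pit_bound ?c n k w d \<and>
        real (card (output_points n s)) \<le> pit_bound ?c n k w d \<and>
        hitting_set n (abp_poly ` {A \<in> read_k_oabps n k w d. var_order A = xs}) (output_points n s)"
      using r(1) 1 2 r(4) by blast
  qed
qed

end
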